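(* Let $1<p,s<\infty$, $n\ge2$, let $\Omega\subseteq\mathbb{R}^n$ be a domain, let $a=(a_1,\dots,a_n)$ be a weight vector and $V\in M^q_{\mathrm{loc}}(p;\Omega)$ as in the context, and suppose that $Q=Q_{p,s,a,V}\ge0$ on $C_c^\infty(\Omega)$. Fix a positive solution $u\in W^{1,p}_{\mathrm{loc}}(\Omega)\cap C(\Omega)$ of the equation $Q'_{p,s,a,V}[v]=0$ in $\Omega$. Then for all $g\in L^1_{\mathrm{loc}}(\Omega)$, $g$ is a Hardy-weight of $Q_{p,s,a,V}$ in $\Omega$ if and only if $\|g\|_u<\infty$. In addition, there exists a positive constant $C$, depending only on $p,s,n$ if $s<p$ and only on $p,s$ if $p\le s$, such that for all $g\in\mathcal{H}_{p,s,a,V}(\Omega)$, $$\|g\|_u\le\|g\|_{\mathcal{H}}\le C\|g\|_u.$$ In particular, $(\mathcal{H}_{p,s,a,V}(\Omega),\|\cdot\|_u)$ is a Banach space.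
   Context: $\omega\Subset\Omega$ means that the closure of $\omega$ is a compact subset of $\Omega$. $C_c(\Omega)$: continuous functions with compact support in $\Omega$. Weights: $a_1,\dots,a_n:\Omega\to(0,\infty)$ are Lebesgue measurable and for every domain $\omega\Subset\Omega$ there are constants $0<c_\omega\le C_\omega<\infty$ with $c_\omega\le a_i\le C_\omega$ a.e. in $\omega$. $|\xi|_{s,a}=(\sum_i a_i(x)|\xi_i|^s)^{1/s}$. Morrey space: for a domain $\omega\Subset\Omega$ and measurable $f$ on $\omega$: if $p<n$ and $q>n/p$, $\|f\|_{M^q(p;\omega)}=\sup_{y\in\omega,\,0<r<\mathrm{diam}(\omega)}r^{-n/q'}\int_{\omega\cap B_r(y)}|f|\,dx$ with $q'=q/(q-1)$; if $p=n$ and $q>n$, $\|f\|_{M^q(n;\omega)}=\sup_{y\in\omega,\,0<r<\mathrm{diam}(\omega)}(\log(\mathrm{diam}(\omega)/r))^{q/n'}\int_{\omega\cap B_r(y)}|f|\,dx$ with $n'=n/(n-1)$; in these cases $M^q(p;\omega)$ is the set of $f\in L^1_{\mathrm{loc}}(\omega)$ with finite norm. If $p>n$, $q=1$ and $M^q(p;\omega)=L^1(\omega)$. $M^q_{\mathrm{loc}}(p;\Omega)$ consists of functions lying in $M^q(p;\omega)$ for all domains $\omega\Subset\Omega$. Functional: $Q[\phi]=Q_{p,s,a,V}[\phi]=\int_\Omega(|\nabla\phi|_{s,a}^p+V|\phi|^p)\,dx$. A positive solution of $Q'_{p,s,a,V}[v]=0$ in $\Omega$ is a positive $v\in W^{1,p}_{\mathrm{loc}}(\Omega)$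 with $\int_\Omega|\nabla v|_{s,a}^{p-s}\sum_i a_i|\partial_iv|^{s-2}\partial_iv\,\partial_i\phi\,dx+\int_\Omega V|v|^{p-2}v\phi\,dx=0$ for all $\phi\in C_c^\infty(\Omega)$ (the first integrand is $0$ where $\nabla v=0$, and $|t|^{s-2}t=0$ at $t=0$). Hardy-weights: $g\in L^1_{\mathrm{loc}}(\Omega)$ is a Hardy-weight of $Q$ in $\Omega$ if there is $C>0$ with $Q[\phi]\ge C\int_\Omega|g||\phi|^p\,dx$ for all $\phi\in C_c^\infty(\Omega)$; $\mathcal{H}_{p,s,a,V}(\Omega)$ is the linear space of all Hardy-weights. For measurable $g$, $S_g=\inf\{Q[\phi]/\int_\Omega|g||\phi|^p\,dx:\phi\in W^{1,p}(\Omega)\cap C_c(\Omega),\ \int_\Omega|g||\phi|^p\,dx>0\}$ and $\|g\|_{\mathcal{H}}=1/S_g$ (with $1/0=\infty$, $1/\infty=0$). Capacity: for compact $K\subseteq\Omega$, $\mathrm{Cap}(K,u)=\inf\{Q[\phi]:\phi\in W^{1,p}(\Omega)\cap C_c(\Omega),\ \phi|_K\ge u\}$. For $g\in L^1_{\mathrm{loc}}(\Omega)$, $\|g\|_u=\inf\{L\in[0,\infty):\int_K|g||u|^p\,dx\le L\,\mathrm{Cap}(K,u)\text{ for all compact }K\subseteq\Omega\}$ (possibly $\infty$). *)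

theory Defs
  imports "HOL-Analysis.Analysis"
begin

text \<open>
  The constant in the theorem does not depend on the dimension when \<open>p \<le> s\<close>, so the
  dimension \<open>n\<close> is quantified inside the statement and cannot be a type. Points of
  \<open>\<real>\<^sup>n\<close> are therefore functions \<open>nat \<Rightarrow> real\<close> that are extensional on \<open>{..<n}\<close>: this is
  the carrier of both the library's product topology and its product measure. Topological
  and measure-theoretic notions have to be taken relative to the two structures below and
  not from the type class instances on \<open>nat \<Rightarrow> real\<close>.
\<close>

abbreviation Rn :: "nat \<Rightarrow> (nat \<Rightarrow> real) topology" where
  "Rn n \<equiv> powertop_real {..<n}"

abbreviation leb :: "nat \<Rightarrow> (nat \<Rightarrow> real) measure" where
  "leb n \<equiv> completion (Pi\<^sub>M {..<n} (\<lambda>_. lborel))"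

definition eball :: "nat \<Rightarrow> (nat \<Rightarrow> real) \<Rightarrow> real \<Rightarrow> (nat \<Rightarrow> real) set" where
  "eball n y r = {x \<in> topspace (Rn n). L2_set (\<lambda>i. x i - y i) {..<n} < r}"

text \<open>A supremum of reals: only meaningful for nonempty bounded sets.\<close>

definition ediam :: "nat \<Rightarrow> (nat \<Rightarrow> real) set \<Rightarrow> real" where
  "ediam n A = (SUP (x, y) \<in> A \<times> A. L2_set (\<lambda>i. x i - y i) {..<n})"

definition domain_in :: "nat \<Rightarrow> (nat \<Rightarrow> real) set \<Rightarrow> bool" where
  "domain_in n \<Omega> \<longleftrightarrow> openin (Rn n) \<Omega> \<and> connectedin (Rn n) \<Omega> \<and> \<Omega> \<noteq> {}"

definition compactly_inside :: "nat \<Rightarrow> (nat \<Rightarrow> real) set \<Rightarrow> (nat \<Rightarrow> real) set \<Rightarrow> bool" where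
  "compactly_inside n \<omega> \<Omega> \<longleftrightarrow>
     compactin (Rn n) (Rn n closure_of \<omega>) \<and> Rn n closure_of \<omega> \<subseteq> \<Omega>"


subsection \<open>Function spaces\<close>

text \<open>
  Functions on \<open>\<Omega>\<close> are total functions whose values outside \<open>\<Omega>\<close> are ignored.
\<close>

definition Lp :: "nat \<Rightarrow> (nat \<Rightarrow> real) set \<Rightarrow> real \<Rightarrow> ((nat \<Rightarrow> real) \<Rightarrow> real) set" where
  "Lp n \<Omega> p = {f. set_borel_measurable (leb n) \<Omega> f \<and>
                  set_integrable (leb n) \<Omega> (\<lambda>x. \<bar>f x\<bar> powr p)}"

definition Lp_loc :: "nat \<Rightarrow> (nat \<Rightarrow> real) set \<Rightarrow> real \<Rightarrow> ((nat \<Rightarrow> real) \<Rightarrow> real) set" where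
  "Lp_loc n \<Omega> p = {f. set_borel_measurable (leb n) \<Omega> f \<and>
     (\<forall>K. compactin (Rn n) K \<and> K \<subseteq> \<Omega> \<longrightarrow> set_integrable (leb n) K (\<lambda>x. \<bar>f x\<bar> powr p))}"

definition partial_deriv :: "nat \<Rightarrow> ((nat \<Rightarrow> real) \<Rightarrow> real) \<Rightarrow> (nat \<Rightarrow> real) \<Rightarrow> real" where
  "partial_deriv i f x = deriv (\<lambda>t. f (x(i := t))) (x i)"

primrec Ck :: "nat \<Rightarrow> nat \<Rightarrow> ((nat \<Rightarrow> real) \<Rightarrow> real) \<Rightarrow> bool" where
  "Ck n 0 f \<longleftrightarrow> continuous_map (Rn n) euclideanreal f"
| "Ck n (Suc k) f \<longleftrightarrow> continuous_map (Rn n) euclideanreal f \<and>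
     (\<forall>i<n. (\<forall>x \<in> topspace (Rn n). (\<lambda>t. f (x(i := t))) field_differentiable at (x i)) \<and>
            Ck n k (partial_deriv i f))"

definition C_continuous :: "nat \<Rightarrow> (nat \<Rightarrow> real) set \<Rightarrow> ((nat \<Rightarrow> real) \<Rightarrow> real) set" where
  "C_continuous n \<Omega> = {f. continuous_map (subtopology (Rn n) \<Omega>) euclideanreal f}"

definition Cc :: "nat \<Rightarrow> (nat \<Rightarrow> real) set \<Rightarrow> ((nat \<Rightarrow> real) \<Rightarrow> real) set" where
  "Cc n \<Omega> = {f \<in> C_continuous n \<Omega>.
     \<exists>K. compactin (Rn n) K \<and> K \<subseteq> \<Omega> \<and> (\<forall>x \<in> \<Omega> - K. f x = 0)}"

text \<open>Elements of \<open>C\<^sub>c\<^sup>\<infinity>(\<Omega>)\<close> are extended by zero to all of \<open>\<real>\<^sup>n\<close>.\<close>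

definition Cc_smooth :: "nat \<Rightarrow> (nat \<Rightarrow> real) set \<Rightarrow> ((nat \<Rightarrow> real) \<Rightarrow> real) set" where
  "Cc_smooth n \<Omega> = {f. (\<forall>k. Ck n k f) \<and>
     (\<exists>K. compactin (Rn n) K \<and> K \<subseteq> \<Omega> \<and> (\<forall>x \<in> topspace (Rn n) - K. f x = 0))}"

definition weak_partial ::
  "nat \<Rightarrow> (nat \<Rightarrow> real) set \<Rightarrow> nat \<Rightarrow> ((nat \<Rightarrow> real) \<Rightarrow> real) \<Rightarrow> ((nat \<Rightarrow> real) \<Rightarrow> real) \<Rightarrow> bool"
  where
  "weak_partial n \<Omega> i f h \<longleftrightarrow> f \<in> Lp_loc n \<Omega> 1 \<and> h \<in> Lp_loc n \<Omega> 1 \<and>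
     (\<forall>\<phi> \<in> Cc_smooth n \<Omega>.
        (LINT x:\<Omega>|leb n. f x * partial_deriv i \<phi> x) = - (LINT x:\<Omega>|leb n. h x * \<phi> x))"

text \<open>
  Weak derivatives are unique up to null sets, and \<open>wgrad\<close> only ever occurs under an
  integral, so the choice of representative does not matter.
\<close>

definition wgrad ::
  "nat \<Rightarrow> (nat \<Rightarrow> real) set \<Rightarrow> ((nat \<Rightarrow> real) \<Rightarrow> real) \<Rightarrow> nat \<Rightarrow> (nat \<Rightarrow> real) \<Rightarrow> real" where
  "wgrad n \<Omega> f i = (SOME h. weak_partial n \<Omega> i f h)"

definition W1p :: "nat \<Rightarrow> (nat \<Rightarrow> real) set \<Rightarrow> real \<Rightarrow> ((nat \<Rightarrow> real) \<Rightarrow> real) set" where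
  "W1p n \<Omega> p = {f \<in> Lp n \<Omega> p. \<forall>i<n. \<exists>h \<in> Lp n \<Omega> p. weak_partial n \<Omega> i f h}"

definition W1p_loc :: "nat \<Rightarrow> (nat \<Rightarrow> real) set \<Rightarrow> real \<Rightarrow> ((nat \<Rightarrow> real) \<Rightarrow> real) set" where
  "W1p_loc n \<Omega> p = {f \<in> Lp_loc n \<Omega> p. \<forall>i<n. \<exists>h \<in> Lp_loc n \<Omega> p. weak_partial n \<Omega> i f h}"


subsection \<open>Weights and Morrey spaces\<close>

definition weight_vector ::
  "nat \<Rightarrow> (nat \<Rightarrow> real) set \<Rightarrow> (nat \<Rightarrow> (nat \<Rightarrow> real) \<Rightarrow> real) \<Rightarrow> bool" where
  "weight_vector n \<Omega> a \<longleftrightarrow>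
     (\<forall>i<n. set_borel_measurable (leb n) \<Omega> (a i) \<and> (\<forall>x\<in>\<Omega>. 0 < a i x)) \<and>
     (\<forall>\<omega>. domain_in n \<omega> \<and> compactly_inside n \<omega> \<Omega> \<longrightarrow>
        (\<exists>c C. 0 < c \<and> c \<le> C \<and> (\<forall>i<n. AE x\<in>\<omega> in leb n. c \<le> a i x \<and> a i x \<le> C)))"

text \<open>The two exponents are \<open>n/q'\<close> with \<open>q' = q/(q-1)\<close> and \<open>q/n'\<close> with \<open>n' = n/(n-1)\<close>.\<close>

definition morrey_norm ::
  "nat \<Rightarrow> real \<Rightarrow> real \<Rightarrow> (nat \<Rightarrow> real) set \<Rightarrow> ((nat \<Rightarrow> real) \<Rightarrow> real) \<Rightarrow> ennreal" where
  "morrey_norm n q p \<omega> f =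
     (SUP (y, r) \<in> \<omega> \<times> {0<..<ediam n \<omega>}.
        ennreal (if p < real n then r powr (- (real n / (q / (q - 1))))
                 else ln (ediam n \<omega> / r) powr (q / (real n / (real n - 1))))
        * (\<integral>\<^sup>+x\<in>\<omega> \<inter> eball n y r. ennreal \<bar>f x\<bar> \<partial>leb n))"

text \<open>The range of \<open>q\<close> that is admissible for given \<open>p\<close> and \<open>n\<close> is part of membership.\<close>

definition in_morrey ::
  "nat \<Rightarrow> real \<Rightarrow> real \<Rightarrow> (nat \<Rightarrow> real) set \<Rightarrow> ((nat \<Rightarrow> real) \<Rightarrow> real) \<Rightarrow> bool" where
  "in_morrey n q p \<omega> f \<longleftrightarrow>
     (if p < real n then real n / p < q \<and> f \<in> Lp_loc n \<omega> 1 \<and> morrey_norm n q p \<omega> f < \<infinity>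
      else if p = real n then real n < q \<and> f \<in> Lp_loc n \<omega> 1 \<and> morrey_norm n q p \<omega> f < \<infinity>
      else q = 1 \<and> f \<in> Lp n \<omega> 1)"

definition in_morrey_loc ::
  "nat \<Rightarrow> real \<Rightarrow> real \<Rightarrow> (nat \<Rightarrow> real) set \<Rightarrow> ((nat \<Rightarrow> real) \<Rightarrow> real) \<Rightarrow> bool" where
  "in_morrey_loc n q p \<Omega> f \<longleftrightarrow>
     (\<forall>\<omega>. domain_in n \<omega> \<and> compactly_inside n \<omega> \<Omega> \<longrightarrow> in_morrey n q p \<omega> f)"


subsection \<open>The functional and its Euler-Lagrange equation\<close>

definition norm_sa ::
  "nat \<Rightarrow> real \<Rightarrow> (nat \<Rightarrow> (nat \<Rightarrow> real) \<Rightarrow> real) \<Rightarrow> (nat \<Rightarrow> real) \<Rightarrow> (nat \<Rightarrow> real) \<Rightarrow> real" where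
  "norm_sa n s a x \<xi> = (\<Sum>i<n. a i x * \<bar>\<xi> i\<bar> powr s) powr (1 / s)"

definition Q_fun ::
  "nat \<Rightarrow> (nat \<Rightarrow> real) set \<Rightarrow> real \<Rightarrow> real \<Rightarrow> (nat \<Rightarrow> (nat \<Rightarrow> real) \<Rightarrow> real) \<Rightarrow>
   ((nat \<Rightarrow> real) \<Rightarrow> real) \<Rightarrow> ((nat \<Rightarrow> real) \<Rightarrow> real) \<Rightarrow> real" where
  "Q_fun n \<Omega> p s a V \<phi> =
     (LINT x:\<Omega>|leb n. norm_sa n s a x (\<lambda>i. wgrad n \<Omega> \<phi> i x) powr p + V x * \<bar>\<phi> x\<bar> powr p)"

text \<open>
  Since \<open>0 powr t = 0\<close> for every \<open>t\<close>, both degenerate cases (vanishing gradient, and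
  \<open>\<bar>t\<bar>\<^sup>s\<^sup>-\<^sup>2t\<close> at \<open>t = 0\<close>) get the value 0.
\<close>

definition positive_solution ::
  "nat \<Rightarrow> (nat \<Rightarrow> real) set \<Rightarrow> real \<Rightarrow> real \<Rightarrow> (nat \<Rightarrow> (nat \<Rightarrow> real) \<Rightarrow> real) \<Rightarrow>
   ((nat \<Rightarrow> real) \<Rightarrow> real) \<Rightarrow> ((nat \<Rightarrow> real) \<Rightarrow> real) \<Rightarrow> bool" where
  "positive_solution n \<Omega> p s a V v \<longleftrightarrow> v \<in> W1p_loc n \<Omega> p \<and> (\<forall>x\<in>\<Omega>. 0 < v x) \<and>
     (\<forall>\<phi> \<in> Cc_smooth n \<Omega>.
        (LINT x:\<Omega>|leb n. norm_sa n s a x (\<lambda>i. wgrad n \<Omega> v i x) powr (p - s) *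
           (\<Sum>i<n. a i x * \<bar>wgrad n \<Omega> v i x\<bar> powr (s - 2) * wgrad n \<Omega> v i x
                   * partial_deriv i \<phi> x))
        + (LINT x:\<Omega>|leb n. V x * \<bar>v x\<bar> powr (p - 2) * v x * \<phi> x) = 0)"


subsection \<open>Hardy-weights and capacity\<close>

definition hardy_weights ::
  "nat \<Rightarrow> (nat \<Rightarrow> real) set \<Rightarrow> real \<Rightarrow> real \<Rightarrow> (nat \<Rightarrow> (nat \<Rightarrow> real) \<Rightarrow> real) \<Rightarrow>
   ((nat \<Rightarrow> real) \<Rightarrow> real) \<Rightarrow> ((nat \<Rightarrow> real) \<Rightarrow> real) set" where
  "hardy_weights n \<Omega> p s a V = {g \<in> Lp_loc n \<Omega> 1.
     \<exists>C>0. \<forall>\<phi> \<in> Cc_smooth n \<Omega>.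
       Q_fun n \<Omega> p s a V \<phi> \<ge> C * (LINT x:\<Omega>|leb n. \<bar>g x\<bar> * \<bar>\<phi> x\<bar> powr p)}"

definition weighted_int ::
  "nat \<Rightarrow> (nat \<Rightarrow> real) set \<Rightarrow> real \<Rightarrow> ((nat \<Rightarrow> real) \<Rightarrow> real) \<Rightarrow> ((nat \<Rightarrow> real) \<Rightarrow> real) \<Rightarrow> ereal"
  where
  "weighted_int n A p g f = enn2ereal (\<integral>\<^sup>+x\<in>A. ennreal (\<bar>g x\<bar> * \<bar>f x\<bar> powr p) \<partial>leb n)"

definition S_const ::
  "nat \<Rightarrow> (nat \<Rightarrow> real) set \<Rightarrow> real \<Rightarrow> real \<Rightarrow> (nat \<Rightarrow> (nat \<Rightarrow> real) \<Rightarrow> real) \<Rightarrow>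
   ((nat \<Rightarrow> real) \<Rightarrow> real) \<Rightarrow> ((nat \<Rightarrow> real) \<Rightarrow> real) \<Rightarrow> ereal" where
  "S_const n \<Omega> p s a V g =
     (INF \<phi> \<in> {\<phi> \<in> W1p n \<Omega> p \<inter> Cc n \<Omega>. 0 < weighted_int n \<Omega> p g \<phi>}.
        ereal (Q_fun n \<Omega> p s a V \<phi>) / weighted_int n \<Omega> p g \<phi>)"

text \<open>In \<open>ereal\<close> one has \<open>1 / 0 = \<infinity>\<close> and \<open>1 / \<infinity> = 0\<close>.\<close>

definition norm_H ::
  "nat \<Rightarrow> (nat \<Rightarrow> real) set \<Rightarrow> real \<Rightarrow> real \<Rightarrow> (nat \<Rightarrow> (nat \<Rightarrow> real) \<Rightarrow> real) \<Rightarrow>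
   ((nat \<Rightarrow> real) \<Rightarrow> real) \<Rightarrow> ((nat \<Rightarrow> real) \<Rightarrow> real) \<Rightarrow> ereal" where
  "norm_H n \<Omega> p s a V g = 1 / S_const n \<Omega> p s a V g"

definition Cap ::
  "nat \<Rightarrow> (nat \<Rightarrow> real) set \<Rightarrow> real \<Rightarrow> real \<Rightarrow> (nat \<Rightarrow> (nat \<Rightarrow> real) \<Rightarrow> real) \<Rightarrow>
   ((nat \<Rightarrow> real) \<Rightarrow> real) \<Rightarrow> (nat \<Rightarrow> real) set \<Rightarrow> ((nat \<Rightarrow> real) \<Rightarrow> real) \<Rightarrow> ereal" where
  "Cap n \<Omega> p s a V K u =
     (INF \<phi> \<in> {\<phi> \<in> W1p n \<Omega> p \<inter> Cc n \<Omega>. \<forall>x\<in>K. u x \<le> \<phi> x}. ereal (Q_fun n \<Omega> p s a V \<phi>))"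

definition norm_u ::
  "nat \<Rightarrow> (nat \<Rightarrow> real) set \<Rightarrow> real \<Rightarrow> real \<Rightarrow> (nat \<Rightarrow> (nat \<Rightarrow> real) \<Rightarrow> real) \<Rightarrow>
   ((nat \<Rightarrow> real) \<Rightarrow> real) \<Rightarrow> ((nat \<Rightarrow> real) \<Rightarrow> real) \<Rightarrow> ((nat \<Rightarrow> real) \<Rightarrow> real) \<Rightarrow> ereal" where
  "norm_u n \<Omega> p s a V u g =
     (INF L \<in> {L. 0 \<le> L \<and> (\<forall>K. compactin (Rn n) K \<and> K \<subseteq> \<Omega> \<longrightarrow>
                     weighted_int n K p g u \<le> ereal L * Cap n \<Omega> p s a V K u)}. ereal L)"

text \<open>
  \<open>(X, N)\<close> is a real Banach space of functions on \<open>\<Omega>\<close>, where functions that agree almost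
  everywhere on \<open>\<Omega>\<close> are identified. The identification is expressed on representatives:
  \<open>X\<close> is invariant under changes on null sets, and \<open>N\<close> vanishes exactly on the functions
  that are zero almost everywhere (by the triangle inequality \<open>N\<close> is then well defined on
  the classes).
\<close>

definition banach_space_ae ::
  "nat \<Rightarrow> (nat \<Rightarrow> real) set \<Rightarrow> ((nat \<Rightarrow> real) \<Rightarrow> real) set \<Rightarrow>
   (((nat \<Rightarrow> real) \<Rightarrow> real) \<Rightarrow> ereal) \<Rightarrow> bool" where
  "banach_space_ae n \<Omega> X N \<longleftrightarrow>
     (\<lambda>x. 0) \<in> X \<and>
     (\<forall>f\<in>X. \<forall>g\<in>X. (\<lambda>x. f x + g x) \<in> X) \<and>
     (\<forall>c. \<forall>f\<in>X. (\<lambda>x. c * f x) \<in> X) \<and>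
     (\<forall>f\<in>X. \<forall>g. (AE x\<in>\<Omega> in leb n. f x = g x) \<longrightarrow> g \<in> X) \<and>
     (\<forall>f\<in>X. 0 \<le> N f \<and> N f < \<infinity>) \<and>
     (\<forall>f\<in>X. N f = 0 \<longleftrightarrow> (AE x\<in>\<Omega> in leb n. f x = 0)) \<and>
     (\<forall>c. \<forall>f\<in>X. N (\<lambda>x. c * f x) = ereal \<bar>c\<bar> * N f) \<and>
     (\<forall>f\<in>X. \<forall>g\<in>X. N (\<lambda>x. f x + g x) \<le> N f + N g) \<and>
     (\<forall>F :: nat \<Rightarrow> (nat \<Rightarrow> real) \<Rightarrow> real.
        range F \<subseteq> X \<and>
        (\<forall>e>0. \<exists>k0. \<forall>j\<ge>k0. \<forall>k\<ge>k0. N (\<lambda>x. F j x - F k x) < ereal e) \<longrightarrow>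
        (\<exists>f\<in>X. (\<lambda>k. N (\<lambda>x. F k x - f x)) \<longlonglongrightarrow> 0))"

end

theory Submission
  imports Defs "HOL-Analysis.Analysis"
begin

text \<open>
  Let \<open>D(\<xi>, \<zeta>)\<close> be the Bregman divergence of \<open>\<bar>\<xi>\<bar>\<^sup>p\<close> with respect to the norm \<open>|.|\<^sub>s\<^sub>,\<^sub>a\<close>. Testing the equation of
  \<open>u\<close> with \<open>|\<phi>|\<^sup>p / u\<^sup>p\<^sup>-\<^sup>1\<close> gives the Picone identity: \<open>Q[\<phi>]\<close> is the integral of \<open>D(\<nabla>\<phi>, (\<phi>/u) \<nabla>u)\<close>.
  The divergence satisfies \<open>D(\<zeta> + t w, \<zeta>) \<le> C max(1, t)\<^sup>M D(\<zeta> + w, \<zeta>)\<close> with \<open>C\<close> and \<open>M\<close> depending only on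
  \<open>p\<close> and \<open>s\<close>, so the truncations \<open>\<phi>\<^sub>m = u h(\<phi> / (\<tau>\<^sub>m u))\<close> at dyadic levels \<open>\<tau>\<^sub>m\<close> satisfy
  \<open>\<Sum>\<^sub>m \<tau>\<^sub>m\<^sup>p Q[\<phi>\<^sub>m] \<le> C' Q[\<phi>]\<close>. Since \<open>\<phi>\<^sub>m \<ge> u\<close> on \<open>{|\<phi>| \<ge> 2 \<tau>\<^sub>m u}\<close>, the capacity bounds on these
  level sets sum up to the Hardy inequality, as in Maz'ya's argument, and the resulting constant
  does not depend on the dimension. Completeness follows from Fatou's lemma, because \<open>norm_u\<close> is a
  supremum of weighted \<open>L\<^sup>1\<close> norms over compact sets.
\<close>

text \<open>The estimate that must be uniform in the dimension is the growth of the divergence along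
  a ray. It is deduced from quasi-symmetry, \<open>D(y, x) \<le> c D(x, y)\<close>: convexity along
  a segment bounds an increment of \<open>D\<close> by the symmetrised divergence. For
  \<open>p \<ge> s\<close> quasi-symmetry reduces to one variable, because the energy is
  \<open>t^(p/s)\<close> applied to a separable function; for \<open>p < s\<close> Legendre duality
  carries it over. Growth in \<open>t\<close> is unavoidable: the truncated gradient is a multiple
  of \<open>(\<phi>/u) \<nabla>u + t (\<nabla>\<phi> - (\<phi>/u) \<nabla>u)\<close>, where
  \<open>t\<close> is the logarithmic derivative of \<open>h\<close>, unbounded where
  \<open>h\<close> leaves 0. Hence \<open>h\<close> is made to vanish there to an order
  \<open>k\<close> with \<open>k p \<ge> M\<close>. It is also continuously differentiable, so that
  the C^1 chain rule for weak derivatives applies. That rule and the passage from smooth test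
  functions to the whole test space both rest on one mollification statement,
  \<open>sobolev_approx\<close>. The inequality \<open>norm_u \<le> norm_H\<close> is elementary:
  competitors for the capacity are inserted into the Hardy inequality.\<close>

type_synonym point = "nat \<Rightarrow> real"

section \<open>The Bregman divergence of a power on the real line\<close>

text \<open>The odd power \<open>|b|^(s-2) b\<close>, which is the derivative of
  \<open>|b|^s / s\<close>. Splitting off \<open>sgn\<close> leaves the exponent
  \<open>s - 1\<close>, which is positive also for \<open>s < 2\<close>.\<close>

definition dual_pow :: "real \<Rightarrow> real \<Rightarrow> real" where
  "dual_pow s b = \<bar>b\<bar> powr (s - 1) * sgn b"

definition bregman1 :: "real \<Rightarrow> real \<Rightarrow> real \<Rightarrow> real" where
  "bregman1 s a b = \<bar>a\<bar> powr s - \<bar>b\<bar> powr s - s * dual_pow s b * (a - b)"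

lemma dual_pow_alt: "\<bar>b\<bar> powr (s - 2) * b = dual_pow s b"
proof (cases "b = 0")
  case False
  then have "\<bar>b\<bar> powr (s - 1) = \<bar>b\<bar> powr (s - 2) * \<bar>b\<bar>"
    by (simp add: powr_mult_base[of "\<bar>b\<bar>" "s - 2"] mult.commute)
  then show ?thesis by (simp add: dual_pow_def mult.assoc abs_mult_sgn)
qed (simp add: dual_pow_def)

lemma dual_pow_0 [simp]: "dual_pow s 0 = 0" by (simp add: dual_pow_def)

lemma dual_pow_minus [simp]: "dual_pow s (- b) = - dual_pow s b"
  by (simp add: dual_pow_def sgn_minus)

lemma abs_dual_pow: "s > 1 \<Longrightarrow> \<bar>dual_pow s b\<bar> = \<bar>b\<bar> powr (s - 1)"
  by (cases "b = 0") (auto simp: dual_pow_def abs_mult abs_sgn_eq)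

lemma dual_pow_self: "dual_pow s b * b = \<bar>b\<bar> powr s"
proof (cases "b = 0")
  case False
  have "dual_pow s b * b = \<bar>b\<bar> powr (s - 1) * \<bar>b\<bar>"
    by (simp add: dual_pow_def mult.assoc abs_sgn mult.commute[of "sgn b"])
  also have "\<dots> = \<bar>b\<bar> powr s" using False by (simp add: powr_mult_base[of "\<bar>b\<bar>" "s-1"] mult.commute)
  finally show ?thesis .
qed simp

lemma dual_pow_mult: "dual_pow s (l * b) = dual_pow s l * dual_pow s b"
  by (simp add: dual_pow_def abs_mult powr_mult sgn_mult)

lemma dual_pow_mono:
  assumes "s > 1" "a \<le> b" shows "dual_pow s a \<le> dual_pow s b"
proof -
  have pos: "dual_pow s x \<le> dual_pow s y" if "0 \<le> x" "x \<le> y" for x y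
    using that assms(1) by (cases "x = 0") (auto simp: dual_pow_def intro!: powr_mono2)
  have sg: "0 \<le> x \<Longrightarrow> 0 \<le> dual_pow s x" for x by (simp add: dual_pow_def)
  consider "0 \<le> a" | "a < 0" "0 \<le> b" | "b < 0" by linarith
  then show ?thesis
  proof cases
    case 2
    then show ?thesis using sg[of b] sg[of "-a"] by simp
  next
    case 3
    then show ?thesis using pos[of "-b" "-a"] assms(2) by simp
  qed (use pos assms in auto)
qed

text \<open>Young's inequality for \<open>|a|\<close> and \<open>|b|^(s-1)\<close> with the
  exponents \<open>s\<close> and \<open>s/(s-1)\<close>. It yields both the nonnegativity of
  \<open>bregman1\<close> and its upper bound by powers.\<close>

lemma young_dual_pow:
  assumes s: "s > 1"
  shows "s * \<bar>dual_pow s b * a\<bar> \<le> \<bar>a\<bar> powr s + (s - 1) * \<bar>b\<bar> powr s"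
proof -
  have "\<bar>a\<bar> * \<bar>b\<bar> powr (s - 1)
      \<le> \<bar>a\<bar> powr s / s + (\<bar>b\<bar> powr (s - 1)) powr (s / (s - 1)) / (s / (s - 1))"
    using s by (intro Youngs_inequality) (auto simp: field_simps)
  also have "(\<bar>b\<bar> powr (s - 1)) powr (s / (s - 1)) = \<bar>b\<bar> powr s"
    using s by (simp add: powr_powr)
  finally have "s * (\<bar>a\<bar> * \<bar>b\<bar> powr (s - 1))
      \<le> s * (\<bar>a\<bar> powr s / s + \<bar>b\<bar> powr s / (s / (s - 1)))"
    using s by (intro mult_left_mono) auto
  also have "\<dots> = \<bar>a\<bar> powr s + (s - 1) * \<bar>b\<bar> powr s"
    using s by (simp add: field_simps)
  finally show ?thesis using s by (simp add: abs_mult abs_dual_pow mult_ac)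
qed

lemma bregman1_eq:
  "bregman1 s a b = \<bar>a\<bar> powr s + (s - 1) * \<bar>b\<bar> powr s - s * (dual_pow s b * a)"
  using dual_pow_self[of s b] by (simp add: bregman1_def algebra_simps)

lemma bregman1_nonneg: "s > 1 \<Longrightarrow> 0 \<le> bregman1 s a b"
  using young_dual_pow[of s b a] abs_ge_self[of "dual_pow s b * a"]
    mult_left_mono[of "dual_pow s b * a" "\<bar>dual_pow s b * a\<bar>" s]
  unfolding bregman1_eq by linarith

lemma bregman1_le:
  assumes "s > 1"
  shows "bregman1 s a b \<le> 2 * \<bar>a\<bar> powr s + 2 * (s - 1) * \<bar>b\<bar> powr s"
proof -
  have "- (s * (dual_pow s b * a)) \<le> s * \<bar>dual_pow s b * a\<bar>"
    using assms by (metis abs_ge_minus_self mult_minus_right mult_left_mono less_eq_real_def less_trans zero_less_one)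
  then show ?thesis
    using young_dual_pow[OF assms, of b a] unfolding bregman1_eq by (simp add: algebra_simps)
qed

text \<open>The law of cosines for Bregman divergences. If \<open>c\<close> lies between
  \<open>a\<close> and \<open>b\<close>, the last term is nonnegative by monotonicity of
  \<open>dual_pow\<close>, so the divergence can only drop when one argument is moved to
  \<open>c\<close>.\<close>

lemma bregman1_three_points:
  "bregman1 s a b = bregman1 s a c + bregman1 s c b + s * (dual_pow s c - dual_pow s b) * (a - c)"
  by (simp add: bregman1_def algebra_simps)

lemma bregman1_scale: "bregman1 s (l * a) (l * b) = \<bar>l\<bar> powr s * bregman1 s a b"
proof -
  have "dual_pow s (l * b) * (l * a - l * b) = (dual_pow s l * l) * (dual_pow s b * (a - b))"
    by (simp add: dual_pow_mult algebra_simps)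
  then have "s * dual_pow s (l * b) * (l * a - l * b) = \<bar>l\<bar> powr s * (s * dual_pow s b * (a - b))"
    unfolding dual_pow_self by (simp add: mult_ac)
  then show ?thesis
    unfolding bregman1_def by (simp add: abs_mult powr_mult right_diff_distrib)
qed

lemma bregman1_taylor:
  assumes s: "s > 1" and ab: "a > 0" "b > 0" "a \<noteq> b"
  obtains t where "min a b < t" "t < max a b"
    "bregman1 s a b = s * (s - 1) / 2 * t powr (s - 2) * (a - b)\<^sup>2"
proof -
  \<comment> \<open>\<open>df 0\<close>, \<open>df 1\<close>, \<open>df 2\<close> are the
    derivatives of \<open>x^s\<close>; a second-order expansion uses no others.\<close>
  define df where "df m x = (if m = 0 then x powr s else if m = 1 then s * x powr (s - 1)
    else s * (s - 1) * x powr (s - 2))" for m :: nat and x :: real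
  have "\<exists>t. (if a < b then a < t \<and> t < b else b < t \<and> t < a) \<and>
    a powr s = (\<Sum>m<2. df m b / fact m * (a - b)^m) + df 2 t / fact 2 * (a - b)^2"
  proof (rule Taylor[where a = "min a b" and b = "max a b"])
    show "\<forall>m t. m < 2 \<and> min a b \<le> t \<and> t \<le> max a b \<longrightarrow> (df m has_real_derivative df (Suc m) t) (at t)"
    proof (intro allI impI)
      fix m :: nat and t assume *: "m < 2 \<and> min a b \<le> t \<and> t \<le> max a b"
      then have t: "t > 0" using ab by linarith
      show "(df m has_real_derivative df (Suc m) t) (at t)"
      proof (cases "m = 0")
        case True
        have "((\<lambda>x. x powr s) has_real_derivative s * t powr (s - 1)) (at t)"
          using t by (auto intro!: derivative_eq_intros)
        then show ?thesis using True by (simp add: df_def[abs_def])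
      next
        case False
        then have m: "m = 1" using * by auto
        have "((\<lambda>x. s * x powr (s - 1)) has_real_derivative s * ((s - 1) * t powr (s - 1 - 1))) (at t)"
          using t by (intro DERIV_cmult) (auto intro!: derivative_eq_intros)
        then show ?thesis using m by (simp add: df_def[abs_def] mult.assoc)
      qed
    qed
  qed (use ab in \<open>auto simp: df_def fun_eq_iff\<close>)
  then obtain t where t: "if a < b then a < t \<and> t < b else b < t \<and> t < a"
    and e: "a powr s = (\<Sum>m<2. df m b / fact m * (a - b)^m) + df 2 t / fact 2 * (a - b)^2"
    by blast
  have "bregman1 s a b = s * (s - 1) / 2 * t powr (s - 2) * (a - b)\<^sup>2"
    using e ab by (simp add: bregman1_def dual_pow_def df_def numeral_2_eq_2)
  then show thesis using t ab(3) that[of t] by (auto split: if_splits)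
qed

text \<open>Near the diagonal both divergences are quadratic; away from it both are comparable to the
  larger of the two powers.\<close>

lemma bregman1_comparable:
  assumes s: "s > 1"
  shows "\<exists>c\<ge>1. \<forall>a b. bregman1 s b a \<le> c * bregman1 s a b"
proof -
  define k where "k = s * (s - 1) / 2"
  have k: "k > 0" using s by (simp add: k_def)
  define lo where "lo = min 1 ((1/2::real) powr (s - 2))"
  define hi where "hi = max 1 ((1/2::real) powr (s - 2))"
  have lo: "lo > 0" by (simp add: lo_def)
  have hi: "hi \<ge> 1" by (simp add: hi_def)
  have tb: "lo \<le> t powr (s - 2) \<and> t powr (s - 2) \<le> hi" if "1/2 \<le> t" "t \<le> 1" for t :: real
  proof (cases "s \<ge> 2")
    case True
    then have "(1/2) powr (s - 2) \<le> t powr (s - 2)" "t powr (s - 2) \<le> 1 powr (s - 2)"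
      using that by (intro powr_mono2; simp)+
    then show ?thesis by (auto simp: lo_def hi_def)
  next
    case False
    then have "t powr (s - 2) \<le> (1/2) powr (s - 2)" "1 powr (s - 2) \<le> t powr (s - 2)"
      using that by (intro powr_mono2'; simp)+
    then show ?thesis by (auto simp: lo_def hi_def)
  qed
  have near: "k * lo * (a - b)\<^sup>2 \<le> bregman1 s a b \<and> bregman1 s a b \<le> k * hi * (a - b)\<^sup>2"
    if "1/2 \<le> a" "a \<le> 1" "1/2 \<le> b" "b \<le> 1" for a b
  proof (cases "a = b")
    case False
    with that obtain t where t: "min a b < t" "t < max a b"
      "bregman1 s a b = s * (s - 1) / 2 * t powr (s - 2) * (a - b)\<^sup>2"
      using bregman1_taylor[OF s, of a b] by (metis half_gt_zero_iff less_le_trans zero_less_one)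
    have "lo \<le> t powr (s - 2) \<and> t powr (s - 2) \<le> hi" using t that by (intro tb) linarith+
    then show ?thesis unfolding t(3) k_def[symmetric]
      using k by (auto intro!: mult_right_mono mult_left_mono)
  qed (simp add: bregman1_def)
  \<comment> \<open>The lower bound of \<open>near\<close> for the pair 1 and 1/2, that is
    \<open>k * lo * (1/2)^2\<close>.\<close>
  define d where "d = k * lo / 4"
  have d: "d > 0" using k lo by (simp add: d_def)
  \<comment> \<open>The three-point identity with middle point 1/2 shows that a pair (1, t) with
    \<open>t \<le> 1/2\<close> is at least as divergent as the pair (1, 1/2), to which
    \<open>near\<close> applies.\<close>
  have far: "d \<le> bregman1 s 1 t \<and> d \<le> bregman1 s t 1" if "t \<le> 1/2" for t
  proof -
    have m: "dual_pow s t \<le> dual_pow s (1/2)" "dual_pow s (1/2) \<le> dual_pow s 1"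
      using that by (auto intro!: dual_pow_mono[OF s])
    have "bregman1 s 1 t \<ge> bregman1 s 1 (1/2)"
      using bregman1_three_points[of s 1 t "1/2"] bregman1_nonneg[OF s, of "1/2" t] m s
      by simp
    moreover have "bregman1 s t 1 \<ge> bregman1 s (1/2) 1"
    proof -
      have "0 \<le> (s * (dual_pow s (1/2) - dual_pow s 1)) * (t - 1/2)"
        using m that s by (intro mult_nonpos_nonpos) (auto simp: mult_le_0_iff)
      then show ?thesis
        using bregman1_three_points[of s t 1 "1/2"] bregman1_nonneg[OF s, of t "1/2"] by linarith
    qed
    ultimately show ?thesis
      using near[of 1 "1/2"] near[of "1/2" 1] by (simp add: d_def power2_eq_square)
  qed
  have up: "bregman1 s a b \<le> 2 * s" if "\<bar>a\<bar> \<le> 1" "\<bar>b\<bar> \<le> 1" for a b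
  proof -
    have "\<bar>a\<bar> powr s \<le> 1" "\<bar>b\<bar> powr s \<le> 1" using that s by (auto intro!: powr_le1)
    then have "2 * \<bar>a\<bar> powr s + 2 * (s - 1) * \<bar>b\<bar> powr s \<le> 2 * 1 + 2 * (s - 1) * 1"
      using s by (intro add_mono mult_left_mono) auto
    then show ?thesis using bregman1_le[OF s, of a b] by simp
  qed
  \<comment> \<open>The quotient of upper and lower bound near the diagonal, and the same quotient
    away from it.\<close>
  define c where "c = max 1 (max (hi / lo) (2 * s / d))"
  have c: "c \<ge> 1" "hi \<le> c * lo" "2 * s \<le> c * d"
  proof -
    show "c \<ge> 1" by (simp add: c_def)
    have "hi / lo \<le> c" "2 * s / d \<le> c" by (simp_all add: c_def)
    then show "hi \<le> c * lo" "2 * s \<le> c * d" using lo d by (simp_all add: pos_divide_le_eq)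
  qed
  have unit: "bregman1 s 1 t \<le> c * bregman1 s t 1 \<and> bregman1 s t 1 \<le> c * bregman1 s 1 t"
    if "\<bar>t\<bar> \<le> 1" for t
  proof (cases "t \<le> 1/2")
    case True
    have "c * d \<le> c * bregman1 s t 1" "c * d \<le> c * bregman1 s 1 t"
      using far[OF True] c by (auto intro!: mult_left_mono)
    moreover have "bregman1 s 1 t \<le> 2 * s" "bregman1 s t 1 \<le> 2 * s" using up that by auto
    ultimately show ?thesis using c(3) by linarith
  next
    case False
    have *: "k * hi * (a - b)\<^sup>2 \<le> c * (k * lo * (a - b)\<^sup>2)" for a b
    proof -
      have "(k * (a - b)\<^sup>2) * hi \<le> (k * (a - b)\<^sup>2) * (c * lo)"
        using c k by (intro mult_left_mono) auto
      then show ?thesis by (simp add: mult_ac)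
    qed
    have n1: "k * lo * (1 - t)\<^sup>2 \<le> bregman1 s 1 t" "bregman1 s 1 t \<le> k * hi * (1 - t)\<^sup>2"
      using near[of 1 t] False that by auto
    have n2: "k * lo * (1 - t)\<^sup>2 \<le> bregman1 s t 1" "bregman1 s t 1 \<le> k * hi * (1 - t)\<^sup>2"
      using near[of t 1] False that by (auto simp: power2_commute[of t 1])
    show ?thesis
      using mult_left_mono[OF n1(1), of c] mult_left_mono[OF n2(1), of c] *[of 1 t] n1 n2 c
      by linarith
  qed
  \<comment> \<open>By homogeneity, dividing by the argument of larger modulus leaves the pair (1,
    t) with \<open>|t| \<le> 1\<close>.\<close>
  have "bregman1 s b a \<le> c * bregman1 s a b" for a b
  proof -
    consider "a = 0" "b = 0" | "\<bar>b\<bar> \<le> \<bar>a\<bar>" "a \<noteq> 0" | "\<bar>a\<bar> \<le> \<bar>b\<bar>" "b \<noteq> 0" by fastforce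
    then show ?thesis
    proof cases
      case 1 then show ?thesis by (simp add: bregman1_def)
    next
      case 2
      have "bregman1 s (a * (b/a)) (a * 1) \<le> c * bregman1 s (a * 1) (a * (b/a))"
        unfolding bregman1_scale
        using mult_left_mono[of "bregman1 s (b/a) 1" "c * bregman1 s 1 (b/a)" "\<bar>a\<bar> powr s"]
          unit[of "b/a"] 2 by (simp add: mult_ac)
      then show ?thesis using 2 by simp
    next
      case 3
      have "bregman1 s (b * 1) (b * (a/b)) \<le> c * bregman1 s (b * (a/b)) (b * 1)"
        unfolding bregman1_scale
        using mult_left_mono[of "bregman1 s 1 (a/b)" "c * bregman1 s (a/b) 1" "\<bar>b\<bar> powr s"]
          unit[of "a/b"] 3 by (simp add: mult_ac)
      then show ?thesis using 3 by simp
    qed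
  qed
  then show ?thesis using c by blast
qed

section \<open>The Bregman divergence of the p-th power of the s-norm\<close>

definition spow :: "real \<Rightarrow> nat \<Rightarrow> point \<Rightarrow> real" where
  "spow s n x = (\<Sum>i<n. \<bar>x i\<bar> powr s)"

text \<open>The gradient of \<open>|y|_s^p / p\<close>. The factor \<open>p\<close> is divided out,
  so that conjugate exponents give exactly inverse maps. At \<open>y = 0\<close> the value is 0,
  because \<open>dual_pow s 0 = 0\<close>.\<close>

definition pgrad :: "real \<Rightarrow> real \<Rightarrow> nat \<Rightarrow> point \<Rightarrow> nat \<Rightarrow> real" where
  "pgrad p s n y i = spow s n y powr ((p - s) / s) * dual_pow s (y i)"

definition bregman :: "real \<Rightarrow> real \<Rightarrow> nat \<Rightarrow> point \<Rightarrow> point \<Rightarrow> real" where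
  "bregman p s n x y = spow s n x powr (p / s) - spow s n y powr (p / s)
     - p * (\<Sum>i<n. pgrad p s n y i * (x i - y i))"

lemma spow_nonneg [simp]: "0 \<le> spow s n x"
  by (simp add: spow_def sum_nonneg)

lemma spow_eq_0_iff: "spow s n x = 0 \<longleftrightarrow> (\<forall>i<n. x i = 0)"
  by (subst spow_def, subst sum_nonneg_eq_0_iff) auto

lemma spow_scale: "spow s n (\<lambda>i. l * x i) = \<bar>l\<bar> powr s * spow s n x"
  by (simp add: spow_def sum_distrib_left abs_mult powr_mult)

lemma pgrad_scale:
  assumes "s > 1"
  shows "pgrad p s n (\<lambda>i. l * x i) i = dual_pow p l * pgrad p s n x i"
proof (cases "l = 0")
  case False
  have "(\<bar>l\<bar> powr s) powr ((p - s) / s) * (\<bar>l\<bar> powr (s - 1)) = \<bar>l\<bar> powr (p - 1)"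
    using False assms by (simp add: powr_powr powr_add[symmetric])
  then show ?thesis
    by (simp add: pgrad_def spow_scale powr_mult dual_pow_mult) (simp add: dual_pow_def mult_ac)
qed (simp add: pgrad_def)

text \<open>Euler's identity for a function that is homogeneous of degree \<open>p\<close>.\<close>

lemma pgrad_self:
  assumes "s > 1"
  shows "(\<Sum>i<n. pgrad p s n y i * y i) = spow s n y powr (p / s)"
proof (cases "spow s n y = 0")
  case True
  then show ?thesis by (simp add: pgrad_def)
next
  case False
  then have pos: "spow s n y > 0" using spow_nonneg[of s n y] by linarith
  have "(\<Sum>i<n. pgrad p s n y i * y i) = spow s n y powr ((p - s) / s) * spow s n y"
    by (simp add: pgrad_def mult.assoc dual_pow_self sum_distrib_left[symmetric] spow_def)
  also have "\<dots> = spow s n y powr ((p - s) / s + 1)" using pos by (simp add: powr_add)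
  also have "(p - s) / s + 1 = p / s" using assms by (simp add: field_simps)
  finally show ?thesis .
qed

lemma bregman_eq:
  assumes "s > 1"
  shows "bregman p s n x y = spow s n x powr (p / s) + (p - 1) * spow s n y powr (p / s)
     - p * (\<Sum>i<n. pgrad p s n y i * x i)"
  using pgrad_self[OF assms, of p n y]
  by (simp add: bregman_def right_diff_distrib sum_subtractf algebra_simps)

lemma bregman_scale:
  assumes "s > 1"
  shows "bregman p s n (\<lambda>i. l * x i) (\<lambda>i. l * y i) = \<bar>l\<bar> powr p * bregman p s n x y"
proof -
  have "spow s n (\<lambda>i. l * z i) powr (p / s) = \<bar>l\<bar> powr p * spow s n z powr (p / s)" for z
    using assms by (simp add: spow_scale powr_mult powr_powr)
  moreover have "(\<Sum>i<n. pgrad p s n (\<lambda>i. l * y i) i * (l * x i))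
      = \<bar>l\<bar> powr p * (\<Sum>i<n. pgrad p s n y i * x i)"
  proof -
    have "pgrad p s n (\<lambda>i. l * y i) i * (l * x i) = \<bar>l\<bar> powr p * (pgrad p s n y i * x i)" for i
      unfolding pgrad_scale[OF assms] dual_pow_self[of p l, symmetric] by (simp only: mult_ac)
    then show ?thesis by (simp only: sum_distrib_left)
  qed
  moreover have "L * a + (p - 1) * (L * b) - p * (L * c) = L * (a + (p - 1) * b - p * c)" for L a b c
    by (simp add: algebra_simps)
  ultimately show ?thesis
    unfolding bregman_eq[OF assms] by (simp only:)
qed

text \<open>The energy is the outer function \<open>t^(p/s)\<close> applied to the separable
  \<open>spow\<close>. The linearisation error of a composition is the error of the outer function
  plus the outer derivative times the error of the inner one. For \<open>p > s\<close> both summands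
  are nonnegative and are built from one-variable divergences, which is how constants free of the
  dimension arise.\<close>

lemma bregman_decompose:
  assumes "s > 1"
  shows "bregman p s n x y = bregman1 (p / s) (spow s n x) (spow s n y)
     + (p / s) * spow s n y powr (p / s - 1) * (\<Sum>i<n. bregman1 s (x i) (y i))"
proof -
  define X Y where "X = spow s n x" and "Y = spow s n y"
  have *: "(\<Sum>i<n. bregman1 s (x i) (y i)) = X - Y - s * (\<Sum>i<n. dual_pow s (y i) * (x i - y i))"
    by (simp add: bregman1_def X_def Y_def spow_def sum_subtractf sum_distrib_left mult.assoc)
  have e: "(p - s) / s = p / s - 1" using assms by (simp add: field_simps)
  have **: "(\<Sum>i<n. pgrad p s n y i * (x i - y i))
      = Y powr (p / s - 1) * (\<Sum>i<n. dual_pow s (y i) * (x i - y i))"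
    by (simp add: pgrad_def Y_def[symmetric] e sum_distrib_left mult.assoc)
  have "dual_pow (p / s) Y = Y powr (p / s - 1)"
    using spow_nonneg[of s n y, folded Y_def] by (cases "Y = 0") (auto simp: dual_pow_def)
  moreover have "p / s * Y powr (p / s - 1) * (s * z) = p * (Y powr (p / s - 1) * z)" for z
    using assms by simp
  ultimately show ?thesis
    unfolding * bregman_def ** using spow_nonneg[of s n x] spow_nonneg[of s n y]
    by (simp add: bregman1_def X_def[symmetric] Y_def[symmetric] right_diff_distrib)
qed

lemma bregman_same_exponent:
  assumes "s > 1"
  shows "bregman s s n x y = (\<Sum>i<n. bregman1 s (x i) (y i))"
\<comment> \<open>For \<open>p = s\<close> the prefactor \<open>spow s n y powr 0\<close> of the
  decomposition is 1 only if \<open>y\<close> is nonzero, since \<open>0 powr 0 = 0\<close>.\<close>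
proof (cases "spow s n y = 0")
  case True
  then have "\<forall>i<n. y i = 0" by (simp add: spow_eq_0_iff)
  then show ?thesis using assms True
    by (auto simp: bregman_def pgrad_def bregman1_def) (simp add: spow_def)
next
  case False
  then have "spow s n y > 0" using spow_nonneg[of s n y] by linarith
  then show ?thesis
    using bregman_decompose[OF assms, of s n x y] assms
    by (simp add: bregman1_def dual_pow_def)
qed

lemma bregman_nonneg_ge:
  assumes "s > 1" "p \<ge> s"
  shows "0 \<le> bregman p s n x y"
proof (cases "p = s")
  case True
  then show ?thesis using assms by (simp add: bregman_same_exponent bregman1_nonneg sum_nonneg)
next
  case False
  then have "p / s > 1" using assms by simp
  then show ?thesis
    unfolding bregman_decompose[OF assms(1)] using assms
    by (intro add_nonneg_nonneg mult_nonneg_nonneg sum_nonneg bregman1_nonneg) auto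
qed

text \<open>Both parts of the decomposition are quasi-symmetric by the one-variable lemma, but
  exchanging the arguments replaces the prefactor \<open>Y^(al-1)\<close> of the inner part by
  \<open>X^(al-1)\<close>. If \<open>X \<le> 2 Y\<close>, this costs a factor
  \<open>2^(al-1)\<close>. Otherwise the outer divergence alone is at least a multiple of
  \<open>X^al\<close> and dominates the whole inner part.\<close>

lemma bregman_comparable_ge:
  assumes s: "s > 1" and ps: "p \<ge> s"
  shows "\<exists>c\<ge>1. \<forall>n x y. bregman p s n y x \<le> c * bregman p s n x y"
proof (cases "p = s")
  case True
  obtain c where c: "c \<ge> 1" "\<And>a b. bregman1 s b a \<le> c * bregman1 s a b"
    using bregman1_comparable[OF s] by blast
  show ?thesis unfolding True bregman_same_exponent[OF s] sum_distrib_left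
    using c by (intro exI[of _ c]) (auto intro!: sum_mono)
next
  case False
  define al where "al = p / s"
  have al: "al > 1" using False assms by (simp add: al_def)
  obtain c where c: "c \<ge> 1" "\<And>a b. bregman1 s b a \<le> c * bregman1 s a b"
    using bregman1_comparable[OF s] by blast
  obtain d where d: "d \<ge> 1" "\<And>a b. bregman1 al b a \<le> d * bregman1 al a b"
    using bregman1_comparable[OF al] by blast
  \<comment> \<open>By scaling, \<open>k * X^al\<close> is a lower bound of the outer divergence
    whenever \<open>Y \<le> X/2\<close>.\<close>
  define k where "k = bregman1 al 1 (1/2)"
  have k: "k > 0"
  proof -
    obtain t where t: "1/2 < t" "k = al * (al - 1) / 2 * t powr (al - 2) * (1 - 1/2)\<^sup>2"
      unfolding k_def by (rule bregman1_taylor[OF al, of 1 "1/2"]) auto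
    show ?thesis unfolding t(2) using al t(1) by (intro mult_pos_pos) auto
  qed
  \<comment> \<open>The first entry serves the case \<open>X > 2 Y\<close>, the second one the case
    \<open>X \<le> 2 Y\<close>.\<close>
  define C where "C = max (d + 2 * s * al / k) (2 powr (al - 1) * c + d)"
  have "0 \<le> 2 * s * al / k" using al k s by (intro divide_nonneg_pos mult_nonneg_nonneg) auto
  then have C: "C \<ge> 1" using d(1) unfolding C_def by linarith
  have "bregman p s n y x \<le> C * bregman p s n x y" for n x y
  proof -
    define X Y G G' where "X = spow s n x" and "Y = spow s n y"
      and "G = (\<Sum>i<n. bregman1 s (x i) (y i))" and "G' = (\<Sum>i<n. bregman1 s (y i) (x i))"
    have XY: "X \<ge> 0" "Y \<ge> 0" by (auto simp: X_def Y_def)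
    have G: "G \<ge> 0" "G' \<ge> 0" "G' \<le> c * G"
      unfolding G_def G'_def sum_distrib_left by (auto intro!: sum_nonneg sum_mono bregman1_nonneg s c)
    have b1: "bregman p s n x y = bregman1 al X Y + al * Y powr (al - 1) * G"
      and b2: "bregman p s n y x = bregman1 al Y X + al * X powr (al - 1) * G'"
      unfolding bregman_decompose[OF s] by (simp_all add: al_def X_def Y_def G_def G'_def)
    have nn: "0 \<le> bregman1 al X Y" "0 \<le> al * Y powr (al - 1) * G"
      using al G by (auto intro!: bregman1_nonneg)
    show ?thesis
    proof (cases "X \<le> 2 * Y")
      case True
      have "X powr (al - 1) \<le> (2 * Y) powr (al - 1)" using True XY al by (intro powr_mono2) auto
      then have "X powr (al - 1) \<le> 2 powr (al - 1) * Y powr (al - 1)" using XY by (simp add: powr_mult)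
      then have "al * X powr (al - 1) * G' \<le> al * (2 powr (al - 1) * Y powr (al - 1)) * (c * G)"
        using al G c by (intro mult_mono mult_left_mono) auto
      also have "\<dots> = (2 powr (al - 1) * c) * (al * Y powr (al - 1) * G)" by simp
      also have "\<dots> \<le> (2 powr (al - 1) * c + d) * (al * Y powr (al - 1) * G)"
        using nn d by (intro mult_right_mono) auto
      finally have "bregman p s n y x \<le> (2 powr (al - 1) * c + d) * bregman1 al X Y
          + (2 powr (al - 1) * c + d) * (al * Y powr (al - 1) * G)"
        unfolding b2 using d(2)[of Y X] mult_right_mono[OF _ nn(1), of d "2 powr (al - 1) * c + d"] c
        by simp
      also have "\<dots> = (2 powr (al - 1) * c + d) * bregman p s n x y" by (simp add: b1 distrib_left)
      also have "\<dots> \<le> C * bregman p s n x y"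
        using nn by (intro mult_right_mono) (auto simp: b1 C_def)
      finally show ?thesis .
    next
      case False
      then have X0: "X > 0" "Y \<le> X / 2" using XY by auto
      have "bregman1 al X (X / 2) \<le> bregman1 al X Y"
      proof -
        have "dual_pow al Y \<le> dual_pow al (X / 2)" using X0 by (intro dual_pow_mono al)
        then have "0 \<le> al * (dual_pow al (X / 2) - dual_pow al Y) * (X - X / 2)"
          using al X0 by simp
        then show ?thesis
          using bregman1_three_points[of al X Y "X / 2"] bregman1_nonneg[OF al, of "X / 2" Y] by linarith
      qed
      then have low: "X powr al * k \<le> bregman1 al X Y"
        using bregman1_scale[of al X 1 "1/2"] XY by (simp add: k_def)
      have "G' \<le> (\<Sum>i<n. 2 * \<bar>y i\<bar> powr s + 2 * (s - 1) * \<bar>x i\<bar> powr s)"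
        unfolding G'_def by (intro sum_mono bregman1_le s)
      also have "\<dots> = 2 * Y + 2 * (s - 1) * X"
        by (simp add: X_def Y_def spow_def sum.distrib sum_distrib_left)
      also have "\<dots> \<le> 2 * s * X"
      proof -
        have "2 * Y \<le> X" using X0 by simp
        then show ?thesis using X0 by (simp add: algebra_simps)
      qed
      finally have "al * X powr (al - 1) * G' \<le> al * X powr (al - 1) * (2 * s * X)"
        using al by (intro mult_left_mono) auto
      also have "\<dots> = (2 * s * al / k) * (X powr al * k)"
        using X0 k by (simp add: powr_mult_base[of X "al - 1", symmetric] mult_ac powr_diff)
      also have "\<dots> \<le> (2 * s * al / k) * bregman1 al X Y"
        using low s al k by (intro mult_left_mono) auto
      finally have "bregman p s n y x \<le> (d + 2 * s * al / k) * bregman1 al X Y"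
        unfolding b2 using d(2)[of Y X] by (simp add: distrib_right)
      also have "\<dots> \<le> (d + 2 * s * al / k) * bregman p s n x y"
        using nn d s al k by (intro mult_left_mono) (auto simp: b1)
      also have "\<dots> \<le> C * bregman p s n x y"
        using nn by (intro mult_right_mono) (auto simp: b1 C_def)
      finally show ?thesis .
    qed
  qed
  with C show ?thesis by blast
qed

text \<open>Legendre duality: the divergence of the (p,s)-energy is that of the energy with the
  conjugate exponents, with the arguments exchanged. It reduces the case p < s to p > s.\<close>

lemma spow_pgrad:
  assumes "p > 1" "s > 1"
  shows "spow (s / (s - 1)) n (pgrad p s n x) = spow s n x powr ((p - 1) / (s - 1))"
proof (cases "spow s n x = 0")
  case True
  then show ?thesis by (simp add: pgrad_def spow_def)
next
  case False
  then have pos: "spow s n x > 0" using spow_nonneg[of s n x] by linarith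
  define e where "e = (p - s) / s * (s / (s - 1))"
  have "\<bar>pgrad p s n x i\<bar> powr (s / (s - 1)) = spow s n x powr e * \<bar>x i\<bar> powr s" for i
    using assms by (simp add: pgrad_def abs_mult abs_dual_pow powr_mult powr_powr e_def)
  then have "spow (s / (s - 1)) n (pgrad p s n x) = spow s n x powr e * spow s n x"
    by (subst spow_def) (simp add: sum_distrib_left[symmetric] spow_def[of s n x])
  also have "\<dots> = spow s n x powr (e + 1)" using pos by (simp add: powr_add)
  also have "e + 1 = (p - 1) / (s - 1)" using assms by (simp add: e_def divide_simps)
  finally show ?thesis .
qed

text \<open>The gradients of a convex function and of its Legendre conjugate are inverse to each
  other. In coordinates the two powers of \<open>spow s n x\<close> have opposite exponents and
  cancel; this is \<open>ex\<close>.\<close>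

lemma pgrad_pgrad:
  assumes "p > 1" "s > 1" "i < n"
  shows "pgrad (p / (p - 1)) (s / (s - 1)) n (pgrad p s n x) i = x i"
proof (cases "spow s n x = 0")
  case True
  then have "x i = 0" using assms by (simp add: spow_eq_0_iff)
  then show ?thesis by (simp add: pgrad_def)
next
  case False
  then have pos: "spow s n x > 0" using spow_nonneg[of s n x] by linarith
  define X where "X = spow s n x"
  have s1: "s / (s - 1) - 1 = 1 / (s - 1)" using assms by (simp add: field_simps)
  have dd: "dual_pow (s / (s - 1)) (dual_pow s t) = t" for t
    using assms by (cases "t = 0")
      (auto simp: dual_pow_def abs_mult sgn_mult s1 powr_powr abs_sgn_eq mult.commute[of "\<bar>t\<bar>"] sgn_mult_abs)
  have dc: "dual_pow (s / (s - 1)) (X powr e) = X powr (e / (s - 1))" for e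
    using pos by (simp add: dual_pow_def s1 powr_powr X_def)
  have "(a - b) / b = a / b - 1" if "b \<noteq> 0" for a b :: real
    using that by (simp add: diff_divide_distrib)
  from this[of "s / (s - 1)" "p / (p - 1)"]
  have "((p / (p - 1) - s / (s - 1)) / (s / (s - 1))) = p * (s - 1) / (s * (p - 1)) - 1"
    using assms by (simp add: mult.commute)
  also have "(p - 1) / (s - 1) * \<dots> = (p - 1) / (s - 1) * (p * (s - 1) / (s * (p - 1))) - (p - 1) / (s - 1)"
    by (simp add: right_diff_distrib)
  also have "(p - 1) / (s - 1) * (p * (s - 1) / (s * (p - 1))) = p / s"
    using assms by (simp add: times_divide_eq_right)
  also have "p / s - (p - 1) / (s - 1) = - ((p - s) / s / (s - 1))"
    using assms by (simp add: divide_simps) (simp add: algebra_simps)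
  finally have ex: "(p - 1) / (s - 1) * ((p / (p - 1) - s / (s - 1)) / (s / (s - 1))) = - ((p - s) / s / (s - 1))" .
  have "pgrad (p / (p - 1)) (s / (s - 1)) n (pgrad p s n x) i
    = (X powr ((p - 1) / (s - 1))) powr ((p / (p - 1) - s / (s - 1)) / (s / (s - 1)))
      * (X powr ((p - s) / s / (s - 1)) * x i)"
    unfolding pgrad_def[of "p / (p - 1)"] spow_pgrad[OF assms(1,2)]
    by (simp add: pgrad_def X_def[symmetric] dual_pow_mult dd dc)
  also have "\<dots> = X powr (- ((p - s) / s / (s - 1))) * X powr ((p - s) / s / (s - 1)) * x i"
    unfolding powr_powr ex by simp
  also have "\<dots> = x i" using pos by (simp add: powr_add[symmetric] X_def)
  finally show ?thesis .
qed

lemma bregman_dual: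
  assumes "p > 1" "s > 1"
  shows "bregman p s n x y
    = (p - 1) * bregman (p / (p - 1)) (s / (s - 1)) n (pgrad p s n y) (pgrad p s n x)"
proof -
  define p' s' where "p' = p / (p - 1)" and "s' = s / (s - 1)"
  have s': "s' > 1" using assms by (simp add: s'_def)
  have F: "spow s' n (pgrad p s n z) powr (p' / s') = spow s n z powr (p / s)" for z
  proof -
    have "(p - 1) / (s - 1) * (p' / s') = p / s" using assms by (simp add: p'_def s'_def)
    then show ?thesis using spow_pgrad[OF assms, of n z, folded s'_def] by (simp only: powr_powr)
  qed
  have "(\<Sum>i<n. pgrad p' s' n (pgrad p s n x) i * pgrad p s n y i) = (\<Sum>i<n. pgrad p s n y i * x i)"
    by (rule sum.cong) (auto simp: p'_def s'_def pgrad_pgrad[OF assms])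
  then have "bregman p' s' n (pgrad p s n y) (pgrad p s n x)
      = spow s n y powr (p / s) + (p' - 1) * spow s n x powr (p / s)
        - p' * (\<Sum>i<n. pgrad p s n y i * x i)"
    unfolding bregman_eq[OF s'] F by simp
  moreover have "(p - 1) * (p' - 1) = 1" "(p - 1) * p' = p"
    using assms by (simp_all add: p'_def field_simps)
  then have "(p - 1) * (a + (p' - 1) * b - p' * c) = b + (p - 1) * a - p * c" for a b c
    by (simp add: right_diff_distrib distrib_left mult.assoc[symmetric])
  ultimately show ?thesis unfolding bregman_eq[OF assms(2)] p'_def s'_def by simp
qed

text \<open>Conjugation reverses the order of the exponents, so the dual of the case
  \<open>p < s\<close> falls under the case settled directly.\<close>

lemma conjugate_less:
  "1 < p \<Longrightarrow> p < s \<Longrightarrow> s / (s - 1) \<le> p / (p - (1::real))"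
  by (simp add: divide_simps) (simp add: algebra_simps)

lemma bregman_nonneg:
  assumes "p > 1" "s > 1"
  shows "0 \<le> bregman p s n x y"
proof (cases "p \<ge> s")
  case False
  then show ?thesis unfolding bregman_dual[OF assms]
    using assms conjugate_less[of p s] by (intro mult_nonneg_nonneg bregman_nonneg_ge) auto
qed (rule bregman_nonneg_ge[OF assms(2)])

lemma bregman_comparable:
  assumes "p > 1" "s > 1"
  shows "\<exists>c\<ge>1. \<forall>n x y. bregman p s n y x \<le> c * bregman p s n x y"
proof (cases "p \<ge> s")
  case False
  have "\<exists>c\<ge>1. \<forall>n x y. bregman (p / (p - 1)) (s / (s - 1)) n y x
      \<le> c * bregman (p / (p - 1)) (s / (s - 1)) n x y"
    using False assms conjugate_less[of p s] by (intro bregman_comparable_ge) auto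
  then obtain c where c: "c \<ge> 1" "\<And>n x y. bregman (p / (p - 1)) (s / (s - 1)) n y x
      \<le> c * bregman (p / (p - 1)) (s / (s - 1)) n x y" by blast
  have "bregman p s n y x \<le> c * bregman p s n x y" for n x y
    unfolding bregman_dual[OF assms, of n y x] bregman_dual[OF assms, of n x y]
    using mult_left_mono[OF c(2), of "p - 1"] assms by (simp add: mult_ac)
  with c show ?thesis by blast
qed (rule bregman_comparable_ge[OF assms(2)])

text \<open>With \<open>g t = bregman (y + t w) y\<close>, convexity bounds \<open>g l - g k\<close> by
  \<open>(l - k) / l\<close> times the symmetrised divergence, hence \<open>g l \<le> 2 * g k\<close> as soon as \<open>l / k\<close> is close
  to 1. Iterating gives polynomial growth.\<close>

lemma bregman_growth:
  assumes p: "p > 1" and s: "s > 1"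
  shows "\<exists>C M. 1 \<le> C \<and> 0 < M \<and> (\<forall>n y w t. 0 \<le> t \<longrightarrow>
    bregman p s n (\<lambda>i. y i + t * w i) y \<le> C * max 1 t powr M * bregman p s n (\<lambda>i. y i + w i) y)"
proof -
  obtain c where c: "c \<ge> 1" "\<And>n x y. bregman p s n y x \<le> c * bregman p s n x y"
    using bregman_comparable[OF p s] by blast
  \<comment> \<open>Chosen so that \<open>(1 - q) * (c + 1) = 1/2\<close>, which lets half of
    \<open>g l\<close> be absorbed in \<open>step\<close>.\<close>
  define q where "q = 1 - 1 / (2 * (c + 1))"
  have q: "0 < q" "q < 1" using c by (auto simp: q_def field_simps)
  \<comment> \<open>Determined by \<open>(1/q)^M = 2\<close>: each shrinking of the parameter by
    \<open>q\<close> costs a factor 2.\<close>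
  define M where "M = ln 2 / ln (1 / q)"
  have M: "M > 0" using q by (auto simp: M_def intro!: divide_pos_pos ln_gt_zero)
  have "bregman p s n (\<lambda>i. y i + t * w i) y \<le> 2 * max 1 t powr M * bregman p s n (\<lambda>i. y i + w i) y"
    if t: "0 \<le> t" for n y w t
  proof -
    define x where "x t = (\<lambda>i. y i + t * w i)" for t
    define g where "g t = bregman p s n (x t) y" for t
    define L where "L z = p * (\<Sum>i<n. pgrad p s n z i * w i)" for z
    have g0: "g t \<ge> 0" for t unfolding g_def by (rule bregman_nonneg[OF p s])
    have gt: "g t = spow s n (x t) powr (p / s) - spow s n y powr (p / s) - t * L y" for t
      by (simp add: g_def bregman_def x_def L_def sum_distrib_left mult_ac)
    have gd: "bregman p s n (x k) (x l) = spow s n (x k) powr (p / s) - spow s n (x l) powr (p / s)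
        - (k - l) * L (x l)" for k l
    proof -
      have "(\<Sum>i<n. pgrad p s n (x l) i * (x k i - x l i)) = (k - l) * (\<Sum>i<n. pgrad p s n (x l) i * w i)"
        unfolding sum_distrib_left by (rule sum.cong) (auto simp: x_def algebra_simps)
      then show ?thesis by (simp add: bregman_def L_def)
    qed
    have yx: "bregman p s n y (x l) = spow s n y powr (p / s) - spow s n (x l) powr (p / s) + l * L (x l)" for l
      using gd[of 0 l] by (simp add: x_def)
    have step: "g l \<le> 2 * g (q * l)" if "l > 0" for l
    proof -
      have "0 \<le> bregman p s n (x (q * l)) (x l)" by (rule bregman_nonneg[OF p s])
      then have 1: "g l - g (q * l) \<le> (1 - q) * (l * (L (x l) - L y))"
        unfolding gd gt by (simp add: algebra_simps)
      have "l * (L (x l) - L y) = g l + bregman p s n y (x l)"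
        unfolding yx gt by (simp add: algebra_simps)
      also have "\<dots> \<le> (c + 1) * g l" using c(2)[of n y "x l"] by (simp add: g_def algebra_simps)
      finally have "(1 - q) * (l * (L (x l) - L y)) \<le> (1 - q) * ((c + 1) * g l)"
        using q by (intro mult_left_mono) auto
      also have "\<dots> = ((1 - q) * (c + 1)) * g l" by (simp only: mult.assoc)
      also have "(1 - q) * (c + 1) = 1 / 2"
      proof -
        have "1 / (2 * d) * d = 1 / 2" if "d > 0" for d :: real using that by simp
        from this[of "c + 1"] have "1 / (2 * (c + 1)) * (c + 1) = 1 / 2" using c by linarith
        moreover have "1 - q = 1 / (2 * (c + 1))" unfolding q_def by linarith
        ultimately show ?thesis by metis
      qed
      finally show ?thesis using 1 by linarith
    qed
    have small: "g l \<le> g k" if "0 \<le> l" "l \<le> k" for l k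
    proof (cases "k = l")
      case False
      then have k: "k > 0" "l < k" using that by auto
      \<comment> \<open>\<open>x l\<close> is the convex combination of \<open>x k\<close> and
        \<open>y\<close> with weights \<open>l/k\<close> and \<open>1 - l/k\<close>, so the gradient
        terms at \<open>x l\<close> cancel.\<close>
      have "0 \<le> l / k * bregman p s n (x k) (x l) + (1 - l / k) * bregman p s n y (x l)"
        using k that by (intro add_nonneg_nonneg mult_nonneg_nonneg bregman_nonneg p s) auto
      also have "\<dots> = l / k * g k - g l"
        unfolding gd yx gt using k by (simp add: field_simps)
      finally have "g l \<le> l / k * g k" by simp
      also have "\<dots> \<le> 1 * g k" using k g0 by (intro mult_right_mono) auto
      finally show ?thesis by simp
    qed simp
    have iter: "g l \<le> 2 ^ N * g 1" if "0 \<le> l" "l * q ^ N \<le> 1" for l N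
      using that
    proof (induction N arbitrary: l)
      case 0
      then show ?case using small[of l 1] by simp
    next
      case (Suc N)
      show ?case
      proof (cases "l = 0")
        case True
        have "g 0 = 0" by (simp add: gt) (simp add: x_def)
        then show ?thesis using True g0 by simp
      next
        case False
        have "g (q * l) \<le> 2 ^ N * g 1" using Suc.prems q by (intro Suc.IH) (auto simp: mult_ac)
        then show ?thesis using step[of l] False Suc.prems by simp
      qed
    qed
    \<comment> \<open>The number of shrinkings that brings \<open>max 1 t\<close> below 1. Rounding
      up adds at most one, which is where the leading constant 2 comes from.\<close>
    define N where "N = nat \<lceil>ln (max 1 t) / ln (1 / q)\<rceil>"
    have lq: "ln (1 / q) > 0" using q by simp
    have "0 \<le> ln (max 1 t) / ln (1 / q)" using lq by (intro divide_nonneg_pos) auto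
    then have N: "ln (max 1 t) / ln (1 / q) \<le> N" "N \<le> ln (max 1 t) / ln (1 / q) + 1"
      unfolding N_def by linarith+
    have "max 1 t * q ^ N \<le> 1"
    proof -
      have "ln (max 1 t) \<le> N * ln (1 / q)" using N(1) lq by (simp add: pos_divide_le_eq)
      also have "\<dots> = ln ((1 / q) ^ N)" using q by (simp add: ln_realpow)
      finally have "max 1 t \<le> (1 / q) ^ N" using q by (subst (asm) ln_le_cancel_iff) auto
      then have "max 1 t * q ^ N \<le> (1 / q) ^ N * q ^ N" using q by (intro mult_right_mono) auto
      also have "\<dots> = 1" using q by (simp add: power_mult_distrib[symmetric])
      finally show ?thesis .
    qed
    moreover have "t * q ^ N \<le> max 1 t * q ^ N" using q by (intro mult_right_mono) auto
    ultimately have "t * q ^ N \<le> 1" by linarith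
    then have "g t \<le> 2 ^ N * g 1" using t by (intro iter)
    also have "(2::real) ^ N = 2 powr N" by (simp add: powr_realpow)
    also have "\<dots> \<le> 2 powr (ln (max 1 t) / ln (1 / q) + 1)" using N(2) by (intro powr_mono) auto
    also have "\<dots> = 2 * max 1 t powr M"
    proof -
      have "max 1 t \<noteq> 0" by linarith
      then show ?thesis by (simp only: powr_add) (simp add: powr_def M_def mult_ac)
    qed
    finally show ?thesis using g0[of 1] by (simp add: g_def x_def mult_right_mono)
  qed
  note G = this
  show ?thesis
  proof (intro exI conjI allI impI)
    show "(1::real) \<le> 2" by simp
    show "0 < M" by (rule M)
    fix n y w and t :: real assume "0 \<le> t"
    then show "bregman p s n (\<lambda>i. y i + t * w i) y
      \<le> 2 * max 1 t powr M * bregman p s n (\<lambda>i. y i + w i) y" by (rule G)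
  qed
qed

section \<open>Topology and Borel sets of the product space\<close>

abbreviation pts :: "nat \<Rightarrow> point set" where
  "pts n \<equiv> PiE {..<n} (\<lambda>_. UNIV)"

abbreviation lbP :: "nat \<Rightarrow> point measure" where
  "lbP n \<equiv> Pi\<^sub>M {..<n} (\<lambda>_. lborel)"

abbreviation ind :: "'a set \<Rightarrow> 'a \<Rightarrow> 'b::zero_neq_one" where
  "ind \<equiv> indicator"

abbreviation pd :: "nat \<Rightarrow> (point \<Rightarrow> real) \<Rightarrow> point \<Rightarrow> real" where
  "pd \<equiv> partial_deriv"

abbreviation borelP :: "nat \<Rightarrow> (point \<Rightarrow> 'a::topological_space) set" where
  "borelP n \<equiv> borel_measurable (lbP n)"

abbreviation lmeas :: "nat \<Rightarrow> point set \<Rightarrow> (point \<Rightarrow> real) \<Rightarrow> bool" where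
  "lmeas n \<equiv> set_borel_measurable (leb n)"

abbreviation cont :: "nat \<Rightarrow> (point \<Rightarrow> real) \<Rightarrow> bool" where
  "cont n \<equiv> continuous_map (Rn n) euclideanreal"

abbreviation cont_on :: "nat \<Rightarrow> point set \<Rightarrow> (point \<Rightarrow> real) \<Rightarrow> bool" where
  "cont_on n U \<equiv> continuous_map (subtopology (Rn n) U) euclideanreal"

abbreviation compact_in :: "nat \<Rightarrow> point set \<Rightarrow> bool" where
  "compact_in n \<equiv> compactin (Rn n)"

text \<open>Cubes instead of Euclidean balls: they are products of intervals, so openness,
  compactness, connectedness and volume follow coordinatewise.\<close>

definition obox :: "nat \<Rightarrow> point \<Rightarrow> real \<Rightarrow> point set" where
  "obox n x r = {y \<in> pts n. \<forall>i<n. \<bar>y i - x i\<bar> < r}"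

definition clbox :: "nat \<Rightarrow> point \<Rightarrow> real \<Rightarrow> point set" where
  "clbox n x r = {y \<in> pts n. \<forall>i<n. \<bar>y i - x i\<bar> \<le> r}"

lemma topspace_Rn [simp]: "topspace (Rn n) = pts n"
  by simp

lemma space_lbP: "space (lbP n) = pts n"
  by (simp add: space_PiM)

lemma obox_eq_PiE: "obox n x r = PiE {..<n} (\<lambda>i. {x i - r<..<x i + r})"
proof -
  have "\<bar>y i - x i\<bar> < r \<longleftrightarrow> y i \<in> {x i - r<..<x i + r}" for y i
    by (auto simp: abs_less_iff)
  then show ?thesis unfolding obox_def PiE_iff by (simp add: set_eq_iff PiE_iff) blast
qed

lemma clbox_eq_PiE: "clbox n x r = PiE {..<n} (\<lambda>i. {x i - r..x i + r})"
proof -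
  have "\<bar>y i - x i\<bar> \<le> r \<longleftrightarrow> y i \<in> {x i - r..x i + r}" for y i
    by (auto simp: abs_le_iff)
  then show ?thesis unfolding clbox_def PiE_iff by (simp add: set_eq_iff PiE_iff) blast
qed

lemma openin_obox: "openin (Rn n) (obox n x r)"
  unfolding obox_eq_PiE by (subst openin_PiE) auto

lemma compactin_clbox: "compact_in n (clbox n x r)"
  unfolding clbox_eq_PiE by (subst compactin_PiE) auto

lemma connectedin_obox: "connectedin (Rn n) (obox n x r)"
  unfolding obox_eq_PiE by (subst connectedin_PiE) auto

lemma obox_subset_clbox: "obox n x r \<subseteq> clbox n x r"
  by (auto simp: obox_def clbox_def less_imp_le)

lemma clbox_subset_obox: "r < r' \<Longrightarrow> clbox n x r \<subseteq> obox n x r'"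
  by (force simp: obox_def clbox_def)

lemma obox_mono: "r \<le> r' \<Longrightarrow> obox n x r \<subseteq> obox n x r'"
  by (force simp: obox_def)

lemma centre_in_obox: "x \<in> pts n \<Longrightarrow> 0 < r \<Longrightarrow> x \<in> obox n x r"
  by (auto simp: obox_def)

lemma obox_triangle:
  "y \<in> obox n x r \<Longrightarrow> z \<in> obox n y r' \<Longrightarrow> z \<in> obox n x (r + r')"
proof -
  assume y: "y \<in> obox n x r" and z: "z \<in> obox n y r'"
  have "\<bar>z i - x i\<bar> < r + r'" if "i < n" for i
  proof -
    have "\<bar>y i - x i\<bar> < r" "\<bar>z i - y i\<bar> < r'" using y z that by (auto simp: obox_def)
    then show ?thesis by linarith
  qed
  then show ?thesis using z by (simp add: obox_def)
qed

lemma obox_sym: "x \<in> pts n \<Longrightarrow> y \<in> obox n x r \<Longrightarrow> x \<in> obox n y r"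
  by (auto simp: obox_def abs_minus_commute)

lemma clbox_sets [measurable]: "clbox n x r \<in> sets (lbP n)"
  unfolding clbox_eq_PiE by (intro sets_PiM_I_finite) auto

lemma obox_sets [measurable]: "obox n x r \<in> sets (lbP n)"
  unfolding obox_eq_PiE by (intro sets_PiM_I_finite) auto

text \<open>The product topology of finitely many lines is the topology of the maximum metric. All
  later epsilon-delta arguments rest on this form.\<close>

lemma openin_Rn_iff:
  "openin (Rn n) U \<longleftrightarrow> U \<subseteq> pts n \<and> (\<forall>x\<in>U. \<exists>r>0. obox n x r \<subseteq> U)"
proof
  assume U: "openin (Rn n) U"
  have "\<exists>r>0. obox n x r \<subseteq> U" if x: "x \<in> U" for x
  proof -
    have "\<exists>W. (\<forall>i\<in>{..<n}. open (W i)) \<and> x \<in> PiE {..<n} W \<and> PiE {..<n} W \<subseteq> U"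
      using U x unfolding openin_product_topology_alt by simp
    then obtain W where W: "\<forall>i\<in>{..<n}. open (W i)" "x \<in> PiE {..<n} W" "PiE {..<n} W \<subseteq> U"
      by blast
    have "\<exists>r>0. \<forall>t. \<bar>t - x i\<bar> < r \<longrightarrow> t \<in> W i" if "i < n" for i
    proof -
      have "open (W i)" "x i \<in> W i" using W that by (auto simp: PiE_iff)
      then show ?thesis unfolding open_dist dist_real_def by blast
    qed
    then obtain r where r: "\<And>i. i < n \<Longrightarrow> r i > 0" "\<And>i t. i < n \<Longrightarrow> \<bar>t - x i\<bar> < r i \<Longrightarrow> t \<in> W i"
      by metis
    \<comment> \<open>The inserted 1 keeps the set nonempty when \<open>n = 0\<close>.\<close>
    define d where "d = Min (insert 1 (r ` {..<n}))"
    have d: "d > 0" "\<And>i. i < n \<Longrightarrow> d \<le> r i" using r by (auto simp: d_def)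
    have "obox n x d \<subseteq> PiE {..<n} W"
    proof
      fix y assume y: "y \<in> obox n x d"
      have "y i \<in> W i" if "i < n" for i
      proof -
        have "\<bar>y i - x i\<bar> < d" using y that by (simp add: obox_def)
        then show ?thesis using r(2)[OF that, of "y i"] d(2)[OF that] by linarith
      qed
      then show "y \<in> PiE {..<n} W" using y by (simp add: obox_def PiE_iff)
    qed
    with W d show ?thesis by blast
  qed
  with openin_subset[OF U] show "U \<subseteq> pts n \<and> (\<forall>x\<in>U. \<exists>r>0. obox n x r \<subseteq> U)" by auto
next
  assume *: "U \<subseteq> pts n \<and> (\<forall>x\<in>U. \<exists>r>0. obox n x r \<subseteq> U)"
  show "openin (Rn n) U"
  proof (subst openin_subopen, intro ballI)
    fix x assume x: "x \<in> U"
    then obtain r where "r > 0" "obox n x r \<subseteq> U" using * by blast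
    then show "\<exists>T. openin (Rn n) T \<and> x \<in> T \<and> T \<subseteq> U"
      using openin_obox[of n x r] centre_in_obox[of x n r] x * by blast
  qed
qed

text \<open>Lebesgue's number lemma. Covering by cubes of half the radius leaves room for a cube of
  uniform radius \<open>d\<close> around each point of \<open>K\<close>.\<close>

lemma compact_obox_lebesgue:
  assumes K: "compact_in n K" and r: "\<And>x. x \<in> K \<Longrightarrow> r x > 0"
  obtains d F where "d > 0" "finite F" "F \<subseteq> K"
    "\<forall>y\<in>K. \<exists>x\<in>F. y \<in> obox n x (r x) \<and> obox n y d \<subseteq> obox n x (r x)"
proof -
  have Kp: "K \<subseteq> pts n" using compactin_subset_topspace[OF K] by simp
  have "\<exists>\<F>. finite \<F> \<and> \<F> \<subseteq> (\<lambda>x. obox n x (r x / 2)) ` K \<and> K \<subseteq> \<Union> \<F>"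
  proof -
    have "\<forall>U\<in>(\<lambda>x. obox n x (r x / 2)) ` K. openin (Rn n) U" using openin_obox by blast
    moreover have "x \<in> obox n x (r x / 2)" if "x \<in> K" for x
      using Kp that r by (intro centre_in_obox) auto
    then have "K \<subseteq> \<Union> ((\<lambda>x. obox n x (r x / 2)) ` K)" by blast
    ultimately show ?thesis using K unfolding compactin_def by blast
  qed
  then obtain \<F> where \<F>: "finite \<F>" "\<F> \<subseteq> (\<lambda>x. obox n x (r x / 2)) ` K" "K \<subseteq> \<Union> \<F>"
    by blast
  obtain F where F0: "F \<subseteq> K" "finite F" "\<F> = (\<lambda>x. obox n x (r x / 2)) ` F"
    using finite_subset_image[OF \<F>(1,2)] by blast
  then have F: "finite F" "F \<subseteq> K" "K \<subseteq> (\<Union>x\<in>F. obox n x (r x / 2))" using \<F>(3) by auto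
  define d where "d = Min (insert 1 ((\<lambda>x. r x / 2) ` F))"
  have d: "d > 0" "\<And>x. x \<in> F \<Longrightarrow> d \<le> r x / 2"
  proof -
    show "d > 0" using F r by (auto simp: d_def subset_iff)
    fix x assume "x \<in> F"
    then show "d \<le> r x / 2" unfolding d_def using F by (intro Min_le) auto
  qed
  have "\<exists>x\<in>F. y \<in> obox n x (r x) \<and> obox n y d \<subseteq> obox n x (r x)" if yK: "y \<in> K" for y
  proof -
    obtain x where x: "x \<in> F" "y \<in> obox n x (r x / 2)" using F yK by auto
    have "obox n y d \<subseteq> obox n x (r x)"
    proof
      fix z assume "z \<in> obox n y d"
      then have "z \<in> obox n y (r x / 2)" using obox_mono[OF d(2)[OF x(1)], of n y] by auto
      then show "z \<in> obox n x (r x)" using obox_triangle[OF x(2)] by fastforce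
    qed
    moreover have "y \<in> obox n x (r x)"
      using x obox_mono[of "r x / 2" "r x" n x] less_imp_le[OF r[of x]] F(2) by auto
    ultimately show ?thesis using x by blast
  qed
  with d F(1,2) show thesis by (intro that[of d F] ballI) auto
qed

text \<open>Provides the margin \<open>d\<close> that mollification at radius below \<open>d\<close>
  consumes: values at points of \<open>K\<close> then depend only on the function in
  \<open>K'\<close>.\<close>

lemma compact_neighbourhood:
  assumes U: "openin (Rn n) U" and K: "compact_in n K" "K \<subseteq> U"
  obtains d K' where "d > 0" "compact_in n K'" "K' \<subseteq> U" "\<forall>x\<in>K. obox n x d \<subseteq> K'" "K \<subseteq> K'"
proof -
  have "\<exists>r>0. clbox n x r \<subseteq> U" if xK: "x \<in> K" for x
  proof -
    obtain r where r: "r > 0" "obox n x r \<subseteq> U" using U K xK unfolding openin_Rn_iff by blast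
    then show ?thesis using clbox_subset_obox[of "r/2" r n x] by (intro exI[of _ "r/2"]) auto
  qed
  then obtain r where r: "\<And>x. x \<in> K \<Longrightarrow> r x > 0" "\<And>x. x \<in> K \<Longrightarrow> clbox n x (r x) \<subseteq> U" by metis
  obtain d F where F: "d > 0" "finite F" "F \<subseteq> K"
    "\<forall>y\<in>K. \<exists>x\<in>F. y \<in> obox n x (r x) \<and> obox n y d \<subseteq> obox n x (r x)"
    by (rule compact_obox_lebesgue[where r = r, OF K(1)], erule r(1), rule that)
  show thesis
  proof
    show "compact_in n (\<Union>x\<in>F. clbox n x (r x))"
      using F by (intro compactin_Union) (auto intro: compactin_clbox)
    show "(\<Union>x\<in>F. clbox n x (r x)) \<subseteq> U" using r F by blast
    show "\<forall>x\<in>K. obox n x d \<subseteq> (\<Union>x\<in>F. clbox n x (r x))"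
      using F(4) obox_subset_clbox by blast
    show "K \<subseteq> (\<Union>x\<in>F. clbox n x (r x))" using F(4) obox_subset_clbox by blast
  qed fact
qed

lemma compact_box_bounded:
  assumes K: "compact_in n K"
  obtains R where "R > 0" "\<forall>x\<in>K. \<forall>i<n. \<bar>x i\<bar> < R"
proof -
  obtain d F where "d > 0" and F: "finite F" "F \<subseteq> K"
    "\<forall>y\<in>K. \<exists>x\<in>F. y \<in> obox n x 1 \<and> obox n y d \<subseteq> obox n x 1"
    by (rule compact_obox_lebesgue[where r = "\<lambda>_. 1", OF K zero_less_one]) (rule that)
  define R where "R = 1 + (\<Sum>x\<in>F. \<Sum>i<n. \<bar>x i\<bar>)"
  have "\<bar>y i\<bar> < R" if y: "y \<in> K" "i < n" for y i
  proof -
    obtain x where x: "x \<in> F" "y \<in> obox n x 1" using F(3)[rule_format, OF y(1)] by blast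
    have "\<bar>x i\<bar> \<le> (\<Sum>i<n. \<bar>x i\<bar>)" using y by (intro member_le_sum) auto
    also have "\<dots> \<le> (\<Sum>x\<in>F. \<Sum>i<n. \<bar>x i\<bar>)" using x F by (intro member_le_sum sum_nonneg) auto
    finally have "\<bar>x i\<bar> \<le> R - 1" by (simp add: R_def)
    moreover have "\<bar>y i - x i\<bar> < 1" using x y by (simp add: obox_def)
    ultimately show ?thesis by linarith
  qed
  moreover have "R > 0" unfolding R_def by (intro add_pos_nonneg sum_nonneg) auto
  ultimately show thesis by (intro that[of R]) auto
qed

lemma continuous_map_Rn_iff:
  assumes U: "openin (Rn n) U"
  shows "cont_on n U f \<longleftrightarrow>
    (\<forall>x\<in>U. \<forall>e>0. \<exists>r>0. \<forall>y\<in>obox n x r \<inter> U. \<bar>f y - f x\<bar> < e)"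
proof -
  have Up: "U \<subseteq> pts n" using openin_subset[OF U] by simp
  have ts: "topspace (subtopology (Rn n) U) = U" using Up by auto
  show ?thesis
  proof (intro iffI ballI allI impI)
    fix x e assume f: "cont_on n U f" and x: "x \<in> U" and e: "(e::real) > 0"
    have "openin (subtopology (Rn n) U) {y \<in> topspace (subtopology (Rn n) U). f y \<in> ball (f x) e}"
      by (intro openin_continuous_map_preimage[OF f]) auto
    then have "openin (Rn n) {y \<in> U. f y \<in> ball (f x) e}"
      unfolding ts openin_open_subtopology[OF U] by auto
    then obtain r where "r > 0" "obox n x r \<subseteq> {y \<in> U. f y \<in> ball (f x) e}"
      unfolding openin_Rn_iff using x e by auto
    then show "\<exists>r>0. \<forall>y\<in>obox n x r \<inter> U. \<bar>f y - f x\<bar> < e"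
      by (intro exI[of _ r]) (auto simp: dist_real_def abs_minus_commute subset_iff)
  next
    assume *: "\<forall>x\<in>U. \<forall>e>0. \<exists>r>0. \<forall>y\<in>obox n x r \<inter> U. \<bar>f y - f x\<bar> < e"
    show "cont_on n U f"
      unfolding continuous_map_def ts openin_open_subtopology[OF U]
    proof (intro conjI allI impI)
      fix S assume "openin euclideanreal S"
      then have S: "open S" by simp
      show "openin (Rn n) {x \<in> U. f x \<in> S}"
        unfolding openin_Rn_iff
      proof (intro conjI ballI)
        fix x assume x: "x \<in> {x \<in> U. f x \<in> S}"
        then obtain e where e: "e > 0" "ball (f x) e \<subseteq> S" using S open_contains_ball by blast
        obtain r where r: "r > 0" "\<forall>y\<in>obox n x r \<inter> U. \<bar>f y - f x\<bar> < e" using * x e by blast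
        obtain r' where r': "r' > 0" "obox n x r' \<subseteq> U" using U x unfolding openin_Rn_iff by blast
        have "obox n x (min r r') \<subseteq> {x \<in> U. f x \<in> S}"
        proof
          fix y assume y: "y \<in> obox n x (min r r')"
          then have "y \<in> U" "y \<in> obox n x r"
            using r' obox_mono[of "min r r'" r n x] obox_mono[of "min r r'" r' n x] by auto
          then have "\<bar>f y - f x\<bar> < e" using r by auto
          then have "f y \<in> S" using e by (auto simp: dist_real_def abs_minus_commute subset_iff)
          with \<open>y \<in> U\<close> show "y \<in> {x \<in> U. f x \<in> S}" by simp
        qed
        then show "\<exists>r>0. obox n x r \<subseteq> {x \<in> U. f x \<in> S}" using r r' by (intro exI[of _ "min r r'"]) auto
      qed (use Up in auto)
    qed auto
  qed
qed

lemma continuous_map_Rn_iff':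
  "cont n f \<longleftrightarrow>
    (\<forall>x\<in>pts n. \<forall>e>0. \<exists>r>0. \<forall>y\<in>obox n x r. \<bar>f y - f x\<bar> < e)"
proof -
  have "subtopology (Rn n) (pts n) = Rn n" by (metis subtopology_topspace topspace_Rn)
  moreover have "obox n x r \<inter> pts n = obox n x r" for x r by (auto simp: obox_def)
  moreover have "openin (Rn n) (pts n)" by (metis openin_topspace topspace_Rn)
  ultimately show ?thesis using continuous_map_Rn_iff[of n "pts n" f] by simp
qed

lemma uniformly_continuous_on_compact:
  assumes U: "openin (Rn n) U" and f: "cont_on n U f"
    and K: "compact_in n K" "K \<subseteq> U" and e: "e > 0"
  obtains d where "d > 0" "\<forall>x\<in>K. \<forall>y\<in>obox n x d. y \<in> U \<and> \<bar>f y - f x\<bar> < e"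
proof -
  have "\<exists>r>0. obox n x r \<subseteq> U \<and> (\<forall>y\<in>obox n x r. \<bar>f y - f x\<bar> < e / 2)" if xK: "x \<in> K" for x
  proof -
    have "x \<in> U" "e / 2 > 0" using xK K e by auto
    then obtain r where r: "r > 0" "\<forall>y\<in>obox n x r \<inter> U. \<bar>f y - f x\<bar> < e / 2"
      using f unfolding continuous_map_Rn_iff[OF U] by blast
    obtain r' where r': "r' > 0" "obox n x r' \<subseteq> U" using U \<open>x \<in> U\<close> unfolding openin_Rn_iff by blast
    have "obox n x (min r r') \<subseteq> obox n x r \<inter> U"
      using r' obox_mono[of "min r r'" r n x] obox_mono[of "min r r'" r' n x] by auto
    then show ?thesis using r r' by (intro exI[of _ "min r r'"]) auto
  qed
  then obtain r where r: "\<And>x. x \<in> K \<Longrightarrow> r x > 0"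
     "\<And>x. x \<in> K \<Longrightarrow> obox n x (r x) \<subseteq> U \<and> (\<forall>y\<in>obox n x (r x). \<bar>f y - f x\<bar> < e / 2)" by metis
  obtain d F where F: "d > 0" "finite F" "F \<subseteq> K"
    "\<forall>y\<in>K. \<exists>x\<in>F. y \<in> obox n x (r x) \<and> obox n y d \<subseteq> obox n x (r x)"
    by (rule compact_obox_lebesgue[where r = r, OF K(1)], erule r(1), rule that)
  have "y \<in> U \<and> \<bar>f y - f x\<bar> < e" if xy: "x \<in> K" "y \<in> obox n x d" for x y
  proof -
    obtain z where z: "z \<in> F" "x \<in> obox n z (r z)" "obox n x d \<subseteq> obox n z (r z)" using F(4)[rule_format, OF xy(1)] by blast
    have "\<bar>f x - f z\<bar> < e / 2" "\<bar>f y - f z\<bar> < e / 2" "y \<in> U" using r(2)[of z] z F(3) xy by blast+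
    then show ?thesis by linarith
  qed
  with F(1) show thesis by (intro that[of d]) blast+
qed

text \<open>Closed cubes with rational data. Countability makes open sets measurable and upgrades
  statements that hold almost everywhere on compact subsets to the whole open set.\<close>

lemma open_eq_countable_Union_clbox:
  assumes U: "openin (Rn n) U"
  obtains C where "countable C" "\<forall>K\<in>C. \<exists>c r. K = clbox n c r" "U = \<Union>C"
proof -
  define C where "C = {clbox n c r | c r. c \<in> PiE {..<n} (\<lambda>_. \<rat>) \<and> r \<in> \<rat> \<and> clbox n c r \<subseteq> U}"
  have "C \<subseteq> (\<lambda>(c, r). clbox n c r) ` (PiE {..<n} (\<lambda>_. \<rat>) \<times> \<rat>)" by (auto simp: C_def)
  moreover have "countable (PiE {..<n} (\<lambda>_. \<rat> :: real set) \<times> (\<rat> :: real set))"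
    by (intro countable_SIGMA countable_PiE) (auto simp: countable_rat)
  ultimately have "countable C" by (meson countable_image countable_subset)
  moreover have "U \<subseteq> \<Union>C"
  proof
    fix x assume x: "x \<in> U"
    then obtain R where R: "R > 0" "obox n x R \<subseteq> U" using U unfolding openin_Rn_iff by blast
    obtain r where r: "r \<in> \<rat>" "0 < r" "r < R / 2" using Rats_dense_in_real[of 0 "R/2"] R by auto
    have "\<exists>q\<in>\<rat>. x i - r < q \<and> q < x i" for i using Rats_dense_in_real[of "x i - r" "x i"] r by auto
    then obtain c0 where c0: "\<And>i. c0 i \<in> \<rat>" "\<And>i. x i - r < c0 i \<and> c0 i < x i" by metis
    define c where "c = restrict c0 {..<n}"
    have "clbox n c r \<subseteq> obox n x R"
    proof
      fix y assume y: "y \<in> clbox n c r"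
      have "\<bar>y i - x i\<bar> < R" if "i < n" for i
      proof -
        have "\<bar>y i - c0 i\<bar> \<le> r" using y that by (auto simp: clbox_def c_def)
        then show ?thesis using c0(2)[of i] r by linarith
      qed
      then show "y \<in> obox n x R" using y by (auto simp: clbox_def obox_def)
    qed
    moreover have "x \<in> clbox n c r"
    proof -
      have "\<bar>x i - c0 i\<bar> \<le> r" for i using c0(2)[of i] by linarith
      moreover have "x \<in> pts n" using U x unfolding openin_Rn_iff by blast
      ultimately show ?thesis by (auto simp: clbox_def c_def)
    qed
    moreover have "c \<in> PiE {..<n} (\<lambda>_. \<rat>)" using c0 by (auto simp: c_def)
    ultimately show "x \<in> \<Union>C" using R r unfolding C_def by blast
  qed
  moreover have "\<Union>C \<subseteq> U" by (auto simp: C_def)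
  moreover have "\<exists>c r. K = clbox n c r" if "K \<in> C" for K using that by (auto simp: C_def)
  ultimately show thesis by (intro that[of C]) auto
qed

lemma openin_sets: "openin (Rn n) U \<Longrightarrow> U \<in> sets (lbP n)"
  by (rule open_eq_countable_Union_clbox[of n U]) (auto intro!: sets.countable_Union)

lemma closedin_sets: "closedin (Rn n) K \<Longrightarrow> K \<in> sets (lbP n)"
proof -
  assume K: "closedin (Rn n) K"
  then have "pts n - K \<in> sets (lbP n)" by (intro openin_sets) (simp add: closedin_def)
  then have "space (lbP n) - (pts n - K) \<in> sets (lbP n)" by (rule sets.compl_sets)
  moreover have "K \<subseteq> pts n" using K closedin_subset by fastforce
  then have "space (lbP n) - (pts n - K) = K" by (auto simp: space_lbP)
  ultimately show ?thesis by simp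
qed

lemma Hausdorff_Rn: "Hausdorff_space (Rn n)"
  by (auto simp: Hausdorff_space_product_topology)

lemma compactin_sets: "compact_in n K \<Longrightarrow> K \<in> sets (lbP n)"
  by (intro closedin_sets compactin_imp_closedin Hausdorff_Rn)

lemma openin_sets_leb: "openin (Rn n) U \<Longrightarrow> U \<in> sets (leb n)"
  using openin_sets sets_completionI_sets by blast

lemma compactin_sets_leb: "compact_in n K \<Longrightarrow> K \<in> sets (leb n)"
  using compactin_sets sets_completionI_sets by blast

interpretation lb: product_sigma_finite "\<lambda>_::nat. lborel :: real measure"
  by standard

lemma emeasure_obox: "0 \<le> r \<Longrightarrow> emeasure (lbP n) (obox n x r) = ennreal (2 * r) ^ n"
  unfolding obox_eq_PiE by (subst lb.emeasure_PiM) auto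

lemma emeasure_compact_finite:
  assumes "compact_in n K" shows "emeasure (lbP n) K < \<infinity>"
proof -
  obtain R where R: "R > 0" "\<forall>x\<in>K. \<forall>i<n. \<bar>x i\<bar> < R"
    using compact_box_bounded[OF assms] by blast
  have "K \<subseteq> obox n (\<lambda>_. 0) R" using R compactin_subset_topspace[OF assms] by (auto simp: obox_def)
  then have "emeasure (lbP n) K \<le> emeasure (lbP n) (obox n (\<lambda>_. 0) R)"
    by (intro emeasure_mono) auto
  also have "\<dots> = ennreal (2 * R) ^ n" using R by (intro emeasure_obox) auto
  also have "\<dots> < \<infinity>" by (simp add: ennreal_power[symmetric] power_less_top_ennreal)
  finally show ?thesis .
qed

lemma continuous_map_borel:
  assumes U: "openin (Rn n) U" and f: "cont_on n U f"
  shows "(\<lambda>x. ind U x * f x) \<in> borelP n"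
proof -
  have Us: "U \<in> sets (lbP n)" by (rule openin_sets[OF U])
  have "f \<in> borel_measurable (restrict_space (lbP n) U)"
  proof (rule borel_measurableI)
    fix S :: "real set" assume "open S"
    then have "openin (subtopology (Rn n) U) {x \<in> topspace (subtopology (Rn n) U). f x \<in> S}"
      by (intro openin_continuous_map_preimage[OF f]) auto
    moreover have Up: "U \<subseteq> pts n" using openin_subset[OF U] by simp
    then have "{x \<in> topspace (subtopology (Rn n) U). f x \<in> S} = f -` S \<inter> U" by auto
    ultimately have "openin (Rn n) (f -` S \<inter> U)" unfolding openin_open_subtopology[OF U] by auto
    then have "f -` S \<inter> U \<in> sets (lbP n)" by (rule openin_sets)
    moreover have "space (restrict_space (lbP n) U) = U"
      using Up by (auto simp: space_restrict_space space_PiM)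
    ultimately show "f -` S \<inter> space (restrict_space (lbP n) U) \<in> sets (restrict_space (lbP n) U)"
      using Us by (auto simp: sets_restrict_space_iff)
  qed
  then show ?thesis
    using Us borel_measurable_restrict_space_iff[of U "lbP n" f] by (simp add: mult.commute)
qed

lemma continuous_map_borel':
  assumes f: "cont n f"
  shows "f \<in> borelP n"
proof -
  have "subtopology (Rn n) (pts n) = Rn n" by (metis subtopology_topspace topspace_Rn)
  moreover have "openin (Rn n) (pts n)" by (metis openin_topspace topspace_Rn)
  ultimately have "(\<lambda>x. ind (pts n) x * f x) \<in> borelP n"
    using continuous_map_borel[of n "pts n" f] f by simp
  then show ?thesis by (subst measurable_cong[where g = "\<lambda>x. ind (pts n) x * f x"]) (auto simp: space_lbP)
qed

subsection \<open>Smooth functions of one variable\<close>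

definition smooth1 :: "(real \<Rightarrow> real) \<Rightarrow> bool" where
  "smooth1 f \<longleftrightarrow> (\<exists>D. D 0 = f \<and> (\<forall>k t. (D k has_real_derivative D (Suc k) t) (at t)))"

text \<open>The finite-order version is suited to induction on the order, as in the product rule.
  Since derivatives are unique, the existential witnesses of different orders agree, which gives
  \<open>smooth1_iff\<close>.\<close>

primrec diff1 :: "nat \<Rightarrow> (real \<Rightarrow> real) \<Rightarrow> bool" where
  "diff1 0 f = True"
| "diff1 (Suc k) f = (\<exists>f'. (\<forall>t. (f has_real_derivative f' t) (at t)) \<and> diff1 k f')"

lemma diff1_Suc_imp: "diff1 (Suc k) f \<Longrightarrow> diff1 k f"
  by (induction k arbitrary: f) auto

lemma diff1_add: "diff1 k f \<Longrightarrow> diff1 k g \<Longrightarrow> diff1 k (\<lambda>t. f t + g t)"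
proof (induction k arbitrary: f g)
  case (Suc k)
  then obtain f' g' where *: "\<forall>t. (f has_real_derivative f' t) (at t)" "diff1 k f'"
    "\<forall>t. (g has_real_derivative g' t) (at t)" "diff1 k g'" by auto
  have "\<forall>t. ((\<lambda>t. f t + g t) has_real_derivative f' t + g' t) (at t)"
    using * by (intro allI DERIV_add) auto
  then show ?case using Suc.IH[OF *(2,4)] by (auto intro!: exI[of _ "\<lambda>t. f' t + g' t"])
qed simp

lemma diff1_mult: "diff1 k f \<Longrightarrow> diff1 k g \<Longrightarrow> diff1 k (\<lambda>t. f t * g t)"
proof (induction k arbitrary: f g)
  case (Suc k)
  from Suc.prems have fg: "diff1 k f" "diff1 k g" using diff1_Suc_imp by blast+
  from Suc.prems obtain f' g' where *: "\<forall>t. (f has_real_derivative f' t) (at t)" "diff1 k f'"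
    "\<forall>t. (g has_real_derivative g' t) (at t)" "diff1 k g'" by auto
  have "\<forall>t. ((\<lambda>t. f t * g t) has_real_derivative f' t * g t + g' t * f t) (at t)"
    using * by (intro allI DERIV_mult) auto
  moreover have "diff1 k (\<lambda>t. f' t * g t + g' t * f t)"
    by (intro diff1_add Suc.IH * fg)
  ultimately show ?case by (auto intro!: exI[of _ "\<lambda>t. f' t * g t + g' t * f t"])
qed simp

lemma diff1_const: "diff1 k (\<lambda>t. c)"
proof (induction k arbitrary: c)
  case (Suc k)
  have "\<forall>t. ((\<lambda>t. c) has_real_derivative 0) (at t)" by simp
  with Suc[of 0] show ?case unfolding diff1.simps by (intro exI[of _ "\<lambda>_. 0"] conjI)
qed simp

lemma diff1_affine: "diff1 k f \<Longrightarrow> diff1 k (\<lambda>t. f (a * t + b))"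
proof (induction k arbitrary: f)
  case (Suc k)
  then obtain f' where *: "\<forall>t. (f has_real_derivative f' t) (at t)" "diff1 k f'" by auto
  have "\<forall>t. ((\<lambda>t. f (a * t + b)) has_real_derivative a * f' (a * t + b)) (at t)"
  proof
    fix t
    have "((\<lambda>t. f (a * t + b)) has_real_derivative f' (a * t + b) * a) (at t)"
      by (rule DERIV_chain2[OF *(1)[rule_format]]) (auto intro!: derivative_eq_intros)
    then show "((\<lambda>t. f (a * t + b)) has_real_derivative a * f' (a * t + b)) (at t)" by (simp add: mult.commute)
  qed
  moreover have "diff1 k (\<lambda>t. a * f' (a * t + b))" by (intro diff1_mult diff1_const Suc.IH *(2))
  ultimately show ?case by (auto intro!: exI[of _ "\<lambda>t. a * f' (a * t + b)"])
qed simp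

lemma smooth1_iff: "smooth1 f \<longleftrightarrow> (\<forall>k. diff1 k f)"
proof
  assume "smooth1 f"
  then obtain D where D: "D 0 = f" "\<And>k t. (D k has_real_derivative D (Suc k) t) (at t)"
    by (auto simp: smooth1_def)
  have "diff1 k (D m)" for k m
    using D(2) by (induction k arbitrary: m) (auto intro!: exI)
  then show "\<forall>k. diff1 k f" using D(1) by metis
next
  assume f: "\<forall>k. diff1 k f"
  have step: "\<forall>k. diff1 k (deriv g) \<and> (\<forall>t. (g has_real_derivative deriv g t) (at t))" if g: "\<forall>k. diff1 k g" for g
  proof
    fix k
    obtain g' where g': "\<forall>t. (g has_real_derivative g' t) (at t)" "diff1 k g'"
      using g[rule_format, of "Suc k"] by auto
    then have "deriv g = g'" by (metis DERIV_imp_deriv ext)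
    with g' show "diff1 k (deriv g) \<and> (\<forall>t. (g has_real_derivative deriv g t) (at t))" by simp
  qed
  define D where "D m = (deriv ^^ m) f" for m
  have "\<forall>k. diff1 k (D m)" for m
    by (induction m) (use f step in \<open>auto simp: D_def\<close>)
  then have "\<forall>k t. (D k has_real_derivative D (Suc k) t) (at t)" using step by (simp add: D_def)
  then show "smooth1 f" unfolding smooth1_def by (intro exI[of _ D]) (simp add: D_def)
qed

lemma smooth1_mult: "smooth1 f \<Longrightarrow> smooth1 g \<Longrightarrow> smooth1 (\<lambda>t. f t * g t)"
  by (simp add: smooth1_iff diff1_mult)

lemma smooth1_affine: "smooth1 f \<Longrightarrow> smooth1 (\<lambda>t. f (a * t + b))"
  by (simp add: smooth1_iff diff1_affine)

lemma smooth1_const: "smooth1 (\<lambda>t. c)"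
  by (simp add: smooth1_iff diff1_const)

lemma smooth1_DERIV: "smooth1 f \<Longrightarrow> (f has_real_derivative deriv f t) (at t)"
  unfolding smooth1_def by (metis DERIV_imp_deriv)

lemma smooth1_deriv: "smooth1 f \<Longrightarrow> smooth1 (deriv f)"
proof -
  assume "smooth1 f"
  then obtain D where D: "D 0 = f" "\<And>k t. (D k has_real_derivative D (Suc k) t) (at t)"
    by (auto simp: smooth1_def)
  have "D 1 = deriv f" using D(2)[of 0] D(1) by (metis DERIV_imp_deriv One_nat_def ext)
  then show ?thesis unfolding smooth1_def using D(2)
    by (intro exI[of _ "\<lambda>k. D (Suc k)"]) auto
qed

lemma smooth1_continuous: "smooth1 f \<Longrightarrow> continuous_on A f"
  by (meson DERIV_continuous_on has_field_derivative_at_within smooth1_DERIV)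

text \<open>The family is closed under differentiation, with \<open>P\<close> replaced by \<open>y\<^sup>2 (P - P')\<close>.\<close>

definition flat_exp :: "real poly \<Rightarrow> real \<Rightarrow> real" where
  "flat_exp P t = (if t > 0 then poly P (1 / t) * exp (- (1 / t)) else 0)"

lemma poly_exp_tendsto_0: "((\<lambda>x. poly P x * exp (- x)) \<longlongrightarrow> (0::real)) at_top"
proof (induction P)
  case (pCons a P)
  have *: "((\<lambda>x. x ^ k * exp (- x)) \<longlongrightarrow> (0::real)) at_top" for k
    using tendsto_power_div_exp_0[of k] by (simp add: exp_minus divide_inverse)
  have "((\<lambda>x. (\<Sum>i\<le>degree (pCons a P). coeff (pCons a P) i * (x ^ i * exp (- x)))) \<longlongrightarrow>
      (\<Sum>i\<le>degree (pCons a P). coeff (pCons a P) i * 0)) at_top"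
    by (intro tendsto_sum tendsto_mult tendsto_const *)
  then show ?case by (simp only: poly_altdef sum_distrib_right mult.assoc) simp
qed simp

text \<open>Only the origin needs an argument: from the right, the difference quotient is again a
  polynomial in \<open>1/h\<close> times \<open>exp (-1/h)\<close>.\<close>

lemma flat_exp_DERIV:
  "(flat_exp P has_real_derivative flat_exp (monom 1 2 * (P - pderiv P)) t) (at t)"
proof -
  consider "t > 0" | "t < 0" | "t = 0" by linarith
  then show ?thesis
  proof cases
    case 1
    have "((\<lambda>t. poly P (1 / t) * exp (- (1 / t))) has_real_derivative
        flat_exp (monom 1 2 * (P - pderiv P)) t) (at t)"
      using 1 by (auto intro!: derivative_eq_intros poly_DERIV[THEN DERIV_chain2]
          simp: flat_exp_def poly_monom power2_eq_square field_simps)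
    moreover have "\<forall>\<^sub>F x in nhds t. x \<in> {0<..}" by (intro eventually_nhds_in_open) (use 1 in auto)
    then have "\<forall>\<^sub>F x in nhds t. poly P (1 / x) * exp (- (1 / x)) = flat_exp P x"
      by eventually_elim (simp add: flat_exp_def)
    ultimately show ?thesis by (subst (asm) DERIV_cong_ev[OF refl _ refl])
  next
    case 2
    have "((\<lambda>t. 0) has_real_derivative flat_exp (monom 1 2 * (P - pderiv P)) t) (at t)"
      using 2 by (simp add: flat_exp_def)
    moreover have "\<forall>\<^sub>F x in nhds t. x \<in> {..<0}" by (intro eventually_nhds_in_open) (use 2 in auto)
    then have "\<forall>\<^sub>F x in nhds t. 0 = flat_exp P x"
      by eventually_elim (simp add: flat_exp_def)
    ultimately show ?thesis by (subst (asm) DERIV_cong_ev[OF refl _ refl])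
  next
    case 3
    have "((\<lambda>h. (flat_exp P (0 + h) - flat_exp P 0) / h) \<longlongrightarrow> 0) (at 0)"
    proof (rule filterlim_split_at)
      show "((\<lambda>h. (flat_exp P (0 + h) - flat_exp P 0) / h) \<longlongrightarrow> 0) (at_left 0)"
        by (rule tendsto_eventually, rule eventually_at_leftI[of "-1"]) (auto simp: flat_exp_def)
      \<comment> \<open>\<open>pCons 0 P\<close> is the polynomial \<open>y * P(y)\<close>; at
        \<open>y = 1/h\<close> it absorbs the division by \<open>h\<close>.\<close>
      have "((\<lambda>h. poly (pCons 0 P) (inverse h) * exp (- inverse h)) \<longlongrightarrow> 0) (at_right (0::real))"
        by (rule filterlim_compose[OF poly_exp_tendsto_0 filterlim_inverse_at_top_right])
      moreover have "\<forall>\<^sub>F h in at_right 0. poly (pCons 0 P) (inverse h) * exp (- inverse h)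
          = (flat_exp P (0 + h) - flat_exp P 0) / h"
        by (rule eventually_at_rightI[of 0 1]) (auto simp: flat_exp_def divide_inverse mult_ac)
      ultimately show "((\<lambda>h. (flat_exp P (0 + h) - flat_exp P 0) / h) \<longlongrightarrow> 0) (at_right 0)"
        by (rule Lim_transform_eventually)
    qed
    then show ?thesis using 3 by (simp add: DERIV_def flat_exp_def)
  qed
qed

lemma smooth1_flat_exp: "smooth1 (flat_exp P)"
proof -
  have "diff1 k (flat_exp P)" for k
    by (induction k arbitrary: P) (auto intro!: exI flat_exp_DERIV)
  then show ?thesis by (simp add: smooth1_iff)
qed

lemma exists_bump1:
  obtains b where "smooth1 b" "\<forall>t. 0 \<le> b t" "\<forall>t. 1 \<le> \<bar>t\<bar> \<longrightarrow> b t = 0"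
    "integrable lborel b" "integral\<^sup>L lborel b = 1"
proof -
  define e where "e = flat_exp 1"
  have e: "smooth1 e" "\<And>t. 0 \<le> e t" "\<And>t. t \<le> 0 \<Longrightarrow> e t = 0" "\<And>t. t > 0 \<Longrightarrow> e t > 0"
    by (auto simp: e_def smooth1_flat_exp flat_exp_def)
  \<comment> \<open>Positive exactly on the open interval from -1 to 1.\<close>
  define b0 where "b0 t = e (1 * t + 1) * e (- 1 * t + 1)" for t
  have s: "smooth1 b0" unfolding b0_def by (intro smooth1_mult smooth1_affine e)
  have z: "b0 t = 0" if "1 \<le> \<bar>t\<bar>" for t using that e(3) by (auto simp: b0_def abs_if split: if_splits)
  have cont: "continuous_on UNIV b0" by (rule smooth1_continuous[OF s])
  have i: "integrable lborel b0"
  proof -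
    have "integrable lborel (\<lambda>t. ind {-1..1} t *\<^sub>R b0 t)"
      by (rule borel_integrable_compact) (auto intro: smooth1_continuous[OF s])
    moreover have "(\<lambda>t. ind {-1..1} t *\<^sub>R b0 t) = b0"
    proof
      fix t show "ind {-1..1} t *\<^sub>R b0 t = b0 t"
        using z[of t] by (cases "t \<in> {-1..1}") (auto simp: abs_if split: if_splits)
    qed
    ultimately show ?thesis by simp
  qed
  define c where "c = integral\<^sup>L lborel b0"
  have "c \<noteq> 0"
  proof
    assume "c = 0"
    then have "AE t in lborel. b0 t = 0"
      using integral_nonneg_eq_0_iff_AE[OF i] e(2) by (auto simp: c_def b0_def)
    then have "emeasure lborel {t. b0 t \<noteq> 0} = 0"
      using borel_measurable_continuous_onI[OF cont] by (subst (asm) AE_iff_measurable[OF _ refl]) auto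
    moreover have "{-1<..<1} \<subseteq> {t. b0 t \<noteq> 0}" using e(4) by (auto simp: b0_def less_imp_neq[symmetric] intro!: less_imp_neq[symmetric])
    then have "emeasure lborel {-1<..<1::real} \<le> emeasure lborel {t. b0 t \<noteq> 0}"
      using borel_measurable_continuous_onI[OF cont] by (intro emeasure_mono) auto
    ultimately show False by simp
  qed
  moreover have "c \<ge> 0" unfolding c_def using e(2) by (intro integral_nonneg_AE) (auto simp: b0_def)
  ultimately have c: "c > 0" by simp
  show thesis
  proof
    show "smooth1 (\<lambda>t. inverse c * b0 t)" by (intro smooth1_mult smooth1_const s)
    show "\<forall>t. 0 \<le> inverse c * b0 t" using c e(2) by (simp add: b0_def)
    show "\<forall>t. 1 \<le> \<bar>t\<bar> \<longrightarrow> inverse c * b0 t = 0" using z by simp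
    show "integrable lborel (\<lambda>t. inverse c * b0 t)" using i by simp
    show "integral\<^sup>L lborel (\<lambda>t. inverse c * b0 t) = 1" using c by (simp add: c_def[symmetric])
  qed
qed

lemma exists_bump:
  assumes "0 < r"
  obtains b where "smooth1 b" "\<forall>t. 0 \<le> b t" "\<forall>t. r \<le> \<bar>t\<bar> \<longrightarrow> b t = 0"
    "integrable lborel b" "integral\<^sup>L lborel b = 1"
proof -
  obtain b where b: "smooth1 b" "\<forall>t. 0 \<le> b t" "\<forall>t. 1 \<le> \<bar>t\<bar> \<longrightarrow> b t = 0"
    "integrable lborel b" "integral\<^sup>L lborel b = 1" using exists_bump1 by blast
  have e: "(1 / r) * t + 0 = t / r" for t by simp
  have 1: "has_bochner_integral lborel b 1" using b by (simp add: has_bochner_integral_iff)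
  then have "has_bochner_integral lborel (\<lambda>t. b (0 + (1/r) * t)) (1 /\<^sub>R \<bar>1/r\<bar>)"
    using assms by (intro lborel_has_bochner_integral_real_affine_iff[THEN iffD1]) auto
  then have 2: "integrable lborel (\<lambda>t. b (t / r))" "integral\<^sup>L lborel (\<lambda>t. b (t / r)) = r"
    using assms by (auto simp: has_bochner_integral_iff)
  show thesis
  proof
    show "smooth1 (\<lambda>t. inverse r * b (t / r))"
      using smooth1_mult[OF smooth1_const smooth1_affine[OF b(1), of "1/r" 0]] by (simp add: e)
    show "\<forall>t. 0 \<le> inverse r * b (t / r)" using assms b(2) by simp
    show "\<forall>t. r \<le> \<bar>t\<bar> \<longrightarrow> inverse r * b (t / r) = 0" using assms by (simp add: b(3))
    show "integrable lborel (\<lambda>t. inverse r * b (t / r))" using 2 by simp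
    show "integral\<^sup>L lborel (\<lambda>t. inverse r * b (t / r)) = 1" using 2 assms by simp
  qed
qed

section \<open>Smooth functions of several variables and convolution\<close>

lemma upd_pts: "x \<in> pts n \<Longrightarrow> i < n \<Longrightarrow> x(i := t) \<in> pts n"
  by (auto simp: PiE_iff extensional_def)

lemma Ck_cong:
  assumes "\<And>x. x \<in> pts n \<Longrightarrow> f x = g x" "Ck n k f"
  shows "Ck n k g"
  using assms
proof (induction k arbitrary: f g)
  case 0
  then have "cont n g"
    using continuous_map_eq[of "Rn n" euclideanreal f g] by auto
  then show ?case by simp
next
  case (Suc k)
  have eq: "(\<lambda>t. f (x(i := t))) = (\<lambda>t. g (x(i := t)))" if "x \<in> pts n" "i < n" for x i
    using Suc.prems(1) upd_pts[OF that] by auto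
  have c: "cont n g"
    using continuous_map_eq[of "Rn n" euclideanreal f g] Suc.prems by auto
  have d: "(\<lambda>t. g (x(i := t))) field_differentiable at (x i)" if "x \<in> pts n" "i < n" for x i
  proof -
    have "(\<lambda>t. f (x(i := t))) field_differentiable at (x i)" using Suc.prems(2) that by simp
    then show ?thesis unfolding eq[OF that] .
  qed
  have "Ck n k (pd i g)" if i: "i < n" for i
  proof (rule Suc.IH)
    show "pd i f x = pd i g x" if "x \<in> pts n" for x
      using eq[OF that i] by (simp add: partial_deriv_def)
    show "Ck n k (pd i f)" using Suc.prems(2) i by simp
  qed
  with c d show ?case by simp
qed

lemma partial_deriv_eq:
  "((\<lambda>t. f (x(i := t))) has_real_derivative D) (at (x i)) \<Longrightarrow> pd i f x = D"
  by (simp add: partial_deriv_def DERIV_imp_deriv)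

text \<open>A family of continuous functions that is closed under partial derivatives consists of
  smooth functions. It is applied to product kernels and to convolutions, where differentiating
  changes one factor of the kernel and stays in the family.\<close>

lemma Ck_family:
  assumes c: "\<And>f. f \<in> \<F> \<Longrightarrow> cont n f"
    and d: "\<And>f i. f \<in> \<F> \<Longrightarrow> i < n \<Longrightarrow> \<exists>f'\<in>\<F>. \<forall>x\<in>pts n.
      ((\<lambda>t. f (x(i := t))) has_real_derivative f' x) (at (x i))"
    and f: "f \<in> \<F>"
  shows "Ck n k f"
  using f
proof (induction k arbitrary: f)
  case (Suc k)
  have "(\<forall>x\<in>pts n. (\<lambda>t. f (x(i := t))) field_differentiable at (x i)) \<and> Ck n k (pd i f)"
    if i: "i < n" for i
  proof -
    obtain f' where f': "f' \<in> \<F>" "\<forall>x\<in>pts n. ((\<lambda>t. f (x(i := t))) has_real_derivative f' x) (at (x i))"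
      using d[OF Suc.prems i] by blast
    have "Ck n k (pd i f)"
      by (rule Ck_cong[OF _ Suc.IH[OF f'(1)]]) (use f'(2) partial_deriv_eq in fastforce)
    with f'(2) show ?thesis by (auto simp: field_differentiable_def)
  qed
  then show ?case using c[OF Suc.prems] by simp
qed (use c in simp)

text \<open>The kernel is a tensor product, so a partial derivative replaces a single factor by its
  derivative and Fubini gives its integral. The factors may differ for that reason.\<close>

definition pker :: "nat \<Rightarrow> (nat \<Rightarrow> real \<Rightarrow> real) \<Rightarrow> point \<Rightarrow> real" where
  "pker n B x = (\<Prod>i<n. B i (x i))"

lemma pker_split: "i < n \<Longrightarrow> pker n B x = B i (x i) * (\<Prod>j\<in>{..<n} - {i}. B j (x j))"
  unfolding pker_def by (subst prod.remove[of "{..<n}" i]) auto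

lemma pker_upd:
  assumes "i < n"
  shows "pker n B (x(i := t)) = B i t * (\<Prod>j\<in>{..<n} - {i}. B j (x j))"
  unfolding pker_split[OF assms] by (auto intro!: prod.cong)

lemma pker_upd_fun:
  assumes "i < n"
  shows "pker n (B(i := b)) x = b (x i) * (\<Prod>j\<in>{..<n} - {i}. B j (x j))"
  unfolding pker_split[OF assms] by (auto intro!: prod.cong)

lemma continuous_map_pker:
  assumes "\<And>i. i < n \<Longrightarrow> smooth1 (B i)"
  shows "cont n (pker n B)"
  unfolding pker_def
proof (rule continuous_map_prod)
  fix i assume i: "i \<in> {..<n}"
  have "cont n (\<lambda>x. x i)"
    using i by (intro continuous_map_product_projection)
  moreover have "continuous_map euclideanreal euclideanreal (B i)"
    using smooth1_continuous[of "B i" UNIV] assms i by simp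
  ultimately show "cont n (\<lambda>x. B i (x i))"
    using continuous_map_compose[of "Rn n" euclideanreal "\<lambda>x. x i" euclideanreal "B i"] by (simp add: o_def)
qed simp

lemma pker_DERIV:
  assumes "smooth1 (B i)" "i < n"
  shows "((\<lambda>t. pker n B (x(i := t))) has_real_derivative pker n (B(i := deriv (B i))) x) (at (x i))"
  unfolding pker_upd[OF assms(2)] pker_upd_fun[OF assms(2)]
  using smooth1_DERIV[OF assms(1)] by (rule DERIV_cmult_right)

lemma Ck_pker:
  assumes "\<And>i. i < n \<Longrightarrow> smooth1 (B i)"
  shows "Ck n k (pker n B)"
proof (rule Ck_family[where \<F> = "{pker n B | B. \<forall>i<n. smooth1 (B i)}"])
  show "pker n B \<in> {pker n B | B. \<forall>i<n. smooth1 (B i)}" using assms by blast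
  show "cont n f" if "f \<in> {pker n B | B. \<forall>i<n. smooth1 (B i)}" for f
    using that continuous_map_pker by blast
  fix f i assume f: "f \<in> {pker n B | B. \<forall>i<n. smooth1 (B i)}" and i: "i < n"
  then obtain B where B: "f = pker n B" "\<forall>i<n. smooth1 (B i)" by blast
  then have "\<forall>j<n. smooth1 ((B(i := deriv (B i))) j)" using i smooth1_deriv by auto
  then show "\<exists>f'\<in>{pker n B | B. \<forall>i<n. smooth1 (B i)}. \<forall>x\<in>pts n.
      ((\<lambda>t. f (x(i := t))) has_real_derivative f' x) (at (x i))"
    unfolding B(1) using pker_DERIV[of B i n] B(2) i by (intro bexI[of _ "pker n (B(i := deriv (B i)))"]) auto
qed

text \<open>The strict inequality leaves an open set where \<open>b\<close> vanishes, so that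
  \<open>deriv b\<close> vanishes there as well and the same \<open>r\<close> serves all
  derivatives.\<close>

definition bumpf :: "real \<Rightarrow> (real \<Rightarrow> real) \<Rightarrow> bool" where
  "bumpf r b \<longleftrightarrow> smooth1 b \<and> (\<forall>t. r < \<bar>t\<bar> \<longrightarrow> b t = 0)"

lemma bumpf_deriv: "bumpf r b \<Longrightarrow> bumpf r (deriv b)"
proof -
  assume b: "bumpf r b"
  have "deriv b t = 0" if t: "r < \<bar>t\<bar>" for t
  proof -
    have "open {t. r < \<bar>t\<bar>}" by (intro open_Collect_less continuous_intros)
    then have "\<forall>\<^sub>F x in nhds t. x \<in> {t. r < \<bar>t\<bar>}" using t by (intro eventually_nhds_in_open) auto
    then have "\<forall>\<^sub>F x in nhds t. b x = 0" by eventually_elim (use b in \<open>auto simp: bumpf_def\<close>)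
    then have "(b has_real_derivative 0) (at t)"
      by (subst DERIV_cong_ev[OF refl _ refl, of _ "\<lambda>_. 0"]) auto
    then show ?thesis by (rule DERIV_imp_deriv)
  qed
  with b show ?thesis by (auto simp: bumpf_def smooth1_deriv)
qed

lemma bumpf_bounded:
  assumes "bumpf r b" obtains C where "C \<ge> 1" "\<forall>t. \<bar>b t\<bar> \<le> C"
proof -
  have "compact (b ` {-r..r})"
    using assms by (intro compact_continuous_image smooth1_continuous) (auto simp: bumpf_def)
  then have "bounded (b ` {-r..r})" by (rule compact_imp_bounded)
  then obtain C where C: "\<forall>t\<in>{-r..r}. \<bar>b t\<bar> \<le> C" unfolding bounded_iff by auto
  have "\<bar>b t\<bar> \<le> max 1 C" for t
  proof (cases "t \<in> {-r..r}")
    case False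
    then have "b t = 0" using assms by (auto simp: bumpf_def)
    then show ?thesis by simp
  qed (use C in \<open>simp add: le_max_iff_disj\<close>)
  then show thesis by (intro that[of "max 1 C"]) auto
qed

lemma bumpf_lipschitz:
  assumes "bumpf r b" obtains L where "L \<ge> 1" "\<forall>t u. \<bar>b t - b u\<bar> \<le> L * \<bar>t - u\<bar>"
proof -
  obtain C where C: "C \<ge> 1" "\<forall>t. \<bar>deriv b t\<bar> \<le> C" using bumpf_bounded[OF bumpf_deriv[OF assms]] by blast
  have lt: "\<bar>b u - b t\<bar> \<le> C * \<bar>u - t\<bar>" if "t < u" for t u
  proof -
    have "\<exists>z. t < z \<and> z < u \<and> b u - b t = (u - t) * deriv b z"
      using that smooth1_DERIV assms by (intro MVT2) (auto simp: bumpf_def)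
    then obtain z where "b u - b t = (u - t) * deriv b z" by blast
    then show ?thesis using C(2) that by (simp add: abs_mult mult.commute[of C] mult_left_mono)
  qed
  have "\<bar>b t - b u\<bar> \<le> C * \<bar>t - u\<bar>" for t u
    using lt[of t u] lt[of u t] by (cases t u rule: linorder_cases) (auto simp: abs_minus_commute)
  then show thesis using C(1) by (intro that[of C]) auto
qed

text \<open>A remainder that is quadratic in \<open>h\<close>, uniformly in \<open>t\<close>, allows
  differentiation under the convolution integral by a direct estimate.\<close>

lemma bumpf_taylor:
  assumes "bumpf r b" obtains L where "L \<ge> 1" "\<forall>t h. \<bar>b (t + h) - b t - h * deriv b t\<bar> \<le> L * h\<^sup>2"
proof -
  obtain L where L: "L \<ge> 1" "\<forall>t u. \<bar>deriv b t - deriv b u\<bar> \<le> L * \<bar>t - u\<bar>"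
    using bumpf_lipschitz[OF bumpf_deriv[OF assms]] by blast
  have D: "(b has_real_derivative deriv b t) (at t)" for t
    using assms smooth1_DERIV by (auto simp: bumpf_def)
  have "\<bar>b (t + h) - b t - h * deriv b t\<bar> \<le> L * h\<^sup>2" for t h
  proof -
    have "\<exists>z. \<bar>z - t\<bar> \<le> \<bar>h\<bar> \<and> b (t + h) - b t = h * deriv b z"
    proof (cases h "0::real" rule: linorder_cases)
      case less
      have "\<exists>z. t + h < z \<and> z < t \<and> b t - b (t + h) = (t - (t + h)) * deriv b z"
        using less D by (intro MVT2) auto
      then obtain z where "t + h < z" "z < t" "b t - b (t + h) = (t - (t + h)) * deriv b z" by blast
      then show ?thesis using less by (intro exI[of _ z]) (auto simp: algebra_simps)
    next
      case greater
      have "\<exists>z. t < z \<and> z < t + h \<and> b (t + h) - b t = (t + h - t) * deriv b z"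
        using greater D by (intro MVT2) auto
      then obtain z where "t < z" "z < t + h" "b (t + h) - b t = (t + h - t) * deriv b z" by blast
      then show ?thesis using greater by (intro exI[of _ z]) auto
    next
      case equal
      then show ?thesis by (intro exI[of _ t]) simp
    qed
    then obtain z where z: "\<bar>z - t\<bar> \<le> \<bar>h\<bar>" "b (t + h) - b t = h * deriv b z" by blast
    have "\<bar>deriv b z - deriv b t\<bar> \<le> L * \<bar>h\<bar>"
      using L(2)[rule_format, of z t] mult_left_mono[OF z(1), of L] L(1) by linarith
    then have "\<bar>h\<bar> * \<bar>deriv b z - deriv b t\<bar> \<le> \<bar>h\<bar> * (L * \<bar>h\<bar>)" by (intro mult_left_mono) auto
    moreover have "b (t + h) - b t - h * deriv b t = h * (deriv b z - deriv b t)"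
      unfolding z(2) by (simp add: right_diff_distrib)
    ultimately show ?thesis by (simp add: abs_mult power2_eq_square mult_ac)
  qed
  then show thesis using L(1) by (intro that[of L]) auto
qed

lemma abs_prod_le_power:
  assumes "finite I" "\<And>i. i \<in> I \<Longrightarrow> \<bar>a i\<bar> \<le> C" "(C::real) \<ge> 1" "card I \<le> m"
  shows "\<bar>\<Prod>i\<in>I. a i\<bar> \<le> C ^ m"
proof -
  have "\<bar>\<Prod>i\<in>I. a i\<bar> = (\<Prod>i\<in>I. \<bar>a i\<bar>)" by (rule abs_prod)
  also have "\<dots> \<le> (\<Prod>i\<in>I. C)" using assms by (intro prod_mono) auto
  also have "\<dots> = C ^ card I" by simp
  also have "\<dots> \<le> C ^ m" using assms by (intro power_increasing) auto
  finally show ?thesis .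
qed

text \<open>Telescoping: the factors are exchanged one at a time while the others are bounded by
  \<open>C\<close>.\<close>

lemma abs_prod_diff_le:
  assumes "\<And>i. i < n \<Longrightarrow> \<bar>a i\<bar> \<le> C" "\<And>i. i < n \<Longrightarrow> \<bar>b i\<bar> \<le> C" "(C::real) \<ge> 1"
  shows "\<bar>(\<Prod>i<n. a i) - (\<Prod>i<n. b i)\<bar> \<le> C ^ n * (\<Sum>i<n. \<bar>a i - b i\<bar>)"
  using assms(1,2)
proof (induction n)
  case (Suc n)
  have IH: "\<bar>(\<Prod>i<n. a i) - (\<Prod>i<n. b i)\<bar> \<le> C ^ n * (\<Sum>i<n. \<bar>a i - b i\<bar>)"
    using Suc by auto
  have "(\<Prod>i<Suc n. a i) - (\<Prod>i<Suc n. b i)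
      = ((\<Prod>i<n. a i) - (\<Prod>i<n. b i)) * a n + (\<Prod>i<n. b i) * (a n - b n)"
    by (simp add: algebra_simps)
  also have "\<bar>\<dots>\<bar> \<le> \<bar>(\<Prod>i<n. a i) - (\<Prod>i<n. b i)\<bar> * \<bar>a n\<bar> + \<bar>\<Prod>i<n. b i\<bar> * \<bar>a n - b n\<bar>"
    by (intro order.trans[OF abs_triangle_ineq]) (simp add: abs_mult)
  also have "\<dots> \<le> (C ^ n * (\<Sum>i<n. \<bar>a i - b i\<bar>)) * C + C ^ Suc n * \<bar>a n - b n\<bar>"
    using Suc.prems assms(3) IH
    by (intro add_mono mult_mono abs_prod_le_power sum_nonneg mult_nonneg_nonneg) auto
  also have "\<dots> = C ^ Suc n * (\<Sum>i<Suc n. \<bar>a i - b i\<bar>)" by (simp add: algebra_simps)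
  finally show ?case .
qed simp

definition conv :: "nat \<Rightarrow> (nat \<Rightarrow> real \<Rightarrow> real) \<Rightarrow> (point \<Rightarrow> real) \<Rightarrow> point \<Rightarrow> real" where
  "conv n B f x = (LINT y|lbP n. f y * pker n B (\<lambda>i. x i - y i))"

lemma bumpf_family_bounded:
  fixes n :: nat
  assumes "\<forall>i<n. bumpf r (B i)" obtains C where "C \<ge> 1" "\<forall>i<n. \<forall>t. \<bar>B i t\<bar> \<le> C"
proof -
  have "\<forall>i. \<exists>C. i < n \<longrightarrow> C \<ge> 1 \<and> (\<forall>t. \<bar>B i t\<bar> \<le> C)" using assms bumpf_bounded by metis
  then obtain C where C: "\<And>i. i < n \<Longrightarrow> C i \<ge> 1 \<and> (\<forall>t. \<bar>B i t\<bar> \<le> C i)" by metis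
  define M where "M = Max (insert 1 (C ` {..<n}))"
  have M: "M \<ge> 1" "\<And>i. i < n \<Longrightarrow> C i \<le> M" by (auto simp: M_def)
  have "\<bar>B i t\<bar> \<le> M" if "i < n" for i t
    using conjunct2[OF C[OF that], rule_format, of t] M(2)[OF that] by linarith
  then show thesis using M(1) by (intro that[of M]) auto
qed

lemma bumpf_family_lipschitz:
  fixes n :: nat
  assumes "\<forall>i<n. bumpf r (B i)" obtains L where "L \<ge> 1" "\<forall>i<n. \<forall>t u. \<bar>B i t - B i u\<bar> \<le> L * \<bar>t - u\<bar>"
proof -
  have "\<forall>i. \<exists>C. i < n \<longrightarrow> C \<ge> 1 \<and> (\<forall>t u. \<bar>B i t - B i u\<bar> \<le> C * \<bar>t - u\<bar>)" using assms bumpf_lipschitz by metis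
  then obtain C where C: "\<And>i. i < n \<Longrightarrow> C i \<ge> 1 \<and> (\<forall>t u. \<bar>B i t - B i u\<bar> \<le> C i * \<bar>t - u\<bar>)" by metis
  define M where "M = Max (insert 1 (C ` {..<n}))"
  have M: "M \<ge> 1" "\<And>i. i < n \<Longrightarrow> C i \<le> M" by (auto simp: M_def)
  have "\<bar>B i t - B i u\<bar> \<le> M * \<bar>t - u\<bar>" if "i < n" for i t u
    using conjunct2[OF C[OF that], rule_format, of t u] mult_right_mono[OF M(2)[OF that], of "\<bar>t - u\<bar>"]
    by linarith
  then show thesis using M(1) by (intro that[of M]) auto
qed

lemma pker_bounded: "C \<ge> 1 \<Longrightarrow> \<forall>i<n. \<forall>t. \<bar>B i t\<bar> \<le> C \<Longrightarrow> \<bar>pker n B z\<bar> \<le> C ^ n"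
  unfolding pker_def by (rule abs_prod_le_power) auto

lemma pker_measurable:
  assumes "\<forall>i<n. smooth1 (B i)"
  shows "(\<lambda>y. pker n B (\<lambda>i. x i - y i)) \<in> borelP n"
proof -
  have "B i \<in> borel_measurable borel" if "i < n" for i
    using assms that by (intro borel_measurable_continuous_onI smooth1_continuous) auto
  then have "(\<lambda>y. B i (x i - y i)) \<in> borelP n" if "i < n" for i
    using that by (intro measurable_compose[of _ _ borel, OF _ \<open>\<And>i. i < n \<Longrightarrow> B i \<in> borel_measurable borel\<close>]) auto
  then show ?thesis unfolding pker_def by (intro borel_measurable_prod) auto
qed

lemma pker_measurable2:
  assumes "\<forall>i<n. smooth1 (B i)"
  shows "(\<lambda>(x, y). pker n B (\<lambda>i. x i - y i)) \<in> borel_measurable (lbP n \<Otimes>\<^sub>M lbP n)"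
proof -
  have B: "B i \<in> borel_measurable borel" if "i < n" for i
    using assms that by (intro borel_measurable_continuous_onI smooth1_continuous) auto
  have "(\<lambda>z. B i (fst z i - snd z i)) \<in> borel_measurable (lbP n \<Otimes>\<^sub>M lbP n)" if i: "i < n" for i
  proof (rule measurable_compose[of _ _ borel, OF _ B[OF i]])
    have "(\<lambda>z. fst z i) \<in> borel_measurable (lbP n \<Otimes>\<^sub>M lbP n)"
      "(\<lambda>z. snd z i) \<in> borel_measurable (lbP n \<Otimes>\<^sub>M lbP n)"
      using i by (auto intro!: measurable_compose[OF measurable_fst] measurable_compose[OF measurable_snd]
          measurable_component_singleton[where M = "\<lambda>_. lborel", simplified])
    then show "(\<lambda>z. fst z i - snd z i) \<in> borel_measurable (lbP n \<Otimes>\<^sub>M lbP n)" by simp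
  qed
  then show ?thesis unfolding pker_def case_prod_beta by (intro borel_measurable_prod) auto
qed

lemma conv_integrable:
  assumes f: "integrable (lbP n) f" and B: "\<forall>i<n. bumpf r (B i)"
  shows "integrable (lbP n) (\<lambda>y. f y * pker n B (\<lambda>i. x i - y i))"
proof -
  obtain C where C: "C \<ge> 1" "\<forall>i<n. \<forall>t. \<bar>B i t\<bar> \<le> C" using bumpf_family_bounded[OF B] by blast
  show ?thesis
  proof (rule Bochner_Integration.integrable_bound)
    show "integrable (lbP n) (\<lambda>y. C ^ n * f y)" using f by simp
    show "(\<lambda>y. f y * pker n B (\<lambda>i. x i - y i)) \<in> borelP n"
      using f B by (intro borel_measurable_times pker_measurable) (auto simp: bumpf_def)
    have "norm (f y * pker n B (\<lambda>i. x i - y i)) \<le> norm (C ^ n * f y)" for y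
      using pker_bounded[OF C, of "\<lambda>i. x i - y i"] C(1)
      by (simp add: abs_mult mult.commute[of "C ^ n"] mult_left_mono)
    then show "AE y in lbP n. norm (f y * pker n B (\<lambda>i. x i - y i)) \<le> norm (C ^ n * f y)" by simp
  qed
qed

lemma continuous_map_conv:
  assumes f: "integrable (lbP n) f" and B: "\<forall>i<n. bumpf r (B i)"
  shows "cont n (conv n B f)"
  unfolding continuous_map_Rn_iff'
proof (intro ballI allI impI)
  fix x and e :: real assume x: "x \<in> pts n" and e: "e > 0"
  obtain C where C: "C \<ge> 1" "\<forall>i<n. \<forall>t. \<bar>B i t\<bar> \<le> C" using bumpf_family_bounded[OF B] by blast
  obtain L where L: "L \<ge> 1" "\<forall>i<n. \<forall>t u. \<bar>B i t - B i u\<bar> \<le> L * \<bar>t - u\<bar>"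
    using bumpf_family_lipschitz[OF B] by blast
  define I where "I = (LINT y|lbP n. \<bar>f y\<bar>)"
  have I: "I \<ge> 0" unfolding I_def by (rule integral_nonneg_AE) simp
  define K where "K = C ^ n * (real n * L)"
  have K: "K \<ge> 0" unfolding K_def using C(1) L(1) by (intro mult_nonneg_nonneg) auto
  \<comment> \<open>The summand 1 covers the case that \<open>K * I\<close> vanishes and makes the
    final inequality strict.\<close>
  define d where "d = e / (K * I + 1)"
  have KI: "K * I + 1 > 0" using mult_nonneg_nonneg[OF K I] by linarith
  have d: "d > 0" unfolding d_def using e KI by (rule divide_pos_pos)
  have "\<bar>conv n B f z - conv n B f x\<bar> < e" if z: "z \<in> obox n x d" for z
  proof -
    have eq: "conv n B f z - conv n B f x
        = (LINT y|lbP n. f y * pker n B (\<lambda>i. z i - y i) - f y * pker n B (\<lambda>i. x i - y i))"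
      unfolding conv_def by (subst Bochner_Integration.integral_diff) (auto intro!: conv_integrable[OF f B])
    have "\<bar>conv n B f z - conv n B f x\<bar>
        \<le> (LINT y|lbP n. \<bar>f y * pker n B (\<lambda>i. z i - y i) - f y * pker n B (\<lambda>i. x i - y i)\<bar>)"
      unfolding eq by (rule integral_abs_bound)
    also have "\<dots> \<le> (LINT y|lbP n. (K * d) * \<bar>f y\<bar>)"
    proof (rule integral_mono)
      show "integrable (lbP n) (\<lambda>y. \<bar>f y * pker n B (\<lambda>i. z i - y i) - f y * pker n B (\<lambda>i. x i - y i)\<bar>)"
        by (intro integrable_abs Bochner_Integration.integrable_diff conv_integrable[OF f B])
      show "integrable (lbP n) (\<lambda>y. (K * d) * \<bar>f y\<bar>)" using f by simp
      fix y
      have "\<bar>pker n B (\<lambda>i. z i - y i) - pker n B (\<lambda>i. x i - y i)\<bar>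
          \<le> C ^ n * (\<Sum>i<n. \<bar>B i (z i - y i) - B i (x i - y i)\<bar>)"
        unfolding pker_def using C by (intro abs_prod_diff_le) auto
      also have "\<dots> \<le> C ^ n * (\<Sum>i<n. L * d)"
      proof (intro mult_left_mono sum_mono)
        fix i assume i: "i \<in> {..<n}"
        have "\<bar>B i (z i - y i) - B i (x i - y i)\<bar> \<le> L * \<bar>(z i - y i) - (x i - y i)\<bar>" using L i by blast
        also have "\<dots> \<le> L * d" using z i L by (intro mult_left_mono) (auto simp: obox_def intro: less_imp_le)
        finally show "\<bar>B i (z i - y i) - B i (x i - y i)\<bar> \<le> L * d" .
      qed (use C(1) in simp)
      also have "\<dots> = K * d" by (simp add: K_def)
      finally have "\<bar>f y\<bar> * \<bar>pker n B (\<lambda>i. z i - y i) - pker n B (\<lambda>i. x i - y i)\<bar> \<le> \<bar>f y\<bar> * (K * d)"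
        by (intro mult_left_mono) auto
      then show "\<bar>f y * pker n B (\<lambda>i. z i - y i) - f y * pker n B (\<lambda>i. x i - y i)\<bar> \<le> (K * d) * \<bar>f y\<bar>"
        by (simp add: right_diff_distrib[symmetric] abs_mult mult.commute)
    qed
    also have "\<dots> = d * (K * I)" by (simp add: I_def)
    also have "\<dots> < d * (K * I + 1)" using d by (intro mult_strict_left_mono) auto
    also have "\<dots> = e" using KI by (simp add: d_def)
    finally show ?thesis .
  qed
  then show "\<exists>r>0. \<forall>y\<in>obox n x r. \<bar>conv n B f y - conv n B f x\<bar> < e" using d by blast
qed

text \<open>Only the i-th factor of the kernel moves with the i-th coordinate, so the one-variable
  Taylor bound makes the error of the difference quotient at most
  \<open>K * I * |h|\<close>.\<close>

lemma conv_DERIV: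
  assumes f: "integrable (lbP n) f" and B: "\<forall>i<n. bumpf r (B i)" and i: "i < n"
  shows "((\<lambda>t. conv n B f (x(i := t))) has_real_derivative conv n (B(i := deriv (B i))) f x) (at (x i))"
proof -
  define B' where "B' = B(i := deriv (B i))"
  have B': "\<forall>j<n. bumpf r (B' j)" using B i bumpf_deriv by (auto simp: B'_def)
  obtain C where C: "C \<ge> 1" "\<forall>i<n. \<forall>t. \<bar>B i t\<bar> \<le> C" using bumpf_family_bounded[OF B] by blast
  obtain L where L: "L \<ge> 1" "\<forall>t h. \<bar>B i (t + h) - B i t - h * deriv (B i) t\<bar> \<le> L * h\<^sup>2"
    using bumpf_taylor[of r "B i"] B i by blast
  define I where "I = (LINT y|lbP n. \<bar>f y\<bar>)"
  define K where "K = C ^ n * L"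
  have bound: "\<bar>conv n B f (x(i := x i + h)) - conv n B f x - h * conv n B' f x\<bar> \<le> K * I * h\<^sup>2" for h
  proof -
    let ?g = "\<lambda>y. f y * pker n B (\<lambda>j. (x(i := x i + h)) j - y j) - f y * pker n B (\<lambda>j. x j - y j)
        - h * (f y * pker n B' (\<lambda>j. x j - y j))"
    have int: "integrable (lbP n) ?g"
      by (intro Bochner_Integration.integrable_diff integrable_mult_right conv_integrable[OF f B] conv_integrable[OF f B'])
    have eq: "conv n B f (x(i := x i + h)) - conv n B f x - h * conv n B' f x = (LINT y|lbP n. ?g y)"
      unfolding conv_def
      by (simp add: Bochner_Integration.integral_diff conv_integrable[OF f B] conv_integrable[OF f B'] del: fun_upd_apply)
    have "\<bar>conv n B f (x(i := x i + h)) - conv n B f x - h * conv n B' f x\<bar> \<le> (LINT y|lbP n. \<bar>?g y\<bar>)"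
      unfolding eq by (rule integral_abs_bound)
    also have "\<dots> \<le> (LINT y|lbP n. (K * h\<^sup>2) * \<bar>f y\<bar>)"
    proof (rule integral_mono[OF integrable_abs[OF int]])
      show "integrable (lbP n) (\<lambda>y. (K * h\<^sup>2) * \<bar>f y\<bar>)" using f by simp
      fix y
      define P where "P = (\<Prod>j\<in>{..<n} - {i}. B j (x j - y j))"
      have P: "\<bar>P\<bar> \<le> C ^ n" unfolding P_def using C
        by (intro abs_prod_le_power) (auto intro: order.trans[OF card_Diff1_le])
      have e1: "pker n B (\<lambda>j. (x(i := x i + h)) j - y j) = B i (x i - y i + h) * P"
        unfolding pker_split[OF i] P_def by (auto intro!: arg_cong2[where f = "(*)"] prod.cong simp: algebra_simps)
      have e2: "pker n B (\<lambda>j. x j - y j) = B i (x i - y i) * P" unfolding pker_split[OF i] P_def ..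
      have e3: "pker n B' (\<lambda>j. x j - y j) = deriv (B i) (x i - y i) * P"
        unfolding B'_def pker_upd_fun[OF i] P_def ..
      have "\<bar>?g y\<bar> = \<bar>f y\<bar> * (\<bar>P\<bar> * \<bar>B i (x i - y i + h) - B i (x i - y i) - h * deriv (B i) (x i - y i)\<bar>)"
        unfolding e1 e2 e3 abs_mult[symmetric] by (simp add: algebra_simps)
      also have "\<dots> \<le> \<bar>f y\<bar> * (C ^ n * (L * h\<^sup>2))"
        using P L C(1) by (intro mult_left_mono mult_mono) auto
      finally show "\<bar>?g y\<bar> \<le> (K * h\<^sup>2) * \<bar>f y\<bar>" by (simp add: K_def mult_ac)
    qed
    also have "\<dots> = K * I * h\<^sup>2" by (simp add: I_def)
    finally show ?thesis .
  qed
  have "(\<lambda>h. (conv n B f (x(i := x i + h)) - conv n B f (x(i := x i))) / h) \<midarrow>0\<rightarrow> conv n B' f x"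
  proof (rule LIM_zero_cancel, rule Lim_null_comparison)
    show "((\<lambda>h. K * I * \<bar>h\<bar>) \<longlongrightarrow> 0) (at 0)"
      by (rule tendsto_eq_intros refl | simp)+
    show "\<forall>\<^sub>F h in at 0. norm ((conv n B f (x(i := x i + h)) - conv n B f (x(i := x i))) / h - conv n B' f x)
        \<le> K * I * \<bar>h\<bar>"
    proof (rule eventually_mono[OF eventually_neq_at_within[of 0]])
      fix h :: real assume h: "h \<noteq> 0"
      have "norm ((conv n B f (x(i := x i + h)) - conv n B f (x(i := x i))) / h - conv n B' f x)
        = \<bar>conv n B f (x(i := x i + h)) - conv n B f x - h * conv n B' f x\<bar> / \<bar>h\<bar>"
        using h by (simp add: abs_divide[symmetric] diff_divide_distrib)
      also have "\<dots> \<le> K * I * h\<^sup>2 / \<bar>h\<bar>" by (intro divide_right_mono bound) auto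
      also have "\<dots> = K * I * \<bar>h\<bar>" using h by (simp add: power2_eq_square abs_if)
      finally show "norm ((conv n B f (x(i := x i + h)) - conv n B f (x(i := x i))) / h - conv n B' f x)
        \<le> K * I * \<bar>h\<bar>" .
    qed
  qed
  then show ?thesis unfolding DERIV_def B'_def by simp
qed

lemma Ck_conv:
  assumes f: "integrable (lbP n) f" and B: "\<forall>i<n. bumpf r (B i)"
  shows "Ck n k (conv n B f)"
proof (rule Ck_family[where \<F> = "{conv n B f | B. \<forall>i<n. bumpf r (B i)}"])
  show "conv n B f \<in> {conv n B f | B. \<forall>i<n. bumpf r (B i)}" using B by blast
  show "cont n g" if "g \<in> {conv n B f | B. \<forall>i<n. bumpf r (B i)}" for g
    using that continuous_map_conv[OF f] by blast
  fix g i assume g: "g \<in> {conv n B f | B. \<forall>i<n. bumpf r (B i)}" and i: "i < n"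
  then obtain B where B: "g = conv n B f" "\<forall>i<n. bumpf r (B i)" by blast
  then have "\<forall>j<n. bumpf r ((B(i := deriv (B i))) j)" using i bumpf_deriv by auto
  then show "\<exists>f'\<in>{conv n B f | B. \<forall>i<n. bumpf r (B i)}. \<forall>x\<in>pts n.
      ((\<lambda>t. g (x(i := t))) has_real_derivative f' x) (at (x i))"
    unfolding B(1) using conv_DERIV[OF f B(2) i]
    by (intro bexI[of _ "conv n (B(i := deriv (B i))) f"]) auto
qed

lemma conv_support:
  assumes B: "\<forall>i<n. bumpf r (B i)" and nz: "conv n B f x \<noteq> 0"
  shows "\<exists>y\<in>pts n. f y \<noteq> 0 \<and> (\<forall>i<n. \<bar>x i - y i\<bar> \<le> r)"
proof (rule ccontr)
  assume *: "\<not> ?thesis"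
  have "f y * pker n B (\<lambda>i. x i - y i) = 0" if y: "y \<in> space (lbP n)" for y
  proof (cases "f y = 0")
    case False
    then obtain i where i: "i < n" "r < \<bar>x i - y i\<bar>" using * y by (auto simp: space_lbP not_le)
    then have "B i (x i - y i) = 0" using B by (auto simp: bumpf_def)
    then show ?thesis by (simp add: pker_split[OF i(1)])
  qed simp
  then have "conv n B f x = (LINT y|lbP n. 0)"
    unfolding conv_def by (intro Bochner_Integration.integral_cong) auto
  with nz show False by simp
qed

section \<open>Density of continuous functions\<close>

lemma ennreal_small_limit:
  assumes "(u \<longlongrightarrow> (0::ennreal)) F" "0 < e"
  shows "\<forall>\<^sub>F i in F. u i < ennreal e"
  using order_tendstoD(2)[OF assms(1), of "ennreal e"] assms(2) by simp

text \<open>The distance is a nonnegative integral, which may be formed without knowing that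
  \<open>f\<close> or \<open>g\<close> is integrable.\<close>

definition approximable :: "nat \<Rightarrow> (point \<Rightarrow> real) \<Rightarrow> bool" where
  "approximable n f \<longleftrightarrow> (\<forall>e>0. \<exists>g. cont n g \<and>
    (\<integral>\<^sup>+x. ennreal \<bar>f x - g x\<bar> \<partial>lbP n) < ennreal e)"

lemma nn_integral_dist_triangle:
  fixes f g h :: "'a \<Rightarrow> real"
  assumes [measurable]: "f \<in> borel_measurable M" "g \<in> borel_measurable M" "h \<in> borel_measurable M"
  shows "(\<integral>\<^sup>+x. ennreal \<bar>f x - h x\<bar> \<partial>M)
    \<le> (\<integral>\<^sup>+x. ennreal \<bar>f x - g x\<bar> \<partial>M) + (\<integral>\<^sup>+x. ennreal \<bar>g x - h x\<bar> \<partial>M)"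
proof -
  have "(\<integral>\<^sup>+x. ennreal \<bar>f x - h x\<bar> \<partial>M) \<le> (\<integral>\<^sup>+x. ennreal \<bar>f x - g x\<bar> + ennreal \<bar>g x - h x\<bar> \<partial>M)"
    by (intro nn_integral_mono) (simp add: ennreal_plus[symmetric] del: ennreal_plus)
  also have "\<dots> = (\<integral>\<^sup>+x. ennreal \<bar>f x - g x\<bar> \<partial>M) + (\<integral>\<^sup>+x. ennreal \<bar>g x - h x\<bar> \<partial>M)"
    by (intro nn_integral_add) auto
  finally show ?thesis .
qed

lemma ennreal_add_less:
  "a < ennreal x \<Longrightarrow> b < ennreal y \<Longrightarrow> 0 \<le> x \<Longrightarrow> 0 \<le> y \<Longrightarrow> a + b < ennreal (x + y)"
  by (simp add: add_strict_mono)

lemma approximable_continuous: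
  assumes "cont n f" shows "approximable n f"
  unfolding approximable_def by (intro allI impI exI[of _ f]) (use assms in simp)

lemma approximable_close:
  assumes f: "f \<in> borelP n"
    and ex: "\<And>e. e > 0 \<Longrightarrow> \<exists>f'. f' \<in> borelP n \<and> approximable n f' \<and>
      (\<integral>\<^sup>+x. ennreal \<bar>f x - f' x\<bar> \<partial>lbP n) < ennreal e"
  shows "approximable n f"
  unfolding approximable_def
proof (intro allI impI)
  fix e :: real assume "e > 0"
  then have e: "e / 2 > 0" by simp
  obtain f' where f': "f' \<in> borelP n" "approximable n f'"
    "(\<integral>\<^sup>+x. ennreal \<bar>f x - f' x\<bar> \<partial>lbP n) < ennreal (e / 2)" using ex[OF e] by blast
  obtain g where g: "cont n g"
    "(\<integral>\<^sup>+x. ennreal \<bar>f' x - g x\<bar> \<partial>lbP n) < ennreal (e / 2)"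
    using f'(2) e unfolding approximable_def by blast
  have "(\<integral>\<^sup>+x. ennreal \<bar>f x - g x\<bar> \<partial>lbP n)
      \<le> (\<integral>\<^sup>+x. ennreal \<bar>f x - f' x\<bar> \<partial>lbP n) + (\<integral>\<^sup>+x. ennreal \<bar>f' x - g x\<bar> \<partial>lbP n)"
    by (intro nn_integral_dist_triangle f f' continuous_map_borel' g)
  also have "\<dots> < ennreal (e / 2 + e / 2)" using f'(3) g(2) e by (intro ennreal_add_less) auto
  finally show "\<exists>g. cont n g \<and> (\<integral>\<^sup>+x. ennreal \<bar>f x - g x\<bar> \<partial>lbP n) < ennreal e"
    using g(1) by auto
qed

lemma approximable_limit:
  assumes f: "f \<in> borelP n" and s: "\<And>i. s i \<in> borelP n"
    and a: "\<And>i. approximable n (s i)"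
    and lim: "\<And>x. x \<in> pts n \<Longrightarrow> (\<lambda>i. s i x) \<longlonglongrightarrow> f x"
    and w: "w \<in> borelP n" "(\<integral>\<^sup>+x. ennreal (w x) \<partial>lbP n) < \<infinity>"
    and dom: "\<And>i x. x \<in> pts n \<Longrightarrow> \<bar>f x - s i x\<bar> \<le> w x"
  shows "approximable n f"
proof (rule approximable_close[OF f])
  fix e :: real assume e: "e > 0"
  have "(\<lambda>i. \<integral>\<^sup>+x. ennreal \<bar>f x - s i x\<bar> \<partial>lbP n) \<longlonglongrightarrow> (\<integral>\<^sup>+x. 0 \<partial>lbP n)"
  proof (rule nn_integral_dominated_convergence[where w = "\<lambda>x. ennreal (w x)"])
    show "AE x in lbP n. (\<lambda>i. ennreal \<bar>f x - s i x\<bar>) \<longlonglongrightarrow> 0"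
    proof (rule AE_I2)
      fix x assume "x \<in> space (lbP n)"
      then have "(\<lambda>i. \<bar>f x - s i x\<bar>) \<longlonglongrightarrow> \<bar>f x - f x\<bar>"
        using lim by (intro tendsto_intros) (auto simp: space_lbP)
      then show "(\<lambda>i. ennreal \<bar>f x - s i x\<bar>) \<longlonglongrightarrow> 0" using tendsto_ennrealI by fastforce
    qed
    show "AE x in lbP n. ennreal \<bar>f x - s j x\<bar> \<le> ennreal (w x)" for j
      using dom by (intro AE_I2 ennreal_leI) (auto simp: space_lbP)
  qed (use f s w in auto)
  then have "\<forall>\<^sub>F i in sequentially. (\<integral>\<^sup>+x. ennreal \<bar>f x - s i x\<bar> \<partial>lbP n) < ennreal e"
    using e by (intro ennreal_small_limit) simp_all
  then obtain i where "(\<integral>\<^sup>+x. ennreal \<bar>f x - s i x\<bar> \<partial>lbP n) < ennreal e"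
    by (meson eventually_gt_at_top eventually_happens' eventually_conj sequentially_bot)
  then show "\<exists>f'. f' \<in> borelP n \<and> approximable n f' \<and>
      (\<integral>\<^sup>+x. ennreal \<bar>f x - f' x\<bar> \<partial>lbP n) < ennreal e" using s a by blast
qed

lemma approximable_add:
  assumes f: "f \<in> borelP n" "approximable n f"
    and g: "g \<in> borelP n" "approximable n g"
  shows "approximable n (\<lambda>x. f x + g x)"
  unfolding approximable_def
proof (intro allI impI)
  fix e :: real assume "e > 0"
  then have e: "e / 2 > 0" by simp
  obtain f' where f': "cont n f'"
    "(\<integral>\<^sup>+x. ennreal \<bar>f x - f' x\<bar> \<partial>lbP n) < ennreal (e / 2)"
    using f(2) e unfolding approximable_def by blast
  obtain g' where g': "cont n g'"
    "(\<integral>\<^sup>+x. ennreal \<bar>g x - g' x\<bar> \<partial>lbP n) < ennreal (e / 2)"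
    using g(2) e unfolding approximable_def by blast
  note [measurable] = f(1) g(1) continuous_map_borel'[OF f'(1)] continuous_map_borel'[OF g'(1)]
  have "(\<integral>\<^sup>+x. ennreal \<bar>(f x + g x) - (f' x + g' x)\<bar> \<partial>lbP n)
      \<le> (\<integral>\<^sup>+x. ennreal \<bar>f x - f' x\<bar> + ennreal \<bar>g x - g' x\<bar> \<partial>lbP n)"
    by (intro nn_integral_mono) (simp add: ennreal_plus[symmetric] del: ennreal_plus)
  also have "\<dots> = (\<integral>\<^sup>+x. ennreal \<bar>f x - f' x\<bar> \<partial>lbP n) + (\<integral>\<^sup>+x. ennreal \<bar>g x - g' x\<bar> \<partial>lbP n)"
    by (intro nn_integral_add) auto
  also have "\<dots> < ennreal (e / 2 + e / 2)" using f'(2) g'(2) e by (intro ennreal_add_less) auto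
  finally show "\<exists>h. cont n h \<and>
      (\<integral>\<^sup>+x. ennreal \<bar>(f x + g x) - h x\<bar> \<partial>lbP n) < ennreal e"
    using f'(1) g'(1) by (intro exI[of _ "\<lambda>x. f' x + g' x"]) (auto intro: continuous_map_add)
qed

lemma approximable_cmult:
  assumes f: "f \<in> borelP n" "approximable n f"
  shows "approximable n (\<lambda>x. c * f x)"
  unfolding approximable_def
proof (intro allI impI)
  fix e :: real assume "e > 0"
  then have e: "e / (\<bar>c\<bar> + 1) > 0" by (intro divide_pos_pos) auto
  obtain f' where f': "cont n f'"
    "(\<integral>\<^sup>+x. ennreal \<bar>f x - f' x\<bar> \<partial>lbP n) < ennreal (e / (\<bar>c\<bar> + 1))"
    using f(2) e unfolding approximable_def by blast
  note [measurable] = f(1) continuous_map_borel'[OF f'(1)]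
  have "(\<integral>\<^sup>+x. ennreal \<bar>c * f x - c * f' x\<bar> \<partial>lbP n) \<le> (\<integral>\<^sup>+x. ennreal (\<bar>c\<bar> + 1) * ennreal \<bar>f x - f' x\<bar> \<partial>lbP n)"
    by (intro nn_integral_mono)
      (simp add: ennreal_mult[symmetric] right_diff_distrib[symmetric] abs_mult mult_right_mono del: ennreal_plus)
  also have "\<dots> = ennreal (\<bar>c\<bar> + 1) * (\<integral>\<^sup>+x. ennreal \<bar>f x - f' x\<bar> \<partial>lbP n)"
    by (intro nn_integral_cmult) auto
  also have "\<dots> < ennreal (\<bar>c\<bar> + 1) * ennreal (e / (\<bar>c\<bar> + 1))"
    using f'(2) by (intro ennreal_mult_strict_left_mono) (auto simp del: ennreal_plus)
  also have "\<dots> = ennreal e"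
  proof -
    have "\<bar>c\<bar> + 1 \<noteq> 0" by linarith
    then show ?thesis using e by (subst ennreal_mult[symmetric]) auto
  qed
  finally show "\<exists>h. cont n h \<and>
      (\<integral>\<^sup>+x. ennreal \<bar>c * f x - h x\<bar> \<partial>lbP n) < ennreal e"
    using f'(1) by (intro exI[of _ "\<lambda>x. c * f' x"]) (auto intro: continuous_map_real_mult_left)
qed

text \<open>The distance to the complement of \<open>W\<close> in the maximum metric, cut off at 1.
  The cut-off keeps the supremum finite when \<open>W\<close> is the whole space.\<close>

definition inner_dist :: "nat \<Rightarrow> point set \<Rightarrow> point \<Rightarrow> real" where
  "inner_dist n W x = Sup {r. 0 \<le> r \<and> r \<le> 1 \<and> obox n x r \<subseteq> W}"

lemma inner_dist_0: "0 < n \<Longrightarrow> obox n x 0 = {}"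
  by (auto simp: obox_def)

lemma inner_dist_props:
  assumes n: "0 < n" and W: "openin (Rn n) W"
  shows "0 \<le> inner_dist n W x" "x \<in> W \<Longrightarrow> 0 < inner_dist n W x"
    "x \<in> pts n \<Longrightarrow> x \<notin> W \<Longrightarrow> inner_dist n W x = 0"
    "cont n (inner_dist n W)"
proof -
  let ?S = "\<lambda>x. {r. 0 \<le> r \<and> r \<le> (1::real) \<and> obox n x r \<subseteq> W}"
  \<comment> \<open>A cube of radius 0 is empty, given \<open>0 < n\<close>, hence contained in
    \<open>W\<close> for any \<open>x\<close>; so the supremum is over a nonempty set.\<close>
  have S0: "0 \<in> ?S x" for x using inner_dist_0[OF n] by auto
  have bd: "bdd_above (?S x)" for x by (rule bdd_aboveI[of _ 1]) auto
  have up: "r \<le> inner_dist n W x" if "r \<in> ?S x" for r x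
    unfolding inner_dist_def by (rule cSup_upper[OF that bd])
  have least: "inner_dist n W x \<le> z" if "\<And>r. r \<in> ?S x \<Longrightarrow> r \<le> z" for x z
    unfolding inner_dist_def
  proof (rule cSup_least)
    show "?S x \<noteq> {}" using S0[of x] by blast
  qed (rule that)
  show "0 \<le> inner_dist n W x" by (rule up[OF S0])
  show "0 < inner_dist n W x" if "x \<in> W"
  proof -
    obtain r where r: "r > 0" "obox n x r \<subseteq> W" using W \<open>x \<in> W\<close> unfolding openin_Rn_iff by blast
    then have "min r 1 \<in> ?S x" using obox_mono[of "min r 1" r n x] by auto
    from up[OF this] show ?thesis using r by linarith
  qed
  show "inner_dist n W x = 0" if "x \<in> pts n" "x \<notin> W"
  proof -
    have "inner_dist n W x \<le> 0"
    proof (rule least)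
      fix r assume r: "r \<in> ?S x"
      show "r \<le> 0"
      proof (rule ccontr)
        assume "\<not> r \<le> 0"
        then have "x \<in> obox n x r" using that by (intro centre_in_obox) auto
        with r that show False by auto
      qed
    qed
    with up[OF S0] show ?thesis by (meson order_antisym)
  qed
  have lip: "inner_dist n W x \<le> inner_dist n W y + e" if e: "e > 0" and xy: "y \<in> obox n x e" for x y e
  proof (rule least)
    fix r assume r: "r \<in> ?S x"
    show "r \<le> inner_dist n W y + e"
    proof (cases "r \<le> e")
      case False
      have "obox n y (r - e) \<subseteq> obox n x r"
      proof
        fix z assume "z \<in> obox n y (r - e)"
        from obox_triangle[OF xy this] show "z \<in> obox n x r" by simp
      qed
      then have "r - e \<in> ?S y" using r False e by auto
      from up[OF this] show ?thesis by simp
    next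
      case True
      then show ?thesis using up[OF S0, of y] by linarith
    qed
  qed
  show "cont n (inner_dist n W)"
    unfolding continuous_map_Rn_iff'
  proof (intro ballI allI impI)
    fix x and e :: real assume x: "x \<in> pts n" and e: "e > 0"
    have "\<bar>inner_dist n W y - inner_dist n W x\<bar> < e" if "y \<in> obox n x (e / 2)" for y
      using lip[of "e/2" y x] lip[of "e/2" x y] obox_sym[OF x that] that e by (auto simp: abs_less_iff)
    then show "\<exists>r>0. \<forall>y\<in>obox n x r. \<bar>inner_dist n W y - inner_dist n W x\<bar> < e"
      using e by (intro exI[of _ "e/2"]) auto
  qed
qed

lemma emeasure_obox_finite: "emeasure (lbP n) (obox n x R) < \<infinity>"
proof -
  have "emeasure (lbP n) (obox n x R) \<le> emeasure (lbP n) (clbox n x R)"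
    by (intro emeasure_mono obox_subset_clbox) auto
  also have "\<dots> < \<infinity>" by (rule emeasure_compact_finite[OF compactin_clbox])
  finally show ?thesis .
qed

text \<open>Multiples of the distance to the complement, cut off at 1, increase to the indicator of
  \<open>W\<close>. The enclosing cube makes that indicator an integrable majorant.\<close>

lemma approximable_open:
  assumes n: "0 < n" and W: "openin (Rn n) W" "W \<subseteq> obox n z R"
  shows "approximable n (ind W)"
proof (rule approximable_limit[where s = "\<lambda>m x. min 1 (real m * inner_dist n W x)" and w = "ind W"])
  note D = inner_dist_props[OF n W(1)]
  have Ws[measurable]: "W \<in> sets (lbP n)" by (rule openin_sets[OF W(1)])
  show "(ind W :: _ \<Rightarrow> real) \<in> borelP n" by simp
  have c: "cont n (\<lambda>x. min 1 (real m * inner_dist n W x))" for m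
    by (intro continuous_map_real_min continuous_map_real_mult_left D(4)) auto
  show "(\<lambda>x. min 1 (real m * inner_dist n W x)) \<in> borelP n" for m
    by (rule continuous_map_borel'[OF c])
  show "approximable n (\<lambda>x. min 1 (real m * inner_dist n W x))" for m
    by (rule approximable_continuous[OF c])
  show "(\<lambda>m. min 1 (real m * inner_dist n W x)) \<longlonglongrightarrow> ind W x" if x: "x \<in> pts n" for x
  proof (cases "x \<in> W")
    case True
    have d: "inner_dist n W x > 0" by (rule D(2)[OF True])
    obtain N :: nat where N: "1 / inner_dist n W x < N" using reals_Archimedean2 by blast
    have "min 1 (real m * inner_dist n W x) = 1" if "m \<ge> N" for m
    proof -
      have "1 = 1 / inner_dist n W x * inner_dist n W x" using d by simp
      also have "\<dots> \<le> real m * inner_dist n W x" using N that d by (intro mult_right_mono) auto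
      finally show ?thesis by simp
    qed
    then have "\<forall>\<^sub>F m in sequentially. min 1 (real m * inner_dist n W x) = 1"
      unfolding eventually_sequentially by blast
    then show ?thesis using True by (simp add: tendsto_eventually)
  next
    case False
    then show ?thesis using D(3)[OF x False] by simp
  qed
  show "\<bar>ind W x - min 1 (real m * inner_dist n W x)\<bar> \<le> ind W x" if x: "x \<in> pts n" for m x
    using D(1)[of x] D(3)[OF x] by (cases "x \<in> W") (auto simp: abs_le_iff)
  show "(ind W :: _ \<Rightarrow> real) \<in> borelP n" by simp
  have "(\<integral>\<^sup>+x. ennreal (ind W x) \<partial>lbP n) = emeasure (lbP n) W"
    by (simp add: ennreal_indicator)
  also have "\<dots> \<le> emeasure (lbP n) (obox n z R)" using W(2) by (intro emeasure_mono) auto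
  also have "\<dots> < \<infinity>" by (rule emeasure_obox_finite)
  finally show "(\<integral>\<^sup>+x. ennreal (ind W x) \<partial>lbP n) < \<infinity>" .
qed

text \<open>The product sigma-algebra is the Borel algebra of the product topology, so an induction
  over measurable sets may start from open ones.\<close>

lemma sets_lbP_eq_sigma_open: "sets (lbP n) = sigma_sets (pts n) {U. openin (Rn n) U}"
proof
  let ?G = "{U. openin (Rn n) U}"
  have G: "?G \<subseteq> Pow (pts n)" using openin_subset by fastforce
  show "sigma_sets (pts n) ?G \<subseteq> sets (lbP n)"
    unfolding space_lbP[symmetric] by (rule sets.sigma_sets_subset) (use openin_sets in blast)
  have "sets (lbP n) \<subseteq> sets (sigma (pts n) ?G)"
  proof (rule sets_PiM_in_sets)
    show "space (sigma (pts n) ?G) = (\<Pi>\<^sub>E i\<in>{..<n}. space lborel)" using G by (simp add: space_measure_of)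
    fix i A assume i: "i \<in> {..<n}" and A: "A \<in> sets (lborel :: real measure)"
    have "(\<lambda>x. x i) \<in> borel_measurable (sigma (pts n) ?G)"
    proof (rule borel_measurableI)
      fix S :: "real set" assume S: "open S"
      have "cont n (\<lambda>x. x i)"
        using i by (intro continuous_map_product_projection)
      then have "openin (Rn n) {x \<in> topspace (Rn n). x i \<in> S}"
        by (rule openin_continuous_map_preimage) (use S in simp)
      moreover have "{x \<in> topspace (Rn n). x i \<in> S} = (\<lambda>x. x i) -` S \<inter> space (sigma (pts n) ?G)"
        using G by (auto simp: space_measure_of)
      ultimately show "(\<lambda>x. x i) -` S \<inter> space (sigma (pts n) ?G) \<in> sets (sigma (pts n) ?G)"
        using G by auto
    qed
    then have "(\<lambda>x. x i) -` A \<inter> space (sigma (pts n) ?G) \<in> sets (sigma (pts n) ?G)"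
      using A by (intro measurable_sets) auto
    moreover have "(\<lambda>x. x i) -` A \<inter> space (sigma (pts n) ?G) = {x \<in> space (sigma (pts n) ?G). x i \<in> A}" by auto
    ultimately show "{x \<in> space (sigma (pts n) ?G). x i \<in> A} \<in> sets (sigma (pts n) ?G)" by simp
  qed
  then show "sets (lbP n) \<subseteq> sigma_sets (pts n) ?G" using G by (simp add: sets_measure_of)
qed

text \<open>Dynkin's pi-lambda argument from the open sets. Intersecting with a fixed cube keeps all
  measures finite, which complements and countable unions require.\<close>

lemma approximable_indicator:
  assumes n: "0 < n" and A: "A \<in> sets (lbP n)"
  shows "approximable n (ind (A \<inter> obox n z R))"
proof -
  let ?B = "obox n z R"
  have fin: "(\<integral>\<^sup>+x. ennreal (ind ?B x) \<partial>lbP n) < \<infinity>"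
    using emeasure_obox_finite[of n z R] by (simp add: ennreal_indicator)
  have "Int_stable {U. openin (Rn n) U}" by (auto simp: Int_stable_def)
  moreover have "{U. openin (Rn n) U} \<subseteq> Pow (pts n)" using openin_subset by fastforce
  moreover have "A \<in> sigma_sets (pts n) {U. openin (Rn n) U}" using A sets_lbP_eq_sigma_open by simp
  ultimately show ?thesis
  proof (induction rule: sigma_sets_induct_disjoint)
    case (basic A)
    then show ?case by (intro approximable_open[OF n, of _ z R] openin_Int openin_obox) auto
  next
    case empty
    have "approximable n (\<lambda>x. 0)" by (intro approximable_continuous) simp
    then show ?case by (simp add: indicator_def[abs_def])
  next
    case (compl A)
    have A: "A \<in> sets (lbP n)" using compl sets_lbP_eq_sigma_open by simp
    have "approximable n (ind ?B)" by (rule approximable_open[OF n openin_obox subset_refl])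
    then have "approximable n (\<lambda>x. ind ?B x + (-1) * ind (A \<inter> ?B) x)"
      using A by (intro approximable_add approximable_cmult compl.IH) auto
    also have "(\<lambda>x. ind ?B x + (-1) * ind (A \<inter> ?B) x) = (ind ((pts n - A) \<inter> ?B) :: _ \<Rightarrow> real)"
      by (auto simp: fun_eq_iff indicator_def obox_def)
    finally show ?case .
  next
    case (union A)
    have A: "A i \<in> sets (lbP n)" for i using union sets_lbP_eq_sigma_open by blast
    have fin_un: "approximable n (\<lambda>x. \<Sum>i<m. ind (A i \<inter> ?B) x)" for m
    proof (induction m)
      case 0
      show ?case by (intro approximable_continuous) simp
    next
      case (Suc m)
      have "approximable n (\<lambda>x. (\<Sum>i<m. ind (A i \<inter> ?B) x) + ind (A m \<inter> ?B) x)"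
        using A by (intro approximable_add Suc union) auto
      then show ?case by simp
    qed
    have eq: "(\<Sum>i<m. ind (A i \<inter> ?B) x) = (ind ((\<Union>i<m. A i) \<inter> ?B) x :: real)" for m x
    proof -
      have "disjoint_family_on (\<lambda>i. A i \<inter> ?B) {..<m}"
        using union(1) by (auto simp: disjoint_family_on_def)
      then have "(ind (\<Union>i<m. A i \<inter> ?B) x :: real) = (\<Sum>i<m. ind (A i \<inter> ?B) x)"
        by (intro indicator_UN_disjoint finite_lessThan)
      then show ?thesis by (simp add: Int_UN_distrib2)
    qed
    show ?case
    proof (rule approximable_limit[where s = "\<lambda>m x. \<Sum>i<m. ind (A i \<inter> ?B) x" and w = "ind ?B"])
      show "(\<lambda>m. \<Sum>i<m. ind (A i \<inter> ?B) x) \<longlonglongrightarrow> (ind ((\<Union>i. A i) \<inter> ?B) x :: real)" for x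
      proof (cases "x \<in> (\<Union>i. A i)")
        case True
        then obtain k where "x \<in> A k" by blast
        then have "(\<Sum>i<m. ind (A i \<inter> ?B) x) = (ind ((\<Union>i. A i) \<inter> ?B) x :: real)" if "m \<ge> Suc k" for m
          unfolding eq using that by (auto simp: indicator_def)
        then have "\<forall>\<^sub>F m in sequentially. (\<Sum>i<m. ind (A i \<inter> ?B) x) = (ind ((\<Union>i. A i) \<inter> ?B) x :: real)"
          unfolding eventually_sequentially by blast
        then show ?thesis by (rule tendsto_eventually)
      qed (auto simp: indicator_def)
      show "\<bar>ind ((\<Union>i. A i) \<inter> ?B) x - (\<Sum>i<m. ind (A i \<inter> ?B) x)\<bar> \<le> (ind ?B x :: real)" for m x
        unfolding eq by (auto simp: indicator_def)
    qed (use A fin fin_un in auto)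
  qed
qed

lemma approximable_integrable:
  assumes n: "0 < n" and f: "integrable (lbP n) f"
  shows "approximable n (\<lambda>x. ind (obox n z R) x * f x)"
  using f
proof (induction rule: integrable_induct)
  case (base A c)
  have "approximable n (\<lambda>x. c * ind (A \<inter> obox n z R) x)"
    using base by (intro approximable_cmult approximable_indicator[OF n]) auto
  also have "(\<lambda>x. c * ind (A \<inter> obox n z R) x) = (\<lambda>x. ind (obox n z R) x * (ind A x *\<^sub>R c))"
    by (auto simp: fun_eq_iff indicator_def)
  finally show ?case .
next
  case (add f g)
  have "approximable n (\<lambda>x. ind (obox n z R) x * f x + ind (obox n z R) x * g x)"
    using add by (intro approximable_add) auto
  then show ?case by (simp add: distrib_left)
next
  case (lim f s)
  have m: "f \<in> borelP n" "\<And>i. s i \<in> borelP n" using lim by auto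
  show ?case
  proof (rule approximable_limit[where s = "\<lambda>i x. ind (obox n z R) x * s i x" and w = "\<lambda>x. 3 * \<bar>f x\<bar>"])
    show "(\<lambda>i. ind (obox n z R) x * s i x) \<longlonglongrightarrow> ind (obox n z R) x * f x" if "x \<in> pts n" for x
      using lim(2) that by (intro tendsto_intros) (auto simp: space_lbP)
    show "\<bar>ind (obox n z R) x * f x - ind (obox n z R) x * s i x\<bar> \<le> 3 * \<bar>f x\<bar>" if "x \<in> pts n" for i x
    proof -
      have "\<bar>s i x\<bar> \<le> 2 * \<bar>f x\<bar>" using lim(3)[of x i] that by (simp add: space_lbP)
      then show ?thesis by (auto simp: indicator_def abs_le_iff)
    qed
    have "integrable (lbP n) (\<lambda>x. 3 * \<bar>f x\<bar>)" using lim(4) by simp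
    then have "(\<integral>\<^sup>+x. norm (3 * \<bar>f x\<bar>) \<partial>lbP n) < \<infinity>" unfolding integrable_iff_bounded by blast
    then show "(\<integral>\<^sup>+x. ennreal (3 * \<bar>f x\<bar>) \<partial>lbP n) < \<infinity>" by simp
  qed (use m lim in auto)
qed

lemma powr_sum2_le:
  assumes "(p::real) \<ge> 0"
  shows "\<bar>a + b\<bar> powr p \<le> 2 powr p * (\<bar>a\<bar> powr p + \<bar>b\<bar> powr p)"
proof -
  have "\<bar>a + b\<bar> powr p \<le> (2 * max \<bar>a\<bar> \<bar>b\<bar>) powr p" using assms by (intro powr_mono2) auto
  also have "\<dots> = 2 powr p * max \<bar>a\<bar> \<bar>b\<bar> powr p" by (simp add: powr_mult)
  also have "max \<bar>a\<bar> \<bar>b\<bar> powr p \<le> \<bar>a\<bar> powr p + \<bar>b\<bar> powr p" by (auto simp: max_def)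
  finally show ?thesis by simp
qed

lemma powr_sum3_le:
  assumes "(p::real) \<ge> 0"
  shows "\<bar>a + b + c\<bar> powr p \<le> 4 powr p * (\<bar>a\<bar> powr p + \<bar>b\<bar> powr p + \<bar>c\<bar> powr p)"
proof -
  have "\<bar>a + b + c\<bar> powr p \<le> 2 powr p * (\<bar>a + b\<bar> powr p + \<bar>c\<bar> powr p)" by (rule powr_sum2_le[OF assms])
  also have "\<dots> \<le> 2 powr p * (2 powr p * (\<bar>a\<bar> powr p + \<bar>b\<bar> powr p) + 2 powr p * \<bar>c\<bar> powr p)"
    using powr_sum2_le[OF assms, of a b] ge_one_powr_ge_zero[of 2 p] assms
      mult_right_mono[of 1 "2 powr p" "\<bar>c\<bar> powr p"]
    by (intro mult_left_mono add_mono) auto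
  also have "\<dots> = (2 powr p * 2 powr p) * (\<bar>a\<bar> powr p + \<bar>b\<bar> powr p + \<bar>c\<bar> powr p)"
    by (simp add: algebra_simps)
  also have "2 powr p * 2 powr p = (4::real) powr p" by (simp add: powr_mult[symmetric])
  finally show ?thesis .
qed

definition clip :: "real \<Rightarrow> real \<Rightarrow> real" where
  "clip T t = max (- T) (min T t)"

lemma clip_props:
  assumes "T \<ge> 0"
  shows "\<bar>clip T t\<bar> \<le> T" "\<bar>clip T t\<bar> \<le> \<bar>t\<bar>" "\<bar>t\<bar> \<le> T \<Longrightarrow> clip T t = t"
    "\<bar>clip T t - clip T u\<bar> \<le> \<bar>t - u\<bar>" "\<bar>t - clip T t\<bar> \<le> \<bar>t\<bar>"
  using assms unfolding clip_def by linarith+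

lemma continuous_map_clip:
  assumes "continuous_map X euclideanreal f" shows "continuous_map X euclideanreal (\<lambda>x. clip T (f x))"
  unfolding clip_def by (intro continuous_map_real_max continuous_map_real_min assms) auto

lemma clip_measurable [measurable]: "clip T \<in> borel_measurable borel"
  unfolding clip_def[abs_def] by measurable

text \<open>Passage from the 1-norm to the p-norm: clip \<open>f\<close> at a height
  \<open>T\<close>, approximate the clipped function in the 1-norm and clip the approximant too. The
  difference is then at most \<open>2 * T\<close>, so its p-th power is at most
  \<open>(2 * T)^(p-1)\<close> times its modulus.\<close>

lemma Lp_density:
  assumes n: "0 < n" and p: "p \<ge> 1" and f[measurable]: "f \<in> borelP n"
    and fin: "(\<integral>\<^sup>+x. ennreal (\<bar>f x\<bar> powr p) \<partial>lbP n) < \<infinity>"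
    and supp: "\<And>x. x \<in> pts n \<Longrightarrow> x \<notin> obox n z R \<Longrightarrow> f x = 0" and e: "e > 0"
  obtains g T where "cont n g" "\<forall>x. \<bar>g x\<bar> \<le> T"
    "(\<integral>\<^sup>+x. ennreal (\<bar>f x - g x\<bar> powr p) \<partial>lbP n) < ennreal e"
proof -
  define e' where "e' = e / (2 * 2 powr p)"
  have e': "e' > 0" using e by (simp add: e'_def)
  have "(\<lambda>m. \<integral>\<^sup>+x. ennreal (\<bar>f x - clip (real m) (f x)\<bar> powr p) \<partial>lbP n) \<longlonglongrightarrow> (\<integral>\<^sup>+x. 0 \<partial>lbP n)"
  proof (rule nn_integral_dominated_convergence[where w = "\<lambda>x. ennreal (\<bar>f x\<bar> powr p)"])
    show "AE x in lbP n. (\<lambda>m. ennreal (\<bar>f x - clip (real m) (f x)\<bar> powr p)) \<longlonglongrightarrow> 0"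
    proof (rule AE_I2)
      fix x
      obtain N :: nat where N: "\<bar>f x\<bar> < N" using reals_Archimedean2 by blast
      have "ennreal (\<bar>f x - clip (real m) (f x)\<bar> powr p) = 0" if "m \<ge> N" for m
        using N that clip_props(3)[of "real m" "f x"] by simp
      then have "\<forall>\<^sub>F m in sequentially. ennreal (\<bar>f x - clip (real m) (f x)\<bar> powr p) = 0"
        unfolding eventually_sequentially by blast
      then show "(\<lambda>m. ennreal (\<bar>f x - clip (real m) (f x)\<bar> powr p)) \<longlonglongrightarrow> 0" by (rule tendsto_eventually)
    qed
    show "AE x in lbP n. ennreal (\<bar>f x - clip (real m) (f x)\<bar> powr p) \<le> ennreal (\<bar>f x\<bar> powr p)" for m
      using p by (intro AE_I2 ennreal_leI powr_mono2 clip_props) auto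
  qed (use fin in auto)
  then have "\<forall>\<^sub>F m in sequentially. (\<integral>\<^sup>+x. ennreal (\<bar>f x - clip (real m) (f x)\<bar> powr p) \<partial>lbP n) < ennreal e'"
    using e' by (intro ennreal_small_limit) simp_all
  then have "\<forall>\<^sub>F m in sequentially. m \<ge> 1 \<and> (\<integral>\<^sup>+x. ennreal (\<bar>f x - clip (real m) (f x)\<bar> powr p) \<partial>lbP n) < ennreal e'"
    using eventually_ge_at_top by (intro eventually_conj) auto
  then obtain m :: nat where m: "m \<ge> 1"
    "(\<integral>\<^sup>+x. ennreal (\<bar>f x - clip (real m) (f x)\<bar> powr p) \<partial>lbP n) < ennreal e'"
    using eventually_happens'[OF sequentially_bot] by blast
  define T where "T = real m"
  have T: "T \<ge> 1" using m by (simp add: T_def)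
  define fT where "fT x = clip T (f x)" for x
  have fTm[measurable]: "fT \<in> borelP n" unfolding fT_def by measurable
  have fTb: "\<bar>fT x\<bar> \<le> T * ind (obox n z R) x" if "x \<in> pts n" for x
    using clip_props(1)[of T "f x"] clip_props(2)[of T "f x"] supp[OF that] T
    by (cases "x \<in> obox n z R") (auto simp: fT_def)
  have fTi: "integrable (lbP n) fT"
  proof (rule Bochner_Integration.integrable_bound)
    show "integrable (lbP n) (\<lambda>x. T * ind (obox n z R) x)"
      using emeasure_obox_finite[of n z R] by (intro integrable_mult_right integrable_real_indicator) auto
    show "AE x in lbP n. norm (fT x) \<le> norm (T * ind (obox n z R) x)"
      using fTb T by (intro AE_I2) (auto simp: space_lbP abs_mult)
  qed simp
  define e2 where "e2 = e' / (2 * T) powr (p - 1)"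
  have T2: "(2 * T) powr (p - 1) > 0" using T by simp
  have e2: "e2 > 0" using e' T by (simp add: e2_def)
  obtain g0 where g0: "cont n g0"
    "(\<integral>\<^sup>+x. ennreal \<bar>ind (obox n z R) x * fT x - g0 x\<bar> \<partial>lbP n) < ennreal e2"
    using approximable_integrable[OF n fTi, of z R] e2 unfolding approximable_def by blast
  define g where "g x = clip T (g0 x)" for x
  have gc: "cont n g" unfolding g_def by (rule continuous_map_clip[OF g0(1)])
  note [measurable] = continuous_map_borel'[OF gc] continuous_map_borel'[OF g0(1)]
  have gT: "\<bar>g x\<bar> \<le> T" for x using clip_props(1)[of T] T by (simp add: g_def)
  have pw: "\<bar>fT x - g x\<bar> powr p \<le> (2 * T) powr (p - 1) * \<bar>ind (obox n z R) x * fT x - g0 x\<bar>"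
    if x: "x \<in> pts n" for x
  proof -
    have fTx: "ind (obox n z R) x * fT x = fT x" using fTb[OF x] by (cases "x \<in> obox n z R") auto
    have "fT x = clip T (fT x)" using clip_props(1)[of T "f x"] clip_props(3)[of T "fT x"] T by (simp add: fT_def)
    then have le: "\<bar>fT x - g x\<bar> \<le> \<bar>fT x - g0 x\<bar>" using clip_props(4)[of T "fT x" "g0 x"] T by (simp add: g_def)
    have le2: "\<bar>fT x - g x\<bar> \<le> 2 * T"
      using gT[of x] clip_props(1)[of T "f x"] T unfolding fT_def by linarith
    have "\<bar>fT x - g x\<bar> powr p = \<bar>fT x - g x\<bar> powr (p - 1) * \<bar>fT x - g x\<bar>"
      by (cases "fT x = g x") (auto simp: powr_mult_base[of "\<bar>fT x - g x\<bar>" "p - 1"] mult.commute)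
    also have "\<dots> \<le> (2 * T) powr (p - 1) * \<bar>fT x - g0 x\<bar>"
      using le le2 p by (intro mult_mono powr_mono2) auto
    finally show ?thesis unfolding fTx .
  qed
  have i2: "(\<integral>\<^sup>+x. ennreal (\<bar>fT x - g x\<bar> powr p) \<partial>lbP n) < ennreal e'"
  proof -
    have "(\<integral>\<^sup>+x. ennreal (\<bar>fT x - g x\<bar> powr p) \<partial>lbP n)
        \<le> (\<integral>\<^sup>+x. ennreal ((2 * T) powr (p - 1)) * ennreal \<bar>ind (obox n z R) x * fT x - g0 x\<bar> \<partial>lbP n)"
      using pw by (intro nn_integral_mono) (auto simp: space_lbP ennreal_mult[symmetric] intro!: ennreal_leI)
    also have "\<dots> = ennreal ((2 * T) powr (p - 1)) * (\<integral>\<^sup>+x. ennreal \<bar>ind (obox n z R) x * fT x - g0 x\<bar> \<partial>lbP n)"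
      by (intro nn_integral_cmult) auto
    also have "\<dots> < ennreal ((2 * T) powr (p - 1)) * ennreal e2"
      using g0(2) T2 by (intro ennreal_mult_strict_left_mono) auto
    also have "\<dots> = ennreal e'" using T2 e2 by (subst ennreal_mult[symmetric]) (auto simp: e2_def)
    finally show ?thesis .
  qed
  have "(\<integral>\<^sup>+x. ennreal (\<bar>f x - g x\<bar> powr p) \<partial>lbP n)
      \<le> (\<integral>\<^sup>+x. ennreal (2 powr p) * (ennreal (\<bar>f x - fT x\<bar> powr p) + ennreal (\<bar>fT x - g x\<bar> powr p)) \<partial>lbP n)"
  proof (intro nn_integral_mono)
    fix x
    have "\<bar>f x - g x\<bar> powr p \<le> 2 powr p * (\<bar>f x - fT x\<bar> powr p + \<bar>fT x - g x\<bar> powr p)"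
      using powr_sum2_le[of p "f x - fT x" "fT x - g x"] p by simp
    then show "ennreal (\<bar>f x - g x\<bar> powr p)
        \<le> ennreal (2 powr p) * (ennreal (\<bar>f x - fT x\<bar> powr p) + ennreal (\<bar>fT x - g x\<bar> powr p))"
      by (simp add: ennreal_plus[symmetric] ennreal_mult[symmetric] ennreal_leI del: ennreal_plus)
  qed
  also have "\<dots> = ennreal (2 powr p) * ((\<integral>\<^sup>+x. ennreal (\<bar>f x - fT x\<bar> powr p) \<partial>lbP n)
      + (\<integral>\<^sup>+x. ennreal (\<bar>fT x - g x\<bar> powr p) \<partial>lbP n))"
    by (subst nn_integral_cmult) (auto simp: nn_integral_add)
  also have "\<dots> < ennreal (2 powr p) * ennreal (e' + e')"
    using m(2) i2 e' unfolding fT_def T_def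
    by (intro ennreal_mult_strict_left_mono ennreal_add_less) auto
  also have "\<dots> = ennreal e" using e e' by (subst ennreal_mult[symmetric]) (auto simp: e'_def)
  finally show thesis using gc gT by (intro that[of g T]) auto
qed

section \<open>Mollification in p-th mean\<close>

definition mollifier :: "real \<Rightarrow> (real \<Rightarrow> real) \<Rightarrow> bool" where
  "mollifier r b \<longleftrightarrow> bumpf r b \<and> (\<forall>t. 0 \<le> b t) \<and> integrable lborel b \<and> integral\<^sup>L lborel b = 1"

lemma exists_mollifier: "0 < r \<Longrightarrow> \<exists>b. mollifier r b"
  using exists_bump[of r] unfolding mollifier_def bumpf_def by (metis less_imp_le)

abbreviation moll :: "nat \<Rightarrow> (real \<Rightarrow> real) \<Rightarrow> (point \<Rightarrow> real) \<Rightarrow> point \<Rightarrow> real" where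
  "moll n b \<equiv> conv n (\<lambda>_. b)"

lemma pker_nonneg: "mollifier r b \<Longrightarrow> 0 \<le> pker n (\<lambda>_. b) z"
  by (auto simp: pker_def mollifier_def intro: prod_nonneg)

lemma pker_integral:
  assumes b: "mollifier r b"
  shows "integrable (lbP n) (\<lambda>y. pker n (\<lambda>_. b) (\<lambda>i. x i - y i))"
    "(LINT y|lbP n. pker n (\<lambda>_. b) (\<lambda>i. x i - y i)) = 1"
    "integrable (lbP n) (\<lambda>y. pker n (\<lambda>_. b) (\<lambda>i. y i - x i))"
    "(LINT y|lbP n. pker n (\<lambda>_. b) (\<lambda>i. y i - x i)) = 1"
proof -
  have h: "has_bochner_integral lborel b 1" using b by (simp add: mollifier_def has_bochner_integral_iff)
  have "has_bochner_integral lborel (\<lambda>t. b (c + (-1) * t)) (1 /\<^sub>R \<bar>-1\<bar>)" for c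
    by (rule lborel_has_bochner_integral_real_affine_iff[THEN iffD1, OF _ h]) simp
  then have 1: "integrable lborel (\<lambda>t. b (c - t))" "integral\<^sup>L lborel (\<lambda>t. b (c - t)) = 1" for c
    by (auto simp: has_bochner_integral_iff)
  have "has_bochner_integral lborel (\<lambda>t. b (c + 1 * t)) (1 /\<^sub>R \<bar>1\<bar>)" for c
    by (rule lborel_has_bochner_integral_real_affine_iff[THEN iffD1, OF _ h]) simp
  from this[of "- c" for c] have 2: "integrable lborel (\<lambda>t. b (t - c))" "integral\<^sup>L lborel (\<lambda>t. b (t - c)) = 1" for c
    by (auto simp: has_bochner_integral_iff)
  show "integrable (lbP n) (\<lambda>y. pker n (\<lambda>_. b) (\<lambda>i. x i - y i))"
    "integrable (lbP n) (\<lambda>y. pker n (\<lambda>_. b) (\<lambda>i. y i - x i))"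
    unfolding pker_def by (intro lb.product_integrable_prod 1 2 finite_lessThan)+
  have "(LINT y|lbP n. pker n (\<lambda>_. b) (\<lambda>i. x i - y i)) = (\<Prod>i<n. integral\<^sup>L lborel (\<lambda>t. b (x i - t)))"
    unfolding pker_def by (intro lb.product_integral_prod 1 finite_lessThan)
  then show "(LINT y|lbP n. pker n (\<lambda>_. b) (\<lambda>i. x i - y i)) = 1" by (simp add: 1)
  have "(LINT y|lbP n. pker n (\<lambda>_. b) (\<lambda>i. y i - x i)) = (\<Prod>i<n. integral\<^sup>L lborel (\<lambda>t. b (t - x i)))"
    unfolding pker_def by (intro lb.product_integral_prod 2 finite_lessThan)
  then show "(LINT y|lbP n. pker n (\<lambda>_. b) (\<lambda>i. y i - x i)) = 1" by (simp add: 2)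
qed

text \<open>The kernel is a probability density, so an average of values within \<open>e\<close> of
  \<open>c\<close> is within \<open>e\<close> of \<open>c\<close>. With uniform continuity this
  gives uniform convergence on compact sets.\<close>

lemma moll_close:
  assumes f: "integrable (lbP n) f" and b: "mollifier r b"
    and c: "\<And>y. y \<in> pts n \<Longrightarrow> (\<forall>i<n. \<bar>x i - y i\<bar> \<le> r) \<Longrightarrow> \<bar>f y - c\<bar> \<le> e"
  shows "\<bar>moll n b f x - c\<bar> \<le> e"
proof -
  let ?k = "\<lambda>y. pker n (\<lambda>_. b) (\<lambda>i. x i - y i)"
  have bB: "\<forall>i<n. bumpf r b" using b by (simp add: mollifier_def)
  have i1: "integrable (lbP n) (\<lambda>y. f y * ?k y)" by (rule conv_integrable[OF f bB])
  have i2: "integrable (lbP n) (\<lambda>y. t * ?k y)" "(LINT y|lbP n. t * ?k y) = t" for t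
    using pker_integral(1,2)[OF b, of n x] by auto
  have eq: "moll n b f x - c = (LINT y|lbP n. f y * ?k y - c * ?k y)"
    unfolding conv_def by (subst Bochner_Integration.integral_diff[OF i1 i2(1)]) (simp only: i2(2))
  have "\<bar>moll n b f x - c\<bar> \<le> (LINT y|lbP n. \<bar>f y * ?k y - c * ?k y\<bar>)" unfolding eq by (rule integral_abs_bound)
  also have "\<dots> \<le> (LINT y|lbP n. e * ?k y)"
  proof (rule integral_mono)
    show "integrable (lbP n) (\<lambda>y. \<bar>f y * ?k y - c * ?k y\<bar>)"
      by (intro integrable_abs Bochner_Integration.integrable_diff i1 i2)
    show "integrable (lbP n) (\<lambda>y. e * ?k y)" by (rule i2)
    fix y assume y: "y \<in> space (lbP n)"
    have k0: "0 \<le> ?k y" by (rule pker_nonneg[OF b])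
    show "\<bar>f y * ?k y - c * ?k y\<bar> \<le> e * ?k y"
    proof (cases "\<forall>i<n. \<bar>x i - y i\<bar> \<le> r")
      case True
      then have "\<bar>f y - c\<bar> * ?k y \<le> e * ?k y" using c y k0 by (intro mult_right_mono) (auto simp: space_lbP)
      then show ?thesis using k0 by (simp add: left_diff_distrib[symmetric] abs_mult)
    next
      case False
      then obtain i where i: "i < n" "r < \<bar>x i - y i\<bar>" by (auto simp: not_le)
      then have "b (x i - y i) = 0" using b by (auto simp: bumpf_def mollifier_def)
      then have "?k y = 0" by (simp add: pker_split[OF i(1)])
      then show ?thesis by simp
    qed
  qed
  also have "\<dots> = e" by (rule i2)
  finally show ?thesis .
qed

text \<open>The exponent 1 is included because Jensen's inequality is also applied to the 1-norm, in
  the fundamental lemma on locally integrable functions.\<close>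

lemma bregman1_nonneg_1: "s \<ge> 1 \<Longrightarrow> 0 \<le> bregman1 s a b"
proof (cases "s = 1")
  case True
  have "bregman1 1 a b = \<bar>a\<bar> - sgn b * a"
    by (auto simp: bregman1_def dual_pow_def sgn_if)
  moreover have "sgn b * a \<le> \<bar>a\<bar>" by (auto simp: sgn_if)
  ultimately show ?thesis using True by simp
qed (simp add: bregman1_nonneg)

text \<open>Integrate the tangent inequality of \<open>|.|\<^sup>p\<close> at the mean.\<close>

lemma moll_jensen:
  assumes p: "p \<ge> 1" and f: "integrable (lbP n) f" and b: "mollifier r b"
  shows "ennreal (\<bar>moll n b f x\<bar> powr p)
    \<le> (\<integral>\<^sup>+y. ennreal (\<bar>f y\<bar> powr p * pker n (\<lambda>_. b) (\<lambda>i. x i - y i)) \<partial>lbP n)"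
proof -
  let ?k = "\<lambda>y. pker n (\<lambda>_. b) (\<lambda>i. x i - y i)"
  have bB: "\<forall>i<n. bumpf r b" using b by (simp add: mollifier_def)
  have k[measurable]: "?k \<in> borelP n" using pker_integral(1)[OF b, of n x] by simp
  have fm[measurable]: "f \<in> borelP n" using f by simp
  have k0: "0 \<le> ?k y" for y by (rule pker_nonneg[OF b])
  define m where "m = moll n b f x"
  have i1: "integrable (lbP n) (\<lambda>y. f y * ?k y)" by (rule conv_integrable[OF f bB])
  show ?thesis
  proof (cases "(\<integral>\<^sup>+y. ennreal (\<bar>f y\<bar> powr p * ?k y) \<partial>lbP n) = \<infinity>")
    case False
    then have i3: "integrable (lbP n) (\<lambda>y. \<bar>f y\<bar> powr p * ?k y)"
      using k0 by (intro integrableI_nonneg) (auto simp: less_top)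
    \<comment> \<open>The tangent of \<open>|.|^p\<close> at the mean \<open>m\<close>, weighted by
      the kernel. Its linear part integrates to 0, because the kernel has total mass 1.\<close>
    define L where "L y = \<bar>m\<bar> powr p * ?k y + (p * dual_pow p m) * (f y * ?k y - m * ?k y)" for y
    have iL: "integrable (lbP n) L" "integral\<^sup>L (lbP n) L = \<bar>m\<bar> powr p"
    proof -
      note * = pker_integral(1,2)[OF b, of n x]
      show "integrable (lbP n) L" unfolding L_def using * i1 by auto
      have "integral\<^sup>L (lbP n) L = \<bar>m\<bar> powr p * 1 + (p * dual_pow p m) * (m - m * 1)"
        unfolding L_def using * i1 by (simp add: m_def conv_def)
      then show "integral\<^sup>L (lbP n) L = \<bar>m\<bar> powr p" by simp
    qed
    have "L y \<le> \<bar>f y\<bar> powr p * ?k y" for y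
    proof -
      have "0 \<le> bregman1 p (f y) m * ?k y" using bregman1_nonneg_1[OF p] k0 by (intro mult_nonneg_nonneg) auto
      then show ?thesis by (simp add: L_def bregman1_def algebra_simps)
    qed
    then have "\<bar>m\<bar> powr p \<le> (LINT y|lbP n. \<bar>f y\<bar> powr p * ?k y)"
      unfolding iL(2)[symmetric] by (intro integral_mono iL i3)
    then show ?thesis
      using k0 nn_integral_eq_integral[OF i3] by (simp add: m_def ennreal_leI)
  qed simp
qed

text \<open>Jensen's inequality pointwise, then Tonelli; the kernel has mass 1 in \<open>x\<close>
  as well as in \<open>y\<close>.\<close>

lemma moll_contraction:
  assumes p: "p \<ge> 1" and f: "integrable (lbP n) f" and b: "mollifier r b"
  shows "(\<integral>\<^sup>+x. ennreal (\<bar>moll n b f x\<bar> powr p) \<partial>lbP n) \<le> (\<integral>\<^sup>+x. ennreal (\<bar>f x\<bar> powr p) \<partial>lbP n)"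
proof -
  interpret sigma_finite_measure "lbP n" by (rule lb.sigma_finite) simp
  interpret P: pair_sigma_finite "lbP n" "lbP n" ..
  have fm[measurable]: "f \<in> borelP n" using f by simp
  let ?k = "\<lambda>x y. pker n (\<lambda>_. b) (\<lambda>i. x i - y i)"
  have sm: "\<forall>i<n. smooth1 b" using b by (simp add: mollifier_def bumpf_def)
  note [measurable] = pker_measurable2[OF sm]
  have m: "(\<lambda>(x, y). ennreal (\<bar>f y\<bar> powr p * ?k x y)) \<in> borel_measurable (lbP n \<Otimes>\<^sub>M lbP n)"
  proof -
    have "(\<lambda>z. ennreal (\<bar>f (snd z)\<bar> powr p * (case z of (x, y) \<Rightarrow> ?k x y))) \<in> borel_measurable (lbP n \<Otimes>\<^sub>M lbP n)"
      by measurable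
    then show ?thesis by (simp add: case_prod_beta)
  qed
  have "(\<integral>\<^sup>+x. ennreal (\<bar>moll n b f x\<bar> powr p) \<partial>lbP n)
      \<le> (\<integral>\<^sup>+x. (\<integral>\<^sup>+y. ennreal (\<bar>f y\<bar> powr p * ?k x y) \<partial>lbP n) \<partial>lbP n)"
    by (intro nn_integral_mono moll_jensen[OF p f b])
  also have "\<dots> = (\<integral>\<^sup>+y. (\<integral>\<^sup>+x. ennreal (\<bar>f y\<bar> powr p * ?k x y) \<partial>lbP n) \<partial>lbP n)"
    using P.Fubini'[OF m] by simp
  also have "\<dots> = (\<integral>\<^sup>+y. ennreal (\<bar>f y\<bar> powr p) \<partial>lbP n)"
  proof (intro nn_integral_cong)
    fix y
    have i: "integrable (lbP n) (\<lambda>x. ?k x y)" "(LINT x|lbP n. ?k x y) = 1"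
      using pker_integral(3,4)[OF b, of n y] by auto
    have "(\<integral>\<^sup>+x. ennreal (\<bar>f y\<bar> powr p * ?k x y) \<partial>lbP n)
        = ennreal (\<bar>f y\<bar> powr p) * (\<integral>\<^sup>+x. ennreal (?k x y) \<partial>lbP n)"
      using i pker_nonneg[OF b] by (subst nn_integral_cmult[symmetric]) (auto simp: ennreal_mult)
    also have "(\<integral>\<^sup>+x. ennreal (?k x y) \<partial>lbP n) = 1"
      using nn_integral_eq_integral[OF i(1)] i(2) pker_nonneg[OF b] by simp
    finally show "(\<integral>\<^sup>+x. ennreal (\<bar>f y\<bar> powr p * ?k x y) \<partial>lbP n) = ennreal (\<bar>f y\<bar> powr p)" by simp
  qed
  finally show ?thesis .
qed

lemma integrable_of_Lp_bounded_support:
  assumes p: "p \<ge> 1" and f[measurable]: "f \<in> borelP n"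
    and fin: "(\<integral>\<^sup>+x. ennreal (\<bar>f x\<bar> powr p) \<partial>lbP n) < \<infinity>"
    and supp: "\<And>x. x \<in> pts n \<Longrightarrow> x \<notin> obox n z R \<Longrightarrow> f x = 0"
  shows "integrable (lbP n) f"
proof (rule Bochner_Integration.integrable_bound)
  show "integrable (lbP n) (\<lambda>x. ind (obox n z R) x + \<bar>f x\<bar> powr p)"
    using emeasure_obox_finite[of n z R] fin
    by (intro Bochner_Integration.integrable_add integrable_real_indicator integrableI_nonneg) auto
  show "AE x in lbP n. norm (f x) \<le> norm (ind (obox n z R) x + \<bar>f x\<bar> powr p)"
  proof (rule AE_I2)
    fix x assume x: "x \<in> space (lbP n)"
    show "norm (f x) \<le> norm (ind (obox n z R) x + \<bar>f x\<bar> powr p)"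
    proof (cases "x \<in> obox n z R")
      case True
      have "\<bar>f x\<bar> \<le> 1 + \<bar>f x\<bar> powr p"
      proof (cases "\<bar>f x\<bar> \<le> 1")
        case False
        then have "\<bar>f x\<bar> powr 1 \<le> \<bar>f x\<bar> powr p" using p by (intro powr_mono) auto
        then show ?thesis using False by simp
      qed (simp add: add_increasing2)
      then show ?thesis using True by simp
    next
      case False
      then show ?thesis using supp x by (simp add: space_lbP)
    qed
  qed
qed simp

text \<open>Split \<open>f\<close> into a bounded function that is continuous near \<open>K\<close>
  and a remainder \<open>h\<close> small in p-th mean. The contraction property controls the
  mollified remainder, uniform continuity the rest. The threshold \<open>r0\<close> works for every
  kernel, so several functions can later be mollified by the same one.\<close>

lemma moll_Lp_tendsto:
  assumes n: "0 < n" and p: "p \<ge> 1" and f[measurable]: "f \<in> borelP n"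
    and fin: "(\<integral>\<^sup>+x. ennreal (\<bar>f x\<bar> powr p) \<partial>lbP n) < \<infinity>"
    and supp: "\<And>x. x \<in> pts n \<Longrightarrow> x \<notin> obox n (\<lambda>_. 0) R \<Longrightarrow> f x = 0"
    and K: "compact_in n K" and e: "e > 0"
  obtains r0 where "r0 > 0" "\<forall>r b. r < r0 \<longrightarrow> mollifier r b \<longrightarrow>
    (\<integral>\<^sup>+x\<in>K. ennreal (\<bar>moll n b f x - f x\<bar> powr p) \<partial>lbP n) < ennreal e"
proof -
  have Ks[measurable]: "K \<in> sets (lbP n)" by (rule compactin_sets[OF K])
  define k where "k = measure (lbP n) K"
  have k: "emeasure (lbP n) K = ennreal k" "k \<ge> 0"
    using emeasure_compact_finite[OF K] by (auto simp: k_def emeasure_eq_ennreal_measure)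
  \<comment> \<open>Three errors \<open>e1\<close>, \<open>e1\<close> and \<open>2 * e1\<close> add
    up to \<open>4 * e1\<close>, and \<open>4 powr p\<close> is the constant of
    \<open>powr_sum3_le\<close>.\<close>
  define e1 where "e1 = e / (4 * 4 powr p)"
  have e1: "e1 > 0" using e by (simp add: e1_def)
  define e2 where "e2 = (e1 / (k + 1)) powr (1 / p)"
  have e2: "e2 > 0" using e1 k by (simp add: e2_def)
  have e2p: "e2 powr p * k \<le> e1"
  proof -
    have "e2 powr p = e1 / (k + 1)" using p e1 k by (simp add: e2_def powr_powr)
    moreover have "e1 / (k + 1) * k \<le> e1 / (k + 1) * (k + 1)" using e1 k by (intro mult_left_mono) auto
    ultimately show ?thesis using k by simp
  qed
  obtain g T where g: "cont n g" "\<forall>x. \<bar>g x\<bar> \<le> T"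
    "(\<integral>\<^sup>+x. ennreal (\<bar>f x - g x\<bar> powr p) \<partial>lbP n) < ennreal e1"
    using Lp_density[OF n p f fin supp e1] by blast
  note [measurable] = continuous_map_borel'[OF g(1)]
  obtain RK where RK: "RK > 0" "\<forall>x\<in>K. \<forall>i<n. \<bar>x i\<bar> < RK" using compact_box_bounded[OF K] by blast
  have Kp: "K \<subseteq> pts n" using compactin_subset_topspace[OF K] by simp
  \<comment> \<open>The cube contains the support of \<open>f\<close> and the neighbourhood of
    \<open>K\<close> of radius 1, so cutting \<open>g\<close> off outside it neither enlarges
    \<open>f - g\<close> nor affects mollification on \<open>K\<close>.\<close>
  define R2 where "R2 = max R (RK + 1)"
  define B2 where "B2 = obox n (\<lambda>_. 0) R2"
  have B2[measurable]: "B2 \<in> sets (lbP n)" by (simp add: B2_def)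
  define g' where "g' x = ind B2 x * g x" for x
  have g'm[measurable]: "g' \<in> borelP n" unfolding g'_def by measurable
  have fi: "integrable (lbP n) f" by (rule integrable_of_Lp_bounded_support[OF p f fin supp])
  have g'i: "integrable (lbP n) g'"
  proof (rule Bochner_Integration.integrable_bound)
    show "integrable (lbP n) (\<lambda>x. T * ind B2 x)"
      using emeasure_obox_finite[of n _ R2] by (intro integrable_mult_right integrable_real_indicator) (auto simp: B2_def)
    have "\<bar>g' x\<bar> \<le> \<bar>T * ind B2 x\<bar>" for x
      using g(2)[rule_format, of x] by (cases "x \<in> B2") (auto simp: g'_def)
    then show "AE x in lbP n. norm (g' x) \<le> norm (T * ind B2 x)" by simp
  qed simp
  define h where "h x = f x - g' x" for x
  have hi: "integrable (lbP n) h" unfolding h_def using fi g'i by simp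
  have hm[measurable]: "h \<in> borelP n" using hi by simp
  have hle: "(\<integral>\<^sup>+x. ennreal (\<bar>h x\<bar> powr p) \<partial>lbP n) < ennreal e1"
  proof -
    have "(\<integral>\<^sup>+x. ennreal (\<bar>h x\<bar> powr p) \<partial>lbP n) \<le> (\<integral>\<^sup>+x. ennreal (\<bar>f x - g x\<bar> powr p) \<partial>lbP n)"
    proof (intro nn_integral_mono)
      fix x assume "x \<in> space (lbP n)"
      then have x: "x \<in> pts n" by (simp add: space_lbP)
      show "ennreal (\<bar>h x\<bar> powr p) \<le> ennreal (\<bar>f x - g x\<bar> powr p)"
      proof (cases "x \<in> B2")
        case True
        then show ?thesis by (simp add: h_def g'_def)
      next
        case False
        then have "x \<notin> obox n (\<lambda>_. 0) R" using obox_mono[of R R2 n "\<lambda>_. 0"] by (auto simp: B2_def R2_def)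
        then have "h x = 0" using supp[OF x] False by (simp add: h_def g'_def)
        then show ?thesis by simp
      qed
    qed
    with g(3) show ?thesis by simp
  qed
  obtain d where d: "d > 0" "\<forall>x\<in>K. \<forall>y\<in>obox n x d. y \<in> pts n \<and> \<bar>g y - g x\<bar> < e2"
  proof -
    have "subtopology (Rn n) (pts n) = Rn n" by (metis subtopology_topspace topspace_Rn)
    moreover have "openin (Rn n) (pts n)" by (metis openin_topspace topspace_Rn)
    ultimately show ?thesis
      using uniformly_continuous_on_compact[of n "pts n" g K e2] g(1) K Kp e2 that by auto
  qed
  define r0 where "r0 = min d 1"
  have r0: "r0 > 0" using d by (simp add: r0_def)
  have "(\<integral>\<^sup>+x\<in>K. ennreal (\<bar>moll n b f x - f x\<bar> powr p) \<partial>lbP n) < ennreal e"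
    if r: "r < r0" and b: "mollifier r b" for r b
  proof -
    have bB: "\<forall>i<n. bumpf r b" using b by (simp add: mollifier_def)
    have mm: "moll n b f x = moll n b h x + moll n b g' x" for x
    proof -
      have "moll n b h x = moll n b f x - moll n b g' x"
        unfolding conv_def h_def left_diff_distrib
        by (intro Bochner_Integration.integral_diff conv_integrable[OF _ bB] fi g'i)
      then show ?thesis by simp
    qed
    have cl: "\<bar>moll n b g' x - g' x\<bar> \<le> e2" if x: "x \<in> K" for x
    proof (rule moll_close[OF g'i b])
      fix y assume y: "y \<in> pts n" "\<forall>i<n. \<bar>x i - y i\<bar> \<le> r"
      have "y \<in> obox n x d" using y r by (auto simp: obox_def r0_def abs_minus_commute)
      then have 1: "\<bar>g y - g x\<bar> < e2" using d x by blast
      have "x \<in> B2" using RK x Kp by (fastforce simp: B2_def R2_def obox_def)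
      moreover have "y \<in> B2"
      proof -
        have "\<bar>y i\<bar> < R2" if "i < n" for i
        proof -
          have "\<bar>x i - y i\<bar> \<le> r" "\<bar>x i\<bar> < RK" using y RK x that by auto
          moreover have "r < 1" "RK + 1 \<le> R2" using r by (auto simp: r0_def R2_def)
          ultimately show ?thesis by linarith
        qed
        then show ?thesis using y by (simp add: B2_def obox_def)
      qed
      ultimately show "\<bar>g' y - g' x\<bar> \<le> e2" using 1 by (simp add: g'_def)
    qed
    have mc[measurable]: "moll n b f \<in> borelP n" "moll n b h \<in> borelP n"
      by (intro continuous_map_borel' continuous_map_conv[OF _ bB] fi hi)+
    have "(\<integral>\<^sup>+x\<in>K. ennreal (\<bar>moll n b f x - f x\<bar> powr p) \<partial>lbP n)
      \<le> (\<integral>\<^sup>+x. ennreal (4 powr p) * (ennreal (\<bar>moll n b h x\<bar> powr p) + ennreal (\<bar>h x\<bar> powr p)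
          + ennreal (e2 powr p) * ind K x) \<partial>lbP n)"
    proof (intro nn_integral_mono)
      fix x
      show "ennreal (\<bar>moll n b f x - f x\<bar> powr p) * ind K x \<le> ennreal (4 powr p) *
        (ennreal (\<bar>moll n b h x\<bar> powr p) + ennreal (\<bar>h x\<bar> powr p) + ennreal (e2 powr p) * ind K x)"
      proof (cases "x \<in> K")
        case True
        have "moll n b f x - f x = moll n b h x + - h x + (moll n b g' x - g' x)" by (simp add: mm h_def)
        then have "\<bar>moll n b f x - f x\<bar> powr p \<le> 4 powr p *
            (\<bar>moll n b h x\<bar> powr p + \<bar>h x\<bar> powr p + \<bar>moll n b g' x - g' x\<bar> powr p)"
          using powr_sum3_le[of p "moll n b h x" "- h x" "moll n b g' x - g' x"] p by simp
        also have "\<dots> \<le> 4 powr p * (\<bar>moll n b h x\<bar> powr p + \<bar>h x\<bar> powr p + e2 powr p)"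
          using cl[OF True] p by (intro mult_left_mono add_left_mono powr_mono2) auto
        finally show ?thesis using True
          by (simp add: ennreal_plus[symmetric] ennreal_mult[symmetric] ennreal_leI del: ennreal_plus)
      qed simp
    qed
    also have "\<dots> = ennreal (4 powr p) * ((\<integral>\<^sup>+x. ennreal (\<bar>moll n b h x\<bar> powr p) \<partial>lbP n)
        + (\<integral>\<^sup>+x. ennreal (\<bar>h x\<bar> powr p) \<partial>lbP n) + ennreal (e2 powr p) * emeasure (lbP n) K)"
      by (subst nn_integral_cmult) (auto simp: nn_integral_add nn_integral_cmult)
    also have "\<dots> < ennreal (4 powr p) * ennreal (e1 + e1 + 2 * e1)"
    proof (intro ennreal_mult_strict_left_mono ennreal_add_less)
      show "(\<integral>\<^sup>+x. ennreal (\<bar>moll n b h x\<bar> powr p) \<partial>lbP n) < ennreal e1"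
        using moll_contraction[OF p hi b] hle by (rule order.strict_trans1)
      have "ennreal (e2 powr p) * emeasure (lbP n) K = ennreal (e2 powr p * k)"
        unfolding k(1) by (subst ennreal_mult[symmetric]) (auto simp: k)
      also have "\<dots> < ennreal (2 * e1)" using e2p e1 by (intro ennreal_lessI) auto
      finally show "ennreal (e2 powr p) * emeasure (lbP n) K < ennreal (2 * e1)" .
    qed (use hle e1 in auto)
    also have "\<dots> = ennreal e" using e1 by (subst ennreal_mult[symmetric]) (auto simp: e1_def)
    finally show ?thesis .
  qed
  then show thesis using r0 by (intro that[of r0]) auto
qed

subsection \<open>Integration by parts\<close>

lemma integral_line_derivative_0:
  assumes F: "\<And>t. (F has_real_derivative f t) (at t)" and c: "continuous_on UNIV f"
    and z: "\<And>t. R < \<bar>t\<bar> \<Longrightarrow> F t = 0" and zf: "\<And>t. R < \<bar>t\<bar> \<Longrightarrow> f t = 0"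
  shows "(LINT t|lborel. f t) = 0"
proof -
  define A where "A = \<bar>R\<bar> + 1"
  have A: "A > 0" "R < A" by (auto simp: A_def)
  have "(LINT t|lborel. f t * ind {-A..A} t) = F A - F (- A)"
    using A F c by (intro integral_FTC_Icc_real) (auto simp: continuous_on_eq_continuous_at)
  also have "(\<lambda>t. f t * ind {-A..A} t) = f"
  proof
    fix t show "f t * ind {-A..A} t = f t"
    proof (cases "t \<in> {-A..A}")
      case False
      then have "R < \<bar>t\<bar>" using A by auto
      then show ?thesis by (simp add: zf)
    qed simp
  qed
  also have "F A - F (- A) = 0" using z[of A] z[of "-A"] A by simp
  finally show ?thesis .
qed

lemma continuous_map_line:
  assumes "cont n f" "x \<in> pts n" "i < n"
  shows "continuous_on UNIV (\<lambda>t. f (x(i := t)))"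
proof -
  have "continuous_map euclideanreal (Rn n) (\<lambda>t. x(i := t))"
    unfolding continuous_map_componentwise using upd_pts[OF assms(2,3)]
    by (auto simp: PiE_iff)
  then have "continuous_map euclideanreal euclideanreal (f \<circ> (\<lambda>t. x(i := t)))"
    using assms(1) by (rule continuous_map_compose)
  then show ?thesis by (simp add: o_def)
qed

definition line_deriv :: "nat \<Rightarrow> nat \<Rightarrow> (point \<Rightarrow> real) \<Rightarrow> (point \<Rightarrow> real) \<Rightarrow> bool" where
  "line_deriv n i f f' \<longleftrightarrow> cont n f \<and> cont n f' \<and>
     (\<forall>x\<in>pts n. ((\<lambda>t. f (x(i := t))) has_real_derivative f' x) (at (x i)))"

lemma line_deriv_at:
  assumes "line_deriv n i f f'" "x \<in> pts n" "i < n"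
  shows "((\<lambda>t. f (x(i := t))) has_real_derivative f' (x(i := t))) (at t)"
  using assms upd_pts[OF assms(2,3), of t] unfolding line_deriv_def by fastforce

lemma line_deriv_support:
  assumes f: "line_deriv n i f f'" and i: "i < n" and K: "compact_in n K"
    and z: "\<And>x. x \<in> pts n \<Longrightarrow> x \<notin> K \<Longrightarrow> f x = 0" and x: "x \<in> pts n" "x \<notin> K"
  shows "f' x = 0"
proof -
  have "closedin (Rn n) K" by (rule compactin_imp_closedin[OF Hausdorff_Rn K])
  then have "openin (Rn n) (pts n - K)" by (simp add: closedin_def)
  then obtain r where r: "r > 0" "obox n x r \<subseteq> pts n - K" using x unfolding openin_Rn_iff by blast
  have "\<forall>\<^sub>F t in nhds (x i). t \<in> ball (x i) r" using r by (intro eventually_nhds_in_open) auto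
  then have "\<forall>\<^sub>F t in nhds (x i). f (x(i := t)) = 0"
  proof eventually_elim
    case (elim t)
    then have "x(i := t) \<in> obox n x r"
      using upd_pts[OF x(1) i] r by (auto simp: obox_def dist_real_def abs_minus_commute)
    then show ?case using r z by blast
  qed
  then have "((\<lambda>t. f (x(i := t))) has_real_derivative 0) (at (x i))"
    by (subst DERIV_cong_ev[OF refl _ refl, of _ "\<lambda>_. 0"]) auto
  moreover have "((\<lambda>t. f (x(i := t))) has_real_derivative f' x) (at (x i))"
    using f x by (simp add: line_deriv_def)
  ultimately show ?thesis using DERIV_unique by blast
qed

lemma continuous_compact_support_integrable:
  assumes f: "cont n f" and K: "compact_in n K"
    and z: "\<And>x. x \<in> pts n \<Longrightarrow> x \<notin> K \<Longrightarrow> f x = 0"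
  shows "integrable (lbP n) f"
proof -
  have "compactin euclideanreal (f ` K)" by (rule image_compactin[OF K f])
  then have "bounded (f ` K)" by (simp add: compact_imp_bounded)
  then obtain C where C: "\<forall>x\<in>K. \<bar>f x\<bar> \<le> C" unfolding bounded_iff by auto
  show ?thesis
  proof (rule Bochner_Integration.integrable_bound)
    show "integrable (lbP n) (\<lambda>x. C * ind K x)"
      using emeasure_compact_finite[OF K] compactin_sets[OF K]
      by (intro integrable_mult_right integrable_real_indicator) auto
    show "f \<in> borelP n" by (rule continuous_map_borel'[OF f])
    show "AE x in lbP n. norm (f x) \<le> norm (C * ind K x)"
    proof (rule AE_I2)
      fix x assume "x \<in> space (lbP n)"
      then show "norm (f x) \<le> norm (C * ind K x)"
        using C z[of x] by (cases "x \<in> K") (auto simp: space_lbP intro: order.trans[OF _ abs_ge_self])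
    qed
  qed
qed

text \<open>Fubini singles out the i-th coordinate, and on each line the fundamental theorem of
  calculus gives 0 by compact support.\<close>

lemma integral_line_deriv_0:
  assumes f: "line_deriv n i f f'" and i: "i < n" and K: "compact_in n K"
    and z: "\<And>x. x \<in> pts n \<Longrightarrow> x \<notin> K \<Longrightarrow> f x = 0"
  shows "(LINT x|lbP n. f' x) = 0"
proof -
  obtain R where R: "R > 0" "\<forall>x\<in>K. \<forall>i<n. \<bar>x i\<bar> < R" using compact_box_bounded[OF K] by blast
  have zf: "f' x = 0" if "x \<in> pts n" "x \<notin> K" for x
    by (rule line_deriv_support[OF f i K z that])
  have int: "integrable (lbP n) f'"
    using f zf by (intro continuous_compact_support_integrable[OF _ K]) (auto simp: line_deriv_def)
  have ins: "insert i ({..<n} - {i}) = {..<n}" using i by auto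
  have int': "integrable (Pi\<^sub>M (insert i ({..<n} - {i})) (\<lambda>_. lborel)) f'" using int by (simp only: ins)
  have "(LINT x|lbP n. f' x) = (LINT x|Pi\<^sub>M ({..<n} - {i}) (\<lambda>_. lborel). LINT t|lborel. f' (x(i := t)))"
    using lb.product_integral_insert[OF _ _ int'] by (simp only: ins finite_Diff finite_lessThan) simp
  also have "\<dots> = (LINT x|Pi\<^sub>M ({..<n} - {i}) (\<lambda>_. lborel :: real measure). 0)"
  proof (rule Bochner_Integration.integral_cong[OF refl])
    fix x assume x: "x \<in> space (Pi\<^sub>M ({..<n} - {i}) (\<lambda>_. lborel :: real measure))"
    \<comment> \<open>\<open>x\<close> has no i-th coordinate. Any value there turns it into a point
      of the space, and the line through it in direction \<open>i\<close> does not depend on the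
      choice.\<close>
    define y where "y = x(i := 0)"
    have y: "y \<in> pts n" using x i by (auto simp: y_def space_PiM PiE_iff extensional_def)
    have eq: "x(i := t) = y(i := t)" for t by (simp add: y_def)
    show "(LINT t|lborel. f' (x(i := t))) = 0"
      unfolding eq
    proof (rule integral_line_derivative_0[where F = "\<lambda>t. f (y(i := t))" and R = R])
      show "((\<lambda>t. f (y(i := t))) has_real_derivative f' (y(i := t))) (at t)" for t
        by (rule line_deriv_at[OF f y i])
      show "continuous_on UNIV (\<lambda>t. f' (y(i := t)))"
        using f by (intro continuous_map_line[OF _ y i]) (simp add: line_deriv_def)
      fix t assume t: "R < \<bar>t\<bar>"
      have "y(i := t) \<notin> K"
      proof
        assume "y(i := t) \<in> K"
        then have "\<bar>(y(i := t)) i\<bar> < R" using R i by blast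
        with t show False by simp
      qed
      then show "f (y(i := t)) = 0" "f' (y(i := t)) = 0" using z zf upd_pts[OF y i] by auto
    qed
  qed
  finally show ?thesis by simp
qed

lemma line_deriv_mult:
  assumes "line_deriv n i f f'" "line_deriv n i g g'"
  shows "line_deriv n i (\<lambda>x. f x * g x) (\<lambda>x. f' x * g x + g' x * f x)"
  unfolding line_deriv_def
proof (intro conjI ballI)
  show "cont n (\<lambda>x. f x * g x)"
    "cont n (\<lambda>x. f' x * g x + g' x * f x)"
    using assms by (auto simp: line_deriv_def intro!: continuous_map_real_mult continuous_map_add)
  fix x assume x: "x \<in> pts n"
  have "((\<lambda>t. f (x(i := t)) * g (x(i := t))) has_real_derivative
      f' x * g (x(i := x i)) + g' x * f (x(i := x i))) (at (x i))"
    using assms x by (intro DERIV_mult) (auto simp: line_deriv_def)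
  then show "((\<lambda>t. f (x(i := t)) * g (x(i := t))) has_real_derivative f' x * g x + g' x * f x) (at (x i))"
    by simp
qed

lemma integration_by_parts:
  assumes f: "line_deriv n i f f'" and g: "line_deriv n i g g'" and i: "i < n" and K: "compact_in n K"
    and z: "\<And>x. x \<in> pts n \<Longrightarrow> x \<notin> K \<Longrightarrow> g x = 0"
  shows "(LINT x|lbP n. f x * g' x) = - (LINT x|lbP n. f' x * g x)"
proof -
  have zg: "g' x = 0" if "x \<in> pts n" "x \<notin> K" for x by (rule line_deriv_support[OF g i K z that])
  have "(LINT x|lbP n. f' x * g x + g' x * f x) = 0"
    by (rule integral_line_deriv_0[OF line_deriv_mult[OF f g] i K]) (simp add: z)
  moreover have "integrable (lbP n) (\<lambda>x. f' x * g x)" "integrable (lbP n) (\<lambda>x. g' x * f x)"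
    using f g z zg
    by (auto simp: line_deriv_def intro!: continuous_compact_support_integrable[OF _ K] continuous_map_real_mult)
  ultimately show ?thesis by (simp add: mult.commute)
qed

lemma Ck_line_deriv:
  assumes "Ck n 1 f" "i < n" shows "line_deriv n i f (pd i f)"
  unfolding line_deriv_def
proof (intro conjI ballI)
  show "cont n f" "cont n (pd i f)"
    using assms by auto
  fix x assume "x \<in> pts n"
  then have "(\<lambda>t. f (x(i := t))) field_differentiable at (x i)" using assms by simp
  then show "((\<lambda>t. f (x(i := t))) has_real_derivative pd i f x) (at (x i))"
    unfolding partial_deriv_def by (rule field_differentiable_derivI)
qed

subsection \<open>Transfer between the completed and the plain product measure\<close>

lemma borel_leb: "f \<in> borelP n \<Longrightarrow> f \<in> borel_measurable (leb n)"
  by (rule measurable_completion)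

text \<open>Replaces a function measurable for the completion by a Borel function supported in
  \<open>K\<close>, to which convolution and Fubini for the uncompleted product measure
  apply.\<close>

lemma borel_rep:
  fixes f :: "point \<Rightarrow> real"
  assumes f: "lmeas n U f" and K: "K \<subseteq> U" "K \<in> sets (lbP n)"
  obtains F where "F \<in> borelP n" "AE x in leb n. ind K x * f x = F x" "\<forall>x. x \<notin> K \<longrightarrow> F x = 0"
proof -
  have "(\<lambda>x. ind U x *\<^sub>R f x) \<in> borel_measurable (leb n)"
    using f by (simp add: set_borel_measurable_def)
  then obtain G where G: "G \<in> borelP n" "AE x in lbP n. ind U x *\<^sub>R f x = G x"
    using completion_ex_borel_measurable_real by blast
  show thesis
  proof
    show "(\<lambda>x. ind K x * G x) \<in> borelP n" using G(1) K by simp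
    show "AE x in leb n. ind K x * f x = ind K x * G x"
      using AE_completion[OF G(2)] by eventually_elim (use K in \<open>auto simp: indicator_def split: if_splits\<close>)
  qed simp
qed

lemma leb_measurable_AE:
  fixes f F :: "point \<Rightarrow> real"
  assumes F: "F \<in> borel_measurable (leb n)" and ae: "AE x in leb n. f x = F x"
  shows "f \<in> borel_measurable (leb n)"
proof (rule measurableI)
  fix S :: "real set" assume S: "S \<in> sets borel"
  have "AE x in leb n. x \<in> F -` S \<inter> space (leb n) \<longleftrightarrow> x \<in> f -` S \<inter> space (leb n)"
    using ae by eventually_elim auto
  then show "f -` S \<inter> space (leb n) \<in> sets (leb n)"
    by (rule completion.in_sets_AE) (use measurable_sets[OF F S] in auto)
qed simp

lemma leb_integral_cong:
  fixes f F :: "point \<Rightarrow> real"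
  assumes F: "F \<in> borelP n" and ae: "AE x in leb n. f x = F x"
  shows "f \<in> borel_measurable (leb n)" "(LINT x|leb n. f x) = (LINT x|lbP n. F x)"
    "integrable (leb n) f \<longleftrightarrow> integrable (lbP n) F"
proof -
  have FL: "F \<in> borel_measurable (leb n)" by (rule borel_leb[OF F])
  show m: "f \<in> borel_measurable (leb n)"
    by (rule leb_measurable_AE[OF FL ae])
  show "(LINT x|leb n. f x) = (LINT x|lbP n. F x)"
    using integral_cong_AE[OF m FL ae] integral_completion[OF F] by simp
  show "integrable (leb n) f \<longleftrightarrow> integrable (lbP n) F"
    using integrable_cong_AE[OF m FL ae] integrable_completion[OF F] by simp
qed

lemma Lp_loc_setI:
  assumes f: "f \<in> Lp_loc n U p" and K: "compact_in n K" "K \<subseteq> U"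
  obtains F where "F \<in> borelP n" "AE x in leb n. ind K x * f x = F x"
    "\<forall>x. x \<notin> K \<longrightarrow> F x = 0" "(\<integral>\<^sup>+x. ennreal (\<bar>F x\<bar> powr p) \<partial>lbP n) < \<infinity>"
proof -
  have fm: "lmeas n U f" and fi: "set_integrable (leb n) K (\<lambda>x. \<bar>f x\<bar> powr p)"
    using f K by (auto simp: Lp_loc_def)
  obtain F where F: "F \<in> borelP n" "AE x in leb n. ind K x * f x = F x"
    "\<forall>x. x \<notin> K \<longrightarrow> F x = 0" using borel_rep[OF fm K(2) compactin_sets[OF K(1)]] by blast
  have "AE x in leb n. ind K x *\<^sub>R \<bar>f x\<bar> powr p = \<bar>F x\<bar> powr p"
    using F(2)
  proof eventually_elim
    case (elim x)
    then show ?case using F(3) by (cases "x \<in> K") auto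
  qed
  then have "integrable (lbP n) (\<lambda>x. \<bar>F x\<bar> powr p)"
    using leb_integral_cong(3)[of "\<lambda>x. \<bar>F x\<bar> powr p" n] F(1) fi unfolding set_integrable_def by simp
  then have "(\<integral>\<^sup>+x. ennreal (norm (\<bar>F x\<bar> powr p)) \<partial>lbP n) < \<infinity>" unfolding integrable_iff_bounded by blast
  then show thesis using F by (intro that[of F]) auto
qed

subsection \<open>Mollification and weak derivatives\<close>

text \<open>As a function of the integration variable the kernel is an admissible test function. The
  reflection \<open>x i - y i\<close> is the source of the minus sign in its derivative.\<close>

lemma Cc_smooth_kernel:
  assumes b: "bumpf r b" and U: "clbox n x r \<subseteq> U"
  shows "(\<lambda>y. pker n (\<lambda>_. b) (\<lambda>i. x i - y i)) \<in> Cc_smooth n U"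
    "i < n \<Longrightarrow> pd i (\<lambda>y. pker n (\<lambda>_. b) (\<lambda>i. x i - y i)) y
       = - pker n ((\<lambda>_. b)(i := deriv b)) (\<lambda>i. x i - y i)"
proof -
  define B where "B j t = b (x j - t)" for j t
  have eq: "(\<lambda>y. pker n (\<lambda>_. b) (\<lambda>i. x i - y i)) = pker n B" by (simp add: pker_def B_def fun_eq_iff)
  have sb: "smooth1 b" using b by (simp add: bumpf_def)
  have sB: "smooth1 (B j)" for j
    using smooth1_affine[OF sb, of "-1" "x j"] by (simp add: B_def[abs_def])
  have "pker n B y = 0" if y: "y \<in> pts n - clbox n x r" for y
  proof -
    obtain j where j: "j < n" "r < \<bar>y j - x j\<bar>" using y by (auto simp: clbox_def not_le)
    then have "B j (y j) = 0" using b by (simp add: B_def bumpf_def abs_minus_commute)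
    then show ?thesis by (simp add: pker_split[OF j(1)])
  qed
  then show "(\<lambda>y. pker n (\<lambda>_. b) (\<lambda>i. x i - y i)) \<in> Cc_smooth n U"
    unfolding eq Cc_smooth_def using Ck_pker[of n B] sB U compactin_clbox[of n x r] by auto
  assume i: "i < n"
  have dB: "deriv (B i) t = - deriv b (x i - t)" for t
  proof (rule DERIV_imp_deriv)
    have "((\<lambda>t. b (x i - t)) has_real_derivative deriv b (x i - t) * (-1)) (at t)"
      by (rule DERIV_chain2[OF smooth1_DERIV[OF sb]]) (auto intro!: derivative_eq_intros)
    then show "(B i has_real_derivative - deriv b (x i - t)) (at t)" by (simp add: B_def[abs_def])
  qed
  have "pd i (pker n B) y = pker n (B(i := deriv (B i))) y"
    by (rule partial_deriv_eq[OF pker_DERIV[OF sB i]])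
  also have "\<dots> = - pker n ((\<lambda>_. b)(i := deriv b)) (\<lambda>i. x i - y i)"
    unfolding pker_upd_fun[OF i] dB by (simp add: B_def)
  finally show "pd i (\<lambda>y. pker n (\<lambda>_. b) (\<lambda>i. x i - y i)) y
       = - pker n ((\<lambda>_. b)(i := deriv b)) (\<lambda>i. x i - y i)" unfolding eq .
qed

lemma conv_eq_set_integral:
  assumes F: "F \<in> borelP n" "AE x in leb n. ind K x * f x = F x"
    and K: "K \<subseteq> U" "clbox n x r \<subseteq> K" and B: "\<forall>i<n. bumpf r (B i)"
  shows "(LINT y:U|leb n. f y * pker n B (\<lambda>i. x i - y i)) = conv n B F x"
proof -
  have km: "(\<lambda>y. pker n B (\<lambda>i. x i - y i)) \<in> borelP n"
    using B by (intro pker_measurable) (auto simp: bumpf_def)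
  have kz: "pker n B (\<lambda>i. x i - y i) = 0" if y: "y \<in> pts n" "y \<notin> clbox n x r" for y
  proof -
    obtain j where j: "j < n" "r < \<bar>y j - x j\<bar>" using y by (auto simp: clbox_def not_le)
    then have "B j (x j - y j) = 0" using B by (simp add: bumpf_def abs_minus_commute)
    then show ?thesis by (simp add: pker_split[OF j(1)])
  qed
  have "AE y in leb n. y \<in> pts n" using AE_space[of "leb n"] by (simp add: space_PiM)
  with F(2) have "AE y in leb n. ind U y *\<^sub>R (f y * pker n B (\<lambda>i. x i - y i))
      = F y * pker n B (\<lambda>i. x i - y i)"
  proof eventually_elim
    case (elim y)
    show ?case
    proof (cases "y \<in> clbox n x r")
      case True
      then show ?thesis using elim(1) K by (auto simp: indicator_def split: if_splits)
    next
      case False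
      then show ?thesis using kz[OF elim(2)] by simp
    qed
  qed
  then show ?thesis
    unfolding set_lebesgue_integral_def conv_def
    by (intro leb_integral_cong(2)) (use F(1) km in auto)
qed

text \<open>The derivative of a mollified function is the mollified weak derivative: test the
  definition with the reflected kernel. The minus sign from the reflection and the one from
  integration by parts cancel.\<close>

lemma conv_partial_eq_moll:
  assumes w: "weak_partial n U i f h" and i: "i < n"
    and F: "F \<in> borelP n" "AE x in leb n. ind K x * f x = F x"
    and H: "H \<in> borelP n" "AE x in leb n. ind K x * h x = H x"
    and K: "K \<subseteq> U" "clbox n x r \<subseteq> K" and b: "bumpf r b"
  shows "conv n ((\<lambda>_. b)(i := deriv b)) F x = moll n b H x"
proof -
  let ?\<eta> = "\<lambda>y. pker n (\<lambda>_. b) (\<lambda>i. x i - y i)"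
  have U: "clbox n x r \<subseteq> U" using K by blast
  have B1: "\<forall>j<n. bumpf r (((\<lambda>_. b)(i := deriv b)) j)" using b bumpf_deriv by auto
  have B2: "\<forall>j<n. bumpf r ((\<lambda>_. b) j)" using b by auto
  have "(LINT y:U|leb n. f y * pd i ?\<eta> y) = - (LINT y:U|leb n. h y * ?\<eta> y)"
    using w Cc_smooth_kernel(1)[OF b U] unfolding weak_partial_def by blast
  then have "- (LINT y:U|leb n. f y * pker n ((\<lambda>_. b)(i := deriv b)) (\<lambda>i. x i - y i))
      = - (LINT y:U|leb n. h y * ?\<eta> y)"
    unfolding Cc_smooth_kernel(2)[OF b U i] by (simp add: set_lebesgue_integral_def)
  then show ?thesis
    unfolding conv_eq_set_integral[OF F K B1] conv_eq_set_integral[OF H K B2] by simp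
qed

lemma compact_in_obox:
  assumes "compact_in n K"
  obtains R where "K \<subseteq> obox n (\<lambda>_. 0) R"
proof -
  obtain R where R: "R > 0" "\<forall>x\<in>K. \<forall>i<n. \<bar>x i\<bar> < R" using compact_box_bounded[OF assms] by blast
  then show thesis using compactin_subset_topspace[OF assms] by (intro that[of R]) (auto simp: obox_def)
qed

lemma moll_Lp_tendsto_compact:
  assumes n: "0 < n" and p: "p \<ge> 1" and f: "f \<in> borelP n"
    and fin: "(\<integral>\<^sup>+x. ennreal (\<bar>f x\<bar> powr p) \<partial>lbP n) < \<infinity>"
    and K': "compact_in n K'" "\<forall>x. x \<notin> K' \<longrightarrow> f x = 0"
    and K: "compact_in n K" and e: "e > 0"
  obtains r0 where "r0 > 0" "\<forall>r b. r < r0 \<longrightarrow> mollifier r b \<longrightarrow>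
    (\<integral>\<^sup>+x\<in>K. ennreal (\<bar>moll n b f x - f x\<bar> powr p) \<partial>lbP n) < ennreal e"
proof -
  obtain R where R: "K' \<subseteq> obox n (\<lambda>_. 0) R" using compact_in_obox[OF K'(1)] by blast
  have "f x = 0" if "x \<in> pts n" "x \<notin> obox n (\<lambda>_. 0) R" for x using that R K'(2) by blast
  from moll_Lp_tendsto[OF n p f fin this K e] show thesis using that by blast
qed

lemma integrable_of_Lp_compact_support:
  assumes p: "p \<ge> 1" and f: "f \<in> borelP n"
    and fin: "(\<integral>\<^sup>+x. ennreal (\<bar>f x\<bar> powr p) \<partial>lbP n) < \<infinity>"
    and K': "compact_in n K'" "\<forall>x. x \<notin> K' \<longrightarrow> f x = 0"
  shows "integrable (lbP n) f"
proof -
  obtain R where R: "K' \<subseteq> obox n (\<lambda>_. 0) R" using compact_in_obox[OF K'(1)] by blast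
  show ?thesis by (rule integrable_of_Lp_bounded_support[OF p f fin, of "\<lambda>_. 0" R]) (use R K'(2) in blast)
qed

lemma AE_open_from_compact:
  assumes U: "openin (Rn n) U"
    and K: "\<And>K. compact_in n K \<Longrightarrow> K \<subseteq> U \<Longrightarrow> AE x\<in>K in leb n. P x"
  shows "AE x\<in>U in leb n. P x"
proof -
  obtain C where C: "countable C" "\<forall>K\<in>C. \<exists>c r. K = clbox n c r" "U = \<Union>C"
    using open_eq_countable_Union_clbox[OF U] by blast
  have "AE x in leb n. x \<in> L \<longrightarrow> P x" if L: "L \<in> C" for L
  proof (rule K)
    have "\<exists>c r. L = clbox n c r" using C(2) L by (rule bspec)
    then show "compact_in n L" using compactin_clbox by auto
    show "L \<subseteq> U" unfolding C(3) using L by (rule Union_upper)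
  qed
  then have "AE x in leb n. \<forall>K\<in>C. x \<in> K \<longrightarrow> P x"
    using C(1) by (subst AE_ball_countable) auto
  then show ?thesis by eventually_elim (use C(3) in blast)
qed

text \<open>Testing with kernels shows that the mollifications of \<open>h\<close> at small radii
  vanish on \<open>K\<close>, while they converge to \<open>h\<close> in mean there.\<close>

lemma fundamental_lemma:
  assumes n: "0 < n" and U: "openin (Rn n) U" and h: "h \<in> Lp_loc n U 1"
    and z: "\<And>\<phi>. \<phi> \<in> Cc_smooth n U \<Longrightarrow> (LINT x:U|leb n. h x * \<phi> x) = 0"
  shows "AE x\<in>U in leb n. h x = 0"
proof (rule AE_open_from_compact[OF U])
  fix K assume K: "compact_in n K" "K \<subseteq> U"
  obtain d K' where K': "d > 0" "compact_in n K'" "K' \<subseteq> U" "\<forall>x\<in>K. obox n x d \<subseteq> K'" "K \<subseteq> K'"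
    using compact_neighbourhood[OF U K] by blast
  obtain H where H: "H \<in> borelP n" "AE x in leb n. ind K' x * h x = H x"
    "\<forall>x. x \<notin> K' \<longrightarrow> H x = 0" "(\<integral>\<^sup>+x. ennreal (\<bar>H x\<bar> powr 1) \<partial>lbP n) < \<infinity>"
    using Lp_loc_setI[OF h K'(2,3)] by blast
  have Ks: "K \<in> sets (lbP n)" by (rule compactin_sets[OF K(1)])
  have zero: "moll n b H x = 0" if b: "mollifier r b" and r: "r < d" and x: "x \<in> K" for r b x
  proof -
    have c: "clbox n x r \<subseteq> K'" using clbox_subset_obox[OF r, of n x] K'(4) x by blast
    have bb: "bumpf r b" using b by (simp add: mollifier_def)
    have "clbox n x r \<subseteq> U" using c K'(3) by blast
    from z[OF Cc_smooth_kernel(1)[OF bb this]] show ?thesis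
      using conv_eq_set_integral[OF H(1,2) K'(3) c, of "\<lambda>_. b"] bb by simp
  qed
  have small: "(\<integral>\<^sup>+x\<in>K. ennreal \<bar>H x\<bar> \<partial>lbP n) \<le> ennreal e" if e: "e > 0" for e
  proof -
    obtain r0 where r0: "r0 > 0" "\<forall>r b. r < r0 \<longrightarrow> mollifier r b \<longrightarrow>
        (\<integral>\<^sup>+x\<in>K. ennreal (\<bar>moll n b H x - H x\<bar> powr 1) \<partial>lbP n) < ennreal e"
      using moll_Lp_tendsto_compact[OF n order_refl H(1,4) K'(2) H(3) K(1) e] by blast
    define r where "r = min r0 d / 2"
    have r: "0 < r" "r < r0" "r < d" using r0 K'(1) by (auto simp: r_def)
    obtain b where b: "mollifier r b" using exists_mollifier[OF r(1)] by blast
    have "(\<integral>\<^sup>+x\<in>K. ennreal \<bar>H x\<bar> \<partial>lbP n) = (\<integral>\<^sup>+x\<in>K. ennreal (\<bar>moll n b H x - H x\<bar> powr 1) \<partial>lbP n)"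
      by (intro nn_integral_cong) (auto simp: indicator_def zero[OF b r(3)])
    also have "\<dots> < ennreal e" using r0(2) r(2) b by blast
    finally show ?thesis by (rule less_imp_le)
  qed
  have "(\<integral>\<^sup>+x\<in>K. ennreal \<bar>H x\<bar> \<partial>lbP n) \<le> 0"
  proof (rule ennreal_le_epsilon)
    fix e :: real assume "0 < e"
    from small[OF this] show "(\<integral>\<^sup>+x\<in>K. ennreal \<bar>H x\<bar> \<partial>lbP n) \<le> 0 + ennreal e" by (simp only: add_0)
  qed
  then have "(\<integral>\<^sup>+x\<in>K. ennreal \<bar>H x\<bar> \<partial>lbP n) = 0" by simp
  then have "AE x in lbP n. ennreal \<bar>H x\<bar> * ind K x = 0"
    by (subst (asm) nn_integral_0_iff_AE) (use H(1) Ks in auto)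
  then have "AE x in leb n. ennreal \<bar>H x\<bar> * ind K x = 0" by (rule AE_completion)
  with H(2) show "AE x\<in>K in leb n. h x = 0"
    by eventually_elim (use K'(5) in \<open>auto simp: indicator_def split: if_splits\<close>)
qed

text \<open>The derivatives are approximated with errors that decay so fast that one integrable
  \<open>S\<close> controls all of them pointwise with a rate. Convergence almost everywhere and a
  common majorant for dominated convergence then come together, without passing to subsequences. The
  clause on nonnegativity later keeps the approximants of \<open>u\<close> away from 0.\<close>

lemma sobolev_approx:
  assumes n: "0 < n" and p: "p \<ge> 1" and U: "openin (Rn n) U"
    and f: "cont_on n U f"
    and h: "\<And>i. i < n \<Longrightarrow> h i \<in> Lp_loc n U p" "\<And>i. i < n \<Longrightarrow> weak_partial n U i f (h i)"
    and K: "compact_in n K" "K \<subseteq> K'" and K': "compact_in n K'" "K' \<subseteq> U"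
    and d: "d > 0" "\<forall>x\<in>K. obox n x d \<subseteq> K'"
  obtains F S where "\<forall>m k. Ck n k (F m)"
    "\<forall>m. \<forall>x\<in>pts n. F m x \<noteq> 0 \<longrightarrow> (\<exists>y\<in>K'. f y \<noteq> 0 \<and> x \<in> obox n y d)"
    "(\<forall>y\<in>K'. 0 \<le> f y) \<longrightarrow> (\<forall>m x. 0 \<le> F m x)"
    "\<forall>m. \<forall>x\<in>K. \<bar>F m x - f x\<bar> \<le> (1/2) ^ m"
    "integrable (leb n) S" "\<forall>x. 0 \<le> S x"
    "\<forall>m. AE x\<in>K in leb n. (\<forall>i<n. \<bar>pd i (F m) x - h i x\<bar> powr p \<le> (1/2) ^ m * S x)"
proof -
  have Ks[measurable]: "K \<in> sets (lbP n)" by (rule compactin_sets[OF K(1)])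
  have K's[measurable]: "K' \<in> sets (lbP n)" by (rule compactin_sets[OF K'(1)])
  define F0 where "F0 x = ind K' x * (ind U x * f x)" for x
  have F0m[measurable]: "F0 \<in> borelP n"
    unfolding F0_def using continuous_map_borel[OF U f] by measurable
  have F0e: "F0 x = (if x \<in> K' then f x else 0)" for x using K'(2) by (auto simp: F0_def indicator_def)
  have F0ae: "AE x in leb n. ind K' x * f x = F0 x" by (auto simp: F0e)
  have "compactin euclideanreal (f ` K')"
    by (rule image_compactin[OF _ f]) (use K' in \<open>simp add: compactin_subtopology\<close>)
  then have "bounded (f ` K')" by (simp add: compact_imp_bounded)
  then obtain C where C: "\<forall>x\<in>K'. \<bar>f x\<bar> \<le> C" unfolding bounded_iff by auto
  have F0i: "integrable (lbP n) F0"
  proof (rule Bochner_Integration.integrable_bound[of _ "\<lambda>x. C * ind K' x"])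
    show "integrable (lbP n) (\<lambda>x. C * ind K' x)"
      using emeasure_compact_finite[OF K'(1)] by (intro integrable_mult_right integrable_real_indicator) auto
    show "AE x in lbP n. norm (F0 x) \<le> norm (C * ind K' x)"
      using C by (auto simp: F0e intro: order.trans[OF _ abs_ge_self])
  qed simp
  define good where "good i H \<longleftrightarrow> H \<in> borelP n \<and> (AE x in leb n. ind K' x * h i x = H x)
      \<and> (\<forall>x. x \<notin> K' \<longrightarrow> H x = 0) \<and> (\<integral>\<^sup>+x. ennreal (\<bar>H x\<bar> powr p) \<partial>lbP n) < \<infinity>" for i H
  have "\<forall>i. \<exists>H. i < n \<longrightarrow> good i H"
  proof
    fix i show "\<exists>H. i < n \<longrightarrow> good i H"
    proof (cases "i < n")
      case True
      show ?thesis
        by (rule Lp_loc_setI[OF h(1)[OF True] K']) (auto simp: good_def)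
    qed simp
  qed
  from choice[OF this] obtain H where H0: "\<forall>i. i < n \<longrightarrow> good i (H i)" by blast
  have H: "\<And>i. i < n \<Longrightarrow> H i \<in> borelP n"
    "\<And>i. i < n \<Longrightarrow> AE x in leb n. ind K' x * h i x = H i x"
    "\<And>i. i < n \<Longrightarrow> \<forall>x. x \<notin> K' \<longrightarrow> H i x = 0"
    "\<And>i. i < n \<Longrightarrow> (\<integral>\<^sup>+x. ennreal (\<bar>H i x\<bar> powr p) \<partial>lbP n) < \<infinity>"
    using H0 by (auto simp: good_def)
  note [measurable] = H(1)
  have Hi: "integrable (lbP n) (H i)" if "i < n" for i
    by (rule integrable_of_Lp_compact_support[OF p H(1)[OF that] H(4)[OF that] K'(1) H(3)[OF that]])
  \<comment> \<open>A single radius and kernel must serve the function and all its \<open>n\<close>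
    derivatives at stage \<open>m\<close>.\<close>
  define okay where "okay m rb \<longleftrightarrow> fst rb < d \<and> mollifier (fst rb) (snd rb)
      \<and> (\<forall>x\<in>K. \<bar>moll n (snd rb) F0 x - f x\<bar> \<le> (1/2) ^ m) \<and>
     (\<forall>i<n. (\<integral>\<^sup>+x\<in>K. ennreal (\<bar>moll n (snd rb) (H i) x - H i x\<bar> powr p) \<partial>lbP n) < ennreal ((1/4) ^ m))" for m rb
  have ex: "\<exists>rb. okay m rb" for m
  proof -
    have "\<forall>i. \<exists>r0. i < n \<longrightarrow> r0 > 0 \<and> (\<forall>r b. r < r0 \<longrightarrow> mollifier r b \<longrightarrow>
        (\<integral>\<^sup>+x\<in>K. ennreal (\<bar>moll n b (H i) x - H i x\<bar> powr p) \<partial>lbP n) < ennreal ((1/4) ^ m))"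
    proof
      fix i
      show "\<exists>r0. i < n \<longrightarrow> r0 > 0 \<and> (\<forall>r b. r < r0 \<longrightarrow> mollifier r b \<longrightarrow>
        (\<integral>\<^sup>+x\<in>K. ennreal (\<bar>moll n b (H i) x - H i x\<bar> powr p) \<partial>lbP n) < ennreal ((1/4) ^ m))"
      proof (cases "i < n")
        case True
        have "(1/4::real) ^ m > 0" by simp
        from moll_Lp_tendsto_compact[OF n p H(1)[OF True] H(4)[OF True] K'(1) H(3)[OF True] K(1) this]
        obtain r0 where "r0 > 0" "\<forall>r b. r < r0 \<longrightarrow> mollifier r b \<longrightarrow>
          (\<integral>\<^sup>+x\<in>K. ennreal (\<bar>moll n b (H i) x - H i x\<bar> powr p) \<partial>lbP n) < ennreal ((1/4) ^ m)" .
        then show ?thesis by (intro exI[of _ r0] impI conjI)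
      qed simp
    qed
    from choice[OF this] obtain r0 where r00: "\<forall>i. i < n \<longrightarrow> r0 i > 0 \<and> (\<forall>r b. r < r0 i \<longrightarrow> mollifier r b \<longrightarrow>
        (\<integral>\<^sup>+x\<in>K. ennreal (\<bar>moll n b (H i) x - H i x\<bar> powr p) \<partial>lbP n) < ennreal ((1/4) ^ m))" by blast
    then have r0: "\<And>i. i < n \<Longrightarrow> r0 i > 0" "\<And>i r b. i < n \<Longrightarrow> r < r0 i \<Longrightarrow> mollifier r b \<Longrightarrow>
        (\<integral>\<^sup>+x\<in>K. ennreal (\<bar>moll n b (H i) x - H i x\<bar> powr p) \<partial>lbP n) < ennreal ((1/4) ^ m)" by simp_all
    have "(1/2::real) ^ m > 0" by simp
    moreover have "K \<subseteq> U" using K K' by blast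
    ultimately obtain d' where d': "d' > 0" "\<forall>x\<in>K. \<forall>y\<in>obox n x d'. y \<in> U \<and> \<bar>f y - f x\<bar> < (1/2) ^ m"
      using uniformly_continuous_on_compact[OF U f K(1)] by blast
    define r where "r = Min (insert (min d d') (r0 ` {..<n})) / 2"
    have r1: "Min (insert (min d d') (r0 ` {..<n})) > 0" using r0 d d' by auto
    have r: "r > 0" "r < d" "r < d'" "\<And>i. i < n \<Longrightarrow> r < r0 i"
    proof -
      have 1: "Min (insert (min d d') (r0 ` {..<n})) \<le> min d d'" by (intro Min_le) auto
      have 2: "Min (insert (min d d') (r0 ` {..<n})) \<le> r0 i" if "i < n" for i
        using that by (intro Min_le) auto
      show "r > 0" "r < d" "r < d'" using r1 1 unfolding r_def by linarith+
      show "r < r0 i" if "i < n" for i using r1 2[OF that] unfolding r_def by linarith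
    qed
    obtain b where b: "mollifier r b" using exists_mollifier[OF r(1)] by blast
    have "\<bar>moll n b F0 x - f x\<bar> \<le> (1/2) ^ m" if x: "x \<in> K" for x
    proof (rule moll_close[OF F0i b])
      fix y assume y: "y \<in> pts n" "\<forall>i<n. \<bar>x i - y i\<bar> \<le> r"
      have "y \<in> obox n x d'" "y \<in> obox n x d" using y r by (auto simp: obox_def abs_minus_commute)
      then have "\<bar>f y - f x\<bar> < (1/2) ^ m" "y \<in> K'" using d' x d(2) by blast+
      then show "\<bar>F0 y - f x\<bar> \<le> (1/2) ^ m" by (simp add: F0e)
    qed
    then have "okay m (r, b)" unfolding okay_def using b r(2) r0(2)[OF _ r(4) b] by simp
    then show ?thesis by blast
  qed
  then have "\<forall>m. \<exists>rb. okay m rb" by blast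
  from choice[OF this] obtain rb where rb: "\<forall>m. okay m (rb m)" by blast
  define b r where "b m = snd (rb m)" and "r m = fst (rb m)" for m
  have b: "\<And>m. r m < d" "\<And>m. mollifier (r m) (b m)"
    "\<And>m. \<forall>x\<in>K. \<bar>moll n (b m) F0 x - f x\<bar> \<le> (1/2) ^ m"
    "\<And>m i. i < n \<Longrightarrow> (\<integral>\<^sup>+x\<in>K. ennreal (\<bar>moll n (b m) (H i) x - H i x\<bar> powr p) \<partial>lbP n) < ennreal ((1/4) ^ m)"
    using rb unfolding okay_def b_def r_def by auto
  have bb: "\<forall>i<n. bumpf (r m) (b m)" for m using b(2) by (simp add: mollifier_def)
  define F where "F m = moll n (b m) F0" for m
  have mm[measurable]: "moll n (b m) (H i) \<in> borelP n" if "i < n" for m i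
    by (intro continuous_map_borel' continuous_map_conv[OF Hi[OF that] bb])
  define D where "D m x = (\<Sum>i<n. \<bar>moll n (b m) (H i) x - H i x\<bar> powr p) * ind K x" for m x
  have D0: "0 \<le> D m x" for m x by (simp add: D_def sum_nonneg)
  have Dm[measurable]: "D m \<in> borelP n" for m
    unfolding D_def by (intro borel_measurable_times borel_measurable_sum borel_measurable_indicator Ks) measurable
  \<comment> \<open>The integral of \<open>D m\<close> is at most \<open>n * 4^-m\<close>, so the
    weights \<open>2^m\<close> leave a convergent series, and each term bounds \<open>D m\<close> by
    \<open>2^-m * S'\<close>.\<close>
  define S' where "S' x = (\<Sum>m. ennreal (2 ^ m * D m x))" for x
  have S'm[measurable]: "S' \<in> borelP n" unfolding S'_def by measurable
  have "(\<integral>\<^sup>+x. S' x \<partial>lbP n) = (\<Sum>m. \<integral>\<^sup>+x. ennreal (2 ^ m * D m x) \<partial>lbP n)"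
    unfolding S'_def by (intro nn_integral_suminf) measurable
  also have "\<dots> \<le> (\<Sum>m. ennreal (real n * (1/2) ^ m))"
  proof (intro suminf_le)
    fix m
    have "(\<integral>\<^sup>+x. ennreal (2 ^ m * D m x) \<partial>lbP n)
      = (\<integral>\<^sup>+x. ennreal (2 ^ m) * (\<Sum>i<n. ennreal (\<bar>moll n (b m) (H i) x - H i x\<bar> powr p) * ind K x) \<partial>lbP n)"
    proof (intro nn_integral_cong)
      fix x
      have "ennreal (D m x) = (\<Sum>i<n. ennreal (\<bar>moll n (b m) (H i) x - H i x\<bar> powr p) * ind K x)"
        by (cases "x \<in> K") (auto simp: D_def)
      then show "ennreal (2 ^ m * D m x)
          = ennreal (2 ^ m) * (\<Sum>i<n. ennreal (\<bar>moll n (b m) (H i) x - H i x\<bar> powr p) * ind K x)"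
        using D0 by (simp add: ennreal_mult)
    qed
    also have "\<dots> = ennreal (2 ^ m) * (\<Sum>i<n. \<integral>\<^sup>+x\<in>K. ennreal (\<bar>moll n (b m) (H i) x - H i x\<bar> powr p) \<partial>lbP n)"
      by (subst nn_integral_cmult, measurable) (subst nn_integral_sum, measurable)
    also have "\<dots> \<le> ennreal (2 ^ m) * (\<Sum>i<n. ennreal ((1/4) ^ m))"
      using b(4) by (intro mult_left_mono sum_mono) (auto intro: less_imp_le)
    also have "\<dots> = ennreal (real n * (2 ^ m * (1/4) ^ m))"
      by (simp add: ennreal_mult[symmetric] ennreal_of_nat_eq_real_of_nat mult_ac)
    also have "(2::real) ^ m * (1/4) ^ m = (1/2) ^ m" by (simp add: power_mult_distrib[symmetric])
    finally show "(\<integral>\<^sup>+x. ennreal (2 ^ m * D m x) \<partial>lbP n) \<le> ennreal (real n * (1/2) ^ m)" .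
  qed auto
  also have "\<dots> = ennreal (\<Sum>m. real n * (1/2) ^ m)"
    by (intro suminf_ennreal2 summable_mult summable_geometric) auto
  also have "\<dots> < \<infinity>" by simp
  finally have S'fin: "(\<integral>\<^sup>+x. S' x \<partial>lbP n) < \<infinity>" .
  have S'ae: "AE x in lbP n. S' x \<noteq> \<infinity>"
    by (rule nn_integral_noteq_infinite) (use S'fin in auto)
  define S where "S x = enn2real (S' x)" for x
  have Sm[measurable]: "S \<in> borelP n" unfolding S_def by measurable
  have Si: "integrable (lbP n) S"
  proof (rule integrableI_nonneg)
    have "(\<integral>\<^sup>+x. ennreal (S x) \<partial>lbP n) \<le> (\<integral>\<^sup>+x. S' x \<partial>lbP n)"
    proof (intro nn_integral_mono)
      fix x show "ennreal (S x) \<le> S' x"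
      proof (cases "S' x = top")
        case False
        then show ?thesis by (simp add: S_def less_top)
      qed simp
    qed
    with S'fin show "(\<integral>\<^sup>+x. ennreal (S x) \<partial>lbP n) < \<infinity>" by simp
  qed (auto simp: S_def)
  show thesis
  proof
    show "\<forall>m k. Ck n k (F m)" unfolding F_def using Ck_conv[OF F0i bb] by blast
    show "\<forall>m. \<forall>x\<in>pts n. F m x \<noteq> 0 \<longrightarrow> (\<exists>y\<in>K'. f y \<noteq> 0 \<and> x \<in> obox n y d)"
    proof (intro allI ballI impI)
      fix m x assume x: "x \<in> pts n" "F m x \<noteq> 0"
      have "moll n (b m) F0 x \<noteq> 0" using x(2) by (simp add: F_def)
      from conv_support[OF bb this]
      obtain y where y: "y \<in> pts n" "F0 y \<noteq> 0" "\<forall>i<n. \<bar>x i - y i\<bar> \<le> r m" by (elim bexE conjE)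
      have yK: "y \<in> K'"
      proof (rule ccontr)
        assume "y \<notin> K'"
        then show False using y(2) unfolding F0e by simp
      qed
      moreover have "f y \<noteq> 0" using y(2) yK unfolding F0e by simp
      moreover have "x \<in> obox n y d"
      proof -
        have "\<bar>x i - y i\<bar> < d" if "i < n" for i
          using y(3)[rule_format, OF that] b(1)[of m] by linarith
        then show ?thesis using x(1) by (simp add: obox_def)
      qed
      ultimately show "\<exists>y\<in>K'. f y \<noteq> 0 \<and> x \<in> obox n y d" by blast
    qed
    show "(\<forall>y\<in>K'. 0 \<le> f y) \<longrightarrow> (\<forall>m x. 0 \<le> F m x)"
      unfolding F_def conv_def using pker_nonneg[OF b(2)]
      by (auto simp: F0e intro!: integral_nonneg_AE mult_nonneg_nonneg)
    show "\<forall>m. \<forall>x\<in>K. \<bar>F m x - f x\<bar> \<le> (1/2) ^ m" unfolding F_def using b(3) by blast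
    show "integrable (leb n) S" using integrable_completion[OF Sm] Si by simp
    show "\<forall>x. 0 \<le> S x" by (simp add: S_def)
    show "\<forall>m. AE x\<in>K in leb n. (\<forall>i<n. \<bar>pd i (F m) x - h i x\<bar> powr p \<le> (1/2) ^ m * S x)"
    proof
      fix m
      have "AE x in leb n. \<forall>i\<in>{..<n}. ind K' x * h i x = H i x"
        using H(2) by (subst AE_ball_countable) auto
      moreover have "AE x in leb n. S' x \<noteq> \<infinity>" by (rule AE_completion[OF S'ae])
      ultimately show "AE x\<in>K in leb n. (\<forall>i<n. \<bar>pd i (F m) x - h i x\<bar> powr p \<le> (1/2) ^ m * S x)"
      proof eventually_elim
        case (elim x)
        show ?case
        proof (intro impI allI)
          fix i assume x: "x \<in> K" and i: "i < n"
          have hx: "h i x = H i x" using elim(1) i x K(2) by (auto simp: indicator_def)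
          have cl: "clbox n x (r m) \<subseteq> K'" using clbox_subset_obox[OF b(1)[of m], of n x] d(2) x by blast
          have "pd i (F m) x = conv n ((\<lambda>_. b m)(i := deriv (b m))) F0 x"
            unfolding F_def by (rule partial_deriv_eq) (use conv_DERIV[OF F0i bb i] in simp)
          also have "\<dots> = moll n (b m) (H i) x"
            by (rule conv_partial_eq_moll[OF h(2)[OF i] i F0m F0ae H(1)[OF i] H(2)[OF i] K'(2) cl])
              (use bb i in blast)
          finally have pd: "pd i (F m) x = moll n (b m) (H i) x" .
          have "\<bar>moll n (b m) (H i) x - H i x\<bar> powr p \<le> (\<Sum>i<n. \<bar>moll n (b m) (H i) x - H i x\<bar> powr p)"
            by (rule member_le_sum[where f = "\<lambda>i. \<bar>moll n (b m) (H i) x - H i x\<bar> powr p"]) (use i in auto)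
          then have "\<bar>moll n (b m) (H i) x - H i x\<bar> powr p \<le> D m x"
            unfolding D_def using x by simp
          moreover have "ennreal (2 ^ m * D m x) \<le> S' x"
            unfolding S'_def using sum_le_suminf[of "\<lambda>m. ennreal (2 ^ m * D m x)" "{m}"] by simp
          then have "2 ^ m * D m x \<le> S x"
            unfolding S_def using elim(2) D0[of m x]
            by (metis enn2real_ennreal enn2real_mono infinity_ennreal_def less_top mult_nonneg_nonneg zero_le_numeral zero_le_power)
          then have "D m x \<le> (1/2) ^ m * S x" by (simp add: power_divide field_simps)
          ultimately show "\<bar>pd i (F m) x - h i x\<bar> powr p \<le> (1/2) ^ m * S x"
            unfolding pd hx by linarith
        qed
      qed
    qed
  qed
qed

subsection \<open>Calculus of weak derivatives\<close>

lemma le_one_plus_powr: "(p::real) \<ge> 1 \<Longrightarrow> 0 \<le> t \<Longrightarrow> t \<le> 1 + t powr p"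
proof (cases "t \<le> 1")
  case False
  assume "p \<ge> 1" "0 \<le> t"
  with False have "t powr 1 \<le> t powr p" by (intro powr_mono) auto
  with False show ?thesis by simp
qed (simp add: add_increasing2)

lemma set_measurable_mult:
  fixes f g :: "'a \<Rightarrow> real"
  assumes "set_borel_measurable M A f" "set_borel_measurable M A g"
  shows "set_borel_measurable M A (\<lambda>x. f x * g x)"
proof -
  have "(\<lambda>x. (ind A x *\<^sub>R f x) * (ind A x *\<^sub>R g x)) \<in> borel_measurable M"
    using assms unfolding set_borel_measurable_def by (intro borel_measurable_times)
  also have "(\<lambda>x. (ind A x *\<^sub>R f x) * (ind A x *\<^sub>R g x)) = (\<lambda>x. ind A x *\<^sub>R (f x * g x))"
    by (auto simp: fun_eq_iff indicator_def)
  finally show ?thesis unfolding set_borel_measurable_def .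
qed

lemma set_measurable_mono:
  fixes f :: "'a \<Rightarrow> real"
  assumes "set_borel_measurable M A f" "B \<subseteq> A" "B \<in> sets M"
  shows "set_borel_measurable M B f"
proof -
  have "(\<lambda>x. ind B x * (ind A x *\<^sub>R f x)) \<in> borel_measurable M"
    using assms unfolding set_borel_measurable_def by (intro borel_measurable_times) auto
  also have "(\<lambda>x. ind B x * (ind A x *\<^sub>R f x)) = (\<lambda>x. ind B x *\<^sub>R f x)"
    using assms(2) by (auto simp: fun_eq_iff indicator_def)
  finally show ?thesis unfolding set_borel_measurable_def .
qed

lemma set_measurable_continuous:
  assumes "openin (Rn n) U" "f \<in> C_continuous n U"
  shows "lmeas n U f"
  using continuous_map_borel[OF assms(1), of f] assms(2)
  unfolding C_continuous_def set_borel_measurable_def by (intro borel_leb) simp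

lemma set_integrable_bound_leb:
  fixes f g :: "'a \<Rightarrow> real"
  assumes g: "integrable M g" and f: "set_borel_measurable M A f"
    and le: "AE x\<in>A in M. \<bar>f x\<bar> \<le> g x"
  shows "set_integrable M A f"
  unfolding set_integrable_def
proof (rule Bochner_Integration.integrable_bound[OF g])
  show "(\<lambda>x. ind A x *\<^sub>R f x) \<in> borel_measurable M" using f unfolding set_borel_measurable_def .
  show "AE x in M. norm (ind A x *\<^sub>R f x) \<le> norm (g x)"
    using le by eventually_elim (auto simp: indicator_def)
qed

lemma Lp_loc_integrable_abs:
  assumes "f \<in> Lp_loc n U p" "compact_in n K" "K \<subseteq> U"
  shows "integrable (leb n) (\<lambda>x. ind K x * \<bar>f x\<bar> powr p)"
  using assms unfolding Lp_loc_def set_integrable_def by simp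

lemma compact_indicator_integrable:
  "compact_in n K \<Longrightarrow> integrable (leb n) (ind K :: _ \<Rightarrow> real)"
  using emeasure_compact_finite[of n K] compactin_sets[of n K]
  by (subst integrable_completion) (auto intro!: integrable_real_indicator)

lemma Lp_loc_mono:
  assumes p: "p \<ge> 1" and f: "f \<in> Lp_loc n U p"
  shows "f \<in> Lp_loc n U 1"
proof -
  have m: "lmeas n U f" using f by (simp add: Lp_loc_def)
  have "set_integrable (leb n) K (\<lambda>x. \<bar>f x\<bar> powr 1)" if K: "compact_in n K" "K \<subseteq> U" for K
  proof (rule set_integrable_bound_leb)
    show "integrable (leb n) (\<lambda>x. ind K x + ind K x * \<bar>f x\<bar> powr p)"
      by (intro Bochner_Integration.integrable_add compact_indicator_integrable K Lp_loc_integrable_abs[OF f])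
    have "lmeas n K f"
      by (rule set_measurable_mono[OF m K(2) compactin_sets_leb[OF K(1)]])
    then have "(\<lambda>x. \<bar>ind K x *\<^sub>R f x\<bar>) \<in> borel_measurable (leb n)"
      unfolding set_borel_measurable_def by (rule borel_measurable_abs)
    then show "lmeas n K (\<lambda>x. \<bar>f x\<bar> powr 1)"
      unfolding set_borel_measurable_def by (simp add: abs_mult)
    show "AE x\<in>K in leb n. \<bar>\<bar>f x\<bar> powr 1\<bar> \<le> ind K x + ind K x * \<bar>f x\<bar> powr p"
      using le_one_plus_powr[OF p] by (intro AE_I2) simp
  qed
  with m show ?thesis by (simp add: Lp_loc_def)
qed

lemma Lp_loc_integrable_mult:
  assumes h: "h \<in> Lp_loc n U 1" and g: "lmeas n U g"
    and K: "compact_in n K" "K \<subseteq> U" and z: "\<And>x. x \<in> U \<Longrightarrow> x \<notin> K \<Longrightarrow> g x = 0"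
    and C: "\<And>x. x \<in> K \<Longrightarrow> \<bar>g x\<bar> \<le> C"
  shows "set_integrable (leb n) U (\<lambda>x. h x * g x)"
proof (rule set_integrable_bound_leb)
  show "integrable (leb n) (\<lambda>x. C * (ind K x * \<bar>h x\<bar> powr 1))"
    by (intro integrable_mult_right Lp_loc_integrable_abs[OF h K])
  show "lmeas n U (\<lambda>x. h x * g x)"
    using h g by (intro set_measurable_mult) (simp add: Lp_loc_def)
  have "\<bar>h x * g x\<bar> \<le> C * (ind K x * \<bar>h x\<bar> powr 1)" if "x \<in> U" for x
  proof (cases "x \<in> K")
    case True
    then show ?thesis using mult_right_mono[OF C[OF True], of "\<bar>h x\<bar>"] by (simp add: abs_mult mult.commute)
  qed (use z that in simp)
  then show "AE x\<in>U in leb n. \<bar>h x * g x\<bar> \<le> C * (ind K x * \<bar>h x\<bar> powr 1)" by simp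
qed

lemma continuous_bounded_on_compact:
  assumes f: "cont_on n U f"
    and K: "compact_in n K" "K \<subseteq> U"
  obtains C where "C > 0" "\<forall>x\<in>K. \<bar>f x\<bar> \<le> C"
proof -
  have "compactin euclideanreal (f ` K)"
    by (rule image_compactin[OF _ f]) (use K in \<open>simp add: compactin_subtopology\<close>)
  then have "bounded (f ` K)" by (simp add: compact_imp_bounded)
  then obtain C where C: "\<forall>x\<in>K. \<bar>f x\<bar> \<le> C" unfolding bounded_iff by auto
  then show thesis by (intro that[of "max 1 C"]) (auto simp: le_max_iff_disj)
qed

lemma positive_lower_bound_on_compact:
  assumes f: "cont_on n U f"
    and K: "compact_in n K" "K \<subseteq> U" and pos: "\<And>x. x \<in> K \<Longrightarrow> 0 < f x"
  obtains c where "c > 0" "\<forall>x\<in>K. c \<le> f x"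
proof (cases "K = {}")
  case False
  have "compactin euclideanreal (f ` K)"
    by (rule image_compactin[OF _ f]) (use K in \<open>simp add: compactin_subtopology\<close>)
  then have "compact (f ` K)" by simp
  then obtain m where "m \<in> f ` K" "\<forall>t\<in>f ` K. m \<le> t"
    using compact_attains_inf[of "f ` K"] False by auto
  then show thesis using pos by (intro that[of m]) auto
qed (use that[of 1] in auto)

lemma continuous_map_sub: "cont n f \<Longrightarrow> cont_on n U f"
  by (rule continuous_map_from_subtopology)

lemma Cc_smoothE:
  assumes "\<phi> \<in> Cc_smooth n U"
  obtains K where "compact_in n K" "K \<subseteq> U" "\<forall>x\<in>pts n. x \<notin> K \<longrightarrow> \<phi> x = 0"
    "\<forall>i<n. \<forall>x\<in>pts n. x \<notin> K \<longrightarrow> pd i \<phi> x = 0"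
    "\<forall>i<n. line_deriv n i \<phi> (pd i \<phi>)"
proof -
  obtain K where K: "compact_in n K" "K \<subseteq> U" "\<forall>x\<in>pts n - K. \<phi> x = 0"
    using assms by (auto simp: Cc_smooth_def)
  have l: "line_deriv n i \<phi> (pd i \<phi>)" if "i < n" for i
  proof -
    have "Ck n 1 \<phi>" using assms unfolding Cc_smooth_def by blast
    then show ?thesis by (rule Ck_line_deriv[OF _ that])
  qed
  have "pd i \<phi> x = 0" if "i < n" "x \<in> pts n" "x \<notin> K" for i x
    by (rule line_deriv_support[OF l[OF that(1)] that(1) K(1) _ that(2,3)]) (use K(3) in auto)
  then show thesis using K l by (intro that[of K]) auto
qed

lemma Cc_smooth_integrable_mult:
  assumes h: "h \<in> Lp_loc n U 1" and U: "openin (Rn n) U" and \<phi>: "\<phi> \<in> Cc_smooth n U"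
  shows "set_integrable (leb n) U (\<lambda>x. h x * \<phi> x)"
    "i < n \<Longrightarrow> set_integrable (leb n) U (\<lambda>x. h x * pd i \<phi> x)"
proof -
  obtain K where K: "compact_in n K" "K \<subseteq> U" "\<forall>x\<in>pts n. x \<notin> K \<longrightarrow> \<phi> x = 0"
    "\<forall>i<n. \<forall>x\<in>pts n. x \<notin> K \<longrightarrow> pd i \<phi> x = 0"
    "\<forall>i<n. line_deriv n i \<phi> (pd i \<phi>)" using Cc_smoothE[OF \<phi>] by blast
  have Up: "U \<subseteq> pts n" using openin_subset[OF U] by simp
  have *: "set_integrable (leb n) U (\<lambda>x. h x * g x)"
    if g: "cont n g" and z: "\<forall>x\<in>pts n. x \<notin> K \<longrightarrow> g x = 0" for g
  proof -
    obtain C where C: "\<forall>x\<in>K. \<bar>g x\<bar> \<le> C"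
      using continuous_bounded_on_compact[OF continuous_map_sub[OF g] K(1,2)] by blast
    show ?thesis
    proof (rule Lp_loc_integrable_mult[OF h _ K(1,2)])
      show "lmeas n U g"
        using continuous_map_sub[OF g] by (intro set_measurable_continuous[OF U]) (simp add: C_continuous_def)
    qed (use z Up C in auto)
  qed
  have "cont n \<phi>" using \<phi> unfolding Cc_smooth_def by (auto dest: spec[of _ 0])
  then show "set_integrable (leb n) U (\<lambda>x. h x * \<phi> x)" using K(3) by (intro *) auto
  show "i < n \<Longrightarrow> set_integrable (leb n) U (\<lambda>x. h x * pd i \<phi> x)"
    using K(4,5) by (intro *) (auto simp: line_deriv_def)
qed

lemma Lp_loc_add_cmult:
  assumes "h \<in> Lp_loc n U 1" "h' \<in> Lp_loc n U 1"
  shows "(\<lambda>x. h x + c * h' x) \<in> Lp_loc n U 1"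
proof -
  have m: "lmeas n U (\<lambda>x. h x + c * h' x)"
  proof -
    have "(\<lambda>x. ind U x *\<^sub>R h x) \<in> borel_measurable (leb n)" "(\<lambda>x. ind U x *\<^sub>R h' x) \<in> borel_measurable (leb n)"
      using assms by (auto simp: Lp_loc_def set_borel_measurable_def)
    then have "(\<lambda>x. ind U x *\<^sub>R h x + c * (ind U x *\<^sub>R h' x)) \<in> borel_measurable (leb n)"
      by (intro borel_measurable_add borel_measurable_times borel_measurable_const)
    then show ?thesis unfolding set_borel_measurable_def by (simp add: distrib_left mult.left_commute)
  qed
  have "set_integrable (leb n) K (\<lambda>x. \<bar>h x + c * h' x\<bar> powr 1)" if K: "compact_in n K" "K \<subseteq> U" for K
  proof (rule set_integrable_bound_leb)
    show "integrable (leb n) (\<lambda>x. ind K x * \<bar>h x\<bar> powr 1 + \<bar>c\<bar> * (ind K x * \<bar>h' x\<bar> powr 1))"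
      by (intro Bochner_Integration.integrable_add integrable_mult_right
          Lp_loc_integrable_abs[OF assms(1) K] Lp_loc_integrable_abs[OF assms(2) K])
    have "lmeas n K (\<lambda>x. h x + c * h' x)"
      by (rule set_measurable_mono[OF m K(2) compactin_sets_leb[OF K(1)]])
    then have "(\<lambda>x. \<bar>ind K x *\<^sub>R (h x + c * h' x)\<bar>) \<in> borel_measurable (leb n)"
      unfolding set_borel_measurable_def by (rule borel_measurable_abs)
    then show "lmeas n K (\<lambda>x. \<bar>h x + c * h' x\<bar> powr 1)"
      unfolding set_borel_measurable_def by (simp add: abs_mult)
    have "\<bar>h x + c * h' x\<bar> \<le> \<bar>h x\<bar> + \<bar>c\<bar> * \<bar>h' x\<bar>" for x
      using abs_triangle_ineq[of "h x" "c * h' x"] by (simp add: abs_mult)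
    then show "AE x\<in>K in leb n. \<bar>\<bar>h x + c * h' x\<bar> powr 1\<bar>
        \<le> ind K x * \<bar>h x\<bar> powr 1 + \<bar>c\<bar> * (ind K x * \<bar>h' x\<bar> powr 1)"
      by (intro AE_I2) simp
  qed
  with m show ?thesis by (simp add: Lp_loc_def)
qed

lemma weak_partial_unique:
  assumes n: "0 < n" and U: "openin (Rn n) U"
    and w: "weak_partial n U i f h" "weak_partial n U i f h'"
  shows "AE x\<in>U in leb n. h x = h' x"
proof -
  have L: "h \<in> Lp_loc n U 1" "h' \<in> Lp_loc n U 1" using w by (auto simp: weak_partial_def)
  have "AE x\<in>U in leb n. h x + (-1) * h' x = 0"
  proof (rule fundamental_lemma[OF n U Lp_loc_add_cmult[OF L]])
    fix \<phi> assume \<phi>: "\<phi> \<in> Cc_smooth n U"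
    have "(LINT x:U|leb n. h x * \<phi> x) = (LINT x:U|leb n. h' x * \<phi> x)"
      using w \<phi> unfolding weak_partial_def by fastforce
    moreover have "(LINT x:U|leb n. h x * \<phi> x - h' x * \<phi> x)
        = (LINT x:U|leb n. h x * \<phi> x) - (LINT x:U|leb n. h' x * \<phi> x)"
      by (intro set_integral_diff Cc_smooth_integrable_mult L U \<phi>)
    ultimately show "(LINT x:U|leb n. (h x + (-1) * h' x) * \<phi> x) = 0" by (simp add: left_diff_distrib)
  qed
  then show ?thesis by eventually_elim simp
qed

lemma set_measurable_AE:
  fixes f g :: "point \<Rightarrow> real"
  assumes "lmeas n U f" "AE x\<in>U in leb n. g x = f x"
  shows "lmeas n U g"
  unfolding set_borel_measurable_def
proof (rule leb_measurable_AE)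
  show "(\<lambda>x. ind U x *\<^sub>R f x) \<in> borel_measurable (leb n)" using assms by (simp add: set_borel_measurable_def)
  show "AE x in leb n. ind U x *\<^sub>R g x = ind U x *\<^sub>R f x"
    using assms(2) by eventually_elim (auto simp: indicator_def)
qed

lemma set_integral_cong_AE':
  fixes f g :: "point \<Rightarrow> real"
  assumes f: "lmeas n U f" and ae: "AE x\<in>U in leb n. g x = f x"
  shows "(LINT x:U|leb n. g x) = (LINT x:U|leb n. f x)"
    "set_integrable (leb n) U g \<longleftrightarrow> set_integrable (leb n) U f"
proof -
  have ae': "AE x in leb n. ind U x *\<^sub>R g x = ind U x *\<^sub>R f x"
    using ae by eventually_elim (auto simp: indicator_def)
  have m: "(\<lambda>x. ind U x *\<^sub>R f x) \<in> borel_measurable (leb n)"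
    "(\<lambda>x. ind U x *\<^sub>R g x) \<in> borel_measurable (leb n)"
    using f set_measurable_AE[OF f ae] by (auto simp: set_borel_measurable_def)
  show "(LINT x:U|leb n. g x) = (LINT x:U|leb n. f x)"
    unfolding set_lebesgue_integral_def by (intro integral_cong_AE m ae')
  show "set_integrable (leb n) U g \<longleftrightarrow> set_integrable (leb n) U f"
    unfolding set_integrable_def by (intro integrable_cong_AE m ae')
qed

lemma set_measurable_abs_powr:
  fixes f :: "'a \<Rightarrow> real"
  assumes "set_borel_measurable M A f"
  shows "set_borel_measurable M A (\<lambda>x. \<bar>f x\<bar> powr p)"
proof -
  have "(\<lambda>x. \<bar>ind A x *\<^sub>R f x\<bar> powr p) \<in> borel_measurable M"
    using assms unfolding set_borel_measurable_def by measurable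
  also have "(\<lambda>x. \<bar>ind A x *\<^sub>R f x\<bar> powr p) = (\<lambda>x. ind A x *\<^sub>R (\<bar>f x\<bar> powr p))"
    by (auto simp: fun_eq_iff indicator_def)
  finally show ?thesis unfolding set_borel_measurable_def .
qed

lemma Lp_cong_AE:
  assumes "f \<in> Lp n U p" "AE x\<in>U in leb n. g x = f x"
  shows "g \<in> Lp n U p"
proof -
  have m: "lmeas n U f" using assms by (simp add: Lp_def)
  have "AE x\<in>U in leb n. \<bar>g x\<bar> powr p = \<bar>f x\<bar> powr p" using assms(2) by eventually_elim auto
  from set_integral_cong_AE'(2)[OF set_measurable_abs_powr[OF m] this] show ?thesis
    using assms(1) set_measurable_AE[OF m assms(2)] by (simp add: Lp_def)
qed

lemma Lp_loc_cong_AE: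
  assumes "f \<in> Lp_loc n U p" "AE x\<in>U in leb n. g x = f x"
  shows "g \<in> Lp_loc n U p"
proof -
  have m: "lmeas n U f" using assms by (simp add: Lp_loc_def)
  have "set_integrable (leb n) K (\<lambda>x. \<bar>g x\<bar> powr p)" if K: "compact_in n K" "K \<subseteq> U" for K
  proof -
    have "AE x\<in>K in leb n. \<bar>g x\<bar> powr p = \<bar>f x\<bar> powr p"
      using assms(2) by eventually_elim (use K(2) in auto)
    from set_integral_cong_AE'(2)[OF set_measurable_abs_powr[OF
          set_measurable_mono[OF m K(2) compactin_sets_leb[OF K(1)]]] this]
    show ?thesis using assms(1) K by (simp add: Lp_loc_def)
  qed
  then show ?thesis using set_measurable_AE[OF m assms(2)] by (simp add: Lp_loc_def)
qed

lemma Lp_imp_Lp_loc: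
  assumes "f \<in> Lp n U p" shows "f \<in> Lp_loc n U p"
  using assms unfolding Lp_def Lp_loc_def
  by (auto intro: set_integrable_subset compactin_sets_leb)

lemma wgrad_W1p_loc:
  assumes n: "0 < n" and U: "openin (Rn n) U" and f: "f \<in> W1p_loc n U p" and i: "i < n"
  shows "weak_partial n U i f (wgrad n U f i)" "wgrad n U f i \<in> Lp_loc n U p"
proof -
  obtain h where h: "h \<in> Lp_loc n U p" "weak_partial n U i f h" using f i by (auto simp: W1p_loc_def)
  show w: "weak_partial n U i f (wgrad n U f i)" unfolding wgrad_def by (rule someI[of _ h]) (rule h(2))
  show "wgrad n U f i \<in> Lp_loc n U p"
    by (rule Lp_loc_cong_AE[OF h(1) weak_partial_unique[OF n U w h(2)]])
qed

lemma wgrad_W1p: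
  assumes n: "0 < n" and U: "openin (Rn n) U" and f: "f \<in> W1p n U p" and i: "i < n"
  shows "weak_partial n U i f (wgrad n U f i)" "wgrad n U f i \<in> Lp n U p"
proof -
  obtain h where h: "h \<in> Lp n U p" "weak_partial n U i f h" using f i by (auto simp: W1p_def)
  show w: "weak_partial n U i f (wgrad n U f i)" unfolding wgrad_def by (rule someI[of _ h]) (rule h(2))
  show "wgrad n U f i \<in> Lp n U p"
    by (rule Lp_cong_AE[OF h(1) weak_partial_unique[OF n U w h(2)]])
qed

lemma wgrad_AE:
  assumes n: "0 < n" and U: "openin (Rn n) U" and w: "weak_partial n U i f h"
  shows "AE x\<in>U in leb n. wgrad n U f i x = h x"
  by (rule weak_partial_unique[OF n U _ w]) (simp add: wgrad_def, rule someI[of _ h], rule w)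

lemma leb_integral_continuous:
  assumes "cont n g" "openin (Rn n) U"
    and z: "\<And>x. x \<in> pts n \<Longrightarrow> x \<notin> U \<Longrightarrow> g x = 0"
  shows "(LINT x:U|leb n. g x) = (LINT x|lbP n. g x)"
proof -
  have "AE x in leb n. x \<in> pts n" using AE_space[of "leb n"] by (simp add: space_PiM)
  then have "AE x in leb n. ind U x *\<^sub>R g x = g x"
    by eventually_elim (use z in \<open>auto simp: indicator_def\<close>)
  then show ?thesis unfolding set_lebesgue_integral_def
    by (intro leb_integral_cong(2) continuous_map_borel' assms(1))
qed

lemma continuous_Lp_loc:
  assumes U: "openin (Rn n) U" and f: "f \<in> C_continuous n U" and p: "p \<ge> 0"
  shows "f \<in> Lp_loc n U p"
proof -
  have m: "lmeas n U f" by (rule set_measurable_continuous[OF U f])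
  have "set_integrable (leb n) K (\<lambda>x. \<bar>f x\<bar> powr p)" if K: "compact_in n K" "K \<subseteq> U" for K
  proof -
    obtain C where C: "C > 0" "\<forall>x\<in>K. \<bar>f x\<bar> \<le> C"
      using continuous_bounded_on_compact[of n U f K] f K unfolding C_continuous_def by blast
    show ?thesis
    proof (rule set_integrable_bound_leb)
      show "integrable (leb n) (\<lambda>x. C powr p * ind K x)"
        by (intro integrable_mult_right compact_indicator_integrable K)
      show "lmeas n K (\<lambda>x. \<bar>f x\<bar> powr p)"
        by (intro set_measurable_abs_powr set_measurable_mono[OF m K(2) compactin_sets_leb[OF K(1)]])
      show "AE x\<in>K in leb n. \<bar>\<bar>f x\<bar> powr p\<bar> \<le> C powr p * ind K x"
        using C p by (intro AE_I2) (auto intro: powr_mono2)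
    qed
  qed
  with m show ?thesis by (simp add: Lp_loc_def)
qed

lemma Cc_smooth_imp:
  assumes U: "openin (Rn n) U" and \<phi>: "\<phi> \<in> Cc_smooth n U" and p: "p \<ge> 1"
  shows "i < n \<Longrightarrow> weak_partial n U i \<phi> (pd i \<phi>)" "\<phi> \<in> W1p n U p" "\<phi> \<in> Cc n U"
proof -
  obtain K where K: "compact_in n K" "K \<subseteq> U" "\<forall>x\<in>pts n. x \<notin> K \<longrightarrow> \<phi> x = 0"
    "\<forall>i<n. \<forall>x\<in>pts n. x \<notin> K \<longrightarrow> pd i \<phi> x = 0"
    "\<forall>i<n. line_deriv n i \<phi> (pd i \<phi>)" using Cc_smoothE[OF \<phi>] by blast
  have Up: "U \<subseteq> pts n" using openin_subset[OF U] by simp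
  have c0: "cont n \<phi>" using \<phi> unfolding Cc_smooth_def by (auto dest: spec[of _ 0])
  have c1: "cont n (pd i \<phi>)" if "i < n" for i
    using K(5) that by (auto simp: line_deriv_def)
  have C: "\<phi> \<in> C_continuous n U" "\<And>i. i < n \<Longrightarrow> pd i \<phi> \<in> C_continuous n U"
    using c0 c1 continuous_map_sub by (auto simp: C_continuous_def)
  show "\<phi> \<in> Cc n U" using C K(1-3) Up unfolding Cc_def by blast
  have L: "g \<in> Lp n U p" if g: "g \<in> C_continuous n U" and z: "\<forall>x\<in>pts n. x \<notin> K \<longrightarrow> g x = 0" for g
  proof -
    have m: "lmeas n U g" by (rule set_measurable_continuous[OF U g])
    have i: "integrable (leb n) (\<lambda>x. ind K x * \<bar>g x\<bar> powr p)"
      using p by (intro Lp_loc_integrable_abs[OF continuous_Lp_loc[OF U g] K(1,2)]) simp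
    have "set_integrable (leb n) U (\<lambda>x. \<bar>g x\<bar> powr p)"
    proof (rule set_integrable_bound_leb[OF i set_measurable_abs_powr[OF m]])
      show "AE x\<in>U in leb n. \<bar>\<bar>g x\<bar> powr p\<bar> \<le> ind K x * \<bar>g x\<bar> powr p"
        using z Up by (intro AE_I2) (auto simp: indicator_def)
    qed
    with m show ?thesis by (simp add: Lp_def)
  qed
  have w: "weak_partial n U i \<phi> (pd i \<phi>)" if i: "i < n" for i
    unfolding weak_partial_def
  proof (intro conjI ballI)
    show "\<phi> \<in> Lp_loc n U 1" "pd i \<phi> \<in> Lp_loc n U 1"
      using C i by (auto intro!: continuous_Lp_loc[OF U])
    fix \<eta> assume \<eta>: "\<eta> \<in> Cc_smooth n U"
    obtain K' where K': "compact_in n K'" "K' \<subseteq> U" "\<forall>x\<in>pts n. x \<notin> K' \<longrightarrow> \<eta> x = 0"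
      "\<forall>i<n. \<forall>x\<in>pts n. x \<notin> K' \<longrightarrow> pd i \<eta> x = 0"
      "\<forall>i<n. line_deriv n i \<eta> (pd i \<eta>)" using Cc_smoothE[OF \<eta>] by blast
    have lf: "line_deriv n i \<phi> (pd i \<phi>)" and lg: "line_deriv n i \<eta> (pd i \<eta>)"
      using K(5) K'(5) i by auto
    have "(LINT x|lbP n. \<phi> x * pd i \<eta> x) = - (LINT x|lbP n. pd i \<phi> x * \<eta> x)"
      by (rule integration_by_parts[OF lf lg i K'(1)]) (use K'(3) in auto)
    moreover have "(LINT x:U|leb n. \<phi> x * pd i \<eta> x) = (LINT x|lbP n. \<phi> x * pd i \<eta> x)"
      using lf lg K'(2,4) i by (intro leb_integral_continuous[OF _ U] continuous_map_real_mult) (auto simp: line_deriv_def)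
    moreover have "(LINT x:U|leb n. pd i \<phi> x * \<eta> x) = (LINT x|lbP n. pd i \<phi> x * \<eta> x)"
      using lf lg K'(2,3) by (intro leb_integral_continuous[OF _ U] continuous_map_real_mult) (auto simp: line_deriv_def)
    ultimately show "(LINT x:U|leb n. \<phi> x * pd i \<eta> x) = - (LINT x:U|leb n. pd i \<phi> x * \<eta> x)"
      by simp
  qed
  then show "i < n \<Longrightarrow> weak_partial n U i \<phi> (pd i \<phi>)" .
  show "\<phi> \<in> W1p n U p"
    unfolding W1p_def using L[OF C(1) K(3)] L[OF C(2)] K(4) w by blast
qed

text \<open>Turns the pointwise rate of \<open>sobolev_approx\<close> into convergence of the
  derivatives.\<close>

lemma powr_geometric_tendsto_0:
  fixes t :: "nat \<Rightarrow> real"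
  assumes p: "p \<ge> 1" and S: "0 \<le> S" and le: "\<And>m. \<bar>t m\<bar> powr p \<le> (1/2) ^ m * S"
  shows "t \<longlonglongrightarrow> 0"
proof -
  have "(\<lambda>m. (1/2) ^ m * S) \<longlonglongrightarrow> 0 * S"
    by (intro tendsto_intros LIMSEQ_realpow_zero) auto
  then have "(\<lambda>m. ((1/2) ^ m * S) powr (1 / p)) \<longlonglongrightarrow> 0"
    using p S by (intro tendsto_zero_powrI[where b = "1 / p"]) auto
  then show ?thesis
  proof (rule Lim_null_comparison[rotated])
    have "norm (t m) \<le> ((1/2) ^ m * S) powr (1 / p)" for m
    proof -
      have "\<bar>t m\<bar> = (\<bar>t m\<bar> powr p) powr (1 / p)" using p by (simp add: powr_powr)
      also have "\<dots> \<le> ((1/2) ^ m * S) powr (1 / p)" using le p by (intro powr_mono2) auto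
      finally show ?thesis by simp
    qed
    then show "\<forall>\<^sub>F m in sequentially. norm (t m) \<le> ((1/2) ^ m * S) powr (1 / p)" by simp
  qed
qed

text \<open>Turns the same rate into a bound independent of \<open>m\<close>, which serves as a
  majorant.\<close>

lemma powr_geometric_bound:
  assumes p: "(p::real) \<ge> 1" and S: "0 \<le> S" and le: "\<bar>t - h\<bar> powr p \<le> (1/2) ^ m * S"
  shows "\<bar>t\<bar> \<le> \<bar>h\<bar> + 1 + S"
proof -
  have "(1/2::real) ^ m * S \<le> 1 * S" using S by (intro mult_right_mono power_le_one) auto
  then have "\<bar>t - h\<bar> \<le> 1 + S" using le_one_plus_powr[OF p, of "\<bar>t - h\<bar>"] le by simp
  then show ?thesis by linarith
qed

lemma half_power_tendsto:
  fixes f :: "nat \<Rightarrow> real"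
  assumes "\<And>m. \<bar>f m - l\<bar> \<le> (1/2) ^ m"
  shows "f \<longlonglongrightarrow> l"
proof (rule LIM_zero_cancel, rule Lim_null_comparison)
  show "(\<lambda>m. (1/2::real) ^ m) \<longlonglongrightarrow> 0" by (rule LIMSEQ_realpow_zero) auto
  show "\<forall>\<^sub>F m in sequentially. norm (f m - l) \<le> (1/2) ^ m" using assms by simp
qed

text \<open>The constant contributes nothing, because the integral of a partial derivative of a test
  function vanishes.\<close>

lemma weak_partial_diff_const:
  assumes U: "openin (Rn n) U" and u: "u \<in> C_continuous n U" and w: "weak_partial n U i u h" and i: "i < n"
  shows "weak_partial n U i (\<lambda>x. u x - c) h"
  unfolding weak_partial_def
proof (intro conjI ballI)
  have "(\<lambda>x. u x - c) \<in> C_continuous n U"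
    using u by (auto simp: C_continuous_def intro!: continuous_map_diff)
  then show "(\<lambda>x. u x - c) \<in> Lp_loc n U 1" by (intro continuous_Lp_loc[OF U]) auto
  show "h \<in> Lp_loc n U 1" using w by (simp add: weak_partial_def)
  fix \<phi> assume \<phi>: "\<phi> \<in> Cc_smooth n U"
  obtain K where K: "compact_in n K" "K \<subseteq> U" "\<forall>x\<in>pts n. x \<notin> K \<longrightarrow> \<phi> x = 0"
    "\<forall>i<n. \<forall>x\<in>pts n. x \<notin> K \<longrightarrow> pd i \<phi> x = 0"
    "\<forall>i<n. line_deriv n i \<phi> (pd i \<phi>)" using Cc_smoothE[OF \<phi>] by blast
  have l: "line_deriv n i \<phi> (pd i \<phi>)" using K(5) i by blast
  have "(LINT x:U|leb n. pd i \<phi> x) = (LINT x|lbP n. pd i \<phi> x)"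
    using l K(2,4) i by (intro leb_integral_continuous[OF _ U]) (auto simp: line_deriv_def)
  also have "\<dots> = 0" by (rule integral_line_deriv_0[OF l i K(1)]) (use K(3) in auto)
  finally have z: "(LINT x:U|leb n. pd i \<phi> x) = 0" .
  have c1: "(\<lambda>x. 1 :: real) \<in> Lp_loc n U 1" by (intro continuous_Lp_loc[OF U]) (auto simp: C_continuous_def)
  have i1: "set_integrable (leb n) U (\<lambda>x. pd i \<phi> x)"
    using Cc_smooth_integrable_mult(2)[OF c1 U \<phi> i] by simp
  have i2: "set_integrable (leb n) U (\<lambda>x. u x * pd i \<phi> x)"
    by (rule Cc_smooth_integrable_mult(2)[OF continuous_Lp_loc[OF U u] U \<phi> i]) simp
  have "(LINT x:U|leb n. (u x - c) * pd i \<phi> x)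
      = (LINT x:U|leb n. u x * pd i \<phi> x - c * pd i \<phi> x)"
    by (simp add: left_diff_distrib)
  also have "\<dots> = (LINT x:U|leb n. u x * pd i \<phi> x) - (LINT x:U|leb n. c * pd i \<phi> x)"
    by (intro set_integral_diff i2 set_integrable_mult_right i1)
  also have "(LINT x:U|leb n. c * pd i \<phi> x) = 0" using z by simp
  finally show "(LINT x:U|leb n. (u x - c) * pd i \<phi> x) = - (LINT x:U|leb n. h x * \<phi> x)"
    using w \<phi> unfolding weak_partial_def by simp
qed

text \<open>One form for the two nonlinear expressions in \<open>f/u\<close> that occur:
  \<open>H = |.|^p\<close> gives \<open>|f|^p / u^(p-1)\<close>, and a cut-off function
  \<open>H\<close> gives the truncations.\<close>

definition quot_comp :: "(real \<Rightarrow> real) \<Rightarrow> ('a \<Rightarrow> real) \<Rightarrow> ('a \<Rightarrow> real) \<Rightarrow> 'a \<Rightarrow> real" where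
  "quot_comp H f u x = u x * H (f x / u x)"

text \<open>The chain rule for \<open>u * H(f/u)\<close>, sorted so that
  \<open>hf - (f/u) * hu\<close> appears: this is the difference of the two arguments of the
  divergence in the Picone identity.\<close>

definition quot_grad ::
  "(real \<Rightarrow> real) \<Rightarrow> (real \<Rightarrow> real) \<Rightarrow> ('a \<Rightarrow> real) \<Rightarrow> ('a \<Rightarrow> real) \<Rightarrow> ('a \<Rightarrow> real) \<Rightarrow> ('a \<Rightarrow> real) \<Rightarrow> 'a \<Rightarrow> real" where
  "quot_grad H H' f u hf hu x = H (f x / u x) * hu x + H' (f x / u x) * (hf x - (f x / u x) * hu x)"

lemma quot_comp_continuous:
  assumes f: "continuous_map X euclideanreal f" and u: "continuous_map X euclideanreal u"
    and pos: "\<And>x. x \<in> topspace X \<Longrightarrow> u x > 0" and H: "continuous_on UNIV H"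
  shows "continuous_map X euclideanreal (\<lambda>x. H (f x / u x))" "continuous_map X euclideanreal (quot_comp H f u)"
proof -
  have 1: "continuous_map X euclideanreal (\<lambda>x. f x / u x)"
    using pos by (intro continuous_map_real_divide f u) fastforce
  show 2: "continuous_map X euclideanreal (\<lambda>x. H (f x / u x))"
    using continuous_map_compose[OF 1, of euclideanreal H] H by (simp add: o_def)
  show "continuous_map X euclideanreal (quot_comp H f u)"
    unfolding quot_comp_def[abs_def] by (intro continuous_map_real_mult u 2)
qed

lemma line_deriv_quot_comp:
  assumes f: "line_deriv n i f f'" and u: "line_deriv n i u u'" and pos: "\<And>x. x \<in> pts n \<Longrightarrow> u x > 0"
    and H: "\<And>t. (H has_real_derivative H' t) (at t)" "continuous_on UNIV H'"
  shows "line_deriv n i (quot_comp H f u) (quot_grad H H' f u f' u')"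
  unfolding line_deriv_def
proof (intro conjI ballI)
  have Hc: "continuous_on UNIV H" using H(1) by (meson DERIV_continuous_on has_field_derivative_at_within)
  have c: "cont n f" "cont n u"
    "cont n f'" "cont n u'"
    using f u by (auto simp: line_deriv_def)
  have pos': "u x > 0" if "x \<in> topspace (Rn n)" for x using pos that by simp
  show "cont n (quot_comp H f u)"
    by (rule quot_comp_continuous(2)[OF c(1,2) pos' Hc])
  show "cont n (quot_grad H H' f u f' u')"
    unfolding quot_grad_def[abs_def]
    by (intro continuous_map_add continuous_map_real_mult continuous_map_diff c
        quot_comp_continuous(1)[OF c(1,2) pos' Hc] quot_comp_continuous(1)[OF c(1,2) pos' H(2)]
        quot_comp_continuous(1)[OF c(1,2) pos' continuous_on_id])
  fix x assume x: "x \<in> pts n"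
  let ?F = "\<lambda>t. f (x(i := t))" and ?U = "\<lambda>t. u (x(i := t))"
  have d: "(?F has_real_derivative f' x) (at (x i))" "(?U has_real_derivative u' x) (at (x i))"
    using f u x by (auto simp: line_deriv_def)
  have U: "?U (x i) = u x" "?F (x i) = f x" by simp_all
  have nz: "u x \<noteq> 0" using pos[OF x] by simp
  have q: "((\<lambda>t. ?F t / ?U t) has_real_derivative (f' x * u x - f x * u' x) / (u x * u x)) (at (x i))"
    using DERIV_divide[OF d] U nz by simp
  have "((\<lambda>t. H (?F t / ?U t)) has_real_derivative H' (f x / u x) * ((f' x * u x - f x * u' x) / (u x * u x))) (at (x i))"
    by (rule DERIV_chain2[OF _ q]) (use H(1)[of "f x / u x"] in simp)
  from DERIV_mult[OF d(2) this]
  have "((\<lambda>t. ?U t * H (?F t / ?U t)) has_real_derivative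
      u' x * H (f x / u x) + H' (f x / u x) * ((f' x * u x - f x * u' x) / (u x * u x)) * u x) (at (x i))"
    by simp
  moreover have "u' x * H (f x / u x) + H' (f x / u x) * ((f' x * u x - f x * u' x) / (u x * u x)) * u x
      = quot_grad H H' f u f' u' x"
    using nz by (simp add: quot_grad_def field_simps)
  ultimately show "((\<lambda>t. quot_comp H f u (x(i := t))) has_real_derivative quot_grad H H' f u f' u' x) (at (x i))"
    by (simp add: quot_comp_def)
qed

lemma continuous_bounded_interval:
  assumes "continuous_on UNIV (H :: real \<Rightarrow> real)" obtains C where "C \<ge> 0" "\<forall>t. \<bar>t\<bar> \<le> R \<longrightarrow> \<bar>H t\<bar> \<le> C"
proof -
  have "compact (H ` {-R..R})" by (intro compact_continuous_image continuous_on_subset[OF assms]) auto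
  then have "bounded (H ` {-R..R})" by (rule compact_imp_bounded)
  then obtain C where C: "\<forall>t\<in>{-R..R}. \<bar>H t\<bar> \<le> C" unfolding bounded_iff by auto
  have "\<bar>H t\<bar> \<le> max 0 C" if "\<bar>t\<bar> \<le> R" for t
    using C that by (simp add: abs_le_iff le_max_iff_disj)
  then show thesis by (intro that[of "max 0 C"]) auto
qed

lemma quot_grad_bound:
  assumes "\<bar>f x / u x\<bar> \<le> R" "\<bar>H (f x / u x)\<bar> \<le> C" "\<bar>H' (f x / u x)\<bar> \<le> C'" "0 \<le> C'" "0 \<le> R" "0 \<le> C"
  shows "\<bar>quot_grad H H' f u hf hu x\<bar> \<le> (C + C' + C' * R) * (\<bar>hf x\<bar> + \<bar>hu x\<bar>)"
proof -
  have "\<bar>quot_grad H H' f u hf hu x\<bar>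
      \<le> \<bar>H (f x / u x)\<bar> * \<bar>hu x\<bar> + \<bar>H' (f x / u x)\<bar> * (\<bar>hf x\<bar> + \<bar>f x / u x\<bar> * \<bar>hu x\<bar>)"
  proof -
    have "\<bar>hf x - f x / u x * hu x\<bar> \<le> \<bar>hf x\<bar> + \<bar>f x / u x\<bar> * \<bar>hu x\<bar>"
      using abs_triangle_ineq4[of "hf x" "f x / u x * hu x"] by (simp only: abs_mult)
    then have "\<bar>H' (f x / u x)\<bar> * \<bar>hf x - f x / u x * hu x\<bar> \<le> \<bar>H' (f x / u x)\<bar> * (\<bar>hf x\<bar> + \<bar>f x / u x\<bar> * \<bar>hu x\<bar>)"
      by (intro mult_left_mono) auto
    then show ?thesis unfolding quot_grad_def
      using abs_triangle_ineq[of "H (f x / u x) * hu x" "H' (f x / u x) * (hf x - f x / u x * hu x)"]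
      by (simp only: abs_mult)
  qed
  also have "\<dots> \<le> C * \<bar>hu x\<bar> + C' * (\<bar>hf x\<bar> + R * \<bar>hu x\<bar>)"
    using assms by (intro add_mono mult_mono) auto
  also have "\<dots> \<le> (C + C' + C' * R) * (\<bar>hf x\<bar> + \<bar>hu x\<bar>)"
  proof -
    have "(C + C' + C' * R) * (\<bar>hf x\<bar> + \<bar>hu x\<bar>) - (C * \<bar>hu x\<bar> + C' * (\<bar>hf x\<bar> + R * \<bar>hu x\<bar>))
        = C * \<bar>hf x\<bar> + C' * \<bar>hu x\<bar> + C' * R * \<bar>hf x\<bar>" by (simp add: algebra_simps)
    moreover have "0 \<le> C * \<bar>hf x\<bar> + C' * \<bar>hu x\<bar> + C' * R * \<bar>hf x\<bar>" using assms by simp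
    ultimately show ?thesis by linarith
  qed
  finally show ?thesis .
qed

lemma set_measurable_quot_grad:
  assumes U: "openin (Rn n) U" and f: "f \<in> C_continuous n U" and u: "u \<in> C_continuous n U"
    and pos: "\<And>x. x \<in> U \<Longrightarrow> u x > 0" and H: "continuous_on UNIV H" "continuous_on UNIV H'"
    and h: "lmeas n U hf" "lmeas n U hu"
  shows "lmeas n U (quot_grad H H' f u hf hu)"
proof -
  have pos': "u x > 0" if "x \<in> topspace (subtopology (Rn n) U)" for x using pos that by simp
  have c: "cont_on n U f" "cont_on n U u"
    using f u by (auto simp: C_continuous_def)
  have m: "lmeas n U (\<lambda>x. G (f x / u x))" if "continuous_on UNIV G" for G :: "real \<Rightarrow> real"
    using quot_comp_continuous(1)[OF c pos' that]
    by (intro set_measurable_continuous[OF U]) (auto simp: C_continuous_def)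
  have a: "lmeas n U (\<lambda>x. g x + g' x)" "lmeas n U (\<lambda>x. g x - g' x)"
    if "lmeas n U g" "lmeas n U g'" for g g' :: "point \<Rightarrow> real"
    using that unfolding set_borel_measurable_def by (simp_all add: distrib_left right_diff_distrib)
  show ?thesis unfolding quot_grad_def[abs_def]
    by (intro a set_measurable_mult m H h continuous_on_id)
qed

lemma quot_grad_Lp_loc:
  assumes p: "p \<ge> 1" and U: "openin (Rn n) U" and f: "f \<in> C_continuous n U" and u: "u \<in> C_continuous n U"
    and pos: "\<And>x. x \<in> U \<Longrightarrow> u x > 0" and H: "continuous_on UNIV H" "continuous_on UNIV H'"
    and h: "hf \<in> Lp_loc n U p" "hu \<in> Lp_loc n U p"
  shows "quot_grad H H' f u hf hu \<in> Lp_loc n U p"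
proof -
  have m: "lmeas n U (quot_grad H H' f u hf hu)"
    using h by (intro set_measurable_quot_grad[OF U f u pos H]) (auto simp: Lp_loc_def)
  have "set_integrable (leb n) K (\<lambda>x. \<bar>quot_grad H H' f u hf hu x\<bar> powr p)"
    if K: "compact_in n K" "K \<subseteq> U" for K
  proof -
    have c: "cont_on n U f" "cont_on n U u"
      using f u by (auto simp: C_continuous_def)
    have pos': "u x > 0" if "x \<in> topspace (subtopology (Rn n) U)" for x using pos that by simp
    obtain R where R: "R > 0" "\<forall>x\<in>K. \<bar>f x / u x\<bar> \<le> R"
      using continuous_bounded_on_compact[OF quot_comp_continuous(1)[OF c pos' continuous_on_id] K] by blast
    obtain C where C: "C \<ge> 0" "\<forall>t. \<bar>t\<bar> \<le> R \<longrightarrow> \<bar>H t\<bar> \<le> C" using continuous_bounded_interval[OF H(1)] by blast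
    obtain C' where C': "C' \<ge> 0" "\<forall>t. \<bar>t\<bar> \<le> R \<longrightarrow> \<bar>H' t\<bar> \<le> C'" using continuous_bounded_interval[OF H(2)] by blast
    define M where "M = C + C' + C' * R"
    have M: "M \<ge> 0" using C C' R by (simp add: M_def)
    show ?thesis
    proof (rule set_integrable_bound_leb)
      show "integrable (leb n) (\<lambda>x. (M powr p * 2 powr p) * (ind K x * \<bar>hf x\<bar> powr p + ind K x * \<bar>hu x\<bar> powr p))"
        by (intro integrable_mult_right Bochner_Integration.integrable_add
            Lp_loc_integrable_abs[OF h(1) K] Lp_loc_integrable_abs[OF h(2) K])
      show "lmeas n K (\<lambda>x. \<bar>quot_grad H H' f u hf hu x\<bar> powr p)"
        by (intro set_measurable_abs_powr set_measurable_mono[OF m K(2) compactin_sets_leb[OF K(1)]])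
      have "\<bar>quot_grad H H' f u hf hu x\<bar> powr p
          \<le> (M powr p * 2 powr p) * (\<bar>hf x\<bar> powr p + \<bar>hu x\<bar> powr p)" if x: "x \<in> K" for x
      proof -
        have "\<bar>quot_grad H H' f u hf hu x\<bar> \<le> M * (\<bar>hf x\<bar> + \<bar>hu x\<bar>)"
          unfolding M_def using R C C' x by (intro quot_grad_bound) auto
        then have "\<bar>quot_grad H H' f u hf hu x\<bar> powr p \<le> (M * (\<bar>hf x\<bar> + \<bar>hu x\<bar>)) powr p"
          using p by (intro powr_mono2) auto
        also have "\<dots> = M powr p * (\<bar>hf x\<bar> + \<bar>hu x\<bar>) powr p" using M by (simp add: powr_mult)
        also have "\<dots> \<le> M powr p * (2 powr p * (\<bar>hf x\<bar> powr p + \<bar>hu x\<bar> powr p))"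
          using powr_sum2_le[of p "\<bar>hf x\<bar>" "\<bar>hu x\<bar>"] p by (intro mult_left_mono) auto
        finally show ?thesis by (simp add: mult.assoc)
      qed
      then show "AE x\<in>K in leb n. \<bar>\<bar>quot_grad H H' f u hf hu x\<bar> powr p\<bar>
          \<le> (M powr p * 2 powr p) * (ind K x * \<bar>hf x\<bar> powr p + ind K x * \<bar>hu x\<bar> powr p)"
        by (intro AE_I2) simp
    qed
  qed
  with m show ?thesis by (simp add: Lp_loc_def)
qed

text \<open>The approximants of \<open>u\<close> have to stay away from 0: mollify \<open>u - c\<close>, which is nonnegative
  on the relevant compact set, and add \<open>c\<close> again.\<close>

lemma weak_partial_quot_comp:
  assumes n: "0 < n" and p: "p \<ge> 1" and U: "openin (Rn n) U"
    and f: "f \<in> C_continuous n U" and u: "u \<in> C_continuous n U" and pos: "\<And>x. x \<in> U \<Longrightarrow> u x > 0"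
    and hf: "\<And>i. i < n \<Longrightarrow> hf i \<in> Lp_loc n U p" "\<And>i. i < n \<Longrightarrow> weak_partial n U i f (hf i)"
    and hu: "\<And>i. i < n \<Longrightarrow> hu i \<in> Lp_loc n U p" "\<And>i. i < n \<Longrightarrow> weak_partial n U i u (hu i)"
    and H: "\<And>t. (H has_real_derivative H' t) (at t)" "continuous_on UNIV H'" and i: "i < n"
  shows "weak_partial n U i (quot_comp H f u) (quot_grad H H' f u (hf i) (hu i))"
  unfolding weak_partial_def
proof (intro conjI ballI)
  have Hc: "continuous_on UNIV H" using H(1) by (meson DERIV_continuous_on has_field_derivative_at_within)
  have fc: "cont_on n U f" and uc: "cont_on n U u"
    using f u by (auto simp: C_continuous_def)
  have pos': "u x > 0" if "x \<in> topspace (subtopology (Rn n) U)" for x using pos that by simp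
  have Gc: "quot_comp H f u \<in> C_continuous n U"
    using quot_comp_continuous(2)[OF fc uc pos' Hc] by (simp add: C_continuous_def)
  show "quot_comp H f u \<in> Lp_loc n U 1" by (rule continuous_Lp_loc[OF U Gc]) simp
  show gL: "quot_grad H H' f u (hf i) (hu i) \<in> Lp_loc n U 1"
    by (rule Lp_loc_mono[OF p quot_grad_Lp_loc[OF p U f u pos Hc H(2) hf(1)[OF i] hu(1)[OF i]]])
  fix \<eta> assume \<eta>: "\<eta> \<in> Cc_smooth n U"
  obtain K where K: "compact_in n K" "K \<subseteq> U" "\<forall>x\<in>pts n. x \<notin> K \<longrightarrow> \<eta> x = 0"
    "\<forall>i<n. \<forall>x\<in>pts n. x \<notin> K \<longrightarrow> pd i \<eta> x = 0"
    "\<forall>i<n. line_deriv n i \<eta> (pd i \<eta>)" using Cc_smoothE[OF \<eta>] by blast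
  have l\<eta>: "line_deriv n i \<eta> (pd i \<eta>)" using K(5) i by blast
  have Up: "U \<subseteq> pts n" using openin_subset[OF U] by simp
  obtain d K' where K': "d > 0" "compact_in n K'" "K' \<subseteq> U" "\<forall>x\<in>K. obox n x d \<subseteq> K'" "K \<subseteq> K'"
    using compact_neighbourhood[OF U K(1,2)] by blast
  obtain c where c: "c > 0" "\<forall>x\<in>K'. c \<le> u x"
    using positive_lower_bound_on_compact[OF uc K'(2,3)] pos K'(3) by blast
  obtain F S where F: "\<forall>m k. Ck n k (F m)" "\<forall>m. \<forall>x\<in>K. \<bar>F m x - f x\<bar> \<le> (1/2) ^ m"
    "integrable (leb n) S" "\<forall>x. 0 \<le> S x"
    "\<forall>m. AE x\<in>K in leb n. (\<forall>i<n. \<bar>pd i (F m) x - hf i x\<bar> powr p \<le> (1/2) ^ m * S x)"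
    by (rule sobolev_approx[OF n p U fc hf K(1) K'(5,2,3,1,4)]) (blast+)
  have uc': "cont_on n U (\<lambda>x. u x - c)"
    using uc by (auto intro!: continuous_map_diff)
  have hu': "weak_partial n U i (\<lambda>x. u x - c) (hu i)" if "i < n" for i
    by (rule weak_partial_diff_const[OF U u hu(2)[OF that] that])
  obtain Z T where Z: "\<forall>m k. Ck n k (Z m)" "(\<forall>y\<in>K'. 0 \<le> u y - c) \<longrightarrow> (\<forall>m x. 0 \<le> Z m x)"
    "\<forall>m. \<forall>x\<in>K. \<bar>Z m x - (u x - c)\<bar> \<le> (1/2) ^ m" "integrable (leb n) T" "\<forall>x. 0 \<le> T x"
    "\<forall>m. AE x\<in>K in leb n. (\<forall>i<n. \<bar>pd i (Z m) x - hu i x\<bar> powr p \<le> (1/2) ^ m * T x)"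
    by (rule sobolev_approx[OF n p U uc' hu(1) hu' K(1) K'(5,2,3,1,4)]) (blast+)
  have U0: "0 \<le> Z m x" for m x using Z(2) c(2) by auto
  define W where "W m x = Z m x + c" for m x
  have Wc: "c \<le> W m x" for m x using U0 by (simp add: W_def)
  have W0: "0 < W m x" for m x using Wc[of m x] c(1) by linarith
  define DF where "DF m = pd i (F m)" for m
  define DU where "DU m = pd i (Z m)" for m
  have lF: "line_deriv n i (F m) (DF m)" for m unfolding DF_def by (rule Ck_line_deriv[OF _ i]) (use F(1) in blast)
  have lU: "line_deriv n i (Z m) (DU m)" for m unfolding DU_def by (rule Ck_line_deriv[OF _ i]) (use Z(1) in blast)
  have lW: "line_deriv n i (W m) (DU m)" for m
    unfolding line_deriv_def
  proof (intro conjI ballI)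
    show "cont n (W m)" "cont n (DU m)"
      unfolding W_def[abs_def] using lU[of m] by (auto simp: line_deriv_def intro!: continuous_map_add)
    fix x assume "x \<in> pts n"
    then have "((\<lambda>t. Z m (x(i := t))) has_real_derivative DU m x) (at (x i))"
      using lU[of m] by (simp add: line_deriv_def)
    from DERIV_add[OF this DERIV_const[of c]]
    show "((\<lambda>t. W m (x(i := t))) has_real_derivative DU m x) (at (x i))" by (simp add: W_def)
  qed
  define G where "G m = quot_comp H (F m) (W m)" for m
  define DG where "DG m = quot_grad H H' (F m) (W m) (DF m) (DU m)" for m
  have lG: "line_deriv n i (G m) (DG m)" for m
    unfolding G_def DG_def by (rule line_deriv_quot_comp[OF lF lW W0 H])
  have ibp: "(LINT x:U|leb n. G m x * pd i \<eta> x) = - (LINT x:U|leb n. DG m x * \<eta> x)" for m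
  proof -
    have "(LINT x|lbP n. G m x * pd i \<eta> x) = - (LINT x|lbP n. DG m x * \<eta> x)"
      by (rule integration_by_parts[OF lG l\<eta> i K(1)]) (use K(3) in auto)
    moreover have "(LINT x:U|leb n. G m x * pd i \<eta> x) = (LINT x|lbP n. G m x * pd i \<eta> x)"
      using lG[of m] l\<eta> K(2,4) i by (intro leb_integral_continuous[OF _ U] continuous_map_real_mult) (auto simp: line_deriv_def)
    moreover have "(LINT x:U|leb n. DG m x * \<eta> x) = (LINT x|lbP n. DG m x * \<eta> x)"
      using lG[of m] l\<eta> K(2,3) by (intro leb_integral_continuous[OF _ U] continuous_map_real_mult) (auto simp: line_deriv_def)
    ultimately show ?thesis by simp
  qed
  obtain Cf where Cf: "Cf > 0" "\<forall>x\<in>K. \<bar>f x\<bar> \<le> Cf" using continuous_bounded_on_compact[OF fc K(1,2)] by blast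
  obtain Cu where Cu: "Cu > 0" "\<forall>x\<in>K. \<bar>u x\<bar> \<le> Cu" using continuous_bounded_on_compact[OF uc K(1,2)] by blast
  have c\<eta>: "cont n \<eta>" "cont n (pd i \<eta>)"
    using l\<eta> by (auto simp: line_deriv_def)
  obtain C0 where C0: "C0 > 0" "\<forall>x\<in>K. \<bar>\<eta> x\<bar> \<le> C0"
    using continuous_bounded_on_compact[OF continuous_map_sub[OF c\<eta>(1)] K(1,2)] by blast
  obtain C1 where C1: "C1 > 0" "\<forall>x\<in>K. \<bar>pd i \<eta> x\<bar> \<le> C1"
    using continuous_bounded_on_compact[OF continuous_map_sub[OF c\<eta>(2)] K(1,2)] by blast
  \<comment> \<open>On \<open>K\<close> the approximants of \<open>f\<close> are bounded by
    \<open>Cf + 1\<close> and those of \<open>u\<close> are at least \<open>c\<close>. All quotients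
    thus stay within \<open>R\<close>, where \<open>H\<close> and \<open>H'\<close> are
    bounded.\<close>
  define R where "R = (Cf + 1) / c"
  have R: "R > 0" using Cf c by (simp add: R_def)
  have half: "(1/2::real) ^ m \<le> 1" for m by (rule power_le_one) auto
  have ratio: "\<bar>F m x / W m x\<bar> \<le> R" if "x \<in> K" for m x
  proof -
    have "\<bar>F m x - f x\<bar> \<le> (1/2) ^ m" "\<bar>f x\<bar> \<le> Cf" using F(2) Cf that by blast+
    then have "\<bar>F m x\<bar> \<le> Cf + 1" using half[of m] by linarith
    then have "\<bar>F m x\<bar> / \<bar>W m x\<bar> \<le> (Cf + 1) / c" using Wc[of m x] c(1) Cf by (intro frac_le) auto
    then show ?thesis by (simp add: R_def)
  qed
  have Wb: "\<bar>W m x\<bar> \<le> Cu + 1" if "x \<in> K" for m x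
  proof -
    have "\<bar>Z m x - (u x - c)\<bar> \<le> (1/2) ^ m" "\<bar>u x\<bar> \<le> Cu" using Z(3) Cu that by blast+
    then show ?thesis using half[of m] W0[of m x] unfolding W_def by linarith
  qed
  obtain C where C: "C \<ge> 0" "\<forall>t. \<bar>t\<bar> \<le> R \<longrightarrow> \<bar>H t\<bar> \<le> C" using continuous_bounded_interval[OF Hc] by blast
  obtain C' where C': "C' \<ge> 0" "\<forall>t. \<bar>t\<bar> \<le> R \<longrightarrow> \<bar>H' t\<bar> \<le> C'" using continuous_bounded_interval[OF H(2)] by blast
  define M where "M = C + C' + C' * R"
  have M: "M \<ge> 0" using C C' R by (simp add: M_def)
  have limF: "(\<lambda>m. F m x) \<longlonglongrightarrow> f x" if "x \<in> K" for x
    using F(2) that by (intro half_power_tendsto) blast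
  have limW: "(\<lambda>m. W m x) \<longlonglongrightarrow> u x" if "x \<in> K" for x
  proof (rule half_power_tendsto)
    fix m
    have "\<bar>Z m x - (u x - c)\<bar> \<le> (1/2) ^ m" using Z(3) that by blast
    then show "\<bar>W m x - u x\<bar> \<le> (1/2) ^ m" by (simp add: W_def algebra_simps)
  qed
  have limq: "(\<lambda>m. F m x / W m x) \<longlonglongrightarrow> f x / u x" if "x \<in> K" for x
    using limF[OF that] limW[OF that] pos[of x] K(2) that by (intro tendsto_divide) auto
  have limH: "(\<lambda>m. H (F m x / W m x)) \<longlonglongrightarrow> H (f x / u x)" "(\<lambda>m. H' (F m x / W m x)) \<longlonglongrightarrow> H' (f x / u x)"
    if "x \<in> K" for x
    using limq[OF that] Hc H(2) by (auto intro!: isCont_tendsto_compose[where g = H] isCont_tendsto_compose[where g = H']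
        simp: continuous_on_eq_continuous_at)
  have in_p: "AE x in leb n. x \<in> pts n" using AE_space[of "leb n"] by (simp add: space_PiM)
  have A: "(\<lambda>m. LINT x:U|leb n. G m x * pd i \<eta> x) \<longlonglongrightarrow> (LINT x:U|leb n. quot_comp H f u x * pd i \<eta> x)"
    unfolding set_lebesgue_integral_def
  proof (rule integral_dominated_convergence[where w = "\<lambda>x. ((Cu + 1) * C * C1) * ind K x"])
    show "integrable (leb n) (\<lambda>x. ((Cu + 1) * C * C1) * ind K x)"
      by (intro integrable_mult_right compact_indicator_integrable K)
    have "lmeas n U (\<lambda>x. quot_comp H f u x * pd i \<eta> x)"
      using Gc continuous_map_sub[OF c\<eta>(2)]
      by (intro set_measurable_mult set_measurable_continuous[OF U]) (auto simp: C_continuous_def)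
    then show "(\<lambda>x. ind U x *\<^sub>R (quot_comp H f u x * pd i \<eta> x)) \<in> borel_measurable (leb n)"
      by (simp add: set_borel_measurable_def)
    have "lmeas n U (\<lambda>x. G m x * pd i \<eta> x)" for m
      using continuous_map_sub lG[of m] c\<eta>(2)
      by (intro set_measurable_mult set_measurable_continuous[OF U]) (auto simp: C_continuous_def line_deriv_def)
    then show "(\<lambda>x. ind U x *\<^sub>R (G m x * pd i \<eta> x)) \<in> borel_measurable (leb n)" for m
      by (simp add: set_borel_measurable_def)
    show "AE x in leb n. (\<lambda>m. ind U x *\<^sub>R (G m x * pd i \<eta> x))
        \<longlonglongrightarrow> ind U x *\<^sub>R (quot_comp H f u x * pd i \<eta> x)"
      using in_p
    proof eventually_elim
      case (elim x)
      show ?case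
      proof (cases "x \<in> K")
        case True
        have "(\<lambda>m. G m x) \<longlonglongrightarrow> quot_comp H f u x"
          unfolding G_def quot_comp_def by (intro tendsto_mult limW limH True)
        then show ?thesis by (intro tendsto_intros)
      qed (use K(4) i elim in auto)
    qed
    show "AE x in leb n. norm (ind U x *\<^sub>R (G m x * pd i \<eta> x)) \<le> ((Cu + 1) * C * C1) * ind K x" for m
      using in_p
    proof eventually_elim
      case (elim x)
      show ?case
      proof (cases "x \<in> K")
        case True
        have "\<bar>H (F m x / W m x)\<bar> \<le> C" using ratio[OF True, of m] C by blast
        then have "\<bar>W m x\<bar> * \<bar>H (F m x / W m x)\<bar> * \<bar>pd i \<eta> x\<bar> \<le> (Cu + 1) * C * C1"
          using Wb[OF True, of m] C(1) C1 Cu(1) True by (intro mult_mono) auto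
        then show ?thesis using True K(2) by (auto simp: G_def quot_comp_def abs_mult)
      qed (use K(4) i elim in auto)
    qed
  qed
  have ae: "AE x in leb n. \<forall>m. x \<in> K \<longrightarrow> (\<bar>DF m x - hf i x\<bar> powr p \<le> (1/2) ^ m * S x) \<and> (\<bar>DU m x - hu i x\<bar> powr p \<le> (1/2) ^ m * T x)"
  proof -
    have "AE x in leb n. \<forall>m. x \<in> K \<longrightarrow> (\<forall>i<n. \<bar>pd i (F m) x - hf i x\<bar> powr p \<le> (1/2) ^ m * S x)"
      by (subst AE_all_countable) (rule F(5))
    moreover have "AE x in leb n. \<forall>m. x \<in> K \<longrightarrow> (\<forall>i<n. \<bar>pd i (Z m) x - hu i x\<bar> powr p \<le> (1/2) ^ m * T x)"
      by (subst AE_all_countable) (rule Z(6))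
    ultimately show ?thesis by eventually_elim (use i in \<open>auto simp: DF_def DU_def\<close>)
  qed
  have B: "(\<lambda>m. LINT x:U|leb n. DG m x * \<eta> x) \<longlonglongrightarrow> (LINT x:U|leb n. quot_grad H H' f u (hf i) (hu i) x * \<eta> x)"
    unfolding set_lebesgue_integral_def
  proof (rule integral_dominated_convergence[where w = "\<lambda>x. (M * C0) * (ind K x * \<bar>hf i x\<bar> powr 1
        + ind K x * \<bar>hu i x\<bar> powr 1 + 2 * ind K x + S x + T x)"])
    show "integrable (leb n) (\<lambda>x. (M * C0) * (ind K x * \<bar>hf i x\<bar> powr 1
        + ind K x * \<bar>hu i x\<bar> powr 1 + 2 * ind K x + S x + T x))"
      by (intro integrable_mult_right Bochner_Integration.integrable_add compact_indicator_integrable K(1) F(3) Z(4)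
          Lp_loc_integrable_abs[OF Lp_loc_mono[OF p hf(1)[OF i]] K(1,2)]
          Lp_loc_integrable_abs[OF Lp_loc_mono[OF p hu(1)[OF i]] K(1,2)])
    have "lmeas n U (\<lambda>x. quot_grad H H' f u (hf i) (hu i) x * \<eta> x)"
      using gL continuous_map_sub[OF c\<eta>(1)]
      by (intro set_measurable_mult[OF _ set_measurable_continuous[OF U]]) (auto simp: C_continuous_def Lp_loc_def)
    then show "(\<lambda>x. ind U x *\<^sub>R (quot_grad H H' f u (hf i) (hu i) x * \<eta> x)) \<in> borel_measurable (leb n)"
      by (simp add: set_borel_measurable_def)
    have "lmeas n U (\<lambda>x. DG m x * \<eta> x)" for m
      using continuous_map_sub lG[of m] c\<eta>(1)
      by (intro set_measurable_mult set_measurable_continuous[OF U]) (auto simp: C_continuous_def line_deriv_def)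
    then show "(\<lambda>x. ind U x *\<^sub>R (DG m x * \<eta> x)) \<in> borel_measurable (leb n)" for m
      by (simp add: set_borel_measurable_def)
    show "AE x in leb n. (\<lambda>m. ind U x *\<^sub>R (DG m x * \<eta> x))
        \<longlonglongrightarrow> ind U x *\<^sub>R (quot_grad H H' f u (hf i) (hu i) x * \<eta> x)"
      using in_p ae
    proof eventually_elim
      case (elim x)
      show ?case
      proof (cases "x \<in> K")
        case True
        have "(\<lambda>m. DF m x - hf i x) \<longlonglongrightarrow> 0"
          by (rule powr_geometric_tendsto_0[OF p, of "S x"]) (use elim(2) True F(4) in auto)
        moreover have "(\<lambda>m. DU m x - hu i x) \<longlonglongrightarrow> 0"
          by (rule powr_geometric_tendsto_0[OF p, of "T x"]) (use elim(2) True Z(5) in auto)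
        ultimately have "(\<lambda>m. DF m x - hf i x) \<longlonglongrightarrow> 0" "(\<lambda>m. DU m x - hu i x) \<longlonglongrightarrow> 0" by auto
        then have "(\<lambda>m. DF m x) \<longlonglongrightarrow> hf i x" "(\<lambda>m. DU m x) \<longlonglongrightarrow> hu i x" by (simp_all only: LIM_zero_iff)
        then have "(\<lambda>m. DG m x) \<longlonglongrightarrow> quot_grad H H' f u (hf i) (hu i) x"
          unfolding DG_def quot_grad_def by (intro tendsto_intros limH[OF True] limq[OF True])
        then show ?thesis by (intro tendsto_intros)
      qed (use K(3) elim in auto)
    qed
    show "AE x in leb n. norm (ind U x *\<^sub>R (DG m x * \<eta> x)) \<le> (M * C0) * (ind K x * \<bar>hf i x\<bar> powr 1
        + ind K x * \<bar>hu i x\<bar> powr 1 + 2 * ind K x + S x + T x)" for m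
      using in_p ae
    proof eventually_elim
      case (elim x)
      have ST: "0 \<le> S x" "0 \<le> T x" using F(4) Z(5) by auto
      show ?case
      proof (cases "x \<in> K")
        case True
        have "\<bar>DG m x\<bar> \<le> M * (\<bar>DF m x\<bar> + \<bar>DU m x\<bar>)"
          unfolding DG_def M_def using ratio[OF True, of m] C C' R by (intro quot_grad_bound) auto
        also have "\<dots> \<le> M * (\<bar>hf i x\<bar> + \<bar>hu i x\<bar> + 2 + S x + T x)"
        proof (intro mult_left_mono M)
          have "\<bar>DF m x\<bar> \<le> \<bar>hf i x\<bar> + 1 + S x" "\<bar>DU m x\<bar> \<le> \<bar>hu i x\<bar> + 1 + T x"
            using powr_geometric_bound[OF p ST(1), of "DF m x" "hf i x" m]
              powr_geometric_bound[OF p ST(2), of "DU m x" "hu i x" m] elim(2) True by auto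
          then show "\<bar>DF m x\<bar> + \<bar>DU m x\<bar> \<le> \<bar>hf i x\<bar> + \<bar>hu i x\<bar> + 2 + S x + T x" by linarith
        qed
        finally have "\<bar>DG m x\<bar> * \<bar>\<eta> x\<bar> \<le> (M * (\<bar>hf i x\<bar> + \<bar>hu i x\<bar> + 2 + S x + T x)) * C0"
          using C0 True M ST by (intro mult_mono) auto
        then show ?thesis using True K(2) by (auto simp: abs_mult mult_ac)
      next
        case False
        then show ?thesis using K(3) elim(1) M C0(1) ST by simp
      qed
    qed
  qed
  have "(\<lambda>m. LINT x:U|leb n. G m x * pd i \<eta> x) \<longlonglongrightarrow> - (LINT x:U|leb n. quot_grad H H' f u (hf i) (hu i) x * \<eta> x)"
    unfolding ibp by (intro tendsto_minus B)
  then show "(LINT x:U|leb n. quot_comp H f u x * pd i \<eta> x) = - (LINT x:U|leb n. quot_grad H H' f u (hf i) (hu i) x * \<eta> x)"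
    using A LIMSEQ_unique by blast
qed

lemma CcE:
  assumes "\<phi> \<in> Cc n U"
  obtains K where "compact_in n K" "K \<subseteq> U" "\<forall>x\<in>U. x \<notin> K \<longrightarrow> \<phi> x = 0"
  using assms unfolding Cc_def by blast

lemma Lp_of_compact_support:
  assumes U: "openin (Rn n) U" and f: "f \<in> Lp_loc n U p" and K: "compact_in n K" "K \<subseteq> U"
    and z: "AE x\<in>U in leb n. x \<notin> K \<longrightarrow> f x = 0"
  shows "f \<in> Lp n U p"
proof -
  have m: "lmeas n U f" using f by (simp add: Lp_loc_def)
  have "set_integrable (leb n) U (\<lambda>x. \<bar>f x\<bar> powr p)"
  proof (rule set_integrable_bound_leb[OF Lp_loc_integrable_abs[OF f K] set_measurable_abs_powr[OF m]])
    show "AE x\<in>U in leb n. \<bar>\<bar>f x\<bar> powr p\<bar> \<le> ind K x * \<bar>f x\<bar> powr p"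
      using z by eventually_elim (auto simp: indicator_def)
  qed
  with m show ?thesis by (simp add: Lp_def)
qed

lemma openin_diff_compact:
  assumes "openin (Rn n) U" "compact_in n K" shows "openin (Rn n) (U - K)"
  using assms compactin_imp_closedin[OF Hausdorff_Rn] by (intro openin_diff) auto

lemma Cc_smooth_mono: "U' \<subseteq> U \<Longrightarrow> \<phi> \<in> Cc_smooth n U' \<Longrightarrow> \<phi> \<in> Cc_smooth n U"
  unfolding Cc_smooth_def by blast

text \<open>On the open set \<open>U - K\<close> every test function sees only the zero function, so
  the fundamental lemma applies there.\<close>

lemma weak_partial_zero_off_support:
  assumes n: "0 < n" and U: "openin (Rn n) U" and w: "weak_partial n U i f h" and i: "i < n"
    and K: "compact_in n K" "K \<subseteq> U" and z: "\<forall>x\<in>U. x \<notin> K \<longrightarrow> f x = 0"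
  shows "AE x\<in>U in leb n. x \<notin> K \<longrightarrow> h x = 0"
proof -
  have U': "openin (Rn n) (U - K)" by (rule openin_diff_compact[OF U K(1)])
  have Up: "U \<subseteq> pts n" using openin_subset[OF U] by simp
  have hL: "h \<in> Lp_loc n U 1" using w by (simp add: weak_partial_def)
  have "h \<in> Lp_loc n (U - K) 1"
    using hL set_measurable_mono[of "leb n" U h "U - K"] openin_sets_leb[OF U'] unfolding Lp_loc_def by auto
  then have "AE x in leb n. x \<in> U - K \<longrightarrow> h x = 0"
  proof (rule fundamental_lemma[OF n U'])
    fix \<phi> assume \<phi>: "\<phi> \<in> Cc_smooth n (U - K)"
    then have \<phi>U: "\<phi> \<in> Cc_smooth n U" by (rule Cc_smooth_mono[rotated]) blast
    obtain L where L: "compact_in n L" "L \<subseteq> U - K" "\<forall>x\<in>pts n. x \<notin> L \<longrightarrow> \<phi> x = 0"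
      "\<forall>i<n. \<forall>x\<in>pts n. x \<notin> L \<longrightarrow> pd i \<phi> x = 0"
      "\<forall>i<n. line_deriv n i \<phi> (pd i \<phi>)" using Cc_smoothE[OF \<phi>] by blast
    have "ind U x *\<^sub>R (f x * pd i \<phi> x) = 0" for x
    proof (cases "x \<in> U")
      case True
      have "x \<notin> K \<longrightarrow> f x = 0" using z True by blast
      moreover have "x \<in> K \<longrightarrow> pd i \<phi> x = 0" using L(2,4) i Up True by blast
      ultimately show ?thesis by (cases "x \<in> K") auto
    qed simp
    then have "(LINT x:U|leb n. f x * pd i \<phi> x) = (LINT x|leb n. 0)"
      unfolding set_lebesgue_integral_def by (rule Bochner_Integration.integral_cong[OF refl])
    then have "(LINT x:U|leb n. f x * pd i \<phi> x) = 0" by simp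
    then have 0: "(LINT x:U|leb n. h x * \<phi> x) = 0" using w \<phi>U unfolding weak_partial_def by simp
    have "(LINT x:U - K|leb n. h x * \<phi> x) = (LINT x:U|leb n. h x * \<phi> x)"
      unfolding set_lebesgue_integral_def
      using L(2,3) Up K(2) by (intro Bochner_Integration.integral_cong refl) (auto simp: indicator_def)
    with 0 show "(LINT x:U - K|leb n. h x * \<phi> x) = 0" by simp
  qed
  then show ?thesis by eventually_elim auto
qed

text \<open>Three nested compact sets occur: \<open>K0\<close> carries \<open>f\<close>,
  \<open>K\<close> carries all approximants, and \<open>K'\<close> contains the values that
  mollification at points of \<open>K\<close> uses.\<close>

lemma smooth_density:
  assumes n: "0 < n" and p: "p \<ge> 1" and U: "openin (Rn n) U" and f: "f \<in> W1p n U p" "f \<in> Cc n U"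
  obtains F K S where "\<forall>m. F m \<in> Cc_smooth n U" "compact_in n K" "K \<subseteq> U"
    "\<forall>x\<in>U. x \<notin> K \<longrightarrow> f x = 0"
    "\<forall>m. \<forall>x\<in>U. x \<notin> K \<longrightarrow> F m x = 0 \<and> (\<forall>i<n. pd i (F m) x = 0)"
    "\<forall>m. \<forall>x\<in>U. \<bar>F m x - f x\<bar> \<le> (1/2) ^ m"
    "integrable (leb n) S" "\<forall>x. 0 \<le> S x"
    "AE x\<in>U in leb n. x \<notin> K \<longrightarrow> (\<forall>i<n. wgrad n U f i x = 0)"
    "AE x\<in>U in leb n. (\<forall>m. \<forall>i<n. \<bar>pd i (F m) x - wgrad n U f i x\<bar> powr p \<le> (1/2) ^ m * S x)"
proof -
  have Up: "U \<subseteq> pts n" using openin_subset[OF U] by simp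
  have fc: "cont_on n U f" using f(2) by (simp add: Cc_def C_continuous_def)
  have w: "weak_partial n U i f (wgrad n U f i)" "wgrad n U f i \<in> Lp_loc n U p" if "i < n" for i
    using wgrad_W1p[OF n U f(1) that] Lp_imp_Lp_loc by auto
  obtain K0 where K0: "compact_in n K0" "K0 \<subseteq> U" "\<forall>x\<in>U. x \<notin> K0 \<longrightarrow> f x = 0" using CcE[OF f(2)] by blast
  obtain d1 K where K: "d1 > 0" "compact_in n K" "K \<subseteq> U" "\<forall>x\<in>K0. obox n x d1 \<subseteq> K" "K0 \<subseteq> K"
    using compact_neighbourhood[OF U K0(1,2)] by blast
  obtain d2 K' where K': "d2 > 0" "compact_in n K'" "K' \<subseteq> U" "\<forall>x\<in>K. obox n x d2 \<subseteq> K'" "K \<subseteq> K'"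
    using compact_neighbourhood[OF U K(2,3)] by blast
  \<comment> \<open>A radius below \<open>d1\<close> keeps the supports of the approximants in
    \<open>K\<close>; one below \<open>d2\<close> keeps the mollification on \<open>K\<close> inside
    \<open>K'\<close>.\<close>
  define d where "d = min d1 d2"
  have d: "d > 0" "\<forall>x\<in>K. obox n x d \<subseteq> K'"
    using K(1) K'(1,4) obox_mono[of d d2 n] by (auto simp: d_def)
  from sobolev_approx[OF n p U fc w(2,1) K(2) K'(5,2,3) d]
  obtain F S where F: "\<forall>m k. Ck n k (F m)"
    "\<forall>m. \<forall>x\<in>pts n. F m x \<noteq> 0 \<longrightarrow> (\<exists>y\<in>K'. f y \<noteq> 0 \<and> x \<in> obox n y d)"
    and "(\<forall>y\<in>K'. 0 \<le> f y) \<longrightarrow> (\<forall>m x. 0 \<le> F m x)"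
    and F': "\<forall>m. \<forall>x\<in>K. \<bar>F m x - f x\<bar> \<le> (1/2) ^ m" "integrable (leb n) S" "\<forall>x. 0 \<le> S x"
    "\<forall>m. AE x\<in>K in leb n. (\<forall>i<n. \<bar>pd i (F m) x - wgrad n U f i x\<bar> powr p \<le> (1/2) ^ m * S x)" .
  note F = F F'
  have Fz: "F m x = 0" if x: "x \<in> pts n" "x \<notin> K" for m x
  proof (rule ccontr)
    assume "F m x \<noteq> 0"
    from F(2)[rule_format, OF x(1) this]
    have "\<exists>y\<in>K'. f y \<noteq> 0 \<and> x \<in> obox n y d" .
    then obtain y where y0: "y \<in> K'" "f y \<noteq> 0 \<and> x \<in> obox n y d" ..
    note y = y0(1) conjunct1[OF y0(2)] conjunct2[OF y0(2)]
    have "y \<in> U" using y(1) K'(3) by (rule rev_subsetD)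
    then have "y \<in> K0" using K0(3) y(2) by auto
    moreover have "x \<in> obox n y d1" using y(3) obox_mono[of d d1 n y] by (auto simp: d_def)
    moreover have "obox n y d1 \<subseteq> K" if "y \<in> K0" using K(4) that ..
    ultimately have "x \<in> K" by auto
    with x(2) show False ..
  qed
  have Fs: "F m \<in> Cc_smooth n U" for m
  proof -
    have "\<forall>k. Ck n k (F m)" using F(1) by simp
    moreover have "\<forall>x\<in>topspace (Rn n) - K. F m x = 0" using Fz by auto
    ultimately show ?thesis unfolding Cc_smooth_def using K(2,3) by auto
  qed
  have Fd: "pd i (F m) x = 0" if "i < n" "x \<in> pts n" "x \<notin> K" for i m x
    by (rule line_deriv_support[OF Ck_line_deriv[OF _ that(1)] that(1) K(2) Fz that(2,3)]) (use F(1) in blast)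
  have wz: "AE x\<in>U in leb n. x \<notin> K \<longrightarrow> (\<forall>i<n. wgrad n U f i x = 0)"
  proof -
    have "AE x in leb n. \<forall>i\<in>{..<n}. x \<in> U \<longrightarrow> x \<notin> K0 \<longrightarrow> wgrad n U f i x = 0"
      using weak_partial_zero_off_support[OF n U w(1) _ K0] by (subst AE_ball_countable) auto
    then show ?thesis by eventually_elim (use K(5) in auto)
  qed
  show thesis
  proof
    show "\<forall>m. F m \<in> Cc_smooth n U" using Fs by blast
    show "\<forall>x\<in>U. x \<notin> K \<longrightarrow> f x = 0" using K0(3) K(5) by blast
    show "\<forall>m. \<forall>x\<in>U. x \<notin> K \<longrightarrow> F m x = 0 \<and> (\<forall>i<n. pd i (F m) x = 0)"
      using Fz Fd Up by blast
    show "\<forall>m. \<forall>x\<in>U. \<bar>F m x - f x\<bar> \<le> (1/2) ^ m"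
    proof (intro allI ballI)
      fix m x assume x: "x \<in> U"
      show "\<bar>F m x - f x\<bar> \<le> (1/2) ^ m"
      proof (cases "x \<in> K")
        case False
        then have "F m x = 0" "f x = 0" using Fz[of x m] x Up K0(3) K(5) by auto
        then show ?thesis by simp
      qed (use F(3) in blast)
    qed
    have "AE x in leb n. \<forall>m. x \<in> K \<longrightarrow> (\<forall>i<n. \<bar>pd i (F m) x - wgrad n U f i x\<bar> powr p \<le> (1/2) ^ m * S x)"
      by (subst AE_all_countable) (rule F(6))
    with wz show "AE x in leb n. x \<in> U \<longrightarrow>
        (\<forall>m. \<forall>i<n. \<bar>pd i (F m) x - wgrad n U f i x\<bar> powr p \<le> (1/2) ^ m * S x)"
    proof eventually_elim
      case (elim x)
      show ?case
      proof (intro impI allI)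
        fix m i assume x: "x \<in> U" and i: "i < n"
        show "\<bar>pd i (F m) x - wgrad n U f i x\<bar> powr p \<le> (1/2) ^ m * S x"
        proof (cases "x \<in> K")
          case False
          then have "pd i (F m) x = 0" "wgrad n U f i x = 0" using Fd[OF i] elim(1) x i Up by auto
          then show ?thesis using F(5) by simp
        qed (use elim(2) i in blast)
      qed
    qed
  qed (use K F wz in auto)
qed

text \<open>With \<open>H 0 = 0\<close> and \<open>H' 0 = 0\<close> the function and its gradient
  formula vanish wherever \<open>f\<close> does, whatever representative of the weak gradient of
  \<open>f\<close> has been chosen. Compact support then upgrades local to global
  integrability.\<close>

lemma quot_comp_W1p:
  assumes n: "0 < n" and p: "p \<ge> 1" and U: "openin (Rn n) U"
    and f: "f \<in> W1p n U p" "f \<in> Cc n U" and u: "u \<in> W1p_loc n U p" "u \<in> C_continuous n U"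
    and pos: "\<And>x. x \<in> U \<Longrightarrow> u x > 0"
    and H: "\<And>t. (H has_real_derivative H' t) (at t)" "continuous_on UNIV H'" "H 0 = 0" "H' 0 = 0"
  shows "quot_comp H f u \<in> W1p n U p" "quot_comp H f u \<in> Cc n U"
    "AE x\<in>U in leb n. (\<forall>i<n. wgrad n U (quot_comp H f u) i x
       = quot_grad H H' f u (wgrad n U f i) (wgrad n U u i) x)"
proof -
  have Hc: "continuous_on UNIV H" using H(1) by (meson DERIV_continuous_on has_field_derivative_at_within)
  have fC: "f \<in> C_continuous n U" using f(2) by (simp add: Cc_def)
  have c: "cont_on n U f" "cont_on n U u"
    using fC u(2) by (auto simp: C_continuous_def)
  have pos': "u x > 0" if "x \<in> topspace (subtopology (Rn n) U)" for x using pos that by simp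
  obtain K where K: "compact_in n K" "K \<subseteq> U" "\<forall>x\<in>U. x \<notin> K \<longrightarrow> f x = 0" using CcE[OF f(2)] by blast
  have GC: "quot_comp H f u \<in> C_continuous n U"
    using quot_comp_continuous(2)[OF c pos' Hc] by (simp add: C_continuous_def)
  have Gz: "\<forall>x\<in>U. x \<notin> K \<longrightarrow> quot_comp H f u x = 0" using K(3) H(3) by (simp add: quot_comp_def)
  show "quot_comp H f u \<in> Cc n U" unfolding Cc_def using GC Gz K(1,2) by blast
  have hf: "weak_partial n U i f (wgrad n U f i)" "wgrad n U f i \<in> Lp_loc n U p" if "i < n" for i
    using wgrad_W1p[OF n U f(1) that] Lp_imp_Lp_loc by auto
  have hu: "weak_partial n U i u (wgrad n U u i)" "wgrad n U u i \<in> Lp_loc n U p" if "i < n" for i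
    using wgrad_W1p_loc[OF n U u(1) that] by auto
  have w: "weak_partial n U i (quot_comp H f u) (quot_grad H H' f u (wgrad n U f i) (wgrad n U u i))" if "i < n" for i
    by (rule weak_partial_quot_comp[OF n p U fC u(2) pos hf(2,1) hu(2,1) H(1,2) that])
  have gz: "quot_grad H H' f u (wgrad n U f i) (wgrad n U u i) x = 0" if "x \<in> U" "x \<notin> K" for i x
    using K(3) that H(3,4) by (simp add: quot_grad_def)
  have gL: "quot_grad H H' f u (wgrad n U f i) (wgrad n U u i) \<in> Lp n U p" if i: "i < n" for i
    by (rule Lp_of_compact_support[OF U quot_grad_Lp_loc[OF p U fC u(2) pos Hc H(2) hf(2)[OF i] hu(2)[OF i]] K(1,2)])
      (use gz in \<open>auto intro!: AE_I2\<close>)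
  have "quot_comp H f u \<in> Lp n U p"
    by (rule Lp_of_compact_support[OF U continuous_Lp_loc[OF U GC] K(1,2)]) (use Gz p in auto)
  then show "quot_comp H f u \<in> W1p n U p" unfolding W1p_def using gL w by blast
  have "AE x in leb n. \<forall>i\<in>{..<n}. x \<in> U \<longrightarrow> wgrad n U (quot_comp H f u) i x
       = quot_grad H H' f u (wgrad n U f i) (wgrad n U u i) x"
    using wgrad_AE[OF n U w] by (subst AE_ball_countable) auto
  then show "AE x\<in>U in leb n. (\<forall>i<n. wgrad n U (quot_comp H f u) i x
       = quot_grad H H' f u (wgrad n U f i) (wgrad n U u i) x)" by eventually_elim auto
qed

subsection \<open>The energy functional\<close>

lemma set_measurable_restrict_iff:
  fixes f :: "point \<Rightarrow> real"
  assumes "U \<in> sets (leb n)"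
  shows "lmeas n U f \<longleftrightarrow> f \<in> borel_measurable (restrict_space (leb n) U)"
  using assms unfolding set_borel_measurable_def
  by (subst borel_measurable_restrict_space_iff) (auto simp: mult.commute)

text \<open>In the coordinates \<open>a_i^(1/s) \<xi>_i\<close> the weighted norm is the plain
  s-norm. The weights therefore do not enter the constants of the divergence estimates.\<close>

definition scaled :: "real \<Rightarrow> (nat \<Rightarrow> point \<Rightarrow> real) \<Rightarrow> point \<Rightarrow> point \<Rightarrow> nat \<Rightarrow> real" where
  "scaled s a x \<xi> i = a i x powr (1 / s) * \<xi> i"

lemma spow_scaled:
  assumes "s > 1" "\<And>i. i < n \<Longrightarrow> 0 < a i x"
  shows "spow s n (scaled s a x \<xi>) = (\<Sum>i<n. a i x * \<bar>\<xi> i\<bar> powr s)"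
  unfolding spow_def
proof (rule sum.cong)
  fix i assume "i \<in> {..<n}"
  then have "0 < a i x" using assms(2) by simp
  then show "\<bar>scaled s a x \<xi> i\<bar> powr s = a i x * \<bar>\<xi> i\<bar> powr s"
    using assms(1) by (simp add: scaled_def abs_mult powr_mult powr_powr)
qed simp

lemma norm_sa_powr:
  assumes "s > 1" "\<And>i. i < n \<Longrightarrow> 0 < a i x"
  shows "norm_sa n s a x \<xi> powr r = spow s n (scaled s a x \<xi>) powr (r / s)"
proof -
  have eq: "spow s n (scaled s a x \<xi>) = (\<Sum>i<n. a i x * \<bar>\<xi> i\<bar> powr s)"
    by (rule spow_scaled[of s n a x, OF assms])
  show ?thesis unfolding norm_sa_def eq by (simp add: powr_powr)
qed

text \<open>Weights and potential appear with bounds on compact subsets; the passage from relatively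
  compact domains to compact sets is made separately.\<close>

locale hardy_setting =
  fixes n :: nat and U :: "point set" and p s :: real
    and a :: "nat \<Rightarrow> point \<Rightarrow> real" and V u :: "point \<Rightarrow> real"
  assumes n: "0 < n" and p: "1 < p" and s: "1 < s" and U: "openin (Rn n) U"
    and a_meas: "\<And>i. i < n \<Longrightarrow> lmeas n U (a i)"
    and a_pos: "\<And>i x. i < n \<Longrightarrow> x \<in> U \<Longrightarrow> 0 < a i x"
    and a_bounded: "\<And>K. compact_in n K \<Longrightarrow> K \<subseteq> U \<Longrightarrow>
      \<exists>C>0. AE x\<in>K in leb n. (\<forall>i<n. a i x \<le> C)"
    and V: "V \<in> Lp_loc n U 1"
    and sol: "positive_solution n U p s a V u" and u: "u \<in> C_continuous n U"
begin

definition energy :: "point \<Rightarrow> point \<Rightarrow> real" where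
  "energy x \<xi> = spow s n (scaled s a x \<xi>) powr (p / s)"

definition pairing :: "point \<Rightarrow> point \<Rightarrow> point \<Rightarrow> real" where
  "pairing x v w = (\<Sum>i<n. pgrad p s n (scaled s a x v) i * scaled s a x w i)"

definition excess :: "point \<Rightarrow> point \<Rightarrow> point \<Rightarrow> real" where
  "excess x \<xi> \<zeta> = bregman p s n (scaled s a x \<xi>) (scaled s a x \<zeta>)"

abbreviation grad :: "(point \<Rightarrow> real) \<Rightarrow> point \<Rightarrow> nat \<Rightarrow> real" where
  "grad f x \<equiv> (\<lambda>i. wgrad n U f i x)"

abbreviation "Q \<equiv> Q_fun n U p s a V"
abbreviation "N \<equiv> norm_u n U p s a V u"
abbreviation "test_space \<equiv> W1p n U p \<inter> Cc n U"

lemma p1: "1 \<le> p" using p by simp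
lemma U_sets: "U \<in> sets (leb n)" by (rule openin_sets_leb[OF U])
lemma U_pts: "U \<subseteq> pts n" using openin_subset[OF U] by simp

lemma u_pos: "x \<in> U \<Longrightarrow> 0 < u x" using sol by (simp add: positive_solution_def)
lemma u_W1p_loc: "u \<in> W1p_loc n U p" using sol by (simp add: positive_solution_def)

lemma scaled_cong: "(\<And>i. i < n \<Longrightarrow> \<xi> i = \<zeta> i) \<Longrightarrow> i < n \<Longrightarrow> scaled s a x \<xi> i = scaled s a x \<zeta> i"
  by (simp add: scaled_def)

lemma energy_cong: "(\<And>i. i < n \<Longrightarrow> \<xi> i = \<zeta> i) \<Longrightarrow> energy x \<xi> = energy x \<zeta>"
  unfolding energy_def spow_def scaled_def by simp

lemma pgrad_cong: "(\<And>i. i < n \<Longrightarrow> v i = w i) \<Longrightarrow> i < n \<Longrightarrow> pgrad p s n v i = pgrad p s n w i"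
  by (simp add: pgrad_def spow_def)

lemma pairing_cong: "(\<And>i. i < n \<Longrightarrow> v i = v' i) \<Longrightarrow> (\<And>i. i < n \<Longrightarrow> w i = w' i) \<Longrightarrow> pairing x v w = pairing x v' w'"
  unfolding pairing_def
  by (intro sum.cong refl arg_cong2[where f = "(*)"] pgrad_cong scaled_cong) auto

lemma excess_eq:
  "excess x \<xi> \<zeta> = energy x \<xi> + (p - 1) * energy x \<zeta> - p * pairing x \<zeta> \<xi>"
  by (simp add: excess_def bregman_eq[OF s] energy_def pairing_def)

lemma excess_nonneg: "0 \<le> excess x \<xi> \<zeta>"
  unfolding excess_def by (rule bregman_nonneg[OF p s])

lemma energy_nonneg: "0 \<le> energy x \<xi>"
  by (simp add: energy_def)

lemma scaled_cmult: "scaled s a x (\<lambda>i. l * \<xi> i) = (\<lambda>i. l * scaled s a x \<xi> i)"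
  by (simp add: scaled_def fun_eq_iff)

lemma energy_cmult: "energy x (\<lambda>i. l * \<xi> i) = \<bar>l\<bar> powr p * energy x \<xi>"
  using s by (simp add: energy_def scaled_cmult spow_scale powr_mult powr_powr)

lemma pairing_cmult_right: "pairing x v (\<lambda>i. l * w i) = l * pairing x v w"
  unfolding pairing_def scaled_cmult by (simp add: sum_distrib_left mult_ac)

lemma pairing_cmult_left: "pairing x (\<lambda>i. l * v i) w = dual_pow p l * pairing x v w"
  unfolding pairing_def scaled_cmult by (simp add: pgrad_scale[OF s] sum_distrib_left mult_ac)

lemma pairing_add_right: "pairing x v (\<lambda>i. w i + w' i) = pairing x v w + pairing x v w'"
  unfolding pairing_def scaled_def by (simp add: sum.distrib algebra_simps)

lemma pairing_self: "pairing x v v = energy x v"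
  unfolding pairing_def energy_def by (rule pgrad_self[OF s])

text \<open>Young's inequality for the pairing, read off from the nonnegativity of the divergence at
  \<open>w\<close> and at \<open>- w\<close>.\<close>

lemma abs_pairing_le: "p * \<bar>pairing x v w\<bar> \<le> energy x w + (p - 1) * energy x v"
proof -
  have "0 \<le> excess x w v" "0 \<le> excess x (\<lambda>i. (-1) * w i) v" by (rule excess_nonneg)+
  then have "p * pairing x v w \<le> energy x w + (p - 1) * energy x v"
    "p * (- pairing x v w) \<le> energy x w + (p - 1) * energy x v"
    unfolding excess_eq energy_cmult pairing_cmult_right by simp_all
  then show ?thesis by (simp add: abs_if)
qed

lemma excess_cong: "(\<And>i. i < n \<Longrightarrow> v i = v' i) \<Longrightarrow> (\<And>i. i < n \<Longrightarrow> w i = w' i) \<Longrightarrow> excess x v w = excess x v' w'"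
  unfolding excess_eq
  using energy_cong[of v v' x] energy_cong[of w w' x] pairing_cong[of w w' v v' x] by simp

lemma excess_scale: "excess x (\<lambda>i. l * v i) (\<lambda>i. l * w i) = \<bar>l\<bar> powr p * excess x v w"
  unfolding excess_def scaled_cmult by (rule bregman_scale[OF s])

lemma excess_self: "excess x v v = 0"
  by (simp add: excess_def bregman_def)

lemma Q_eq: "Q f = (LINT x:U|leb n. energy x (grad f x) + V x * \<bar>f x\<bar> powr p)"
proof -
  have e: "norm_sa n s a x \<xi> powr p = energy x \<xi>" if "x \<in> U" for x \<xi>
    unfolding energy_def by (rule norm_sa_powr[of s n a x, OF s a_pos[OF _ that]])
  show ?thesis unfolding Q_fun_def set_lebesgue_integral_def
    by (rule Bochner_Integration.integral_cong) (auto simp: indicator_def e)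
qed

text \<open>Identifies the integrand of the weak equation. The weight splits as
  \<open>a^((s-1)/s) * a^(1/s)\<close>, one factor for each argument of the pairing.\<close>

lemma pairing_eq:
  assumes x: "x \<in> U"
  shows "norm_sa n s a x v powr (p - s) * (\<Sum>i<n. a i x * \<bar>v i\<bar> powr (s - 2) * v i * w i) = pairing x v w"
proof -
  have "norm_sa n s a x v powr (p - s) = spow s n (scaled s a x v) powr ((p - s) / s)"
    by (rule norm_sa_powr[of s n a x, OF s a_pos[OF _ x]])
  moreover have "a i x * \<bar>v i\<bar> powr (s - 2) * v i * w i = dual_pow s (scaled s a x v i) * scaled s a x w i" if i: "i < n" for i
  proof -
    have ai: "0 < a i x" by (rule a_pos[OF i x])
    have "dual_pow s (scaled s a x v i) = dual_pow s (a i x powr (1 / s)) * dual_pow s (v i)"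
      by (simp add: scaled_def dual_pow_mult)
    also have "dual_pow s (a i x powr (1 / s)) = a i x powr ((s - 1) / s)"
      using ai by (simp add: dual_pow_def powr_powr)
    finally have "dual_pow s (scaled s a x v i) * scaled s a x w i
        = (a i x powr ((s - 1) / s) * a i x powr (1 / s)) * (dual_pow s (v i) * w i)"
      by (simp add: scaled_def mult_ac)
    also have "a i x powr ((s - 1) / s) * a i x powr (1 / s) = a i x"
    proof -
      have "(s - 1) / s + 1 / s = 1" using s by (simp add: add_divide_distrib[symmetric])
      then show ?thesis using ai by (simp add: powr_add[symmetric])
    qed
    finally show ?thesis unfolding dual_pow_alt[symmetric] by (simp add: mult_ac)
  qed
  ultimately show ?thesis
    by (simp add: pairing_def pgrad_def sum_distrib_left mult.assoc)
qed

lemma scaled_measurable: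
  assumes "\<And>i. i < n \<Longrightarrow> lmeas n U (h i)" "i < n"
  shows "(\<lambda>x. scaled s a x (\<lambda>i. h i x) i) \<in> borel_measurable (restrict_space (leb n) U)"
proof -
  have "h i \<in> borel_measurable (restrict_space (leb n) U)" "a i \<in> borel_measurable (restrict_space (leb n) U)"
    using assms a_meas set_measurable_restrict_iff[OF U_sets] by auto
  then show ?thesis unfolding scaled_def by measurable
qed

lemma spow_measurable:
  assumes "\<And>i. i < n \<Longrightarrow> lmeas n U (h i)"
  shows "(\<lambda>x. spow s n (scaled s a x (\<lambda>i. h i x))) \<in> borel_measurable (restrict_space (leb n) U)"
  unfolding spow_def
proof (rule borel_measurable_sum)
  fix i assume "i \<in> {..<n}"
  then have [measurable]: "(\<lambda>x. scaled s a x (\<lambda>i. h i x) i) \<in> borel_measurable (restrict_space (leb n) U)"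
    by (intro scaled_measurable assms) auto
  show "(\<lambda>x. \<bar>scaled s a x (\<lambda>i. h i x) i\<bar> powr s) \<in> borel_measurable (restrict_space (leb n) U)" by measurable
qed

lemma energy_measurable:
  assumes "\<And>i. i < n \<Longrightarrow> lmeas n U (h i)"
  shows "lmeas n U (\<lambda>x. energy x (\<lambda>i. h i x))"
  unfolding set_measurable_restrict_iff[OF U_sets] energy_def
  using spow_measurable[OF assms] by measurable

lemma pairing_measurable:
  assumes "\<And>i. i < n \<Longrightarrow> lmeas n U (h i)"
    and "\<And>i. i < n \<Longrightarrow> lmeas n U (k i)"
  shows "lmeas n U (\<lambda>x. pairing x (\<lambda>i. h i x) (\<lambda>i. k i x))"
  unfolding set_measurable_restrict_iff[OF U_sets] pairing_def
proof (rule borel_measurable_sum)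
  fix i assume i: "i \<in> {..<n}"
  note [measurable] = spow_measurable[OF assms(1)]
  have [measurable]: "(\<lambda>x. scaled s a x (\<lambda>i. h i x) i) \<in> borel_measurable (restrict_space (leb n) U)"
    "(\<lambda>x. scaled s a x (\<lambda>i. k i x) i) \<in> borel_measurable (restrict_space (leb n) U)"
    using i by (auto intro!: scaled_measurable assms)
  show "(\<lambda>x. pgrad p s n (scaled s a x (\<lambda>i. h i x)) i * scaled s a x (\<lambda>i. k i x) i)
      \<in> borel_measurable (restrict_space (leb n) U)"
    unfolding pgrad_def dual_pow_def by measurable
qed

text \<open>A crude comparison of the s-norm with the p-norm. Its constant depends on
  \<open>n\<close> and on \<open>K\<close>, which is harmless because it only serves to dominate
  integrands.\<close>

lemma energy_bound:
  assumes K: "compact_in n K" "K \<subseteq> U"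
  obtains C where "C > 0" "AE x\<in>K in leb n. (\<forall>\<xi>. energy x \<xi> \<le> C * (\<Sum>i<n. \<bar>\<xi> i\<bar> powr p))"
proof -
  obtain A where A: "A > 0" "AE x\<in>K in leb n. (\<forall>i<n. a i x \<le> A)" using a_bounded[OF K] by blast
  define C where "C = (real n * A) powr (p / s)"
  have nA: "real n * A > 0" using n A by simp
  have C: "C > 0" using nA n A by (simp add: C_def)
  have "energy x \<xi> \<le> C * (\<Sum>i<n. \<bar>\<xi> i\<bar> powr p)" if x: "x \<in> K" and ax: "\<forall>i<n. a i x \<le> A" for x \<xi>
  proof -
    define t where "t = (\<Sum>i<n. \<bar>\<xi> i\<bar> powr p)"
    have t: "0 \<le> t" by (simp add: t_def sum_nonneg)
    have "\<bar>\<xi> i\<bar> powr s \<le> t powr (s / p)" if i: "i < n" for i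
    proof -
      have "\<bar>\<xi> i\<bar> powr p \<le> t" unfolding t_def
        by (rule member_le_sum[where f = "\<lambda>i. \<bar>\<xi> i\<bar> powr p"]) (use i in auto)
      then have "(\<bar>\<xi> i\<bar> powr p) powr (s / p) \<le> t powr (s / p)" using p s by (intro powr_mono2) auto
      then show ?thesis using p by (simp add: powr_powr)
    qed
    moreover have "spow s n (scaled s a x \<xi>) = (\<Sum>i<n. a i x * \<bar>\<xi> i\<bar> powr s)"
      by (rule spow_scaled[OF s]) (use a_pos x K(2) in blast)
    ultimately have "spow s n (scaled s a x \<xi>) \<le> (\<Sum>i<n. A * t powr (s / p))"
      using ax A(1) by (simp only:) (intro sum_mono mult_mono; simp)
    then have "spow s n (scaled s a x \<xi>) \<le> (real n * A) * t powr (s / p)" by simp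
    then have "energy x \<xi> \<le> ((real n * A) * t powr (s / p)) powr (p / s)"
      unfolding energy_def using p s by (intro powr_mono2) auto
    also have "\<dots> = C * t" using nA t p s by (simp add: powr_mult powr_powr C_def)
    finally show ?thesis by (simp add: t_def)
  qed
  then have "AE x\<in>K in leb n. (\<forall>\<xi>. energy x \<xi> \<le> C * (\<Sum>i<n. \<bar>\<xi> i\<bar> powr p))"
    using A(2) by (auto elim!: eventually_mono)
  then show thesis using C that by blast
qed

lemma energy_tendsto:
  assumes "\<And>i. i < n \<Longrightarrow> (\<lambda>m. \<xi> m i) \<longlonglongrightarrow> \<zeta> i"
  shows "(\<lambda>m. energy x (\<xi> m)) \<longlonglongrightarrow> energy x \<zeta>"
proof -
  have "(\<lambda>m. spow s n (scaled s a x (\<xi> m))) \<longlonglongrightarrow> spow s n (scaled s a x \<zeta>)"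
    unfolding spow_def scaled_def
  proof (rule tendsto_sum)
    fix i assume "i \<in> {..<n}"
    then have "(\<lambda>m. \<bar>a i x powr (1 / s) * \<xi> m i\<bar>) \<longlonglongrightarrow> \<bar>a i x powr (1 / s) * \<zeta> i\<bar>"
      using assms by (intro tendsto_intros) auto
    then show "(\<lambda>m. \<bar>a i x powr (1 / s) * \<xi> m i\<bar> powr s) \<longlonglongrightarrow> \<bar>a i x powr (1 / s) * \<zeta> i\<bar> powr s"
      using s by (intro tendsto_powr2) auto
  qed
  then show ?thesis unfolding energy_def using p s by (intro tendsto_powr2) auto
qed

lemma pairing_tendsto:
  assumes "\<And>i. i < n \<Longrightarrow> (\<lambda>m. w m i) \<longlonglongrightarrow> z i"
  shows "(\<lambda>m. pairing x v (w m)) \<longlonglongrightarrow> pairing x v z"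
  unfolding pairing_def scaled_def using assms by (intro tendsto_sum tendsto_mult tendsto_const) auto

lemma V_integrable:
  assumes f: "f \<in> C_continuous n U" and K: "compact_in n K" "K \<subseteq> U" "\<forall>x\<in>U. x \<notin> K \<longrightarrow> f x = 0"
    and h: "h \<in> Lp_loc n U 1"
  shows "set_integrable (leb n) U (\<lambda>x. h x * \<bar>f x\<bar> powr p)"
proof -
  obtain C where C: "C > 0" "\<forall>x\<in>K. \<bar>f x\<bar> \<le> C"
    using continuous_bounded_on_compact[of n U f K] f K unfolding C_continuous_def by blast
  show ?thesis
  proof (rule Lp_loc_integrable_mult[OF h _ K(1,2)])
    show "lmeas n U (\<lambda>x. \<bar>f x\<bar> powr p)"
      by (intro set_measurable_abs_powr set_measurable_continuous[OF U f])
    show "\<bar>\<bar>f x\<bar> powr p\<bar> \<le> C powr p" if "x \<in> K" for x using C that p by (auto intro: powr_mono2)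
  qed (use K(3) in auto)
qed

lemma wgrad_measurable: "f \<in> W1p n U p \<Longrightarrow> i < n \<Longrightarrow> lmeas n U (wgrad n U f i)"
  using wgrad_W1p(2)[OF n U] by (simp add: Lp_def)

lemma u_grad_measurable: "i < n \<Longrightarrow> lmeas n U (wgrad n U u i)"
  using wgrad_W1p_loc(2)[OF n U u_W1p_loc] by (simp add: Lp_loc_def)

text \<open>Packages the smooth approximation with one integrable majorant for the energies of all
  approximants and of the limit, ready for dominated convergence.\<close>

lemma energy_density:
  assumes f: "f \<in> test_space"
  obtains F K B S where "\<forall>m. F m \<in> Cc_smooth n U" "compact_in n K" "K \<subseteq> U"
    "\<forall>x\<in>U. x \<notin> K \<longrightarrow> f x = 0" "\<forall>m. \<forall>x\<in>U. x \<notin> K \<longrightarrow> F m x = 0"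
    "\<forall>m. \<forall>x\<in>U. \<bar>F m x - f x\<bar> \<le> (1/2) ^ m" "\<forall>m. \<forall>x\<in>U. \<bar>F m x\<bar> \<le> B" "\<forall>x\<in>U. \<bar>f x\<bar> \<le> B"
    "integrable (leb n) S"
    "AE x\<in>U in leb n. energy x (grad f x) \<le> S x
       \<and> (\<forall>m. energy x (\<lambda>i. pd i (F m) x) \<le> S x)
       \<and> (\<forall>i<n. (\<lambda>m. pd i (F m) x) \<longlonglongrightarrow> grad f x i)"
    "AE x\<in>U in leb n. x \<notin> K \<longrightarrow> (\<forall>i<n. grad f x i = 0)"
    "\<forall>m. \<forall>x\<in>U. x \<notin> K \<longrightarrow> (\<forall>i<n. pd i (F m) x = 0)"
proof -
  have fW: "f \<in> W1p n U p" and fCc: "f \<in> Cc n U" using f by auto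
  have fC: "f \<in> C_continuous n U" using fCc by (simp add: Cc_def)
  obtain F K S where F: "\<forall>m. F m \<in> Cc_smooth n U" and K: "compact_in n K" "K \<subseteq> U"
    and fz: "\<forall>x\<in>U. x \<notin> K \<longrightarrow> f x = 0"
    and Fz: "\<forall>m. \<forall>x\<in>U. x \<notin> K \<longrightarrow> F m x = 0 \<and> (\<forall>i<n. pd i (F m) x = 0)"
    and Fl: "\<forall>m. \<forall>x\<in>U. \<bar>F m x - f x\<bar> \<le> (1/2) ^ m"
    and S: "integrable (leb n) S" "\<forall>x. 0 \<le> S x"
    and gz: "AE x\<in>U in leb n. x \<notin> K \<longrightarrow> (\<forall>i<n. wgrad n U f i x = 0)"
    and gl: "AE x\<in>U in leb n. (\<forall>m. \<forall>i<n. \<bar>pd i (F m) x - wgrad n U f i x\<bar> powr p \<le> (1/2) ^ m * S x)"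
    by (rule smooth_density[OF n p1 U fW fCc])
  obtain B where B: "B > 0" "\<forall>x\<in>K. \<bar>f x\<bar> \<le> B"
    using continuous_bounded_on_compact[of n U f K] fC K unfolding C_continuous_def by blast
  have fB: "\<bar>f x\<bar> \<le> B" if "x \<in> U" for x using B fz that by (cases "x \<in> K") auto
  have FB: "\<bar>F m x\<bar> \<le> B + 1" if "x \<in> U" for m x
  proof -
    have "\<bar>F m x - f x\<bar> \<le> (1/2) ^ m" using Fl that by blast
    moreover have "(1/2::real) ^ m \<le> 1" by (rule power_le_one) auto
    ultimately show ?thesis using fB[OF that] by linarith
  qed
  obtain C where C: "C > 0" "AE x\<in>K in leb n. (\<forall>\<xi>. energy x \<xi> \<le> C * (\<Sum>i<n. \<bar>\<xi> i\<bar> powr p))"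
    by (rule energy_bound[OF K])
  \<comment> \<open>The majorant of the energies: \<open>|v|^p \<le> 2^p (|w|^p + |v - w|^p)\<close>
    for each derivative, with the difference controlled by \<open>S\<close>.\<close>
  define T where "T x = C * (\<Sum>i<n. 2 powr p * (ind K x * \<bar>wgrad n U f i x\<bar> powr p + S x))" for x
  have T: "integrable (leb n) T"
    unfolding T_def using S(1) Lp_loc_integrable_abs[OF Lp_imp_Lp_loc[OF wgrad_W1p(2)[OF n U fW]] K]
    by (intro integrable_mult_right Bochner_Integration.integrable_sum Bochner_Integration.integrable_add) auto
  have T0: "0 \<le> T x" for x unfolding T_def using C(1) S(2) by (intro mult_nonneg_nonneg sum_nonneg) auto
  have z: "energy x (\<lambda>i. 0) = 0" for x using energy_cmult[of x 0 "\<lambda>_. 0"] by simp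
  show thesis
  proof (rule that[OF F K fz _ Fl _ _ T _ gz])
    show "\<forall>m. \<forall>x\<in>U. x \<notin> K \<longrightarrow> F m x = 0" "\<forall>m. \<forall>x\<in>U. x \<notin> K \<longrightarrow> (\<forall>i<n. pd i (F m) x = 0)"
      using Fz by blast+
    show "\<forall>m. \<forall>x\<in>U. \<bar>F m x\<bar> \<le> B + 1" using FB by blast
    show "\<forall>x\<in>U. \<bar>f x\<bar> \<le> B + 1" using fB by force
    show "AE x\<in>U in leb n. energy x (grad f x) \<le> T x
       \<and> (\<forall>m. energy x (\<lambda>i. pd i (F m) x) \<le> T x)
       \<and> (\<forall>i<n. (\<lambda>m. pd i (F m) x) \<longlonglongrightarrow> grad f x i)"
      using C(2) gz gl
    proof eventually_elim
      case (elim x)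
      show ?case
      proof (intro impI)
        assume x: "x \<in> U"
        have lim: "(\<lambda>m. pd i (F m) x) \<longlonglongrightarrow> grad f x i" if i: "i < n" for i
        proof -
          have "(\<lambda>m. pd i (F m) x - grad f x i) \<longlonglongrightarrow> 0"
            by (rule powr_geometric_tendsto_0[OF p1, of "S x"]) (use elim(3) x i S(2) in auto)
          then show ?thesis by (simp only: LIM_zero_iff)
        qed
        have Eb: "energy x (\<lambda>i. pd i (F m) x) \<le> T x" for m
        proof (cases "x \<in> K")
          case False
          have "energy x (\<lambda>i. pd i (F m) x) = energy x (\<lambda>i. 0)"
            by (rule energy_cong) (use Fz x False in auto)
          then show ?thesis using z T0 by simp
        next
          case True
          have le: "\<bar>pd i (F m) x\<bar> powr p \<le> 2 powr p * (ind K x * \<bar>wgrad n U f i x\<bar> powr p + S x)"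
            if i: "i < n" for i
          proof -
            have h: "(1/2::real) ^ m * S x \<le> 1 * S x" using S(2) by (intro mult_right_mono power_le_one) auto
            have "\<bar>pd i (F m) x - grad f x i\<bar> powr p \<le> S x"
              using elim(3)[rule_format, OF x i, of m] h by simp
            moreover have "\<bar>grad f x i + (pd i (F m) x - grad f x i)\<bar> powr p
                \<le> 2 powr p * (\<bar>grad f x i\<bar> powr p + \<bar>pd i (F m) x - grad f x i\<bar> powr p)"
              using p by (intro powr_sum2_le) auto
            ultimately have "\<bar>pd i (F m) x\<bar> powr p \<le> 2 powr p * (\<bar>grad f x i\<bar> powr p + S x)"
              by (smt (verit) mult_left_mono powr_ge_zero)
            then show ?thesis using True by simp
          qed
          have "energy x (\<lambda>i. pd i (F m) x) \<le> C * (\<Sum>i<n. \<bar>pd i (F m) x\<bar> powr p)"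
            using elim(1) True by blast
          also have "\<dots> \<le> T x" unfolding T_def using C(1) le by (intro mult_left_mono sum_mono) auto
          finally show ?thesis .
        qed
        have "energy x (grad f x) \<le> T x"
          by (rule LIMSEQ_le_const2[OF energy_tendsto[OF lim]]) (use Eb in auto)
        then show "energy x (grad f x) \<le> T x \<and> (\<forall>m. energy x (\<lambda>i. pd i (F m) x) \<le> T x)
            \<and> (\<forall>i<n. (\<lambda>m. pd i (F m) x) \<longlonglongrightarrow> grad f x i)" using Eb lim by blast
      qed
    qed
  qed
qed

end

subsection \<open>The Picone identity\<close>

lemma set_dominated_convergence:
  fixes f w :: "'a \<Rightarrow> real"
  assumes f: "set_borel_measurable M A f" and g: "\<And>m. set_borel_measurable M A (g m)" and w: "integrable M w"
    and lim: "AE x\<in>A in M. (\<lambda>m. g m x) \<longlonglongrightarrow> f x"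
    and le: "\<And>m. AE x\<in>A in M. \<bar>g m x\<bar> \<le> w x"
  shows "set_integrable M A f" "(\<lambda>m. LINT x:A|M. g m x) \<longlonglongrightarrow> (LINT x:A|M. f x)"
proof -
  have w': "integrable M (\<lambda>x. \<bar>w x\<bar>)" using w by simp
  have l: "AE x in M. (\<lambda>m. ind A x *\<^sub>R g m x) \<longlonglongrightarrow> ind A x *\<^sub>R f x"
    using lim by eventually_elim (auto simp: indicator_def)
  have b: "AE x in M. norm (ind A x *\<^sub>R g m x) \<le> \<bar>w x\<bar>" for m
    using le[of m] by eventually_elim (auto simp: indicator_def)
  note m = f[unfolded set_borel_measurable_def] g[unfolded set_borel_measurable_def]
  show "set_integrable M A f" unfolding set_integrable_def
    by (rule integrable_dominated_convergence[OF m w' l b])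
  show "(\<lambda>m. LINT x:A|M. g m x) \<longlonglongrightarrow> (LINT x:A|M. f x)" unfolding set_lebesgue_integral_def
    by (rule integral_dominated_convergence[OF m w' l b])
qed

text \<open>Powers of the positive part with exponent above 1 are continuously differentiable: at 0
  the difference quotient is at most \<open>|h|^(k-1)\<close>. They are the building blocks of
  \<open>|.|^p\<close> and of the cut-off function.\<close>

lemma DERIV_pos_powr:
  fixes k :: real
  assumes k: "k > 1"
  shows "((\<lambda>t. max 0 t powr k) has_real_derivative k * max 0 t powr (k - 1)) (at t)"
proof -
  consider "t > 0" | "t < 0" | "t = 0" by linarith
  then show ?thesis
  proof cases
    case 1
    have "((\<lambda>t. t powr k) has_real_derivative k * t powr (k - 1)) (at t)" by (rule has_real_derivative_powr[OF 1])
    moreover have "\<forall>\<^sub>F x in nhds t. max 0 x powr k = x powr k"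
      using eventually_nhds_in_open[of "{0<..}" t] 1 by (auto elim!: eventually_mono)
    ultimately show ?thesis using 1 by (subst DERIV_cong_ev) auto
  next
    case 2
    have "((\<lambda>t. 0) has_real_derivative 0) (at t)" by simp
    moreover have "\<forall>\<^sub>F x in nhds t. max 0 x powr k = 0"
      using eventually_nhds_in_open[of "{..<0}" t] 2 by (auto elim!: eventually_mono)
    ultimately show ?thesis using 2 k by (subst DERIV_cong_ev[where g = "\<lambda>_. 0"]) auto
  next
    case 3
    have "((\<lambda>h. max 0 h powr k / h) \<longlongrightarrow> 0) (at 0)"
    proof (rule Lim_null_comparison)
      have "norm (max 0 h powr k / h) \<le> \<bar>h\<bar> powr (k - 1)" if "h \<noteq> 0" for h :: real
      proof (cases "h > 0")
        case False
        then have "max 0 h = 0" by simp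
        then show ?thesis by simp
      qed (simp add: powr_diff)
      then show "\<forall>\<^sub>F h in at 0. norm (max 0 h powr k / h) \<le> \<bar>h\<bar> powr (k - 1)"
        by (simp add: eventually_at_filter)
      have "((\<lambda>h::real. \<bar>h\<bar>) \<longlongrightarrow> 0) (at 0)" by (rule tendsto_rabs_zero[OF tendsto_ident_at])
      then have "((\<lambda>h::real. \<bar>h\<bar> powr (k - 1)) \<longlongrightarrow> 0 powr (k - 1)) (at 0)" using k by (intro tendsto_powr2) auto
      then show "((\<lambda>h::real. \<bar>h\<bar> powr (k - 1)) \<longlongrightarrow> 0) (at 0)" using k by simp
    qed
    then show ?thesis using 3 k by (simp add: DERIV_def)
  qed
qed

lemma continuous_pos_powr: "k > 0 \<Longrightarrow> continuous_on UNIV (\<lambda>t::real. max 0 t powr k)"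
  by (intro continuous_on_powr' continuous_intros) auto

lemma DERIV_abs_powr:
  assumes "p > 1"
  shows "((\<lambda>t. \<bar>t\<bar> powr p) has_real_derivative p * dual_pow p t) (at t)"
proof -
  have "((\<lambda>t. max 0 t powr p + max 0 (- t) powr p) has_real_derivative
      p * max 0 t powr (p - 1) + p * max 0 (- t) powr (p - 1) * (- 1)) (at t)"
    by (intro DERIV_add DERIV_pos_powr assms DERIV_chain2[OF DERIV_pos_powr[OF assms]] DERIV_minus DERIV_ident)
  moreover have "max 0 t powr p + max 0 (- t) powr p = \<bar>t\<bar> powr p" for t :: real
    using assms by (cases "t \<ge> 0") auto
  moreover have "p * max 0 t powr (p - 1) + p * max 0 (- t) powr (p - 1) * (- 1) = p * dual_pow p t"
    using assms by (cases "t > 0"; cases "t = 0") (auto simp: dual_pow_def)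
  ultimately show ?thesis by simp
qed

lemma continuous_dual_pow:
  assumes "p > 1"
  shows "continuous_on UNIV (dual_pow p)"
proof -
  have "dual_pow p = (\<lambda>t. max 0 t powr (p - 1) - max 0 (- t) powr (p - 1))"
  proof
    fix t :: real
    show "dual_pow p t = max 0 t powr (p - 1) - max 0 (- t) powr (p - 1)"
      using assms by (cases "t > 0"; cases "t = 0") (auto simp: dual_pow_def)
  qed
  moreover have "continuous_on UNIV (\<lambda>t::real. max 0 (- t) powr (p - 1))"
    using assms by (intro continuous_on_powr' continuous_intros) auto
  ultimately show ?thesis using continuous_pos_powr[of "p - 1"] assms by (auto intro!: continuous_on_diff)
qed

context hardy_setting
begin

lemma smooth_partial_measurable:
  assumes F: "F \<in> Cc_smooth n U" and i: "i < n"
  shows "lmeas n U (pd i F)"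
proof -
  have "\<forall>i<n. line_deriv n i F (pd i F)" using Cc_smoothE[OF F] by blast
  then have "cont n (pd i F)" using i by (simp add: line_deriv_def)
  then have "pd i F \<in> C_continuous n U" by (simp add: C_continuous_def continuous_map_sub)
  then show ?thesis by (rule set_measurable_continuous[OF U])
qed

lemma Cc_measurable: "f \<in> Cc n U \<Longrightarrow> lmeas n U f"
  by (rule set_measurable_continuous[OF U]) (simp add: Cc_def)

lemma smooth_in_test_space: "F \<in> Cc_smooth n U \<Longrightarrow> F \<in> test_space"
  using Cc_smooth_imp[OF U _ p1] by blast

lemma pairing_zero: "(\<And>i. i < n \<Longrightarrow> w i = 0) \<Longrightarrow> pairing x v w = 0"
  unfolding pairing_def scaled_def by simp

lemma dual_pow_u_measurable: "lmeas n U (\<lambda>x. dual_pow p (u x))"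
proof -
  have "u \<in> borel_measurable (restrict_space (leb n) U)"
    using set_measurable_continuous[OF U u] set_measurable_restrict_iff[OF U_sets] by blast
  then show ?thesis unfolding set_measurable_restrict_iff[OF U_sets] dual_pow_def by measurable
qed

lemma V_measurable: "lmeas n U V" using V by (simp add: Lp_loc_def)

lemma smooth_euler:
  assumes F: "F \<in> Cc_smooth n U"
  shows "(LINT x:U|leb n. pairing x (grad u x) (\<lambda>i. pd i F x))
    + (LINT x:U|leb n. V x * (dual_pow p (u x) * F x)) = 0"
proof -
  have 1: "(LINT x:U|leb n. norm_sa n s a x (\<lambda>i. wgrad n U u i x) powr (p - s) *
           (\<Sum>i<n. a i x * \<bar>wgrad n U u i x\<bar> powr (s - 2) * wgrad n U u i x * pd i F x))
     = (LINT x:U|leb n. pairing x (grad u x) (\<lambda>i. pd i F x))"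
    unfolding set_lebesgue_integral_def
    by (intro Bochner_Integration.integral_cong refl) (auto simp: indicator_def pairing_eq)
  have 2: "(LINT x:U|leb n. V x * \<bar>u x\<bar> powr (p - 2) * u x * F x)
     = (LINT x:U|leb n. V x * (dual_pow p (u x) * F x))"
    unfolding dual_pow_alt[symmetric] by (simp add: mult.assoc)
  show ?thesis using sol F unfolding positive_solution_def 1[symmetric] 2[symmetric] by blast
qed

lemma u_dual_pow_bound:
  assumes K: "compact_in n K" "K \<subseteq> U"
  obtains D where "D \<ge> 0" "\<forall>x\<in>K. \<bar>dual_pow p (u x)\<bar> \<le> D"
proof -
  obtain D where D: "D > 0" "\<forall>x\<in>K. \<bar>u x\<bar> \<le> D"
    using continuous_bounded_on_compact[of n U u K] u K unfolding C_continuous_def by blast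
  have "\<forall>x\<in>K. \<bar>dual_pow p (u x)\<bar> \<le> D powr (p - 1)"
    using D p by (auto simp: abs_dual_pow[OF p] intro!: powr_mono2)
  then show thesis by (rule that[rotated]) simp
qed

text \<open>Extends the weak equation from smooth functions to the test space, which contains
  \<open>|f|^p / u^(p-1)\<close>.\<close>

lemma euler:
  assumes f: "f \<in> test_space"
  shows "set_integrable (leb n) U (\<lambda>x. pairing x (grad u x) (grad f x))"
    "(LINT x:U|leb n. pairing x (grad u x) (grad f x))
      + (LINT x:U|leb n. V x * (dual_pow p (u x) * f x)) = 0"
proof -
  obtain F K B S where F: "\<forall>m. F m \<in> Cc_smooth n U" and K: "compact_in n K" "K \<subseteq> U"
    and fz: "\<forall>x\<in>U. x \<notin> K \<longrightarrow> f x = 0" and Fz: "\<forall>m. \<forall>x\<in>U. x \<notin> K \<longrightarrow> F m x = 0"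
    and Fl: "\<forall>m. \<forall>x\<in>U. \<bar>F m x - f x\<bar> \<le> (1/2) ^ m" and B: "\<forall>m. \<forall>x\<in>U. \<bar>F m x\<bar> \<le> B" "\<forall>x\<in>U. \<bar>f x\<bar> \<le> B"
    and S: "integrable (leb n) S"
    and lim: "AE x\<in>U in leb n. energy x (grad f x) \<le> S x
       \<and> (\<forall>m. energy x (\<lambda>i. pd i (F m) x) \<le> S x)
       \<and> (\<forall>i<n. (\<lambda>m. pd i (F m) x) \<longlonglongrightarrow> grad f x i)"
    and gz: "AE x\<in>U in leb n. x \<notin> K \<longrightarrow> (\<forall>i<n. grad f x i = 0)"
    and Gz: "\<forall>m. \<forall>x\<in>U. x \<notin> K \<longrightarrow> (\<forall>i<n. pd i (F m) x = 0)"
    by (rule energy_density[OF f])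
  obtain C where C: "C > 0" "AE x\<in>K in leb n. (\<forall>\<xi>. energy x \<xi> \<le> C * (\<Sum>i<n. \<bar>\<xi> i\<bar> powr p))"
    by (rule energy_bound[OF K])
  obtain D where D: "D \<ge> 0" "\<forall>x\<in>K. \<bar>dual_pow p (u x)\<bar> \<le> D" by (rule u_dual_pow_bound[OF K])
  \<comment> \<open>The right-hand side of \<open>abs_pairing_le\<close> divided by
    \<open>p\<close>, with both energies replaced by integrable bounds.\<close>
  define T where "T x = (S x + (p - 1) * (C * (\<Sum>i<n. ind K x * \<bar>wgrad n U u i x\<bar> powr p))) / p" for x
  have T: "integrable (leb n) T"
    unfolding T_def using S Lp_loc_integrable_abs[OF wgrad_W1p_loc(2)[OF n U u_W1p_loc] K]
    by (intro integrable_divide integrable_mult_right Bochner_Integration.integrable_sum Bochner_Integration.integrable_add) auto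
  have meas: "lmeas n U (\<lambda>x. pairing x (grad u x) (grad f x))"
    by (rule pairing_measurable) (use f in \<open>auto intro: u_grad_measurable wgrad_measurable\<close>)
  have measF: "lmeas n U (\<lambda>x. pairing x (grad u x) (\<lambda>i. pd i (F m) x))" for m
    by (rule pairing_measurable) (use F in \<open>auto intro: u_grad_measurable smooth_partial_measurable\<close>)
  have plim: "AE x\<in>U in leb n. (\<lambda>m. pairing x (grad u x) (\<lambda>i. pd i (F m) x))
      \<longlonglongrightarrow> pairing x (grad u x) (grad f x)"
    using lim
  proof eventually_elim
    case (elim x)
    show ?case
    proof
      assume "x \<in> U"
      with elim show "(\<lambda>m. pairing x (grad u x) (\<lambda>i. pd i (F m) x)) \<longlonglongrightarrow> pairing x (grad u x) (grad f x)"
        by (intro pairing_tendsto) simp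
    qed
  qed
  have ple: "AE x\<in>U in leb n. \<bar>pairing x (grad u x) (\<lambda>i. pd i (F m) x)\<bar> \<le> T x" for m
    using lim C(2)
  proof eventually_elim
    case (elim x)
    show ?case
    proof
      assume x: "x \<in> U"
      have S0: "energy x (\<lambda>i. pd i (F m) x) \<le> S x" using elim(1) x by blast
      show "\<bar>pairing x (grad u x) (\<lambda>i. pd i (F m) x)\<bar> \<le> T x"
      proof (cases "x \<in> K")
        case False
        have "pairing x (grad u x) (\<lambda>i. pd i (F m) x) = 0"
          by (rule pairing_zero) (use Gz x False in blast)
        moreover have "T x = S x / p" using False by (simp add: T_def)
        moreover have "0 \<le> S x" using S0 energy_nonneg[of x "\<lambda>i. pd i (F m) x"] by linarith
        ultimately show ?thesis using p by simp
      next
        case True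
        have "energy x (grad u x) \<le> C * (\<Sum>i<n. \<bar>wgrad n U u i x\<bar> powr p)" using elim(2) True by blast
        then have "(p - 1) * energy x (grad u x) \<le> (p - 1) * (C * (\<Sum>i<n. \<bar>wgrad n U u i x\<bar> powr p))"
          using p by (intro mult_left_mono) auto
        moreover have "p * T x = S x + (p - 1) * (C * (\<Sum>i<n. \<bar>wgrad n U u i x\<bar> powr p))"
          using p True by (simp add: T_def)
        ultimately have "p * \<bar>pairing x (grad u x) (\<lambda>i. pd i (F m) x)\<bar> \<le> p * T x"
          using abs_pairing_le[of x "grad u x" "\<lambda>i. pd i (F m) x"] S0 by linarith
        then show ?thesis using p by simp
      qed
    qed
  qed
  note A = set_dominated_convergence[OF meas measF T plim ple]
  show "set_integrable (leb n) U (\<lambda>x. pairing x (grad u x) (grad f x))" by (rule A(1))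
  have Vm: "lmeas n U (\<lambda>x. V x * (dual_pow p (u x) * h x))" if "h \<in> Cc n U" for h
    by (intro set_measurable_mult V_measurable dual_pow_u_measurable Cc_measurable that)
  have FC: "F m \<in> Cc n U" for m using smooth_in_test_space F by blast
  have fC: "f \<in> Cc n U" using f by blast
  define W where "W x = (D * B) * (ind K x * \<bar>V x\<bar> powr 1)" for x
  have W: "integrable (leb n) W" unfolding W_def by (intro integrable_mult_right Lp_loc_integrable_abs[OF V K])
  have vlim: "AE x\<in>U in leb n. (\<lambda>m. V x * (dual_pow p (u x) * F m x)) \<longlonglongrightarrow> V x * (dual_pow p (u x) * f x)"
  proof (intro AE_I2 impI tendsto_mult tendsto_const)
    fix x assume "x \<in> U"
    then show "(\<lambda>m. F m x) \<longlonglongrightarrow> f x" using Fl by (intro half_power_tendsto) blast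
  qed
  have vle: "AE x\<in>U in leb n. \<bar>V x * (dual_pow p (u x) * F m x)\<bar> \<le> W x" for m
  proof (intro AE_I2 impI)
    fix x assume x: "x \<in> U"
    show "\<bar>V x * (dual_pow p (u x) * F m x)\<bar> \<le> W x"
    proof (cases "x \<in> K")
      case True
      have "\<bar>V x\<bar> * (\<bar>dual_pow p (u x)\<bar> * \<bar>F m x\<bar>) \<le> \<bar>V x\<bar> * (D * B)"
        using D B(1) True x by (intro mult_left_mono mult_mono) auto
      then show ?thesis using True by (simp add: W_def abs_mult mult_ac)
    qed (use Fz x in \<open>simp add: W_def\<close>)
  qed
  note E = set_dominated_convergence(2)[OF Vm[OF fC] Vm[OF FC] W vlim vle]
  have "(\<lambda>m. 0) \<longlonglongrightarrow> (LINT x:U|leb n. pairing x (grad u x) (grad f x))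
      + (LINT x:U|leb n. V x * (dual_pow p (u x) * f x))"
    using tendsto_add[OF A(2) E] smooth_euler F by simp
  then show "(LINT x:U|leb n. pairing x (grad u x) (grad f x))
      + (LINT x:U|leb n. V x * (dual_pow p (u x) * f x)) = 0"
    using LIMSEQ_unique tendsto_const by blast
qed

lemma energy_integrable:
  assumes f: "f \<in> test_space"
  shows "set_integrable (leb n) U (\<lambda>x. energy x (grad f x))"
proof -
  obtain S where S: "integrable (leb n) S" "AE x\<in>U in leb n. energy x (grad f x) \<le> S x"
  proof (rule energy_density[OF f])
    fix F :: "nat \<Rightarrow> point \<Rightarrow> real" and S
    assume "integrable (leb n) S" "AE x\<in>U in leb n. energy x (grad f x) \<le> S x
       \<and> (\<forall>m. energy x (\<lambda>i. pd i (F m) x) \<le> S x)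
       \<and> (\<forall>i<n. (\<lambda>m. pd i (F m) x) \<longlonglongrightarrow> grad f x i)"
    then show thesis by (auto intro: that elim!: eventually_mono)
  qed
  show ?thesis
  proof (rule set_integrable_bound_leb[OF S(1)])
    show "lmeas n U (\<lambda>x. energy x (grad f x))"
      by (rule energy_measurable) (use f in \<open>auto intro: wgrad_measurable\<close>)
    show "AE x\<in>U in leb n. \<bar>energy x (grad f x)\<bar> \<le> S x"
      using S(2) energy_nonneg by simp
  qed
qed

lemma Cc_integrable:
  assumes f: "f \<in> Cc n U" and h: "h \<in> Lp_loc n U 1"
  shows "set_integrable (leb n) U (\<lambda>x. h x * \<bar>f x\<bar> powr p)"
proof -
  obtain K where K: "compact_in n K" "K \<subseteq> U" "\<forall>x\<in>U. x \<notin> K \<longrightarrow> f x = 0" by (rule CcE[OF f])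
  show ?thesis by (rule V_integrable[OF _ K h]) (use f in \<open>simp add: Cc_def\<close>)
qed

lemma Q_eq_add:
  assumes f: "f \<in> test_space"
  shows "Q f = (LINT x:U|leb n. energy x (grad f x)) + (LINT x:U|leb n. V x * \<bar>f x\<bar> powr p)"
  unfolding Q_eq by (rule set_integral_add(2)[OF energy_integrable[OF f] Cc_integrable[OF _ V]]) (use f in blast)

definition picone :: "(point \<Rightarrow> real) \<Rightarrow> point \<Rightarrow> real" where
  "picone f x = excess x (grad f x) (\<lambda>i. (f x / u x) * wgrad n U u i x)"

lemma picone_nonneg: "0 \<le> picone f x" by (simp add: picone_def excess_nonneg)

lemma quot_test_space:
  assumes f: "f \<in> test_space"
    and H: "\<And>t. (H has_real_derivative H' t) (at t)" "continuous_on UNIV H'" "H 0 = 0" "H' 0 = 0"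
  shows "quot_comp H f u \<in> test_space"
    "AE x\<in>U in leb n. (\<forall>i<n. wgrad n U (quot_comp H f u) i x
       = quot_grad H H' f u (wgrad n U f i) (wgrad n U u i) x)"
proof -
  have fW: "f \<in> W1p n U p" "f \<in> Cc n U" using f by auto
  have "quot_comp H f u \<in> W1p n U p"
    by (rule quot_comp_W1p(1)[OF n p1 U fW u_W1p_loc u _ H]) (rule u_pos)
  moreover have "quot_comp H f u \<in> Cc n U"
    by (rule quot_comp_W1p(2)[OF n p1 U fW u_W1p_loc u _ H]) (rule u_pos)
  ultimately show "quot_comp H f u \<in> test_space" by blast
  show "AE x\<in>U in leb n. (\<forall>i<n. wgrad n U (quot_comp H f u) i x
       = quot_grad H H' f u (wgrad n U f i) (wgrad n U u i) x)"
    by (rule quot_comp_W1p(3)[OF n p1 U fW u_W1p_loc u _ H]) (rule u_pos)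
qed

text \<open>The Euler-Lagrange equation is tested with \<open>\<bar>f\<bar>\<^sup>p / u\<^sup>p\<^sup>-\<^sup>1\<close>.\<close>

lemma picone_identity:
  assumes f: "f \<in> test_space"
  shows "set_integrable (leb n) U (picone f)" "Q f = (LINT x:U|leb n. picone f x)"
proof -
  define \<Phi> where "\<Phi> = quot_comp (\<lambda>t. \<bar>t\<bar> powr p) f u"
  have c: "continuous_on UNIV (\<lambda>t. p * dual_pow p t)"
    by (intro continuous_on_mult continuous_on_const continuous_dual_pow[OF p])
  have z: "\<bar>0::real\<bar> powr p = 0" "p * dual_pow p 0 = 0" by auto
  note q = quot_test_space[OF f DERIV_abs_powr[OF p] c z, folded \<Phi>_def]
  note \<Phi> = q(1)
  have id: "AE x\<in>U in leb n. picone f x = energy x (grad f x) - pairing x (grad u x) (grad \<Phi> x)"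
    using q(2)
  proof eventually_elim
    case (elim x)
    show ?case
    proof
      assume x: "x \<in> U"
      define t where "t = f x / u x"
      have "pairing x (grad u x) (grad \<Phi> x) = pairing x (grad u x)
          (\<lambda>i. (\<bar>t\<bar> powr p - p * \<bar>t\<bar> powr p) * grad u x i + (p * dual_pow p t) * grad f x i)"
      proof (rule pairing_cong)
        fix i assume i: "i < n"
        have "grad \<Phi> x i = \<bar>t\<bar> powr p * grad u x i + (p * dual_pow p t) * (grad f x i - t * grad u x i)"
          using elim x i by (simp add: quot_grad_def t_def)
        also have "\<dots> = (\<bar>t\<bar> powr p - p * (dual_pow p t * t)) * grad u x i + (p * dual_pow p t) * grad f x i"
          by (simp add: algebra_simps)
        finally show "grad \<Phi> x i = (\<bar>t\<bar> powr p - p * \<bar>t\<bar> powr p) * grad u x i + (p * dual_pow p t) * grad f x i"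
          unfolding dual_pow_self .
      qed simp
      then have P: "pairing x (grad u x) (grad \<Phi> x) = (\<bar>t\<bar> powr p - p * \<bar>t\<bar> powr p) * energy x (grad u x)
          + (p * dual_pow p t) * pairing x (grad u x) (grad f x)"
        unfolding pairing_add_right pairing_cmult_right pairing_self .
      have "picone f x = energy x (grad f x) + (p - 1) * (\<bar>t\<bar> powr p * energy x (grad u x))
          - p * (dual_pow p t * pairing x (grad u x) (grad f x))"
        unfolding picone_def excess_eq t_def[symmetric] energy_cmult pairing_cmult_left ..
      then show "picone f x = energy x (grad f x) - pairing x (grad u x) (grad \<Phi> x)"
        unfolding P by (simp add: algebra_simps)
    qed
  qed
  note E = energy_integrable[OF f] and P = euler(1)[OF \<Phi>]
  note D = set_integral_diff[OF E P]
  have m: "lmeas n U (\<lambda>x. energy x (grad f x) - pairing x (grad u x) (grad \<Phi> x))"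
    using D(1) by (simp add: set_integrable_def set_borel_measurable_def)
  note I = set_integral_cong_AE'[OF m id]
  show "set_integrable (leb n) U (picone f)" using I(2) D(1) by blast
  \<comment> \<open>The test function is made for this: \<open>u^(p-1) * \<Phi> = |f|^p\<close> on
    \<open>U\<close>.\<close>
  have V\<Phi>: "(LINT x:U|leb n. V x * (dual_pow p (u x) * \<Phi> x)) = (LINT x:U|leb n. V x * \<bar>f x\<bar> powr p)"
    unfolding set_lebesgue_integral_def
  proof (rule Bochner_Integration.integral_cong[OF refl])
    fix x
    have "dual_pow p (u x) * \<Phi> x = \<bar>f x\<bar> powr p" if "x \<in> U"
    proof -
      have up: "0 < u x" by (rule u_pos[OF that])
      have "dual_pow p (u x) * \<Phi> x = (dual_pow p (u x) * u x) * \<bar>f x / u x\<bar> powr p"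
        by (simp add: \<Phi>_def quot_comp_def)
      also have "\<dots> = \<bar>u x * (f x / u x)\<bar> powr p" unfolding dual_pow_self by (simp add: powr_mult abs_mult del: times_divide_eq_right)
      finally show ?thesis using up by simp
    qed
    then show "ind U x *\<^sub>R (V x * (dual_pow p (u x) * \<Phi> x)) = ind U x *\<^sub>R (V x * \<bar>f x\<bar> powr p)"
      by (auto simp: indicator_def)
  qed
  have "(LINT x:U|leb n. picone f x) = (LINT x:U|leb n. energy x (grad f x)) - (LINT x:U|leb n. pairing x (grad u x) (grad \<Phi> x))"
    using I(1) D(2) by simp
  then show "Q f = (LINT x:U|leb n. picone f x)"
    using euler(2)[OF \<Phi>] unfolding V\<Phi> Q_eq_add[OF f] by linarith
qed

lemma Q_nonneg: "f \<in> test_space \<Longrightarrow> 0 \<le> Q f"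
  unfolding picone_identity(2) set_lebesgue_integral_def
  by (rule Bochner_Integration.integral_nonneg) (simp add: picone_nonneg)

text \<open>Hardy-weights are defined with smooth functions, whereas capacity and
  \<open>S_const\<close> use the larger test space. Smooth approximation carries the inequality over
  with the same constant.\<close>

lemma hardy_inequality_extends:
  assumes f: "f \<in> test_space" and g: "g \<in> Lp_loc n U 1"
    and H: "\<forall>\<phi>\<in>Cc_smooth n U. C * (LINT x:U|leb n. \<bar>g x\<bar> * \<bar>\<phi> x\<bar> powr p) \<le> Q \<phi>"
  shows "C * (LINT x:U|leb n. \<bar>g x\<bar> * \<bar>f x\<bar> powr p) \<le> Q f"
proof -
  obtain F K B S where F: "\<forall>m. F m \<in> Cc_smooth n U" and K: "compact_in n K" "K \<subseteq> U"
    and fz: "\<forall>x\<in>U. x \<notin> K \<longrightarrow> f x = 0" and Fz: "\<forall>m. \<forall>x\<in>U. x \<notin> K \<longrightarrow> F m x = 0"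
    and Fl: "\<forall>m. \<forall>x\<in>U. \<bar>F m x - f x\<bar> \<le> (1/2) ^ m" and B: "\<forall>m. \<forall>x\<in>U. \<bar>F m x\<bar> \<le> B" "\<forall>x\<in>U. \<bar>f x\<bar> \<le> B"
    and S: "integrable (leb n) S"
    and lim: "AE x\<in>U in leb n. energy x (grad f x) \<le> S x
       \<and> (\<forall>m. energy x (\<lambda>i. pd i (F m) x) \<le> S x)
       \<and> (\<forall>i<n. (\<lambda>m. pd i (F m) x) \<longlonglongrightarrow> grad f x i)"
    and gz: "AE x\<in>U in leb n. x \<notin> K \<longrightarrow> (\<forall>i<n. grad f x i = 0)"
    and Gz: "\<forall>m. \<forall>x\<in>U. x \<notin> K \<longrightarrow> (\<forall>i<n. pd i (F m) x = 0)"
    by (rule energy_density[OF f])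
  have FT: "F m \<in> test_space" for m using smooth_in_test_space F by blast
  have Em: "lmeas n U (\<lambda>x. energy x (\<lambda>i. pd i (F m) x))" for m
    by (rule energy_measurable) (use F in \<open>auto intro: smooth_partial_measurable\<close>)
  have Em': "lmeas n U (\<lambda>x. energy x (grad f x))"
    by (rule energy_measurable) (use f in \<open>auto intro: wgrad_measurable\<close>)
  have EF: "(LINT x:U|leb n. energy x (grad (F m) x)) = (LINT x:U|leb n. energy x (\<lambda>i. pd i (F m) x))" for m
  proof (rule set_integral_cong_AE'(1)[OF Em])
    have "AE x in leb n. \<forall>i\<in>{..<n}. x \<in> U \<longrightarrow> wgrad n U (F m) i x = pd i (F m) x"
      using wgrad_AE[OF n U Cc_smooth_imp(1)[OF U F[rule_format] p1]] by (subst AE_ball_countable) auto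
    then show "AE x\<in>U in leb n. energy x (grad (F m) x) = energy x (\<lambda>i. pd i (F m) x)"
      by eventually_elim (auto intro!: energy_cong)
  qed
  have Elim: "(\<lambda>m. LINT x:U|leb n. energy x (grad (F m) x)) \<longlonglongrightarrow> (LINT x:U|leb n. energy x (grad f x))"
    unfolding EF
  proof (rule set_dominated_convergence(2)[OF Em' Em S])
    show "AE x\<in>U in leb n. (\<lambda>m. energy x (\<lambda>i. pd i (F m) x)) \<longlonglongrightarrow> energy x (grad f x)"
      using lim
    proof eventually_elim
      case (elim x)
      show ?case
      proof
        assume "x \<in> U"
        with elim show "(\<lambda>m. energy x (\<lambda>i. pd i (F m) x)) \<longlonglongrightarrow> energy x (grad f x)"
          by (intro energy_tendsto) simp
      qed
    qed
    show "AE x\<in>U in leb n. \<bar>energy x (\<lambda>i. pd i (F m) x)\<bar> \<le> S x" for m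
      using lim by eventually_elim (simp add: energy_nonneg)
  qed
  have hlim: "(\<lambda>m. LINT x:U|leb n. h x * \<bar>F m x\<bar> powr p) \<longlonglongrightarrow> (LINT x:U|leb n. h x * \<bar>f x\<bar> powr p)"
    if h: "h \<in> Lp_loc n U 1" for h
  proof (rule set_dominated_convergence(2))
    have hm: "lmeas n U h" using h by (simp add: Lp_loc_def)
    show "lmeas n U (\<lambda>x. h x * \<bar>f x\<bar> powr p)"
      by (intro set_measurable_mult hm set_measurable_abs_powr Cc_measurable) (use f in blast)
    show "lmeas n U (\<lambda>x. h x * \<bar>F m x\<bar> powr p)" for m
      by (intro set_measurable_mult hm set_measurable_abs_powr Cc_measurable) (use FT in blast)
    show "integrable (leb n) (\<lambda>x. B powr p * (ind K x * \<bar>h x\<bar> powr 1))"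
      by (intro integrable_mult_right Lp_loc_integrable_abs[OF h K])
    show "AE x\<in>U in leb n. (\<lambda>m. h x * \<bar>F m x\<bar> powr p) \<longlonglongrightarrow> h x * \<bar>f x\<bar> powr p"
    proof (intro AE_I2 impI tendsto_mult tendsto_const)
      fix x assume "x \<in> U"
      then have "(\<lambda>m. F m x) \<longlonglongrightarrow> f x" using Fl by (intro half_power_tendsto) blast
      then have "(\<lambda>m. \<bar>F m x\<bar>) \<longlonglongrightarrow> \<bar>f x\<bar>" by (rule tendsto_rabs)
      then show "(\<lambda>m. \<bar>F m x\<bar> powr p) \<longlonglongrightarrow> \<bar>f x\<bar> powr p" using p by (intro tendsto_powr2) auto
    qed
    show "AE x\<in>U in leb n. \<bar>h x * \<bar>F m x\<bar> powr p\<bar> \<le> B powr p * (ind K x * \<bar>h x\<bar> powr 1)" for m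
    proof (intro AE_I2 impI)
      fix x assume x: "x \<in> U"
      show "\<bar>h x * \<bar>F m x\<bar> powr p\<bar> \<le> B powr p * (ind K x * \<bar>h x\<bar> powr 1)"
      proof (cases "x \<in> K")
        case True
        have "\<bar>F m x\<bar> powr p \<le> B powr p" using B(1) x p by (intro powr_mono2) auto
        then have "\<bar>h x\<bar> * \<bar>F m x\<bar> powr p \<le> \<bar>h x\<bar> * B powr p" by (rule mult_left_mono) simp
        then show ?thesis using True by (simp add: abs_mult mult_ac)
      qed (use Fz x p in simp)
    qed
  qed
  have "(\<lambda>x. \<bar>g x\<bar>) \<in> Lp_loc n U 1"
    using g set_measurable_abs_powr[of "leb n" U g 1] by (simp add: Lp_loc_def)
  note L = hlim[OF this]
  have Ql: "(\<lambda>m. Q (F m)) \<longlonglongrightarrow> Q f"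
    unfolding Q_eq_add[OF FT] Q_eq_add[OF f] by (intro tendsto_add Elim hlim V)
  show ?thesis
    by (rule LIMSEQ_le[OF tendsto_mult[OF tendsto_const L] Ql]) (use H F in blast)
qed

end

subsection \<open>Truncation of the quotient by the positive solution\<close>

text \<open>The k-th power of the positive part of \<open>|t| - 1\<close>, written as a sum of two
  one-sided powers to avoid differentiating the absolute value.\<close>

definition ramp :: "real \<Rightarrow> real \<Rightarrow> real" where
  "ramp k t = max 0 (t - 1) powr k + max 0 (- t - 1) powr k"

definition ramp' :: "real \<Rightarrow> real \<Rightarrow> real" where
  "ramp' k t = k * max 0 (t - 1) powr (k - 1) - k * max 0 (- t - 1) powr (k - 1)"

text \<open>An even function equal to 0 for \<open>|t| \<le> 1\<close> and to 1 for
  \<open>|t| \<ge> 2\<close>. The square makes the junction at \<open>ramp k t = 1\<close>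
  continuously differentiable.\<close>

definition cut :: "real \<Rightarrow> real \<Rightarrow> real" where
  "cut k t = 1 - max 0 (1 - ramp k t) powr 2"

definition cut' :: "real \<Rightarrow> real \<Rightarrow> real" where
  "cut' k t = 2 * max 0 (1 - ramp k t) powr (2 - 1) * ramp' k t"

lemma DERIV_ramp:
  assumes "k > 1"
  shows "(ramp k has_real_derivative ramp' k t) (at t)"
proof -
  have "((\<lambda>t. max 0 (t - 1) powr k + max 0 (- t - 1) powr k) has_real_derivative
      k * max 0 (t - 1) powr (k - 1) * (1 - 0) + k * max 0 (- t - 1) powr (k - 1) * (- 1 - 0)) (at t)"
    by (intro DERIV_add DERIV_chain2[OF DERIV_pos_powr[OF assms]] DERIV_minus DERIV_ident DERIV_const DERIV_diff)
  then show ?thesis unfolding ramp_def[abs_def] ramp'_def by simp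
qed

lemma DERIV_cut:
  assumes "k > 1"
  shows "(cut k has_real_derivative cut' k t) (at t)"
proof -
  have "((\<lambda>t. 1 - max 0 (1 - ramp k t) powr 2) has_real_derivative
      0 - 2 * max 0 (1 - ramp k t) powr (2 - 1) * (0 - ramp' k t)) (at t)"
    by (intro DERIV_diff DERIV_const DERIV_chain2[OF DERIV_pos_powr] DERIV_ramp[OF assms]) simp
  then show ?thesis unfolding cut_def[abs_def] cut'_def by simp
qed

lemma continuous_cut':
  assumes "k > 1"
  shows "continuous_on UNIV (cut' k)"
proof -
  have "continuous_on UNIV (ramp k)"
    using DERIV_ramp[OF assms] by (meson DERIV_continuous_on has_field_derivative_at_within)
  then show ?thesis unfolding cut'_def[abs_def] ramp'_def
    using assms by (intro continuous_on_mult continuous_on_diff continuous_on_powr' continuous_intros) auto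
qed

lemma cut_0:
  assumes "k > 1" "\<bar>t\<bar> \<le> 1"
  shows "cut k t = 0" "cut' k t = 0"
  using assms by (auto simp: cut_def cut'_def ramp_def ramp'_def)

lemma ramp_ge_1:
  assumes "k > 1" "2 \<le> \<bar>t\<bar>"
  shows "1 \<le> ramp k t"
proof -
  have "1 \<le> (\<bar>t\<bar> - 1) powr k" using assms by (intro ge_one_powr_ge_zero) auto
  moreover have "(\<bar>t\<bar> - 1) powr k \<le> ramp k t" using assms by (cases "t \<ge> 0") (auto simp: ramp_def)
  ultimately show ?thesis by linarith
qed

lemma cut_1:
  assumes "k > 1" "2 \<le> \<bar>t\<bar>"
  shows "cut k t = 1" "cut' k t = 0"
  using ramp_ge_1[OF assms] by (auto simp: cut_def cut'_def)

text \<open>With \<open>r = z^k\<close> the function is \<open>r * (2 - r)\<close>, comparable to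
  \<open>z^k\<close>, whereas its logarithmic derivative can be as large as a multiple of
  \<open>1/z\<close> near \<open>|t| = 1\<close>.\<close>

lemma cut_estimates:
  assumes k: "k > 1" and t: "1 < \<bar>t\<bar>" "\<bar>t\<bar> < 2"
  defines "z \<equiv> \<bar>t\<bar> - 1"
  shows "0 < z" "z < 1" "0 < cut k t" "cut k t \<le> 2 * z powr k"
    "0 \<le> cut' k t * t / cut k t" "cut' k t * t / cut k t \<le> 4 * k / z"
proof -
  show z: "0 < z" "z < 1" using t by (auto simp: z_def)
  define r where "r = z powr k"
  have r: "0 < r" "r < 1" using z k powr_less_mono2[of k z 1] by (auto simp: r_def)
  have ramp: "ramp k t = r" using t k by (cases "t \<ge> 0") (auto simp: ramp_def r_def z_def)
  have cut: "cut k t = r * (2 - r)"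
    using r by (simp add: cut_def ramp power2_eq_square algebra_simps)
  then have cr: "r * 1 \<le> cut k t" "cut k t \<le> r * 2" unfolding cut using r by (auto intro!: mult_left_mono)
  show c0: "0 < cut k t" using cr r by linarith
  show "cut k t \<le> 2 * z powr k" using cr by (simp add: r_def)
  have rz: "r = z powr (k - 1) * z" using z by (simp add: r_def powr_diff)
  have c': "cut' k t * t = 2 * (1 - r) * (k * z powr (k - 1)) * \<bar>t\<bar>"
    using t k r unfolding cut'_def ramp by (cases "t \<ge> 0") (auto simp: ramp'_def z_def)
  then show "0 \<le> cut' k t * t / cut k t" using r k c0 by simp
  have "2 * (1 - r) * (k * z powr (k - 1)) * \<bar>t\<bar> \<le> 2 * 1 * (k * z powr (k - 1)) * 2"
    using r t k by (intro mult_mono) auto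
  then have "cut' k t * t \<le> (4 * k / z) * r" unfolding c' rz using z by simp
  also have "\<dots> \<le> (4 * k / z) * cut k t" using cr z k by (intro mult_left_mono) auto
  finally show "cut' k t * t / cut k t \<le> 4 * k / z" using c0 by (simp add: pos_divide_le_eq)
qed

text \<open>\<open>cut k\<close> vanishes to order \<open>k\<close> at \<open>\<bar>t\<bar> = 1\<close>, which absorbs the power \<open>M\<close> of the growth estimate
  for the Bregman divergence once \<open>k p \<ge> M\<close>.\<close>

lemma cut_factor_le:
  assumes k: "k > 1" "M \<le> k * p" and p: "p > 0" and M: "M > 0" and t: "1 < \<bar>t\<bar>" "\<bar>t\<bar> < 2"
  shows "\<bar>cut k t / t\<bar> powr p * max 1 (cut' k t * t / cut k t) powr M \<le> 2 powr p * (4 * k) powr M"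
proof -
  define z where "z = \<bar>t\<bar> - 1"
  note e = cut_estimates[OF k(1) t, folded z_def]
  have "\<bar>cut k t / t\<bar> \<le> \<bar>cut k t\<bar> / 1" unfolding abs_divide using t by (intro divide_left_mono) auto
  then have "\<bar>cut k t / t\<bar> powr p \<le> (2 * z powr k) powr p" using e p by (intro powr_mono2) auto
  moreover have "max 1 (cut' k t * t / cut k t) \<le> 4 * k / z"
    using e k by (auto simp: pos_le_divide_eq)
  then have "max 1 (cut' k t * t / cut k t) powr M \<le> (4 * k / z) powr M" using M by (intro powr_mono2) auto
  ultimately have "\<bar>cut k t / t\<bar> powr p * max 1 (cut' k t * t / cut k t) powr M
      \<le> (2 * z powr k) powr p * (4 * k / z) powr M" by (intro mult_mono) auto
  also have "\<dots> = 2 powr p * (4 * k) powr M * z powr (k * p - M)"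
    using e k by (simp add: powr_mult powr_divide powr_powr powr_diff)
  also have "\<dots> \<le> 2 powr p * (4 * k) powr M * 1" using e k by (intro mult_left_mono powr_le1) auto
  finally show ?thesis by simp
qed

lemma compact_superlevel:
  assumes f: "cont_on n U f" and K: "compact_in n K" "K \<subseteq> U"
  shows "compact_in n {x \<in> K. c \<le> f x}"
proof -
  have "cont_on n K f"
    by (rule continuous_map_from_subtopology_mono[OF f K(2)])
  then have "closedin (subtopology (Rn n) K) {x \<in> topspace (subtopology (Rn n) K). f x \<in> {c..}}"
    by (rule closedin_continuous_map_preimage) simp
  moreover have "{x \<in> topspace (subtopology (Rn n) K). f x \<in> {c..}} = {x \<in> K. c \<le> f x}"
    using compactin_subset_topspace[OF K(1)] by auto
  ultimately have "closedin (subtopology (Rn n) K) {x \<in> K. c \<le> f x}" by simp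
  moreover have "compact_space (subtopology (Rn n) K)" using K(1) by (simp add: compact_space_subtopology)
  ultimately have "compactin (subtopology (Rn n) K) {x \<in> K. c \<le> f x}" by (rule closedin_compact_space[rotated])
  then show ?thesis by (simp add: compactin_subtopology)
qed

abbreviation band :: "real \<Rightarrow> real \<Rightarrow> real" where
  "band \<tau> \<equiv> ind {y. \<tau> < \<bar>y\<bar> \<and> \<bar>y\<bar> < 2 * \<tau>}"

text \<open>Each open band spans one factor of 2, and successive levels are halved, so the bands are
  disjoint.\<close>

lemma sum_dyadic_indicator_le_1:
  fixes T y :: real
  assumes T: "T > 0"
  shows "(\<Sum>m<N. ind {y. T * (1/2) ^ m < \<bar>y\<bar> \<and> \<bar>y\<bar> < 2 * (T * (1/2) ^ m)} y :: real) \<le> 1"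
proof -
  define A where "A m = {y. T * (1/2) ^ m < \<bar>y\<bar> \<and> \<bar>y\<bar> < 2 * (T * (1/2) ^ m)}" for m :: nat
  have "A m \<inter> A m' = {}" if "m < m'" for m m'
  proof -
    have "(1/2::real) ^ m' \<le> (1/2) ^ Suc m" using that by (intro power_decreasing) auto
    then have "2 * (T * (1/2) ^ m') \<le> T * (1/2) ^ m" using T by simp
    then show ?thesis by (auto simp: A_def)
  qed
  then have "disjoint_family_on A {..<N}" unfolding disjoint_family_on_def by (metis Int_commute nat_neq_iff)
  then have "(\<Sum>m<N. ind (A m) y :: real) = ind (\<Union>m<N. A m) y"
    by (simp add: indicator_UN_disjoint)
  also have "\<dots> \<le> 1" by (simp add: indicator_def)
  finally show ?thesis by (simp add: A_def)
qed

text \<open>Take the least \<open>m\<close> whose lower threshold is reached. For positive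
  \<open>m\<close> the upper bound is the failure at \<open>m - 1\<close>; for \<open>m = 0\<close>
  it is the hypothesis \<open>y < 4 * T\<close>.\<close>

lemma dyadic_level:
  fixes T y :: real
  assumes "T > 0" "0 < y" "y < 4 * T"
  obtains m :: nat where "2 * (T * (1/2) ^ m) \<le> y" "y < 4 * (T * (1/2) ^ m)"
proof -
  have "\<exists>m. 2 * (T * (1/2) ^ m) \<le> y"
  proof -
    obtain m where "(1/2::real) ^ m < y / (2 * T)" using real_arch_pow_inv[of "y / (2 * T)" "1/2"] assms by auto
    then have "2 * (T * (1/2) ^ m) \<le> y" using assms by (simp add: pos_less_divide_eq mult_ac)
    then show ?thesis ..
  qed
  then obtain m where m: "2 * (T * (1/2) ^ m) \<le> y" "\<forall>j<m. \<not> 2 * (T * (1/2) ^ j) \<le> y"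
    using exists_least_iff[of "\<lambda>m. 2 * (T * (1/2) ^ m) \<le> y"] by blast
  have "y < 4 * (T * (1/2) ^ m)"
  proof (cases m)
    case (Suc j)
    then show ?thesis using m(2) by (auto simp: not_le)
  qed (use assms in simp)
  with m(1) show thesis by (rule that)
qed

text \<open>In \<open>growth\<close> the bound \<open>n\<close> shadows the dimension of the
  setting: the same \<open>C\<close> and \<open>M\<close> serve every dimension.\<close>

locale hardy_growth = hardy_setting +
  fixes C M :: real
  assumes C: "1 \<le> C" and M: "0 < M"
    and growth: "\<And>n y w t. 0 \<le> t \<Longrightarrow>
      bregman p s n (\<lambda>i. y i + t * w i) y \<le> C * max 1 t powr M * bregman p s n (\<lambda>i. y i + w i) y"
begin

text \<open>The 2 makes the cut-off continuously differentiable, the quotient makes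
  \<open>k * p\<close> at least \<open>M\<close>.\<close>

definition "k = max 2 (M / p)"
definition "C1 = C * (2 powr p * (4 * k) powr M)"

lemma k: "k > 1" "M \<le> k * p"
proof -
  show "k > 1" by (simp add: k_def)
  have "M / p \<le> k" by (simp add: k_def)
  then show "M \<le> k * p" using p by (simp add: pos_divide_le_eq)
qed

lemma C1_nonneg: "0 \<le> C1" using C by (simp add: C1_def)

lemma excess_growth:
  assumes "0 \<le> t"
  shows "excess x (\<lambda>i. y i + t * w i) y \<le> C * max 1 t powr M * excess x (\<lambda>i. y i + w i) y"
proof -
  have "scaled s a x (\<lambda>i. y i + t * w i) = (\<lambda>i. scaled s a x y i + t * scaled s a x w i)" for t
    by (simp add: scaled_def fun_eq_iff algebra_simps)
  from this[of t] this[of 1] show ?thesis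
    unfolding excess_def using growth[OF assms, of n "scaled s a x y" "scaled s a x w"] by simp
qed

text \<open>Off the band \<open>cut'\<close> vanishes, both arguments coincide and the divergence is
  0. On the band a common factor \<open>l\<close> is extracted: the truncated gradient is
  \<open>l\<close> times \<open>\<psi> Z + t (v - \<psi> Z)\<close>, where \<open>t\<close> is the
  logarithmic derivative of the cut-off. Homogeneity handles \<open>l\<close>, the growth estimate
  handles \<open>t\<close>, and \<open>cut_factor_le\<close> bounds the product of the two
  factors.\<close>

lemma truncation_pointwise:
  assumes \<tau>: "\<tau> > 0"
  shows "\<tau> powr p * excess x (\<lambda>i. cut k (\<psi> / \<tau>) * Z i + cut' k (\<psi> / \<tau>) / \<tau> * (v i - \<psi> * Z i)) (\<lambda>i. cut k (\<psi> / \<tau>) * Z i)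
    \<le> C1 * (band \<tau> \<psi> * excess x v (\<lambda>i. \<psi> * Z i))"
proof (cases "\<tau> < \<bar>\<psi>\<bar> \<and> \<bar>\<psi>\<bar> < 2 * \<tau>")
  case False
  then have "\<bar>\<psi> / \<tau>\<bar> \<le> 1 \<or> 2 \<le> \<bar>\<psi> / \<tau>\<bar>" using \<tau> by (auto simp: abs_divide pos_le_divide_eq)
  then have "cut' k (\<psi> / \<tau>) = 0" using cut_0(2)[OF k(1)] cut_1(2)[OF k(1)] by blast
  then show ?thesis using False by (simp add: excess_self)
next
  case True
  define \<sigma> where "\<sigma> = \<psi> / \<tau>"
  have \<sigma>: "1 < \<bar>\<sigma>\<bar>" "\<bar>\<sigma>\<bar> < 2" using True \<tau> by (auto simp: \<sigma>_def abs_divide pos_divide_less_eq pos_less_divide_eq)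
  have nz: "\<psi> \<noteq> 0" using True \<tau> by auto
  define l where "l = cut k \<sigma> / \<psi>"
  define t where "t = cut' k \<sigma> * \<sigma> / cut k \<sigma>"
  note e = cut_estimates[OF k(1) \<sigma>]
  have t0: "0 \<le> t" using e by (simp add: t_def)
  have l\<psi>: "l * \<psi> = cut k \<sigma>" using nz by (simp add: l_def)
  have lt: "l * t = cut' k \<sigma> / \<tau>" using nz e \<tau> by (simp add: l_def t_def \<sigma>_def)
  have "excess x (\<lambda>i. cut k \<sigma> * Z i + cut' k \<sigma> / \<tau> * (v i - \<psi> * Z i)) (\<lambda>i. cut k \<sigma> * Z i)
      = excess x (\<lambda>i. l * (\<psi> * Z i + t * (v i - \<psi> * Z i))) (\<lambda>i. l * (\<psi> * Z i))"
    unfolding l\<psi>[symmetric] lt[symmetric] by (simp add: algebra_simps)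
  also have "\<dots> = \<bar>l\<bar> powr p * excess x (\<lambda>i. \<psi> * Z i + t * (v i - \<psi> * Z i)) (\<lambda>i. \<psi> * Z i)"
    by (rule excess_scale)
  finally have eq: "excess x (\<lambda>i. cut k \<sigma> * Z i + cut' k \<sigma> / \<tau> * (v i - \<psi> * Z i)) (\<lambda>i. cut k \<sigma> * Z i)
      = \<bar>l\<bar> powr p * excess x (\<lambda>i. \<psi> * Z i + t * (v i - \<psi> * Z i)) (\<lambda>i. \<psi> * Z i)" .
  have g: "excess x (\<lambda>i. \<psi> * Z i + t * (v i - \<psi> * Z i)) (\<lambda>i. \<psi> * Z i) \<le> C * max 1 t powr M * excess x v (\<lambda>i. \<psi> * Z i)"
    using excess_growth[OF t0, of x "\<lambda>i. \<psi> * Z i" "\<lambda>i. v i - \<psi> * Z i"] by simp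
  have "\<tau> * \<bar>l\<bar> = \<bar>cut k \<sigma> / \<sigma>\<bar>" using \<tau> by (simp add: l_def \<sigma>_def abs_mult abs_divide)
  then have "\<tau> powr p * \<bar>l\<bar> powr p = \<bar>cut k \<sigma> / \<sigma>\<bar> powr p" using \<tau> by (simp add: powr_mult[symmetric])
  then have "(\<tau> powr p * \<bar>l\<bar> powr p) * max 1 t powr M \<le> 2 powr p * (4 * k) powr M"
    using cut_factor_le[OF k _ M \<sigma>] p by (simp add: t_def)
  then have "C * ((\<tau> powr p * \<bar>l\<bar> powr p) * max 1 t powr M) \<le> C1"
    unfolding C1_def using C by (intro mult_left_mono) auto
  then have f: "C * ((\<tau> powr p * \<bar>l\<bar> powr p) * max 1 t powr M) * excess x v (\<lambda>i. \<psi> * Z i) \<le> C1 * excess x v (\<lambda>i. \<psi> * Z i)"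
    by (rule mult_right_mono) (rule excess_nonneg)
  have "\<tau> powr p * (\<bar>l\<bar> powr p * excess x (\<lambda>i. \<psi> * Z i + t * (v i - \<psi> * Z i)) (\<lambda>i. \<psi> * Z i))
      \<le> \<tau> powr p * (\<bar>l\<bar> powr p * (C * max 1 t powr M * excess x v (\<lambda>i. \<psi> * Z i)))"
    by (intro mult_left_mono g) auto
  also have "\<dots> = C * ((\<tau> powr p * \<bar>l\<bar> powr p) * max 1 t powr M) * excess x v (\<lambda>i. \<psi> * Z i)"
    by (simp only: mult_ac)
  also note f
  also have "C1 * excess x v (\<lambda>i. \<psi> * Z i)
      = C1 * (band \<tau> \<psi> * excess x v (\<lambda>i. \<psi> * Z i))" using True by simp
  finally show ?thesis unfolding \<sigma>_def[symmetric] eq .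
qed

definition trunc :: "real \<Rightarrow> (point \<Rightarrow> real) \<Rightarrow> point \<Rightarrow> real" where
  "trunc \<tau> f = quot_comp (\<lambda>t. cut k (t / \<tau>)) f u"

lemma level_integrable:
  assumes f: "f \<in> test_space"
  shows "set_integrable (leb n) U (\<lambda>x. band \<tau> (f x / u x) * picone f x)"
proof (rule set_integrable_bound_leb)
  note P = picone_identity(1)[OF f]
  show "integrable (leb n) (\<lambda>x. ind U x * picone f x)" using P by (simp add: set_integrable_def)
  have "f \<in> borel_measurable (restrict_space (leb n) U)" "u \<in> borel_measurable (restrict_space (leb n) U)"
    using Cc_measurable[of f] f set_measurable_continuous[OF U u] set_measurable_restrict_iff[OF U_sets] by blast+
  then have "(\<lambda>x. band \<tau> (f x / u x)) \<in> borel_measurable (restrict_space (leb n) U)"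
    by measurable
  then have m: "lmeas n U (\<lambda>x. band \<tau> (f x / u x))"
    by (simp add: set_measurable_restrict_iff[OF U_sets])
  have "lmeas n U (picone f)"
    using P by (simp add: set_integrable_def set_borel_measurable_def)
  with m show "lmeas n U (\<lambda>x. band \<tau> (f x / u x) * picone f x)"
    by (rule set_measurable_mult)
  show "AE x\<in>U in leb n. \<bar>band \<tau> (f x / u x) * picone f x\<bar> \<le> ind U x * picone f x"
    by (auto intro!: AE_I2 simp: indicator_def picone_nonneg)
qed

lemma truncation:
  assumes f: "f \<in> test_space" and \<tau>: "\<tau> > 0"
  shows "trunc \<tau> f \<in> test_space"
    "\<tau> powr p * Q (trunc \<tau> f)
      \<le> C1 * (LINT x:U|leb n. band \<tau> (f x / u x) * picone f x)"
proof -
  have D: "((\<lambda>t. cut k (t / \<tau>)) has_real_derivative cut' k (t / \<tau>) / \<tau>) (at t)" for t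
    using DERIV_chain2[OF DERIV_cut[OF k(1)] DERIV_cdivide[OF DERIV_ident, of \<tau>], of t] by simp
  have c: "continuous_on UNIV (\<lambda>t. cut' k (t / \<tau>) / \<tau>)"
    using \<tau> by (intro continuous_on_divide continuous_on_const continuous_on_compose2[OF continuous_cut'[OF k(1)]]
      continuous_on_id) auto
  have z: "cut k (0 / \<tau>) = 0" "cut' k (0 / \<tau>) / \<tau> = 0" using cut_0[OF k(1), of 0] by auto
  note q = quot_test_space[OF f D c z, folded trunc_def]
  show T: "trunc \<tau> f \<in> test_space" by (rule q(1))
  have le: "AE x\<in>U in leb n. \<tau> powr p * picone (trunc \<tau> f) x
      \<le> C1 * (band \<tau> (f x / u x) * picone f x)"
    using q(2)
  proof eventually_elim
    case (elim x)
    show ?case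
    proof
      assume x: "x \<in> U"
      define \<psi> where "\<psi> = f x / u x"
      have "trunc \<tau> f x / u x = cut k (\<psi> / \<tau>)" using u_pos[OF x] by (simp add: trunc_def quot_comp_def \<psi>_def)
      then have "picone (trunc \<tau> f) x = excess x (grad (trunc \<tau> f) x) (\<lambda>i. cut k (\<psi> / \<tau>) * grad u x i)"
        by (simp add: picone_def)
      also have "\<dots> = excess x (\<lambda>i. cut k (\<psi> / \<tau>) * grad u x i + cut' k (\<psi> / \<tau>) / \<tau> * (grad f x i - \<psi> * grad u x i))
          (\<lambda>i. cut k (\<psi> / \<tau>) * grad u x i)"
        by (rule excess_cong) (use elim x in \<open>auto simp: quot_grad_def \<psi>_def\<close>)
      finally have "picone (trunc \<tau> f) x = \<dots>" .
      then show "\<tau> powr p * picone (trunc \<tau> f) x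
          \<le> C1 * (band \<tau> (f x / u x) * picone f x)"
        using truncation_pointwise[OF \<tau>, of x \<psi> "grad u x" "grad f x"]
        unfolding picone_def[of f] \<psi>_def[symmetric] by simp
    qed
  qed
  have "(LINT x:U|leb n. \<tau> powr p * picone (trunc \<tau> f) x)
      \<le> (LINT x:U|leb n. C1 * (band \<tau> (f x / u x) * picone f x))"
    by (rule set_integral_mono_AE[OF set_integrable_mult_right[OF picone_identity(1)[OF T]]
      set_integrable_mult_right[OF level_integrable[OF f]] le])
  then show "\<tau> powr p * Q (trunc \<tau> f)
      \<le> C1 * (LINT x:U|leb n. band \<tau> (f x / u x) * picone f x)"
    unfolding picone_identity(2)[OF T] by simp
qed

lemma trunc_ge: "x \<in> U \<Longrightarrow> \<tau> > 0 \<Longrightarrow> 2 * \<tau> \<le> \<bar>f x / u x\<bar> \<Longrightarrow> u x \<le> trunc \<tau> f x"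
proof -
  assume x: "x \<in> U" and \<tau>: "\<tau> > 0" and ge: "2 * \<tau> \<le> \<bar>f x / u x\<bar>"
  have "\<bar>f x / u x / \<tau>\<bar> = \<bar>f x / u x\<bar> / \<tau>" using \<tau> abs_divide[of "f x / u x" \<tau>] by (simp only: abs_of_pos)
  moreover have "2 \<le> \<bar>f x / u x\<bar> / \<tau>" using ge pos_le_divide_eq[OF \<tau>, of 2 "\<bar>f x / u x\<bar>"] by (rule iffD2[rotated])
  ultimately have "2 \<le> \<bar>f x / u x / \<tau>\<bar>" by (simp only:)
  then show ?thesis using cut_1(1)[OF k(1)] by (simp add: trunc_def quot_comp_def)
qed

text \<open>Each truncation is charged only to its own band, and the bands are disjoint, so the
  charges together do not exceed the full Picone integral.\<close>

lemma trunc_sum: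
  assumes f: "f \<in> test_space" and T: "T > 0"
  shows "(\<Sum>m<J. (T * (1/2) ^ m) powr p * Q (trunc (T * (1/2) ^ m) f)) \<le> C1 * Q f"
proof -
  let ?I = "\<lambda>m. {y. T * (1/2) ^ m < \<bar>y\<bar> \<and> \<bar>y\<bar> < 2 * (T * (1/2) ^ m)}"
  have Tm: "T * (1/2) ^ m > 0" for m using T by simp
  note li = level_integrable[OF f]
  have "(\<Sum>m<J. (T * (1/2) ^ m) powr p * Q (trunc (T * (1/2) ^ m) f))
      \<le> (\<Sum>m<J. C1 * (LINT x:U|leb n. ind (?I m) (f x / u x) * picone f x))"
    by (intro sum_mono truncation(2)[OF f Tm])
  also have "\<dots> = C1 * (\<Sum>m<J. (LINT x:U|leb n. ind (?I m) (f x / u x) * picone f x))"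
    by (simp add: sum_distrib_left)
  also have "(\<Sum>m<J. (LINT x:U|leb n. ind (?I m) (f x / u x) * picone f x))
      = (LINT x|leb n. (\<Sum>m<J. ind U x *\<^sub>R (ind (?I m) (f x / u x) * picone f x)))"
    unfolding set_lebesgue_integral_def
    by (rule Bochner_Integration.integral_sum[symmetric]) (rule li[unfolded set_integrable_def])
  also have "C1 * \<dots> \<le> C1 * Q f" unfolding picone_identity(2)[OF f] set_lebesgue_integral_def
  proof (intro mult_left_mono C1_nonneg integral_mono)
    show "integrable (leb n) (\<lambda>x. \<Sum>m<J. ind U x *\<^sub>R (ind (?I m) (f x / u x) * picone f x))"
      by (rule Bochner_Integration.integrable_sum) (rule li[unfolded set_integrable_def])
    show "integrable (leb n) (\<lambda>x. ind U x *\<^sub>R picone f x)"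
      using picone_identity(1)[OF f] by (simp add: set_integrable_def)
    fix x
    have "(\<Sum>m<J. ind U x *\<^sub>R (ind (?I m) (f x / u x) * picone f x))
        = (\<Sum>m<J. ind (?I m) (f x / u x)) * (ind U x *\<^sub>R picone f x)"
      unfolding sum_distrib_right real_scaleR_def by (intro sum.cong refl) (simp only: mult_ac)
    also have "\<dots> \<le> 1 * (ind U x *\<^sub>R picone f x)"
      by (intro mult_right_mono sum_dyadic_indicator_le_1[OF T]) (simp add: picone_nonneg)
    finally show "(\<Sum>m<J. ind U x *\<^sub>R (ind (?I m) (f x / u x) * picone f x)) \<le> ind U x *\<^sub>R picone f x" by simp
  qed
  finally show ?thesis .
qed

end

subsection \<open>Capacity and the two norms\<close>

lemma enn2ereal_le_iff: "0 \<le> r \<Longrightarrow> enn2ereal x \<le> ereal r \<longleftrightarrow> x \<le> ennreal r"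
  by (simp add: less_eq_ennreal.rep_eq)

context hardy_setting
begin

definition mass :: "point set \<Rightarrow> (point \<Rightarrow> real) \<Rightarrow> ennreal" where
  "mass K g = (\<integral>\<^sup>+x\<in>K. ennreal (\<bar>g x\<bar> * \<bar>u x\<bar> powr p) \<partial>leb n)"

lemma weighted_int_u: "weighted_int n K p g u = enn2ereal (mass K g)"
  by (simp add: weighted_int_def mass_def)

lemma mass_integrand_measurable:
  assumes g: "lmeas n U g" and K: "K \<subseteq> U" "K \<in> sets (leb n)"
  shows "(\<lambda>x. ennreal (\<bar>g x\<bar> * \<bar>u x\<bar> powr p) * ind K x) \<in> borel_measurable (leb n)"
proof -
  have "lmeas n U (\<lambda>x. \<bar>g x\<bar> powr 1 * \<bar>u x\<bar> powr p)"
    by (intro set_measurable_mult set_measurable_abs_powr g set_measurable_continuous[OF U u])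
  then have "lmeas n K (\<lambda>x. \<bar>g x\<bar> powr 1 * \<bar>u x\<bar> powr p)"
    by (rule set_measurable_mono[OF _ K])
  then have "(\<lambda>x. ennreal (ind K x *\<^sub>R (\<bar>g x\<bar> powr 1 * \<bar>u x\<bar> powr p))) \<in> borel_measurable (leb n)"
    unfolding set_borel_measurable_def by measurable
  also have "(\<lambda>x. ennreal (ind K x *\<^sub>R (\<bar>g x\<bar> powr 1 * \<bar>u x\<bar> powr p)))
      = (\<lambda>x. ennreal (\<bar>g x\<bar> * \<bar>u x\<bar> powr p) * ind K x)"
    by (auto simp: indicator_def fun_eq_iff)
  finally show ?thesis .
qed

lemma weighted_int_eq:
  assumes f: "f \<in> Cc n U" and g: "g \<in> Lp_loc n U 1"
  shows "weighted_int n U p g f = ereal (LINT x:U|leb n. \<bar>g x\<bar> * \<bar>f x\<bar> powr p)"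
    "0 \<le> (LINT x:U|leb n. \<bar>g x\<bar> * \<bar>f x\<bar> powr p)"
proof -
  have "(\<lambda>x. \<bar>g x\<bar>) \<in> Lp_loc n U 1"
    using g set_measurable_abs_powr[of "leb n" U g 1] by (simp add: Lp_loc_def)
  note I = Cc_integrable[OF f this]
  show 0: "0 \<le> (LINT x:U|leb n. \<bar>g x\<bar> * \<bar>f x\<bar> powr p)"
    unfolding set_lebesgue_integral_def by (rule Bochner_Integration.integral_nonneg) simp
  have "(\<integral>\<^sup>+x. ennreal (\<bar>g x\<bar> * \<bar>f x\<bar> powr p) * ind U x \<partial>leb n)
      = (\<integral>\<^sup>+x. ennreal (ind U x *\<^sub>R (\<bar>g x\<bar> * \<bar>f x\<bar> powr p)) \<partial>leb n)"
    by (intro nn_integral_cong) (auto simp: indicator_def)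
  also have "\<dots> = ennreal (LINT x:U|leb n. \<bar>g x\<bar> * \<bar>f x\<bar> powr p)"
    unfolding set_lebesgue_integral_def
    by (rule nn_integral_eq_integral) (use I in \<open>auto simp: set_integrable_def\<close>)
  finally show "weighted_int n U p g f = ereal (LINT x:U|leb n. \<bar>g x\<bar> * \<bar>f x\<bar> powr p)"
    using 0 by (simp add: weighted_int_def)
qed

text \<open>Shows that the capacity of a compact set has competitors. A mollification of
  \<open>u\<close>, cut off outside a neighbourhood of \<open>K\<close>, stays comparable to
  \<open>u\<close> on \<open>K\<close>.\<close>

lemma positive_test_function:
  assumes K: "compact_in n K" "K \<subseteq> U"
  obtains F c where "F \<in> test_space" "c > 0" "\<forall>x\<in>K. c \<le> \<bar>F x / u x\<bar>"
proof -
  have uc: "cont_on n U u" using u by (simp add: C_continuous_def)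
  obtain d1 K' where K': "d1 > 0" "compact_in n K'" "K' \<subseteq> U" "\<forall>x\<in>K. obox n x d1 \<subseteq> K'" "K \<subseteq> K'"
    by (rule compact_neighbourhood[OF U K])
  obtain d2 L where L: "d2 > 0" "compact_in n L" "L \<subseteq> U" "\<forall>x\<in>K'. obox n x d2 \<subseteq> L" "K' \<subseteq> L"
    by (rule compact_neighbourhood[OF U K'(2,3)])
  define d where "d = min d1 d2"
  have d: "d > 0" "\<forall>x\<in>K. obox n x d \<subseteq> K'"
    using K'(1,4) L(1) obox_mono[of d d1 n] by (auto simp: d_def)
  note w = wgrad_W1p_loc[OF n U u_W1p_loc]
  obtain F S where F: "\<forall>m k. Ck n k (F m)"
    and Fs: "\<forall>m. \<forall>x\<in>pts n. F m x \<noteq> 0 \<longrightarrow> (\<exists>y\<in>K'. u y \<noteq> 0 \<and> x \<in> obox n y d)"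
    and "(\<forall>y\<in>K'. 0 \<le> u y) \<longrightarrow> (\<forall>m x. 0 \<le> F m x)"
    and Fl: "\<forall>m. \<forall>x\<in>K. \<bar>F m x - u x\<bar> \<le> (1/2) ^ m" and "integrable (leb n) S" "\<forall>x. 0 \<le> S x"
    "\<forall>m. AE x\<in>K in leb n. (\<forall>i<n. \<bar>pd i (F m) x - wgrad n U u i x\<bar> powr p \<le> (1/2) ^ m * S x)"
    by (rule sobolev_approx[OF n p1 U uc w(2) w(1) K(1) K'(5,2,3) d])
  have Fz: "F m x = 0" if x: "x \<in> pts n" "x \<notin> L" for m x
  proof (rule ccontr)
    assume "F m x \<noteq> 0"
    from Fs[rule_format, OF x(1) this] obtain y where y: "y \<in> K'" "u y \<noteq> 0 \<and> x \<in> obox n y d" ..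
    have "obox n y d2 \<subseteq> L" using L(4) y(1) ..
    moreover have "x \<in> obox n y d2" using y(2) obox_mono[of d d2 n y] by (auto simp: d_def)
    ultimately have "x \<in> L" by auto
    with x(2) show False ..
  qed
  have FC: "F m \<in> test_space" for m
  proof (rule smooth_in_test_space)
    have "\<forall>k. Ck n k (F m)" using F by simp
    moreover have "\<forall>x\<in>topspace (Rn n) - L. F m x = 0" using Fz by auto
    ultimately show "F m \<in> Cc_smooth n U" unfolding Cc_smooth_def using L(2,3) by auto
  qed
  have upos: "0 < u x" if "x \<in> K" for x using u_pos K(2) that by blast
  obtain c where c: "c > 0" "\<forall>x\<in>K. c \<le> u x" by (rule positive_lower_bound_on_compact[OF uc K upos])
  \<comment> \<open>The uniform error is made less than half the lower bound of \<open>u\<close>, so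
    that \<open>F m \<ge> u/2\<close> on \<open>K\<close>.\<close>
  obtain m where m: "(1/2::real) ^ m < c / 2" using real_arch_pow_inv[of "c / 2" "1/2"] c(1) by auto
  have "1/2 \<le> \<bar>F m x / u x\<bar>" if x: "x \<in> K" for x
  proof -
    have "\<bar>F m x - u x\<bar> \<le> (1/2) ^ m" using Fl x by blast
    then have "u x / 2 \<le> F m x" using m c(2) x by fastforce
    then have "1/2 \<le> F m x / u x" using upos[OF x] by (simp add: pos_le_divide_eq)
    then show ?thesis by linarith
  qed
  then show thesis by (intro that[OF FC, of "1/2"]) auto
qed

end

context hardy_growth
begin

definition cap :: "point set \<Rightarrow> real" where
  "cap K = real_of_ereal (Cap n U p s a V K u)"

text \<open>Truncating a function with \<open>|F/u| \<ge> c\<close> at level \<open>c/2\<close>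
  produces a competitor that is at least \<open>u\<close> on \<open>K\<close>, so the infimum is
  finite.\<close>

lemma cap:
  assumes K: "compact_in n K" "K \<subseteq> U"
  shows "Cap n U p s a V K u = ereal (cap K)" "0 \<le> cap K"
proof -
  obtain F c where F: "F \<in> test_space" "c > 0" "\<forall>x\<in>K. c \<le> \<bar>F x / u x\<bar>" by (rule positive_test_function[OF K])
  have "u x \<le> trunc (c / 2) F x" if "x \<in> K" for x
    by (rule trunc_ge) (use F that K(2) in auto)
  then have "Cap n U p s a V K u \<le> ereal (Q (trunc (c / 2) F))"
    unfolding Cap_def using truncation(1)[OF F(1), of "c / 2"] F(2) by (intro INF_lower) auto
  moreover have "0 \<le> Cap n U p s a V K u"
    unfolding Cap_def by (rule INF_greatest) (use Q_nonneg in auto)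
  ultimately show "Cap n U p s a V K u = ereal (cap K)" "0 \<le> cap K"
    unfolding cap_def by (cases "Cap n U p s a V K u"; simp)+
qed

lemma norm_u_nonneg: "0 \<le> N g"
  unfolding norm_u_def by (rule INF_greatest) auto

text \<open>The infimum in \<open>norm_u\<close> is attained, because capacities are finite and the
  inequality for each compact set survives the limit in the constant. This exhibits the norm as a
  supremum of weighted masses, which is the form used everywhere below.\<close>

lemma norm_u_le_iff:
  assumes L: "0 \<le> L"
  shows "N g \<le> ereal L \<longleftrightarrow>
    (\<forall>K. compact_in n K \<and> K \<subseteq> U \<longrightarrow> mass K g \<le> ennreal (L * cap K))"
proof -
  have eq: "weighted_int n K p g u \<le> ereal l * Cap n U p s a V K u \<longleftrightarrow> mass K g \<le> ennreal (l * cap K)"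
    if "0 \<le> l" "compact_in n K" "K \<subseteq> U" for l K
    unfolding weighted_int_u cap(1)[OF that(2,3)] times_ereal.simps(1)
    by (rule enn2ereal_le_iff) (use that(1) cap(2)[OF that(2,3)] in simp)
  show ?thesis
  proof
    assume le: "N g \<le> ereal L"
    show "\<forall>K. compact_in n K \<and> K \<subseteq> U \<longrightarrow> mass K g \<le> ennreal (L * cap K)"
    proof (intro allI impI)
      fix K assume K: "compact_in n K \<and> K \<subseteq> U"
      have "mass K g \<le> ennreal (L * cap K + e)" if e: "e > 0" for e
      proof -
        \<comment> \<open>The summand 1 allows for a set of capacity 0.\<close>
        define \<delta> where "\<delta> = e / (cap K + 1)"
        have c0: "0 \<le> cap K" using cap(2) K by blast
        have \<delta>: "\<delta> > 0" using e c0 by (simp add: \<delta>_def)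
        have "N g < ereal (L + \<delta>)" by (rule order_le_less_trans[OF le]) (use \<delta> in simp)
        then obtain l where l: "0 \<le> l" "weighted_int n K p g u \<le> ereal l * Cap n U p s a V K u" "ereal l < ereal (L + \<delta>)"
          unfolding norm_u_def INF_less_iff using K by auto
        have "mass K g \<le> ennreal (l * cap K)" using eq l K by blast
        also have "\<dots> \<le> ennreal (L * cap K + e)"
        proof (rule ennreal_leI)
          have "l * cap K \<le> (L + \<delta>) * cap K" using l(3) c0 by (intro mult_right_mono) auto
          also have "\<dots> \<le> L * cap K + \<delta> * (cap K + 1)" using \<delta> by (simp add: algebra_simps)
          finally show "l * cap K \<le> L * cap K + e" using c0 by (simp add: \<delta>_def)
        qed
        finally show ?thesis .
      qed
      then have "mass K g \<le> ennreal (L * cap K) + ennreal e" if "e > 0" for e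
        using L cap(2) K that by (simp add: ennreal_plus)
      then show "mass K g \<le> ennreal (L * cap K)" by (rule ennreal_le_epsilon)
    qed
  next
    assume "\<forall>K. compact_in n K \<and> K \<subseteq> U \<longrightarrow> mass K g \<le> ennreal (L * cap K)"
    then show "N g \<le> ereal L"
      unfolding norm_u_def using L eq by (intro INF_lower) auto
  qed
qed

lemma mass_le_weighted_int:
  assumes K: "K \<subseteq> U" and f: "\<forall>x\<in>K. u x \<le> f x"
  shows "weighted_int n K p g u \<le> weighted_int n U p g f"
  unfolding weighted_int_def less_eq_ennreal.rep_eq[symmetric]
proof (rule nn_integral_mono)
  fix x
  have "\<bar>g x\<bar> * \<bar>u x\<bar> powr p \<le> \<bar>g x\<bar> * \<bar>f x\<bar> powr p" if "x \<in> K"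
  proof -
    have "0 < u x" "u x \<le> f x" using that u_pos K f by auto
    then show ?thesis using p by (intro mult_left_mono powr_mono2) auto
  qed
  then show "ennreal (\<bar>g x\<bar> * \<bar>u x\<bar> powr p) * ind K x \<le> ennreal (\<bar>g x\<bar> * \<bar>f x\<bar> powr p) * ind U x"
    using K by (auto simp: indicator_def intro: ennreal_leI)
qed

text \<open>Any competitor \<open>f \<ge> u\<close> on \<open>K\<close> gives
  \<open>mass K g \<le> L * Q f\<close> by monotonicity; then take the infimum over the competitors.
  No constant is lost.\<close>

lemma norm_u_le_of_hardy:
  assumes L: "0 \<le> L" and H: "\<forall>f\<in>test_space. weighted_int n U p g f \<le> ereal (L * Q f)"
  shows "N g \<le> ereal L"
proof (unfold norm_u_le_iff[OF L], intro allI impI)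
  fix K assume K: "compact_in n K \<and> K \<subseteq> U"
  have le: "mass K g \<le> ennreal (L * Q f)" if "f \<in> test_space" "\<forall>x\<in>K. u x \<le> f x" for f
  proof -
    have "enn2ereal (mass K g) \<le> ereal (L * Q f)"
      using mass_le_weighted_int[of K f g] H that K unfolding weighted_int_u by (auto intro: order_trans)
    then show ?thesis using L Q_nonneg[OF that(1)] by (simp add: enn2ereal_le_iff)
  qed
  have "mass K g \<le> ennreal (L * cap K) + ennreal e" if e: "e > 0" for e
  proof -
    define \<delta> where "\<delta> = e / (L + 1)"
    have \<delta>: "\<delta> > 0" using e L by (simp add: \<delta>_def)
    have "Cap n U p s a V K u < ereal (cap K + \<delta>)" using cap(1) K \<delta> by simp
    then obtain f where f: "f \<in> test_space" "\<forall>x\<in>K. u x \<le> f x" "Q f < cap K + \<delta>"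
      unfolding Cap_def INF_less_iff by auto
    have "L * Q f \<le> L * (cap K + \<delta>)" using f(3) L by (intro mult_left_mono) auto
    also have "\<dots> \<le> L * cap K + \<delta> * (L + 1)" using \<delta> by (simp add: algebra_simps)
    also have "\<delta> * (L + 1) = e" using L by (simp add: \<delta>_def)
    finally have "ennreal (L * Q f) \<le> ennreal (L * cap K + e)" by (rule ennreal_leI)
    moreover have "ennreal (L * cap K + e) = ennreal (L * cap K) + ennreal e"
      using L cap(2) K e by (simp add: ennreal_plus)
    ultimately show ?thesis using order_trans[OF le[OF f(1,2)]] by simp
  qed
  then show "mass K g \<le> ennreal (L * cap K)" by (rule ennreal_le_epsilon)
qed

text \<open>The level set \<open>D m\<close> carries the truncation at level \<open>\<tau> m\<close>
  as a competitor for its capacity. On the layer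
  \<open>2 * \<tau> m \<le> |f/u| < 4 * \<tau> m\<close> one has
  \<open>|f| \<le> 4 * \<tau> m * u\<close>, which accounts for the factor
  \<open>4 powr p\<close>.\<close>

lemma mazya:
  assumes f: "f \<in> test_space" and g: "lmeas n U g" and L: "0 \<le> L"
    and H: "N g \<le> ereal L"
  shows "weighted_int n U p g f \<le> ereal ((4 powr p * C1 * L) * Q f)"
proof -
  have fC: "f \<in> Cc n U" using f by blast
  obtain K where K: "compact_in n K" "K \<subseteq> U" "\<forall>x\<in>U. x \<notin> K \<longrightarrow> f x = 0" by (rule CcE[OF fC])
  have c: "cont_on n U f" "cont_on n U u"
    using fC u by (auto simp: C_continuous_def Cc_def)
  have pos: "u x > 0" if "x \<in> topspace (subtopology (Rn n) U)" for x using u_pos that by simp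
  have \<psi>c: "cont_on n U (\<lambda>x. \<bar>f x / u x\<bar>)"
    by (rule quot_comp_continuous(1)[OF c pos]) (auto intro!: continuous_intros)
  obtain T where T: "T > 0" "\<forall>x\<in>K. \<bar>\<bar>f x / u x\<bar>\<bar> \<le> T" by (rule continuous_bounded_on_compact[OF \<psi>c K(1,2)])
  define \<tau> where "\<tau> m = T * (1/2) ^ m" for m :: nat
  have \<tau>: "\<tau> m > 0" for m using T by (simp add: \<tau>_def)
  define D where "D m = {x \<in> K. 2 * \<tau> m \<le> \<bar>f x / u x\<bar>}" for m
  have Dc: "compact_in n (D m)" "D m \<subseteq> U" for m
    unfolding D_def using compact_superlevel[OF \<psi>c K(1,2)] K(2) by auto
  have mass: "mass (D m) g \<le> ennreal (L * Q (trunc (\<tau> m) f))" for m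
  proof -
    have "mass (D m) g \<le> ennreal (L * cap (D m))" using H Dc unfolding norm_u_le_iff[OF L] by blast
    moreover have "cap (D m) \<le> Q (trunc (\<tau> m) f)"
    proof -
      have "\<forall>x\<in>D m. u x \<le> trunc (\<tau> m) f x"
        using trunc_ge[OF _ \<tau>[of m]] K(2) unfolding D_def by blast
      then have "Cap n U p s a V (D m) u \<le> ereal (Q (trunc (\<tau> m) f))"
        unfolding Cap_def using truncation(1)[OF f \<tau>] by (intro INF_lower) auto
      then show ?thesis unfolding cap(1)[OF Dc] by simp
    qed
    then have "ennreal (L * cap (D m)) \<le> ennreal (L * Q (trunc (\<tau> m) f))"
      using L by (intro ennreal_leI mult_left_mono)
    ultimately show ?thesis by (rule order_trans)
  qed
  \<comment> \<open>The indicator of the whole superlevel set is used rather than that of the layer.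
    A point with \<open>f x \<noteq> 0\<close> lies in some layer, and that single term already
    dominates.\<close>
  define h where "h m x = ennreal ((4 * \<tau> m) powr p) * (ennreal (\<bar>g x\<bar> * \<bar>u x\<bar> powr p) * ind (D m) x)" for m x
  have hm: "(\<lambda>x. ennreal (\<bar>g x\<bar> * \<bar>u x\<bar> powr p) * ind (D m) x) \<in> borel_measurable (leb n)" for m
    by (rule mass_integrand_measurable[OF g Dc(2) compactin_sets_leb[OF Dc(1)]])
  have le: "ennreal (\<bar>g x\<bar> * \<bar>f x\<bar> powr p) * ind U x \<le> (\<Sum>m. h m x)" for x
  proof (cases "x \<in> U \<and> f x \<noteq> 0")
    case False
    then show ?thesis using p by (auto simp: indicator_def)
  next
    case True
    then have x: "x \<in> U" "x \<in> K" "u x > 0" using K(3) u_pos by auto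
    have y: "0 < \<bar>f x / u x\<bar>" "\<bar>f x / u x\<bar> < 4 * T" using True x T by force+
    obtain m where m: "2 * (T * (1/2) ^ m) \<le> \<bar>f x / u x\<bar>" "\<bar>f x / u x\<bar> < 4 * (T * (1/2) ^ m)"
      by (rule dyadic_level[OF T(1) y])
    have xD: "x \<in> D m" using m(1) x by (simp add: D_def \<tau>_def)
    have fx: "\<bar>f x\<bar> = \<bar>f x / u x\<bar> * \<bar>u x\<bar>" using x by (simp add: abs_divide)
    have "\<bar>f x / u x\<bar> * \<bar>u x\<bar> \<le> (4 * \<tau> m) * \<bar>u x\<bar>"
      using less_imp_le[OF m(2)] unfolding \<tau>_def by (rule mult_right_mono) simp
    then have "\<bar>f x\<bar> \<le> (4 * \<tau> m) * \<bar>u x\<bar>" by (simp only: fx)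
    then have "\<bar>f x\<bar> powr p \<le> ((4 * \<tau> m) * \<bar>u x\<bar>) powr p" using p by (intro powr_mono2) auto
    then have "\<bar>f x\<bar> powr p \<le> (4 * \<tau> m) powr p * \<bar>u x\<bar> powr p" by (simp only: powr_mult)
    then have "\<bar>g x\<bar> * \<bar>f x\<bar> powr p \<le> \<bar>g x\<bar> * ((4 * \<tau> m) powr p * \<bar>u x\<bar> powr p)" by (rule mult_left_mono) simp
    then have "ennreal (\<bar>g x\<bar> * \<bar>f x\<bar> powr p) \<le> ennreal ((4 * \<tau> m) powr p * (\<bar>g x\<bar> * \<bar>u x\<bar> powr p))"
      by (intro ennreal_leI) (simp only: mult_ac)
    also have "\<dots> = h m x" using xD by (simp add: h_def ennreal_mult)
    also have "\<dots> = sum (\<lambda>m. h m x) {m}" by simp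
    also have "\<dots> \<le> (\<Sum>m. h m x)" by (rule sum_le_suminf) auto
    finally show ?thesis using x by simp
  qed
  have "(\<integral>\<^sup>+x. ennreal (\<bar>g x\<bar> * \<bar>f x\<bar> powr p) * ind U x \<partial>leb n) \<le> (\<integral>\<^sup>+x. (\<Sum>m. h m x) \<partial>leb n)"
    by (intro nn_integral_mono le)
  also have "\<dots> = (\<Sum>m. \<integral>\<^sup>+x. h m x \<partial>leb n)"
  proof (rule nn_integral_suminf)
    have "h m = (\<lambda>x. ennreal ((4 * \<tau> m) powr p) * (ennreal (\<bar>g x\<bar> * \<bar>u x\<bar> powr p) * ind (D m) x))" for m
      by (simp add: h_def fun_eq_iff)
    then show "h m \<in> borel_measurable (leb n)" for m
      using borel_measurable_times_ennreal[OF borel_measurable_const hm] by (simp only:)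
  qed
  also have "\<dots> = (\<Sum>m. ennreal ((4 * \<tau> m) powr p) * mass (D m) g)"
    unfolding h_def mass_def by (simp add: nn_integral_cmult[OF hm])
  also have "\<dots> \<le> ennreal ((4 powr p * C1 * L) * Q f)"
  proof (rule suminf_le_const)
    fix J
    have Qn: "0 \<le> Q (trunc (\<tau> m) f)" for m by (rule Q_nonneg[OF truncation(1)[OF f \<tau>]])
    have "(\<Sum>m<J. ennreal ((4 * \<tau> m) powr p) * mass (D m) g)
        \<le> (\<Sum>m<J. ennreal ((4 * \<tau> m) powr p) * ennreal (L * Q (trunc (\<tau> m) f)))"
      by (intro sum_mono mult_left_mono mass) simp
    also have "\<dots> = (\<Sum>m<J. ennreal ((4 * \<tau> m) powr p * (L * Q (trunc (\<tau> m) f))))"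
      using L Qn by (simp add: ennreal_mult)
    also have "\<dots> = ennreal (\<Sum>m<J. (4 * \<tau> m) powr p * (L * Q (trunc (\<tau> m) f)))"
      using L Qn by (intro sum_ennreal) simp
    also have "(\<Sum>m<J. (4 * \<tau> m) powr p * (L * Q (trunc (\<tau> m) f)))
        = (4 powr p * L) * (\<Sum>m<J. \<tau> m powr p * Q (trunc (\<tau> m) f))"
      unfolding sum_distrib_left by (intro sum.cong refl) (simp add: powr_mult mult_ac)
    also have "ennreal \<dots> \<le> ennreal ((4 powr p * L) * (C1 * Q f))"
      using trunc_sum[OF f T(1)] L unfolding \<tau>_def by (intro ennreal_leI mult_left_mono) auto
    finally show "(\<Sum>m<J. ennreal ((4 * \<tau> m) powr p) * mass (D m) g) \<le> ennreal ((4 powr p * C1 * L) * Q f)"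
      by (simp only: mult_ac)
  qed simp
  finally have "(\<integral>\<^sup>+x. ennreal (\<bar>g x\<bar> * \<bar>f x\<bar> powr p) * ind U x \<partial>leb n) \<le> ennreal ((4 powr p * C1 * L) * Q f)" .
  then show ?thesis unfolding weighted_int_def
    using L C1_nonneg Q_nonneg[OF f] by (subst enn2ereal_le_iff) auto
qed

lemma norm_H_le:
  assumes L: "0 \<le> L" and g: "g \<in> Lp_loc n U 1" and H: "\<forall>f\<in>test_space. weighted_int n U p g f \<le> ereal (L * Q f)"
  shows "norm_H n U p s a V g \<le> ereal L"
proof (cases "L = 0")
  case True
  \<comment> \<open>With \<open>L = 0\<close> no function has positive weighted integral. The
    infimum over the empty set is infinite, and \<open>1/\<infinity> = 0\<close>.\<close>
  then have E: "{f \<in> test_space. 0 < weighted_int n U p g f} = {}" using H by (auto simp: not_less zero_ereal_def)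
  have "S_const n U p s a V g = \<infinity>"
    unfolding S_const_def by (simp only: E image_empty Inf_empty top_ereal_def)
  then show ?thesis using True by (simp add: norm_H_def)
next
  case False
  then have L: "L > 0" using L by simp
  have "ereal (1 / L) \<le> S_const n U p s a V g"
    unfolding S_const_def
  proof (rule INF_greatest)
    fix f assume f: "f \<in> {f \<in> test_space. 0 < weighted_int n U p g f}"
    then have fT: "f \<in> test_space" by simp
    define r where "r = (LINT x:U|leb n. \<bar>g x\<bar> * \<bar>f x\<bar> powr p)"
    have w: "weighted_int n U p g f = ereal r" unfolding r_def using weighted_int_eq(1)[OF _ g] f by blast
    have r: "0 < r" using f w by simp
    have "weighted_int n U p g f \<le> ereal (L * Q f)" using H fT ..
    then have "r \<le> L * Q f" unfolding w by simp
    then have "1 / L \<le> Q f / r" using r L by (simp add: field_simps)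
    then show "ereal (1 / L) \<le> ereal (Q f) / weighted_int n U p g f" using r w by simp
  qed
  then show ?thesis unfolding norm_H_def
  proof (cases "S_const n U p s a V g")
    case (real c)
    assume le: "ereal (1 / L) \<le> S_const n U p s a V g"
    have "1 / L \<le> c" using le real by simp
    moreover then have "c > 0" using L by (auto intro: less_le_trans[of 0 "1 / L"])
    ultimately have "1 / c \<le> L" using L by (simp add: field_simps)
    moreover have "1 / ereal c = ereal (1 / c)" using \<open>c > 0\<close> by (simp add: one_ereal_def)
    ultimately show "1 / S_const n U p s a V g \<le> ereal L" using real by simp
  qed (use L in auto)
qed

text \<open>\<open>1/S\<close> is the best constant in the Hardy inequality on the test space, and
  \<open>norm_u_le_of_hardy\<close> passes it on unchanged. The cases \<open>S = \<infinity>\<close>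
  and \<open>S = 0\<close> follow the conventions for \<open>1/S\<close>.\<close>

lemma norm_u_le_norm_H:
  assumes g: "g \<in> Lp_loc n U 1"
  shows "N g \<le> norm_H n U p s a V g"
proof -
  have wn: "weighted_int n U p g f = ereal (LINT x:U|leb n. \<bar>g x\<bar> * \<bar>f x\<bar> powr p)"
    "0 \<le> (LINT x:U|leb n. \<bar>g x\<bar> * \<bar>f x\<bar> powr p)" if "f \<in> test_space" for f
    using weighted_int_eq[OF _ g] that by auto
  have S0: "0 \<le> S_const n U p s a V g" unfolding S_const_def
  proof (rule INF_greatest)
    fix f assume f: "f \<in> {f \<in> test_space. 0 < weighted_int n U p g f}"
    then show "0 \<le> ereal (Q f) / weighted_int n U p g f" using Q_nonneg[of f] wn[of f] by auto
  qed
  have Sle: "S_const n U p s a V g \<le> ereal (Q f / (LINT x:U|leb n. \<bar>g x\<bar> * \<bar>f x\<bar> powr p))"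
    if f: "f \<in> test_space" "0 < (LINT x:U|leb n. \<bar>g x\<bar> * \<bar>f x\<bar> powr p)" for f
  proof -
    have "S_const n U p s a V g \<le> ereal (Q f) / weighted_int n U p g f"
      unfolding S_const_def by (rule INF_lower) (use f wn in auto)
    then show ?thesis using f(2) wn(1)[OF f(1)] by simp
  qed
  show ?thesis
  proof (cases "S_const n U p s a V g")
    case PInf
    have "N g \<le> ereal 0"
    proof (rule norm_u_le_of_hardy[OF order_refl], intro ballI)
      fix f assume f: "f \<in> test_space"
      have "\<not> 0 < (LINT x:U|leb n. \<bar>g x\<bar> * \<bar>f x\<bar> powr p)" using Sle[OF f] PInf by auto
      then show "weighted_int n U p g f \<le> ereal (0 * Q f)" using wn[OF f] by simp
    qed
    then show ?thesis using PInf by (simp add: norm_H_def zero_ereal_def)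
  next
    case MInf
    then show ?thesis using S0 by simp
  next
    case (real c)
    show ?thesis
    proof (cases "c = 0")
      case True
      then have "S_const n U p s a V g = 0" using real by (simp add: zero_ereal_def)
      then show ?thesis by (simp add: norm_H_def divide_ereal_def)
    next
      case False
      then have c: "c > 0" using S0 real by simp
      have "N g \<le> ereal (1 / c)"
      proof (rule norm_u_le_of_hardy)
        show "0 \<le> 1 / c" using c by simp
        show "\<forall>f\<in>test_space. weighted_int n U p g f \<le> ereal (1 / c * Q f)"
        proof
          fix f assume f: "f \<in> test_space"
          let ?r = "LINT x:U|leb n. \<bar>g x\<bar> * \<bar>f x\<bar> powr p"
          have "?r \<le> 1 / c * Q f"
          proof (cases "0 < ?r")
            case True
            have "c \<le> Q f / ?r" using Sle[OF f True] real by simp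
            then show ?thesis using True c by (simp add: field_simps)
          next
            case False
            moreover have "0 \<le> 1 / c * Q f" using c Q_nonneg[OF f] by simp
            ultimately show ?thesis by linarith
          qed
          then show "weighted_int n U p g f \<le> ereal (1 / c * Q f)" using wn(1)[OF f] by simp
        qed
      qed
      moreover have "1 / ereal c = ereal (1 / c)" using c by (simp add: one_ereal_def)
      ultimately show ?thesis using real by (simp add: norm_H_def)
    qed
  qed
qed

lemma norm_u_finite:
  assumes "N g < \<infinity>"
  obtains l where "0 \<le> l" "N g = ereal l"
  using assms norm_u_nonneg[of g] by (cases "N g") auto

lemma norm_H_le_norm_u:
  assumes g: "g \<in> Lp_loc n U 1" and fin: "N g < \<infinity>"
  shows "norm_H n U p s a V g \<le> ereal (4 powr p * C1) * N g"
proof -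
  obtain l where l: "0 \<le> l" "N g = ereal l" by (rule norm_u_finite[OF fin])
  have gm: "lmeas n U g" using g by (simp add: Lp_loc_def)
  have "norm_H n U p s a V g \<le> ereal (4 powr p * C1 * l)"
    using mazya[OF _ gm l(1) eq_refl[OF l(2)]] l(1) C1_nonneg by (intro norm_H_le[OF _ g] ballI) auto
  then show ?thesis using l(2) by simp
qed

lemma hardy_weights_iff: "g \<in> hardy_weights n U p s a V \<longleftrightarrow> g \<in> Lp_loc n U 1 \<and> N g < \<infinity>"
proof
  assume h: "g \<in> hardy_weights n U p s a V"
  then have g: "g \<in> Lp_loc n U 1" by (simp add: hardy_weights_def)
  obtain c where c: "c > 0" "\<forall>\<phi>\<in>Cc_smooth n U. c * (LINT x:U|leb n. \<bar>g x\<bar> * \<bar>\<phi> x\<bar> powr p) \<le> Q \<phi>"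
    using h by (auto simp: hardy_weights_def)
  have "N g \<le> ereal (1 / c)"
  proof (rule norm_u_le_of_hardy)
    show "0 \<le> 1 / c" using c by simp
    show "\<forall>f\<in>test_space. weighted_int n U p g f \<le> ereal (1 / c * Q f)"
    proof
      fix f assume f: "f \<in> test_space"
      then have fC: "f \<in> Cc n U" by simp
      have "c * (LINT x:U|leb n. \<bar>g x\<bar> * \<bar>f x\<bar> powr p) \<le> Q f"
        by (rule hardy_inequality_extends[OF f g c(2)])
      then have "(LINT x:U|leb n. \<bar>g x\<bar> * \<bar>f x\<bar> powr p) \<le> 1 / c * Q f" using c(1) by (simp add: field_simps)
      then show "weighted_int n U p g f \<le> ereal (1 / c * Q f)" unfolding weighted_int_eq(1)[OF fC g] by simp
    qed
  qed
  with g show "g \<in> Lp_loc n U 1 \<and> N g < \<infinity>" by (auto intro: le_less_trans)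
next
  assume "g \<in> Lp_loc n U 1 \<and> N g < \<infinity>"
  then have g: "g \<in> Lp_loc n U 1" and fin: "N g < \<infinity>" by auto
  obtain l where l: "0 \<le> l" "N g = ereal l" by (rule norm_u_finite[OF fin])
  have gm: "lmeas n U g" using g by (simp add: Lp_loc_def)
  \<comment> \<open>The summand 1 makes the constant positive even if the norm of \<open>g\<close>
    is 0.\<close>
  define B where "B = 4 powr p * C1 * l + 1"
  have B: "B > 0" using l(1) C1_nonneg by (simp add: B_def add_nonneg_pos)
  have "1 / B * (LINT x:U|leb n. \<bar>g x\<bar> * \<bar>\<phi> x\<bar> powr p) \<le> Q \<phi>" if "\<phi> \<in> Cc_smooth n U" for \<phi>
  proof -
    have f: "\<phi> \<in> test_space" by (rule smooth_in_test_space[OF that])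
    then have fC: "\<phi> \<in> Cc n U" by simp
    have "(LINT x:U|leb n. \<bar>g x\<bar> * \<bar>\<phi> x\<bar> powr p) \<le> (4 powr p * C1 * l) * Q \<phi>"
      using mazya[OF f gm l(1) eq_refl[OF l(2)]] unfolding weighted_int_eq(1)[OF fC g] by simp
    also have "\<dots> \<le> B * Q \<phi>" using Q_nonneg[OF f] by (intro mult_right_mono) (auto simp: B_def)
    finally show ?thesis using B by (simp add: field_simps)
  qed
  then show "g \<in> hardy_weights n U p s a V"
    unfolding hardy_weights_def using g B by (auto intro!: exI[of _ "1 / B"])
qed

end

section \<open>The norm properties of \<open>norm_u\<close> and completeness\<close>

lemma set_measurable_add:
  fixes f g :: "'a \<Rightarrow> real"
  assumes "set_borel_measurable M' A f" "set_borel_measurable M' A g"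
  shows "set_borel_measurable M' A (\<lambda>x. f x + g x)"
  using borel_measurable_add[OF assms[unfolded set_borel_measurable_def]]
  by (simp add: set_borel_measurable_def algebra_simps)

lemma set_measurable_cmult:
  fixes g :: "'a \<Rightarrow> real"
  assumes "set_borel_measurable M' A g"
  shows "set_borel_measurable M' A (\<lambda>x. c * g x)"
  using borel_measurable_times[OF borel_measurable_const[of c] assms[unfolded set_borel_measurable_def]]
  by (simp add: set_borel_measurable_def mult_ac)

lemma convergent_of_summable_differences:
  fixes b :: "nat \<Rightarrow> real"
  assumes "summable (\<lambda>m. \<bar>b (Suc m) - b m\<bar>)"
  shows "convergent b"
proof -
  have "summable (\<lambda>m. b (Suc m) - b m)" by (rule summable_rabs_cancel[OF assms])
  then have "convergent (\<lambda>N. b N - b 0)"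
    unfolding summable_iff_convergent sum_lessThan_telescope .
  then obtain L where "(\<lambda>N. b N - b 0) \<longlonglongrightarrow> L" unfolding convergent_def ..
  then have "(\<lambda>N. (b N - b 0) + b 0) \<longlonglongrightarrow> L + b 0" by (intro tendsto_add tendsto_const)
  then show ?thesis unfolding convergent_def by auto
qed

context hardy_growth
begin

lemma mass_measurable:
  assumes "lmeas n U g" "compact_in n K" "K \<subseteq> U"
  shows "(\<lambda>x. ennreal (\<bar>g x\<bar> * \<bar>u x\<bar> powr p) * ind K x) \<in> borel_measurable (leb n)"
  by (rule mass_integrand_measurable[OF assms(1,3) compactin_sets_leb[OF assms(2)]])

lemma mass_add_le:
  assumes f: "lmeas n U f" and g: "lmeas n U g"
    and K: "compact_in n K" "K \<subseteq> U"
  shows "mass K (\<lambda>x. f x + g x) \<le> mass K f + mass K g"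
proof -
  have "mass K (\<lambda>x. f x + g x) \<le> (\<integral>\<^sup>+x. ennreal (\<bar>f x\<bar> * \<bar>u x\<bar> powr p) * ind K x
      + ennreal (\<bar>g x\<bar> * \<bar>u x\<bar> powr p) * ind K x \<partial>leb n)"
    unfolding mass_def
  proof (rule nn_integral_mono)
    fix x
    have "\<bar>f x + g x\<bar> * \<bar>u x\<bar> powr p \<le> (\<bar>f x\<bar> + \<bar>g x\<bar>) * \<bar>u x\<bar> powr p" by (intro mult_right_mono) auto
    then have "ennreal (\<bar>f x + g x\<bar> * \<bar>u x\<bar> powr p) \<le> ennreal (\<bar>f x\<bar> * \<bar>u x\<bar> powr p + \<bar>g x\<bar> * \<bar>u x\<bar> powr p)"
      by (intro ennreal_leI) (simp add: distrib_right)
    also have "\<dots> = ennreal (\<bar>f x\<bar> * \<bar>u x\<bar> powr p) + ennreal (\<bar>g x\<bar> * \<bar>u x\<bar> powr p)" by (rule ennreal_plus) auto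
    finally show "ennreal (\<bar>f x + g x\<bar> * \<bar>u x\<bar> powr p) * ind K x
        \<le> ennreal (\<bar>f x\<bar> * \<bar>u x\<bar> powr p) * ind K x + ennreal (\<bar>g x\<bar> * \<bar>u x\<bar> powr p) * ind K x"
      by (auto simp: indicator_def)
  qed
  also have "\<dots> = mass K f + mass K g"
    unfolding mass_def by (rule nn_integral_add[OF mass_measurable[OF f K] mass_measurable[OF g K]])
  finally show ?thesis .
qed

lemma mass_cmult:
  assumes g: "lmeas n U g" and K: "compact_in n K" "K \<subseteq> U"
  shows "mass K (\<lambda>x. c * g x) = ennreal \<bar>c\<bar> * mass K g"
proof -
  have "mass K (\<lambda>x. c * g x) = (\<integral>\<^sup>+x. ennreal \<bar>c\<bar> * (ennreal (\<bar>g x\<bar> * \<bar>u x\<bar> powr p) * ind K x) \<partial>leb n)"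
    unfolding mass_def by (intro nn_integral_cong) (simp add: abs_mult mult.assoc ennreal_mult)
  also have "\<dots> = ennreal \<bar>c\<bar> * mass K g"
    unfolding mass_def by (rule nn_integral_cmult[OF mass_measurable[OF g K]])
  finally show ?thesis .
qed

lemma norm_u_add:
  assumes f: "lmeas n U f" "N f < \<infinity>" and g: "lmeas n U g" "N g < \<infinity>"
  shows "N (\<lambda>x. f x + g x) \<le> N f + N g"
proof -
  obtain b where b: "0 \<le> b" "N f = ereal b" by (rule norm_u_finite[OF f(2)])
  obtain c where c: "0 \<le> c" "N g = ereal c" by (rule norm_u_finite[OF g(2)])
  have "N (\<lambda>x. f x + g x) \<le> ereal (b + c)"
  proof (subst norm_u_le_iff)
    show "\<forall>K. compact_in n K \<and> K \<subseteq> U \<longrightarrow> mass K (\<lambda>x. f x + g x) \<le> ennreal ((b + c) * cap K)"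
    proof (intro allI impI)
      fix K assume K: "compact_in n K \<and> K \<subseteq> U"
      have "mass K (\<lambda>x. f x + g x) \<le> mass K f + mass K g" using mass_add_le[OF f(1) g(1)] K by blast
      also have "\<dots> \<le> ennreal (b * cap K) + ennreal (c * cap K)"
      proof (rule add_mono)
        show "mass K f \<le> ennreal (b * cap K)" using norm_u_le_iff[OF b(1), of f] b(2) K by simp
        show "mass K g \<le> ennreal (c * cap K)" using norm_u_le_iff[OF c(1), of g] c(2) K by simp
      qed
      also have "\<dots> = ennreal (b * cap K + c * cap K)"
        using b(1) c(1) cap(2) K by (intro ennreal_plus[symmetric]) auto
      finally show "mass K (\<lambda>x. f x + g x) \<le> ennreal ((b + c) * cap K)" by (simp add: distrib_right)
    qed
  qed (use b c in simp)
  then show ?thesis using b c by simp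
qed

lemma norm_u_cmult_le:
  assumes g: "lmeas n U g" "N g < \<infinity>"
  shows "N (\<lambda>x. c * g x) \<le> ereal \<bar>c\<bar> * N g"
proof -
  obtain b where b: "0 \<le> b" "N g = ereal b" by (rule norm_u_finite[OF g(2)])
  have "N (\<lambda>x. c * g x) \<le> ereal (\<bar>c\<bar> * b)"
  proof (subst norm_u_le_iff)
    show "\<forall>K. compact_in n K \<and> K \<subseteq> U \<longrightarrow> mass K (\<lambda>x. c * g x) \<le> ennreal (\<bar>c\<bar> * b * cap K)"
    proof (intro allI impI)
      fix K assume K: "compact_in n K \<and> K \<subseteq> U"
      have "mass K (\<lambda>x. c * g x) = ennreal \<bar>c\<bar> * mass K g" using mass_cmult[OF g(1)] K by blast
      also have "mass K g \<le> ennreal (b * cap K)" using norm_u_le_iff[OF b(1), of g] b(2) K by simp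
      then have "ennreal \<bar>c\<bar> * mass K g \<le> ennreal \<bar>c\<bar> * ennreal (b * cap K)" by (rule mult_left_mono) simp
      also have "\<dots> = ennreal (\<bar>c\<bar> * b * cap K)"
        using b(1) cap(2) K by (simp add: ennreal_mult[symmetric] mult.assoc)
      finally show "mass K (\<lambda>x. c * g x) \<le> ennreal (\<bar>c\<bar> * b * cap K)" .
    qed
  qed (use b in simp)
  then show ?thesis using b by simp
qed

text \<open>The reverse inequality is the bound for the factor \<open>1/c\<close>, applied to
  \<open>c * g\<close>.\<close>

lemma norm_u_cmult:
  assumes g: "lmeas n U g" "N g < \<infinity>"
  shows "N (\<lambda>x. c * g x) = ereal \<bar>c\<bar> * N g"
proof (rule antisym[OF norm_u_cmult_le[OF g]])
  obtain b where b: "0 \<le> b" "N g = ereal b" by (rule norm_u_finite[OF g(2)])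
  show "ereal \<bar>c\<bar> * N g \<le> N (\<lambda>x. c * g x)"
  proof (cases "c = 0")
    case True
    then show ?thesis using norm_u_nonneg[of "\<lambda>x. c * g x"] b by (simp add: zero_ereal_def)
  next
    case False
    have le: "N (\<lambda>x. c * g x) \<le> ereal (\<bar>c\<bar> * b)" using norm_u_cmult_le[OF g, of c] b by simp
    then have fin: "N (\<lambda>x. c * g x) < \<infinity>" by (rule le_less_trans) simp
    obtain d where d: "0 \<le> d" "N (\<lambda>x. c * g x) = ereal d" by (rule norm_u_finite[OF fin])
    have "N (\<lambda>x. (1 / c) * (c * g x)) \<le> ereal \<bar>1 / c\<bar> * N (\<lambda>x. c * g x)"
      by (rule norm_u_cmult_le[OF set_measurable_cmult[OF g(1)] fin])
    then have "ereal b \<le> ereal (\<bar>1 / c\<bar> * d)" using False b d by simp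
    then have "\<bar>c\<bar> * b \<le> d" using False by (simp add: abs_divide field_simps)
    then show ?thesis using b d by simp
  qed
qed

lemma mass_cong_AE:
  assumes "AE x\<in>U in leb n. f x = g x" "K \<subseteq> U"
  shows "mass K f = mass K g"
  unfolding mass_def
proof (rule nn_integral_cong_AE)
  show "AE x in leb n. ennreal (\<bar>f x\<bar> * \<bar>u x\<bar> powr p) * ind K x = ennreal (\<bar>g x\<bar> * \<bar>u x\<bar> powr p) * ind K x"
    using assms(1) by eventually_elim (use assms(2) in \<open>auto simp: indicator_def\<close>)
qed

lemma norm_u_cong_AE:
  assumes ae: "AE x\<in>U in leb n. f x = g x" and fin: "N f < \<infinity>"
  shows "N g < \<infinity>"
proof -
  obtain b where b: "0 \<le> b" "N f = ereal b" by (rule norm_u_finite[OF fin])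
  have "\<forall>K. compact_in n K \<and> K \<subseteq> U \<longrightarrow> mass K f \<le> ennreal (b * cap K)"
    using norm_u_le_iff[OF b(1), of f] b(2) by simp
  then have "\<forall>K. compact_in n K \<and> K \<subseteq> U \<longrightarrow> mass K g \<le> ennreal (b * cap K)"
    using mass_cong_AE[OF ae] by metis
  then have "N g \<le> ereal b" unfolding norm_u_le_iff[OF b(1)] .
  then show ?thesis by (rule le_less_trans) simp
qed

lemma norm_u_eq_0_iff:
  assumes g: "lmeas n U g"
  shows "N g = 0 \<longleftrightarrow> (AE x\<in>U in leb n. g x = 0)"
proof -
  have m0: "mass K g \<le> 0 \<longleftrightarrow> (AE x\<in>K in leb n. g x = 0)" if K: "compact_in n K" "K \<subseteq> U" for K
  proof -
    have "mass K g \<le> 0 \<longleftrightarrow> (AE x in leb n. ennreal (\<bar>g x\<bar> * \<bar>u x\<bar> powr p) * ind K x = 0)"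
      unfolding mass_def using nn_integral_0_iff_AE[OF mass_measurable[OF g K]] by simp
    also have "\<dots> \<longleftrightarrow> (AE x\<in>K in leb n. g x = 0)"
    proof (rule AE_cong)
      fix x
      have "0 < \<bar>u x\<bar> powr p" if "x \<in> K"
      proof -
        have "0 < u x" using u_pos K(2) that by blast
        then show ?thesis by simp
      qed
      then show "(ennreal (\<bar>g x\<bar> * \<bar>u x\<bar> powr p) * ind K x = 0) = (x \<in> K \<longrightarrow> g x = 0)"
        by (cases "x \<in> K") (auto simp: zero_less_mult_iff ennreal_eq_0_iff mult_le_0_iff)
    qed
    finally show ?thesis .
  qed
  have "N g = 0 \<longleftrightarrow> N g \<le> ereal 0" using norm_u_nonneg[of g] by (auto simp: zero_ereal_def)
  also have "\<dots> \<longleftrightarrow> (\<forall>K. compact_in n K \<and> K \<subseteq> U \<longrightarrow> mass K g \<le> 0)"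
    unfolding norm_u_le_iff[OF order_refl] by simp
  also have "\<dots> \<longleftrightarrow> (AE x\<in>U in leb n. g x = 0)"
  proof
    assume "\<forall>K. compact_in n K \<and> K \<subseteq> U \<longrightarrow> mass K g \<le> 0"
    then show "AE x\<in>U in leb n. g x = 0" by (intro AE_open_from_compact[OF U]) (simp add: m0[symmetric])
  next
    assume ae: "AE x\<in>U in leb n. g x = 0"
    show "\<forall>K. compact_in n K \<and> K \<subseteq> U \<longrightarrow> mass K g \<le> 0"
    proof (intro allI impI)
      fix K assume K: "compact_in n K \<and> K \<subseteq> U"
      have "AE x\<in>K in leb n. g x = 0" using ae by eventually_elim (use K in auto)
      then show "mass K g \<le> 0" using m0 K by blast
    qed
  qed
  finally show ?thesis .
qed

text \<open>\<open>u\<close> is bounded below by a positive constant on each compact set, whose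
  weighted mass is bounded by a multiple of its finite capacity.\<close>

lemma Lp_loc_of_mass:
  assumes g: "lmeas n U g" and fin: "N g < \<infinity>"
  shows "g \<in> Lp_loc n U 1"
proof -
  obtain b where b: "0 \<le> b" "N g = ereal b" by (rule norm_u_finite[OF fin])
  have "set_integrable (leb n) K (\<lambda>x. \<bar>g x\<bar> powr 1)" if K: "compact_in n K" "K \<subseteq> U" for K
    unfolding set_integrable_def
  proof (rule integrableI_bounded)
    have "lmeas n K (\<lambda>x. \<bar>g x\<bar> powr 1)"
      by (rule set_measurable_mono[OF set_measurable_abs_powr[OF g] K(2) compactin_sets_leb[OF K(1)]])
    then show "(\<lambda>x. ind K x *\<^sub>R \<bar>g x\<bar> powr 1) \<in> borel_measurable (leb n)" by (simp add: set_borel_measurable_def)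
    have uc: "cont_on n U u" using u by (simp add: C_continuous_def)
    have upos: "0 < u x" if "x \<in> K" for x using u_pos K(2) that by blast
    obtain c where c: "c > 0" "\<forall>x\<in>K. c \<le> u x" by (rule positive_lower_bound_on_compact[OF uc K upos])
    have "ennreal (norm (ind K x *\<^sub>R \<bar>g x\<bar> powr 1))
        \<le> ennreal (1 / c powr p) * (ennreal (\<bar>g x\<bar> * \<bar>u x\<bar> powr p) * ind K x)" for x
    proof (cases "x \<in> K")
      case True
      have "c powr p \<le> \<bar>u x\<bar> powr p" using c True p by (intro powr_mono2) auto
      then have "\<bar>g x\<bar> * c powr p \<le> \<bar>g x\<bar> * \<bar>u x\<bar> powr p" by (rule mult_left_mono) simp
      then have "\<bar>g x\<bar> \<le> (1 / c powr p) * (\<bar>g x\<bar> * \<bar>u x\<bar> powr p)" using c(1) by (simp add: pos_le_divide_eq)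
      then have "ennreal \<bar>g x\<bar> \<le> ennreal ((1 / c powr p) * (\<bar>g x\<bar> * \<bar>u x\<bar> powr p))" by (rule ennreal_leI)
      also have "\<dots> = ennreal (1 / c powr p) * ennreal (\<bar>g x\<bar> * \<bar>u x\<bar> powr p)" by (rule ennreal_mult) auto
      finally show ?thesis using True by simp
    qed simp
    then have "(\<integral>\<^sup>+x. ennreal (norm (ind K x *\<^sub>R \<bar>g x\<bar> powr 1)) \<partial>leb n)
        \<le> (\<integral>\<^sup>+x. ennreal (1 / c powr p) * (ennreal (\<bar>g x\<bar> * \<bar>u x\<bar> powr p) * ind K x) \<partial>leb n)"
      by (rule nn_integral_mono)
    also have "\<dots> = ennreal (1 / c powr p) * mass K g"
      unfolding mass_def by (rule nn_integral_cmult[OF mass_measurable[OF g K]])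
    also have "\<dots> \<le> ennreal (1 / c powr p) * ennreal (b * cap K)"
      using norm_u_le_iff[OF b(1), of g] b(2) K by (intro mult_left_mono) auto
    also have "\<dots> < \<infinity>" by (simp add: ennreal_mult_less_top)
    finally show "(\<integral>\<^sup>+x. ennreal (norm (ind K x *\<^sub>R \<bar>g x\<bar> powr 1)) \<partial>leb n) < \<infinity>" .
  qed
  then show ?thesis using g by (simp add: Lp_loc_def)
qed

text \<open>Lower semicontinuity under convergence almost everywhere: Fatou's lemma on each compact
  set separately, with the same bound \<open>l * cap K\<close>.\<close>

lemma norm_u_Fatou:
  assumes G: "\<And>m. lmeas n U (G m)"
    and lim: "AE x\<in>U in leb n. (\<lambda>m. G m x) \<longlonglongrightarrow> g x"
    and l: "0 \<le> l" "\<forall>\<^sub>F m in sequentially. N (G m) \<le> ereal l"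
  shows "N g \<le> ereal l"
proof (unfold norm_u_le_iff[OF l(1)], intro allI impI)
  fix K assume K: "compact_in n K \<and> K \<subseteq> U"
  let ?h = "\<lambda>m x. ennreal (\<bar>G m x\<bar> * \<bar>u x\<bar> powr p) * ind K x"
  have "mass K g = (\<integral>\<^sup>+x. liminf (\<lambda>m. ?h m x) \<partial>leb n)" unfolding mass_def
  proof (rule nn_integral_cong_AE)
    show "AE x in leb n. ennreal (\<bar>g x\<bar> * \<bar>u x\<bar> powr p) * ind K x = liminf (\<lambda>m. ?h m x)"
      using lim
    proof eventually_elim
      case (elim x)
      show ?case
      proof (cases "x \<in> K")
        case True
        then have "(\<lambda>m. G m x) \<longlonglongrightarrow> g x" using elim K by blast
        then have "(\<lambda>m. ennreal (\<bar>G m x\<bar> * \<bar>u x\<bar> powr p)) \<longlonglongrightarrow> ennreal (\<bar>g x\<bar> * \<bar>u x\<bar> powr p)"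
          by (intro tendsto_intros)
        from lim_imp_Liminf[OF sequentially_bot this]
        show ?thesis using True by simp
      qed (simp add: Liminf_const)
    qed
  qed
  also have "\<dots> \<le> liminf (\<lambda>m. \<integral>\<^sup>+x. ?h m x \<partial>leb n)"
    by (rule nn_integral_liminf) (use mass_measurable[OF G] K in blast)
  also have "\<dots> \<le> limsup (\<lambda>m. mass K (G m))" unfolding mass_def by (rule Liminf_le_Limsup) simp
  also have "\<dots> \<le> ennreal (l * cap K)"
  proof (rule Limsup_bounded)
    show "\<forall>\<^sub>F m in sequentially. mass K (G m) \<le> ennreal (l * cap K)"
      using l(2) by eventually_elim (use K in \<open>simp add: norm_u_le_iff[OF l(1)]\<close>)
  qed
  finally show "mass K g \<le> ennreal (l * cap K)" .
qed

lemma norm_u_complete: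
  assumes F: "\<And>k. F k \<in> Lp_loc n U 1" "\<And>k. N (F k) < \<infinity>"
    and Cauchy: "\<forall>e>0. \<exists>k0. \<forall>j\<ge>k0. \<forall>k\<ge>k0. N (\<lambda>x. F j x - F k x) < ereal e"
  obtains f where "f \<in> Lp_loc n U 1" "N f < \<infinity>" "(\<lambda>k. N (\<lambda>x. F k x - f x)) \<longlonglongrightarrow> 0"
proof -
  have Fm: "lmeas n U (F k)" for k using F(1) by (simp add: Lp_loc_def)
  have diff: "lmeas n U (\<lambda>x. g x - h x)"
    if "lmeas n U g" "lmeas n U h" for g h :: "point \<Rightarrow> real"
    using set_measurable_add[OF that(1) set_measurable_cmult[OF that(2), of "-1"]] by simp
  have "\<forall>m. \<exists>k0. \<forall>j\<ge>k0. \<forall>k\<ge>k0. N (\<lambda>x. F j x - F k x) < ereal ((1/2) ^ m)" using Cauchy by simp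
  then obtain k0 where k0: "\<forall>m. \<forall>j\<ge>k0 m. \<forall>k\<ge>k0 m. N (\<lambda>x. F j x - F k x) < ereal ((1/2) ^ m)" by metis
  \<comment> \<open>Partial sums give a nondecreasing sequence with \<open>r j \<ge> k0 m\<close>
    for all \<open>j \<ge> m\<close>, so consecutive members differ by at most \<open>2^-m\<close>
    in norm.\<close>
  define r where "r m = sum k0 {..m}" for m
  have r: "k0 m \<le> r j" if "m \<le> j" for m j
    unfolding r_def by (rule member_le_sum) (use that in auto)
  have step: "N (\<lambda>x. F (r (Suc m)) x - F (r m) x) \<le> ereal ((1/2) ^ m)" for m
    using k0 r[of m "Suc m"] r[of m m] by (intro less_imp_le) simp
  have conv: "AE x\<in>U in leb n. convergent (\<lambda>m. F (r m) x)"
  proof (rule AE_open_from_compact[OF U])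
    fix K assume K: "compact_in n K" "K \<subseteq> U"
    let ?h = "\<lambda>m x. ennreal (\<bar>F (r (Suc m)) x - F (r m) x\<bar> * \<bar>u x\<bar> powr p) * ind K x"
    have hm: "?h m \<in> borel_measurable (leb n)" for m by (rule mass_measurable[OF diff[OF Fm Fm] K])
    have "(\<integral>\<^sup>+x. (\<Sum>m. ?h m x) \<partial>leb n) = (\<Sum>m. mass K (\<lambda>x. F (r (Suc m)) x - F (r m) x))"
      unfolding mass_def by (rule nn_integral_suminf[OF hm])
    also have "\<dots> \<le> (\<Sum>m. ennreal ((1/2) ^ m * cap K))"
    proof (intro suminf_le summableI)
      fix m
      have z: "(0::real) \<le> (1/2) ^ m" by simp
      show "mass K (\<lambda>x. F (r (Suc m)) x - F (r m) x) \<le> ennreal ((1/2) ^ m * cap K)"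
        using step[of m] K unfolding norm_u_le_iff[OF z] by blast
    qed
    also have "\<dots> < \<infinity>"
    proof -
      have "summable (\<lambda>m. (1/2::real) ^ m * cap K)" by (intro summable_mult2 summable_geometric) simp
      then have "(\<Sum>m. ennreal ((1/2) ^ m * cap K)) = ennreal (\<Sum>m. (1/2) ^ m * cap K)"
        using cap(2)[OF K] by (intro suminf_ennreal2) auto
      then show ?thesis by simp
    qed
    finally have fin: "(\<integral>\<^sup>+x. (\<Sum>m. ?h m x) \<partial>leb n) \<noteq> \<infinity>" by simp
    have "AE x in leb n. (\<Sum>m. ?h m x) \<noteq> \<infinity>"
      by (rule nn_integral_noteq_infinite[OF _ fin]) (rule borel_measurable_suminf_order, rule hm)
    then show "AE x\<in>K in leb n. convergent (\<lambda>m. F (r m) x)"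
    proof eventually_elim
      case (elim x)
      show ?case
      proof
        assume x: "x \<in> K"
        have up: "0 < u x" using u_pos K(2) x by blast
        have "(\<Sum>m. ennreal (\<bar>F (r (Suc m)) x - F (r m) x\<bar> * \<bar>u x\<bar> powr p)) \<noteq> top" using elim x by simp
        then have "summable (\<lambda>m. \<bar>F (r (Suc m)) x - F (r m) x\<bar> * \<bar>u x\<bar> powr p)"
          by (rule summable_suminf_not_top[rotated]) simp
        then have "summable (\<lambda>m. \<bar>u x\<bar> powr p * \<bar>F (r (Suc m)) x - F (r m) x\<bar>)" by (simp only: mult.commute)
        then have "summable (\<lambda>m. \<bar>F (r (Suc m)) x - F (r m) x\<bar>)" using up by (simp add: summable_cmult_iff)
        then show "convergent (\<lambda>m. F (r m) x)" by (rule convergent_of_summable_differences)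
      qed
    qed
  qed
  \<comment> \<open>The indicator makes all members measurable on the whole space, hence also the
    limit. Where the sequence diverges the value of \<open>lim\<close> is arbitrary, but inside
    \<open>U\<close> this concerns only a null set.\<close>
  define f where "f x = lim (\<lambda>m. ind U x *\<^sub>R F (r m) x)" for x
  have "f \<in> borel_measurable (leb n)" unfolding f_def
    by (rule borel_measurable_lim_metric) (use Fm in \<open>simp add: set_borel_measurable_def\<close>)
  then have fm: "lmeas n U f"
    unfolding set_borel_measurable_def using U_sets by (intro borel_measurable_scaleR borel_measurable_indicator)
  have lim: "AE x\<in>U in leb n. (\<lambda>m. F (r m) x) \<longlonglongrightarrow> f x"
    using conv by eventually_elim (simp add: f_def convergent_LIMSEQ_iff)
  \<comment> \<open>Fatou along the subsequence with the index \<open>k\<close> kept fixed: this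
    gives convergence of the full sequence.\<close>
  have le: "N (\<lambda>x. F k x - f x) \<le> ereal ((1/2) ^ m)" if k: "k0 m \<le> k" for k m
  proof (rule norm_u_Fatou[of "\<lambda>j x. F k x - F (r j) x"])
    show "lmeas n U (\<lambda>x. F k x - F (r j) x)" for j by (rule diff[OF Fm Fm])
    show "AE x\<in>U in leb n. (\<lambda>j. F k x - F (r j) x) \<longlonglongrightarrow> F k x - f x"
      using lim by eventually_elim (auto intro: tendsto_diff)
    show "\<forall>\<^sub>F j in sequentially. N (\<lambda>x. F k x - F (r j) x) \<le> ereal ((1/2) ^ m)"
      unfolding eventually_sequentially
    proof (intro exI[of _ m] allI impI less_imp_le)
      fix j assume "m \<le> j"
      then show "N (\<lambda>x. F k x - F (r j) x) < ereal ((1/2) ^ m)" using k0 r[of m j] k by simp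
    qed
  qed simp
  define k where "k = k0 0"
  define G where "G x = F k x - f x" for x
  have Gm: "lmeas n U G" unfolding G_def by (rule diff[OF Fm fm])
  have "N G \<le> ereal ((1/2) ^ 0)" unfolding G_def by (rule le) (simp add: k_def)
  then have Gfin: "N G < \<infinity>" by (rule le_less_trans) simp
  \<comment> \<open>The limit differs from one member by a function of finite norm, so it inherits
    local integrability and finite norm from the two.\<close>
  have feq: "f = (\<lambda>x. F k x + (-1) * G x)" by (simp add: G_def fun_eq_iff)
  show thesis
  proof (rule that)
    show "f \<in> Lp_loc n U 1" unfolding feq by (rule Lp_loc_add_cmult[OF F(1) Lp_loc_of_mass[OF Gm Gfin]])
    have m1: "N (\<lambda>x. (-1) * G x) < \<infinity>"
    proof (rule le_less_trans[OF norm_u_cmult_le[OF Gm Gfin]])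
      show "ereal \<bar>-1\<bar> * N G < \<infinity>" using Gfin by (simp add: one_ereal_def[symmetric])
    qed
    have "N f \<le> N (F k) + N (\<lambda>x. (-1) * G x)"
      unfolding feq by (rule norm_u_add[OF Fm F(2) set_measurable_cmult[OF Gm] m1])
    also have "\<dots> < \<infinity>" using F(2)[of k] m1 by simp
    finally show "N f < \<infinity>" .
    show "(\<lambda>k. N (\<lambda>x. F k x - f x)) \<longlonglongrightarrow> 0"
    proof (rule order_tendstoI)
      fix b :: ereal assume b: "b < 0"
      show "\<forall>\<^sub>F k in sequentially. b < N (\<lambda>x. F k x - f x)"
        by (intro always_eventually allI less_le_trans[OF b norm_u_nonneg])
    next
      fix b :: ereal assume "0 < b"
      then obtain e where e: "0 < ereal e" "ereal e < b" using ereal_dense2 by blast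
      obtain m where m: "(1/2::real) ^ m < e" using real_arch_pow_inv[of e "1/2"] e(1) by auto
      have "N (\<lambda>x. F k x - f x) < b" if "k0 m \<le> k" for k
      proof -
        have "N (\<lambda>x. F k x - f x) \<le> ereal ((1/2) ^ m)" by (rule le[OF that])
        also have "\<dots> < ereal e" using m by simp
        also note e(2)
        finally show ?thesis .
      qed
      then show "\<forall>\<^sub>F k in sequentially. N (\<lambda>x. F k x - f x) < b" unfolding eventually_sequentially by blast
    qed
  qed
qed

lemma banach: "banach_space_ae n U (hardy_weights n U p s a V) N"
proof -
  let ?X = "hardy_weights n U p s a V"
  have X: "f \<in> ?X \<longleftrightarrow> f \<in> Lp_loc n U 1 \<and> N f < \<infinity>" for f by (rule hardy_weights_iff)
  have Xm: "lmeas n U f" if "f \<in> ?X" for f using that X by (simp add: Lp_loc_def)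
  have zm: "lmeas n U (\<lambda>x. 0 :: real)" by (simp add: set_borel_measurable_def)
  have "N (\<lambda>x. 0) = 0" using norm_u_eq_0_iff[OF zm] by simp
  then have zero: "(\<lambda>x. 0) \<in> ?X" unfolding X using zm by (simp add: Lp_loc_def set_integrable_def)
  have add: "(\<lambda>x. f x + g x) \<in> ?X" "N (\<lambda>x. f x + g x) \<le> N f + N g" if "f \<in> ?X" "g \<in> ?X" for f g
  proof -
    show le: "N (\<lambda>x. f x + g x) \<le> N f + N g" using norm_u_add Xm that X by blast
    have "N f + N g < \<infinity>" using that X by simp
    then have "N (\<lambda>x. f x + g x) < \<infinity>" using le by (rule le_less_trans[rotated])
    moreover have "(\<lambda>x. f x + 1 * g x) \<in> Lp_loc n U 1" using that X by (intro Lp_loc_add_cmult) blast+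
    ultimately show "(\<lambda>x. f x + g x) \<in> ?X" unfolding X by simp
  qed
  have cmult: "(\<lambda>x. c * f x) \<in> ?X" "N (\<lambda>x. c * f x) = ereal \<bar>c\<bar> * N f" if f: "f \<in> ?X" for f c
  proof -
    have fin: "N f < \<infinity>" using f X by blast
    show eq: "N (\<lambda>x. c * f x) = ereal \<bar>c\<bar> * N f" by (rule norm_u_cmult[OF Xm[OF f] fin])
    obtain b where b: "0 \<le> b" "N f = ereal b" by (rule norm_u_finite[OF fin])
    have "(\<lambda>x. 0 + c * f x) \<in> Lp_loc n U 1" using zero f X by (intro Lp_loc_add_cmult) blast+
    then show "(\<lambda>x. c * f x) \<in> ?X" unfolding X using eq b by simp
  qed
  have inv: "g \<in> ?X" if f: "f \<in> ?X" and ae: "AE x\<in>U in leb n. f x = g x" for f g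
  proof -
    have "AE x\<in>U in leb n. g x = f x" using ae by eventually_elim auto
    then have "g \<in> Lp_loc n U 1" using Lp_loc_cong_AE f X by blast
    moreover have "N g < \<infinity>" using norm_u_cong_AE[OF ae] f X by blast
    ultimately show ?thesis unfolding X by blast
  qed
  have complete: "\<exists>f\<in>?X. (\<lambda>k. N (\<lambda>x. F k x - f x)) \<longlonglongrightarrow> 0"
    if F: "range F \<subseteq> ?X" "\<forall>e>0. \<exists>k0. \<forall>j\<ge>k0. \<forall>k\<ge>k0. N (\<lambda>x. F j x - F k x) < ereal e" for F
  proof -
    have FX: "F k \<in> ?X" for k using F(1) by auto
    have F1: "F k \<in> Lp_loc n U 1" "N (F k) < \<infinity>" for k using FX[of k] unfolding X by auto
    obtain f where "f \<in> Lp_loc n U 1" "N f < \<infinity>" "(\<lambda>k. N (\<lambda>x. F k x - f x)) \<longlonglongrightarrow> 0"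
      by (rule norm_u_complete[OF F1 F(2)])
    then show ?thesis using X by blast
  qed
  have fin: "0 \<le> N f \<and> N f < \<infinity>" if "f \<in> ?X" for f using that X norm_u_nonneg by blast
  have z: "N f = 0 \<longleftrightarrow> (AE x\<in>U in leb n. f x = 0)" if "f \<in> ?X" for f by (rule norm_u_eq_0_iff[OF Xm[OF that]])
  show ?thesis
    unfolding banach_space_ae_def
  proof (intro conjI)
    show "(\<lambda>x. 0) \<in> ?X" by (rule zero)
    show "\<forall>f\<in>?X. \<forall>g\<in>?X. (\<lambda>x. f x + g x) \<in> ?X" using add(1) by blast
    show "\<forall>c. \<forall>f\<in>?X. (\<lambda>x. c * f x) \<in> ?X" using cmult(1) by blast
    show "\<forall>f\<in>?X. \<forall>g. (AE x\<in>U in leb n. f x = g x) \<longrightarrow> g \<in> ?X" using inv by blast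
    show "\<forall>f\<in>?X. 0 \<le> N f \<and> N f < \<infinity>" using fin by blast
    show "\<forall>f\<in>?X. N f = 0 \<longleftrightarrow> (AE x\<in>U in leb n. f x = 0)" using z by blast
    show "\<forall>c. \<forall>f\<in>?X. N (\<lambda>x. c * f x) = ereal \<bar>c\<bar> * N f" using cmult(2) by blast
    show "\<forall>f\<in>?X. \<forall>g\<in>?X. N (\<lambda>x. f x + g x) \<le> N f + N g" using add(2) by blast
    show "\<forall>F :: nat \<Rightarrow> point \<Rightarrow> real. range F \<subseteq> ?X \<and>
        (\<forall>e>0. \<exists>k0. \<forall>j\<ge>k0. \<forall>k\<ge>k0. N (\<lambda>x. F j x - F k x) < ereal e) \<longrightarrow>
        (\<exists>f\<in>?X. (\<lambda>k. N (\<lambda>x. F k x - f x)) \<longlonglongrightarrow> 0)"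
      using complete by blast
  qed
qed

end

subsection \<open>Localization to compact subsets\<close>

text \<open>The conditions on weights and potential are stated on relatively compact domains. Open
  cubes of radius \<open>2 * r\<close> are such domains, and the closed cubes of radius
  \<open>r\<close> inside them cover \<open>K\<close>.\<close>

lemma finite_domain_cover:
  assumes U: "openin (Rn n) U" and K: "compact_in n K" "K \<subseteq> U"
  obtains F r where "finite F" "r > 0" "K \<subseteq> (\<Union>x\<in>F. clbox n x r)"
    "\<forall>x\<in>F. domain_in n (obox n x (2 * r)) \<and> compactly_inside n (obox n x (2 * r)) U"
proof -
  obtain d K' where d: "d > 0" "compact_in n K'" "K' \<subseteq> U" "\<forall>x\<in>K. obox n x d \<subseteq> K'" "K \<subseteq> K'"
    by (rule compact_neighbourhood[OF U K])
  define r where "r = d / 4"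
  have r: "r > 0" "2 * r < d" using d(1) by (auto simp: r_def)
  obtain e F where F: "e > 0" "finite F" "F \<subseteq> K" "\<forall>y\<in>K. \<exists>x\<in>F. y \<in> obox n x r \<and> obox n y e \<subseteq> obox n x r"
    by (rule compact_obox_lebesgue[OF K(1), of "\<lambda>_. r"]) (rule r(1))
  have Kp: "K \<subseteq> pts n" using compactin_subset_topspace[OF K(1)] by simp
  have "K \<subseteq> (\<Union>x\<in>F. clbox n x r)" using F(4) obox_subset_clbox by blast
  moreover have "domain_in n (obox n x (2 * r)) \<and> compactly_inside n (obox n x (2 * r)) U" if x: "x \<in> F" for x
  proof
    have "x \<in> obox n x (2 * r)" using x F(3) Kp r(1) by (intro centre_in_obox) auto
    then show "domain_in n (obox n x (2 * r))"
      unfolding domain_in_def using openin_obox connectedin_obox by blast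
    have cl: "closedin (Rn n) (clbox n x (2 * r))" by (rule compactin_imp_closedin[OF Hausdorff_Rn compactin_clbox])
    have sub: "Rn n closure_of (obox n x (2 * r)) \<subseteq> clbox n x (2 * r)"
      by (rule closure_of_minimal[OF obox_subset_clbox cl])
    have "compact_in n (Rn n closure_of (obox n x (2 * r)))"
      by (rule closed_compactin[OF compactin_clbox sub closedin_closure_of])
    moreover have "clbox n x (2 * r) \<subseteq> U"
      using clbox_subset_obox[OF r(2), of n x] d(3,4) x F(3) by blast
    ultimately show "compactly_inside n (obox n x (2 * r)) U" unfolding compactly_inside_def using sub by blast
  qed
  ultimately show thesis using that F(2) r(1) by blast
qed

lemma set_measurable_Union:
  fixes f :: "'a \<Rightarrow> real"
  assumes C: "countable C" and K: "\<And>K. K \<in> C \<Longrightarrow> K \<in> sets M" "\<And>K. K \<in> C \<Longrightarrow> set_borel_measurable M K f"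
  shows "set_borel_measurable M (\<Union>C) f"
  unfolding set_borel_measurable_def
proof (rule measurable_piecewise_restrict[where C = "insert (space M - \<Union>C) C"])
  show "countable (insert (space M - \<Union>C) C)" using C by simp
  have Un: "\<Union>C \<in> sets M" using C K(1) by (intro sets.countable_Union) auto
  show "U \<inter> space M \<in> sets M" if "U \<in> insert (space M - \<Union>C) C" for U
    using that Un K(1) by auto
  show "space M \<subseteq> \<Union>(insert (space M - \<Union>C) C)" by auto
  show "(\<lambda>x. ind (\<Union>C) x *\<^sub>R f x) \<in> borel_measurable (restrict_space M U)"
    if "U \<in> insert (space M - \<Union>C) C" for U
  proof (cases "U \<in> C")
    case True
    have "(\<lambda>x. ind U x *\<^sub>R f x) \<in> borel_measurable (restrict_space M U)"
      using K(2)[OF True] by (intro measurable_restrict_space1) (simp add: set_borel_measurable_def)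
    then show ?thesis
      by (rule measurable_cong[THEN iffD1, rotated]) (use True in \<open>auto simp: space_restrict_space indicator_def\<close>)
  next
    case False
    then have U: "U = space M - \<Union>C" using that by simp
    have "(\<lambda>x. 0 :: real) \<in> borel_measurable (restrict_space M U)" by simp
    then show ?thesis
      by (rule measurable_cong[THEN iffD1, rotated]) (auto simp: space_restrict_space indicator_def U)
  qed
qed

lemma in_morrey_imp_Lp_loc: "in_morrey n q p \<omega> f \<Longrightarrow> f \<in> Lp_loc n \<omega> 1"
  by (auto simp: in_morrey_def Lp_imp_Lp_loc split: if_splits)

text \<open>Integrability on a compact set follows from a finite cover by cubes; measurability on
  the whole of \<open>U\<close> is glued from countably many.\<close>

lemma Lp_loc_local:
  assumes U: "openin (Rn n) U"
    and loc: "\<And>\<omega>. domain_in n \<omega> \<Longrightarrow> compactly_inside n \<omega> U \<Longrightarrow> f \<in> Lp_loc n \<omega> 1"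
  shows "f \<in> Lp_loc n U 1"
proof -
  have K: "lmeas n K f \<and> set_integrable (leb n) K (\<lambda>x. \<bar>f x\<bar> powr 1)"
    if K: "compact_in n K" "K \<subseteq> U" for K
  proof -
    obtain F r where F: "finite F" "r > 0" "K \<subseteq> (\<Union>x\<in>F. clbox n x r)"
      "\<forall>x\<in>F. domain_in n (obox n x (2 * r)) \<and> compactly_inside n (obox n x (2 * r)) U"
      by (rule finite_domain_cover[OF U K])
    have sub: "clbox n x r \<subseteq> obox n x (2 * r)" for x using F(2) by (intro clbox_subset_obox) simp
    have fL: "f \<in> Lp_loc n (obox n x (2 * r)) 1" if "x \<in> F" for x using loc F(4) that by blast
    have cs: "clbox n x r \<in> sets (leb n)" for x by (rule compactin_sets_leb[OF compactin_clbox])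
    have Ks: "K \<in> sets (leb n)" by (rule compactin_sets_leb[OF K(1)])
    have m: "lmeas n (clbox n x r) f" if "x \<in> F" for x
      using fL[OF that] set_measurable_mono[OF _ sub cs] by (simp add: Lp_loc_def)
    have "lmeas n (\<Union>x\<in>F. clbox n x r) f"
      by (rule set_measurable_Union) (use F(1) cs m in \<open>auto intro: countable_finite\<close>)
    then have 1: "lmeas n K f" by (rule set_measurable_mono[OF _ F(3) Ks])
    have i: "set_integrable (leb n) (clbox n x r) (\<lambda>x. \<bar>f x\<bar> powr 1)" if "x \<in> F" for x
      using fL[OF that] compactin_clbox[of n x r] sub[of x] by (simp add: Lp_loc_def)
    have "set_integrable (leb n) (\<Union>x\<in>F. clbox n x r) (\<lambda>x. \<bar>f x\<bar> powr 1)"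
      by (rule set_integrable_UN[OF F(1) i cs])
    then have "set_integrable (leb n) K (\<lambda>x. \<bar>f x\<bar> powr 1)" by (rule set_integrable_subset[OF _ Ks F(3)])
    with 1 show ?thesis ..
  qed
  obtain C where C: "countable C" "\<forall>K\<in>C. \<exists>c r. K = clbox n c r" "U = \<Union>C"
    by (rule open_eq_countable_Union_clbox[OF U])
  have Cc: "compact_in n L" "L \<subseteq> U" if "L \<in> C" for L
    using C(2,3) that compactin_clbox by auto
  have "lmeas n (\<Union>C) f"
    by (rule set_measurable_Union[OF C(1)]) (use Cc compactin_sets_leb K in blast)+
  then show ?thesis unfolding Lp_loc_def using K C(3) by simp
qed

lemma weight_bounded_on_compact:
  assumes U: "openin (Rn n) U" and a: "weight_vector n U a" and K: "compact_in n K" "K \<subseteq> U"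
  shows "\<exists>C>0. AE x\<in>K in leb n. (\<forall>i<n. a i x \<le> C)"
proof -
  obtain F r where F: "finite F" "r > 0" "K \<subseteq> (\<Union>x\<in>F. clbox n x r)"
    "\<forall>x\<in>F. domain_in n (obox n x (2 * r)) \<and> compactly_inside n (obox n x (2 * r)) U"
    by (rule finite_domain_cover[OF U K])
  have sub: "clbox n y r \<subseteq> obox n y (2 * r)" for y using F(2) by (intro clbox_subset_obox) simp
  have "\<exists>C. AE x in leb n. x \<in> clbox n y r \<longrightarrow> (\<forall>i<n. a i x \<le> C)" if y: "y \<in> F" for y
  proof -
    have dc: "domain_in n (obox n y (2 * r)) \<and> compactly_inside n (obox n y (2 * r)) U" using F(4) y ..
    have bd: "\<forall>\<omega>. domain_in n \<omega> \<and> compactly_inside n \<omega> U \<longrightarrow>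
        (\<exists>c C. 0 < c \<and> c \<le> C \<and> (\<forall>i<n. AE x\<in>\<omega> in leb n. c \<le> a i x \<and> a i x \<le> C))"
      using a unfolding weight_vector_def by (rule conjunct2)
    obtain c C where "0 < c \<and> c \<le> C \<and> (\<forall>i<n. AE x\<in>obox n y (2 * r) in leb n. c \<le> a i x \<and> a i x \<le> C)"
      using bd[rule_format, OF dc] by (elim exE)
    then have C: "\<forall>i<n. AE x\<in>obox n y (2 * r) in leb n. c \<le> a i x \<and> a i x \<le> C" by (elim conjE)
    have "AE x in leb n. \<forall>i\<in>{..<n}. x \<in> obox n y (2 * r) \<longrightarrow> c \<le> a i x \<and> a i x \<le> C"
      using C by (subst AE_ball_countable) auto
    then have "AE x in leb n. x \<in> clbox n y r \<longrightarrow> (\<forall>i<n. a i x \<le> C)"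
      by eventually_elim (use sub in auto)
    then show ?thesis ..
  qed
  then have "\<forall>y\<in>F. \<exists>C. AE x in leb n. x \<in> clbox n y r \<longrightarrow> (\<forall>i<n. a i x \<le> C)" by (intro ballI)
  from bchoice[OF this]
  obtain C where C: "\<forall>y\<in>F. AE x in leb n. x \<in> clbox n y r \<longrightarrow> (\<forall>i<n. a i x \<le> C y)" ..
  \<comment> \<open>The inserted 1 makes the bound positive, also when \<open>F\<close> is
    empty.\<close>
  define D where "D = Max (insert 1 (C ` F))"
  have D: "1 \<le> D" "\<forall>y\<in>F. C y \<le> D" using F(1) by (auto simp: D_def)
  have "AE x in leb n. \<forall>y\<in>F. x \<in> clbox n y r \<longrightarrow> (\<forall>i<n. a i x \<le> C y)"
    using C countable_finite[OF F(1)] by (subst AE_ball_countable) auto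
  then have "AE x\<in>K in leb n. (\<forall>i<n. a i x \<le> D)"
  proof eventually_elim
    case (elim x)
    show ?case
    proof (intro impI allI)
      fix i assume x: "x \<in> K" and i: "i < n"
      obtain y where y: "y \<in> F" "x \<in> clbox n y r" using F(3) x by blast
      have "a i x \<le> C y" using elim y i by blast
      also have "C y \<le> D" using D(2) y(1) by blast
      finally show "a i x \<le> D" .
    qed
  qed
  then show ?thesis using D(1) by (intro exI[of _ D]) auto
qed

theorem theorem3p21:
  fixes p s :: real
  assumes "1 < p" and "1 < s"
  shows "\<exists>C :: nat \<Rightarrow> real. (\<forall>n. 0 < C n) \<and> (p \<le> s \<longrightarrow> (\<forall>m n. C m = C n)) \<and>
    (\<forall>(n :: nat) (\<Omega> :: (nat \<Rightarrow> real) set) (a :: nat \<Rightarrow> (nat \<Rightarrow> real) \<Rightarrow> real)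
      (q :: real) (V :: (nat \<Rightarrow> real) \<Rightarrow> real) (u :: (nat \<Rightarrow> real) \<Rightarrow> real).
      2 \<le> n \<and> domain_in n \<Omega> \<and> weight_vector n \<Omega> a \<and> in_morrey_loc n q p \<Omega> V \<and>
      (\<forall>\<phi> \<in> Cc_smooth n \<Omega>. 0 \<le> Q_fun n \<Omega> p s a V \<phi>) \<and>
      positive_solution n \<Omega> p s a V u \<and> u \<in> C_continuous n \<Omega>
      \<longrightarrow>
      (\<forall>g \<in> Lp_loc n \<Omega> 1. g \<in> hardy_weights n \<Omega> p s a V \<longleftrightarrow> norm_u n \<Omega> p s a V u g < \<infinity>) \<and>
      (\<forall>g \<in> hardy_weights n \<Omega> p s a V.
         norm_u n \<Omega> p s a V u g \<le> norm_H n \<Omega> p s a V g \<and>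
         norm_H n \<Omega> p s a V g \<le> ereal (C n) * norm_u n \<Omega> p s a V u g) \<and>
      banach_space_ae n \<Omega> (hardy_weights n \<Omega> p s a V) (norm_u n \<Omega> p s a V u))"
proof -
  obtain C M where C: "1 \<le> C" and M: "0 < M" and growth: "\<forall>n y w t. 0 \<le> t \<longrightarrow>
      bregman p s n (\<lambda>i. y i + t * w i) y \<le> C * max 1 t powr M * bregman p s n (\<lambda>i. y i + w i) y"
    using bregman_growth[OF assms] by blast
  \<comment> \<open>The constant \<open>4 powr p * C1\<close>, written out in \<open>p\<close>,
    \<open>C\<close> and \<open>M\<close> because it has to be fixed before the dimension and the
    data are given.\<close>
  define D where "D = 4 powr p * (C * (2 powr p * (4 * max 2 (M / p)) powr M))"
  have D: "0 < D" unfolding D_def using C by (auto intro!: mult_pos_pos simp: powr_gt_zero)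
  have main: "(\<forall>g \<in> Lp_loc n \<Omega> 1. g \<in> hardy_weights n \<Omega> p s a V \<longleftrightarrow> norm_u n \<Omega> p s a V u g < \<infinity>) \<and>
      (\<forall>g \<in> hardy_weights n \<Omega> p s a V.
         norm_u n \<Omega> p s a V u g \<le> norm_H n \<Omega> p s a V g \<and>
         norm_H n \<Omega> p s a V g \<le> ereal D * norm_u n \<Omega> p s a V u g) \<and>
      banach_space_ae n \<Omega> (hardy_weights n \<Omega> p s a V) (norm_u n \<Omega> p s a V u)"
    if n: "2 \<le> n" and \<Omega>: "domain_in n \<Omega>" and a: "weight_vector n \<Omega> a" and V: "in_morrey_loc n q p \<Omega> V"
      and u: "positive_solution n \<Omega> p s a V u" "u \<in> C_continuous n \<Omega>" for n \<Omega> a q V u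
  proof -
    have op: "openin (Rn n) \<Omega>" using \<Omega> by (simp add: domain_in_def)
    have VL: "V \<in> Lp_loc n \<Omega> 1"
    proof (rule Lp_loc_local[OF op])
      fix \<omega> assume "domain_in n \<omega>" "compactly_inside n \<omega> \<Omega>"
      then have "in_morrey n q p \<omega> V" using V unfolding in_morrey_loc_def by blast
      then show "V \<in> Lp_loc n \<omega> 1" by (rule in_morrey_imp_Lp_loc)
    qed
    interpret hardy_growth n \<Omega> p s a V u C M
    proof
      show "0 < n" using n by simp
      show "bregman p s n' (\<lambda>i. y i + t * w i) y \<le> C * max 1 t powr M * bregman p s n' (\<lambda>i. y i + w i) y"
        if "0 \<le> t" for n' y w t using growth that by blast
      show "\<exists>C>0. AE x in leb n. x \<in> K \<longrightarrow> (\<forall>i<n. a i x \<le> C)" if "compactin (Rn n) K" "K \<subseteq> \<Omega>" for K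
        by (rule weight_bounded_on_compact[OF op a that])
    qed (use assms op a VL u C M in \<open>auto simp: weight_vector_def\<close>)
    have DC: "4 powr p * C1 = D" by (simp add: D_def C1_def k_def)
    show ?thesis
      using hardy_weights_iff norm_u_le_norm_H norm_H_le_norm_u banach unfolding DC by blast
  qed
  \<comment> \<open>A constant sequence satisfies the clause on the dependence on \<open>n\<close>
    whether or not \<open>p \<le> s\<close>.\<close>
  show ?thesis
    by (rule exI[of _ "\<lambda>_. D"]) (use D main in blast)
qed

end
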